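(* Let $m,n$ be positive integers with $\gcd(m,n)=1$, let $0\le \alpha\le \frac{m+n-1}{m}$, and let $T_\alpha$ denote the Toeplitz operator on $\mathbb{H}_{m/n}$ with symbol $\phi(z_1,z_2)=|z_2|^\alpha$. Then, for an exponent $1\le p<\infty$, $T_\alpha$ maps $L^p(\mathbb{H}_{m/n})$ to $A^p(\mathbb{H}_{m/n})$ boundedly if and only if $$\frac{2m+2n}{m+n+1+m\alpha}<p<\frac{2m+2n}{m+n-1}.$$
   Context: For $\gamma>0$ the generalized Hartogs triangle is $\mathbb{H}_\gamma=\{(z_1,z_2)\in\mathbb{C}^2: |z_1|^\gamma<|z_2|<1\}$; here $\gamma=m/n$. $dV$ is Lebesgue measure, $L^p(\mathbb{H}_\gamma)$ is taken with respect to $dV$, and $A^p(\mathbb{H}_\gamma)$ is the space of holomorphic functions in $L^p(\mathbb{H}_\gamma)$. The Bergman projection $\mathbf{B}_\gamma$ is the orthogonal projection of $L^2(\mathbb{H}_\gamma)$ onto its closed subspace $A^2(\mathbb{H}_\gamma)$; it is the integral operator $\mathbf{B}_\gamma f(z)=\int_{\mathbb{H}_\gamma}B_\gamma(z,w)f(w)\,dV(w)$, where $B_\gamma(z,w)$ is the Bergman kernel. For a bounded symbol $\phi$, the Toeplitz operator is $T_\phi f(z)=\mathbf{B}_\gamma(\phi f)(z)=\int_{\mathbb{H}_\gamma}B_\gamma(z,w)f(w)\phi(w)\,dV(w)$. "$T_\phi$ maps $L^p$ to $A^p$ boundedly" means that for every $f\in L^p$ this integral converges absolutely for almost every $z$,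 defines (after modification on a null set) an element of $A^p$, and $\|T_\phi f\|_p\le C\|f\|_p$ with $C$ independent of $f$. *)

theory Defs
  imports "HOL-Complex_Analysis.Complex_Analysis"
begin

definition hartogs_triangle :: "real \<Rightarrow> (complex \<times> complex) set" where
  "hartogs_triangle \<gamma> = {(z1, z2). norm z1 powr \<gamma> < norm z2 \<and> norm z2 < 1}"

text \<open>Functions are total, so membership in the spaces below only restricts \<open>f\<close> on \<open>\<Omega>\<close>.\<close>

definition Lp_space :: "real \<Rightarrow> (complex \<times> complex) set \<Rightarrow> (complex \<times> complex \<Rightarrow> complex) set" where
  "Lp_space p \<Omega> = {f. f \<in> borel_measurable (lebesgue_on \<Omega>)
                      \<and> integrable (lebesgue_on \<Omega>) (\<lambda>z. norm (f z) powr p)}"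

definition Lp_norm :: "real \<Rightarrow> (complex \<times> complex) set \<Rightarrow> (complex \<times> complex \<Rightarrow> complex) \<Rightarrow> real" where
  "Lp_norm p \<Omega> f = (integral\<^sup>L (lebesgue_on \<Omega>) (\<lambda>z. norm (f z) powr p)) powr (1 / p)"

text \<open>Holomorphy in two variables (for open \<open>\<Omega>\<close>): the real Frechet derivative exists at each
  point and is complex linear.\<close>

definition holomorphic2_on ::
    "(complex \<times> complex \<Rightarrow> complex) \<Rightarrow> (complex \<times> complex) set \<Rightarrow> bool" where
  "holomorphic2_on f \<Omega> \<longleftrightarrow>
     (\<forall>z\<in>\<Omega>. \<exists>a b. (f has_derivative (\<lambda>h. a * fst h + b * snd h)) (at z))"

definition Bergman_space ::
    "real \<Rightarrow> (complex \<times> complex) set \<Rightarrow> (complex \<times> complex \<Rightarrow> complex) set" where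
  "Bergman_space p \<Omega> = {f. holomorphic2_on f \<Omega> \<and> f \<in> Lp_space p \<Omega>}"

text \<open>The reproducing kernel of \<open>A\<^sup>2(\<Omega>)\<close>; its values off \<open>\<Omega> \<times> \<Omega>\<close> are fixed to be \<open>0\<close> only to make
  the description unique.\<close>

definition Bergman_kernel ::
    "(complex \<times> complex) set \<Rightarrow> complex \<times> complex \<Rightarrow> complex \<times> complex \<Rightarrow> complex" where
  "Bergman_kernel \<Omega> = (THE K.
     (\<forall>z\<in>\<Omega>. (\<lambda>w. cnj (K z w)) \<in> Bergman_space 2 \<Omega> \<and>
            (\<forall>f\<in>Bergman_space 2 \<Omega>. f z = integral\<^sup>L (lebesgue_on \<Omega>) (\<lambda>w. K z w * f w))) \<and>
     (\<forall>z w. z \<notin> \<Omega> \<or> w \<notin> \<Omega> \<longrightarrow> K z w = 0))"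

text \<open>The integral form of the Bergman projection; on \<open>L\<^sup>2(\<Omega>)\<close> it is the orthogonal projection onto
  \<open>A\<^sup>2(\<Omega>)\<close>, and it is applied to any \<open>f\<close> for which the integral converges.\<close>

definition Bergman_projection ::
    "(complex \<times> complex) set \<Rightarrow> (complex \<times> complex \<Rightarrow> complex) \<Rightarrow> complex \<times> complex \<Rightarrow> complex" where
  "Bergman_projection \<Omega> f z = integral\<^sup>L (lebesgue_on \<Omega>) (\<lambda>w. Bergman_kernel \<Omega> z w * f w)"

definition Toeplitz ::
    "(complex \<times> complex) set \<Rightarrow> (complex \<times> complex \<Rightarrow> complex) \<Rightarrow>
     (complex \<times> complex \<Rightarrow> complex) \<Rightarrow> complex \<times> complex \<Rightarrow> complex" where
  "Toeplitz \<Omega> \<phi> f = Bergman_projection \<Omega> (\<lambda>w. \<phi> w * f w)"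

text \<open>Absolute convergence is required explicitly, since the Bochner integral of a non-integrable
  function is \<open>0\<close>.\<close>

definition Toeplitz_maps_boundedly ::
    "real \<Rightarrow> (complex \<times> complex) set \<Rightarrow> (complex \<times> complex \<Rightarrow> complex) \<Rightarrow> bool" where
  "Toeplitz_maps_boundedly p \<Omega> \<phi> \<longleftrightarrow>
     (\<exists>C. \<forall>f\<in>Lp_space p \<Omega>.
        (AE z in lebesgue_on \<Omega>.
           integrable (lebesgue_on \<Omega>) (\<lambda>w. Bergman_kernel \<Omega> z w * (\<phi> w * f w))) \<and>
        (\<exists>g\<in>Bergman_space p \<Omega>.
           (AE z in lebesgue_on \<Omega>. Toeplitz \<Omega> \<phi> f z = g z) \<and>
           Lp_norm p \<Omega> g \<le> C * Lp_norm p \<Omega> f))"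

end

theory Submission
  imports Defs
begin

text \<open>
  The map \<open>(v, t) \<mapsto> (v t\<^sup>n, t\<^sup>m)\<close> is an unbranched \<open>m\<close>-fold covering of the Hartogs triangle \<open>H\<close> by the product of the disc and
  the punctured disc. Its jacobian is \<open>m t\<^sup>N\<close> with \<open>N = m + n - 1\<close>, and square integrable holomorphic
  functions extend across \<open>t = 0\<close>; hence by Bell's transformation formula the Bergman kernel of
  \<open>H\<close> is an average of bidisc kernels divided by \<open>(t cnj u)\<^sup>N\<close>. With respect to the
  pulled back measure \<open>\<bar>t\<bar>\<^bsup>2N\<^esup> dV\<close>, the upper bound on \<open>p\<close> means \<open>\<bar>t\<bar>\<^bsup>-N\<^esup> \<in> L\<^sup>p\<close>, and for \<open>p > 1\<close> the lower
  bound means \<open>\<bar>t\<bar>\<^bsup>m\<alpha>-N\<^esup> \<in> L\<^sup>q\<close> for the conjugate exponent \<open>q\<close>.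

  Sufficiency is Schur's test on the bidisc with test functions
  \<open>\<bar>t\<bar>\<^bsup>-a\<^esup> (1 - \<bar>v\<bar>\<^sup>2)\<^bsup>-\<epsilon>\<^esup> (1 - \<bar>t\<bar>\<^sup>2)\<^bsup>-\<epsilon>\<^esup>\<close>. Necessity for \<open>p > 1\<close>, and of the upper bound for all \<open>p\<close>, follows
  by testing on monomials times radial functions of \<open>t\<close>. For \<open>p = 1\<close> boundedness would bound the \<open>L\<^sup>1\<close>
  norms of the kernel functions at \<open>(0, \<rho>)\<close>, but these grow like \<open>- ln (1 - \<rho>)\<close> as \<open>\<rho>\<close> tends to \<open>1\<close>.
\<close>

section \<open>Polar coordinates in the complex plane\<close>

text \<open>Since 2m + 2n = 2N + 2, the bounds read (2N + 2)/(N + 2 + m\<alpha>) < p < (2N + 2)/N.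
  After lifting by \<open>cover\<close> the operator is g \<mapsto> t^-N B(t^N |t|^(m\<alpha>) g),
  with B the unweighted Bergman projection of the bidisc (\<open>integral_hartogs_kernel\<close>).
  Boundedness can fail at t = 0, which is governed by powers of |t|, or at the boundary, where it
  requires p > 1. At p = 1 the lower bound reads N < m\<alpha>, so the hypothesis on \<alpha> is
  what makes the stated range exclude p = 1. Coprimality enters through Bezout: the test functions
  need a monomial on H whose pullback has a prescribed power of t. Two features of the definitions
  shape the formal side. The kernel is a definite description, so uniqueness has to be proved along
  with the reproducing property. Lp functions are Lebesgue measurable, while the changes of
  variables are carried out for Borel functions, so each f is first replaced by a Borel
  representative.\<close>

lemma measurable_Complex[measurable]:
  assumes [measurable]: "f \<in> borel_measurable M" "g \<in> borel_measurable M"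
  shows "(\<lambda>x. Complex (f x) (g x)) \<in> borel_measurable M"
  unfolding Complex_eq by measurable

text \<open>Both measures give a box the product of its side lengths. The identification with the
  plane opens complex integrals to Fubini.\<close>

lemma lborel_complex_eq_distr:
  "(lborel :: complex measure) = distr (lborel \<Otimes>\<^sub>M lborel) borel (\<lambda>(x, y). Complex x y)"
proof (rule lborel_eqI)
  have m: "(\<lambda>(x, y). Complex x y) \<in> borel_measurable (lborel \<Otimes>\<^sub>M lborel)"
    unfolding case_prod_unfold by measurable
  fix l u :: complex
  assume le: "\<And>b. b \<in> Basis \<Longrightarrow> l \<bullet> b \<le> u \<bullet> b"
  have re: "Re l \<le> Re u" and im: "Im l \<le> Im u"
    using le[of 1] le[of \<i>] by (auto simp: Basis_complex_def)
  have "(\<lambda>(x, y). Complex x y) -` box l u = {Re l<..<Re u} \<times> {Im l<..<Im u}"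
    by (auto simp: in_box_complex_iff)
  then show "emeasure (distr (lborel \<Otimes>\<^sub>M lborel) borel (\<lambda>(x, y). Complex x y)) (box l u)
      = (\<Prod>b\<in>Basis. (u - l) \<bullet> b)"
    using re im
    by (subst emeasure_distr[OF m])
       (simp_all add: space_pair_measure lborel.emeasure_pair_measure_Times Basis_complex_def
         ennreal_mult)
qed simp

lemma nn_integral_complex:
  fixes g :: "complex \<Rightarrow> ennreal"
  assumes [measurable]: "g \<in> borel_measurable borel"
  shows "(\<integral>\<^sup>+z. g z \<partial>lborel) = (\<integral>\<^sup>+x. \<integral>\<^sup>+y. g (Complex x y) \<partial>lborel \<partial>lborel)"
proof -
  have m: "(\<lambda>(x, y). Complex x y) \<in> borel_measurable (lborel \<Otimes>\<^sub>M lborel)"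
    unfolding case_prod_unfold by measurable
  have g': "(\<lambda>(x, y). g (Complex x y)) \<in> borel_measurable (lborel \<Otimes>\<^sub>M lborel)"
    using measurable_compose[OF m assms] by (simp add: case_prod_unfold)
  show ?thesis
    using lborel.nn_integral_fst[OF g']
    by (subst lborel_complex_eq_distr, subst nn_integral_distr[OF m])
       (simp_all add: case_prod_unfold)
qed

text \<open>The substitution \<open>t = arctan s\<close> on the whole line:
  \<open>nn_integral_substitution_aux\<close> treats compact intervals, and monotone convergence
  along \<open>{- c k..c k}\<close> passes to the limit on both sides.\<close>

lemma nn_integral_arctan:
  fixes h :: "real \<Rightarrow> ennreal"
  assumes [measurable]: "h \<in> borel_measurable borel"
  shows "(\<integral>\<^sup>+s. h (arctan s) * ennreal (1 / (1 + s\<^sup>2)) \<partial>lborel)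
       = (\<integral>\<^sup>+t. h t * indicator {-pi/2<..<pi/2} t \<partial>lborel)"
proof -
  have [measurable]: "arctan \<in> borel_measurable borel"
    by (intro borel_measurable_continuous_onI continuous_intros)
  \<comment> \<open>\<open>Suc\<close> keeps the interval \<open>{- c k..c k}\<close> nondegenerate
    at \<open>k = 0\<close>, as the substitution rule requires.\<close>
  define c where "c = (\<lambda>k. real (Suc k))"
  have sub: "(\<integral>\<^sup>+t. h t * indicator {arctan (- c k)..arctan (c k)} t \<partial>lborel)
      = (\<integral>\<^sup>+s. h (arctan s) * ennreal (1 / (1 + s\<^sup>2)) * indicator {- c k..c k} s \<partial>lborel)" for k
    by (rule nn_integral_substitution_aux)
       (auto intro!: derivative_eq_intros continuous_intros simp: c_def add_nonneg_eq_0_iff field_simps)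
  have c_mono: "c i \<le> c j" if "i \<le> j" for i j using that by (auto simp: c_def)
  have "(\<integral>\<^sup>+s. h (arctan s) * ennreal (1 / (1 + s\<^sup>2)) \<partial>lborel)
     = (\<integral>\<^sup>+s. (SUP k. h (arctan s) * ennreal (1 / (1 + s\<^sup>2)) * indicator {- c k..c k} s) \<partial>lborel)"
  proof (rule nn_integral_cong)
    fix s :: real
    obtain k where k: "\<bar>s\<bar> < real k" using reals_Archimedean2 by blast
    have "(SUP k. indicator {- c k..c k} s :: ennreal) = 1"
    proof (rule antisym)
      show "(SUP k. indicator {- c k..c k} s :: ennreal) \<le> 1"
        by (rule SUP_least) (auto simp: indicator_def)
      show "1 \<le> (SUP k. indicator {- c k..c k} s :: ennreal)"
        by (rule SUP_upper2[of k]) (use k in \<open>auto simp: c_def indicator_def\<close>)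
    qed
    then show "h (arctan s) * ennreal (1 / (1 + s\<^sup>2))
        = (SUP k. h (arctan s) * ennreal (1 / (1 + s\<^sup>2)) * indicator {- c k..c k} s)"
      by (simp add: SUP_mult_left_ennreal[symmetric])
  qed
  also have "\<dots> = (SUP k. \<integral>\<^sup>+s. h (arctan s) * ennreal (1 / (1 + s\<^sup>2)) * indicator {- c k..c k} s \<partial>lborel)"
  proof (rule nn_integral_monotone_convergence_SUP)
    show "incseq (\<lambda>k s. h (arctan s) * ennreal (1 / (1 + s\<^sup>2)) * indicator {- c k..c k} s)"
      by (intro monoI le_funI mult_left_mono) (auto simp: indicator_def c_def)
  qed measurable
  also have "\<dots> = (SUP k. \<integral>\<^sup>+t. h t * indicator {arctan (- c k)..arctan (c k)} t \<partial>lborel)"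
    by (simp only: sub)
  also have "\<dots> = (\<integral>\<^sup>+t. (SUP k. h t * indicator {arctan (- c k)..arctan (c k)} t) \<partial>lborel)"
  proof (rule nn_integral_monotone_convergence_SUP[symmetric])
    show "incseq (\<lambda>k t. h t * indicator {arctan (- c k)..arctan (c k)} t)"
    proof (intro monoI le_funI mult_left_mono)
      fix i j :: nat and t assume "i \<le> j"
      then have "arctan (c i) \<le> arctan (c j)" using c_mono by (intro arctan_monotone') auto
      then show "(indicator {arctan (- c i)..arctan (c i)} t :: ennreal)
          \<le> indicator {arctan (- c j)..arctan (c j)} t"
        by (auto simp: indicator_def arctan_minus)
    qed simp
  qed measurable
  also have "\<dots> = (\<integral>\<^sup>+t. h t * indicator {-pi/2<..<pi/2} t \<partial>lborel)"
  proof (rule nn_integral_cong)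
    fix t :: real
    have "(SUP k. indicator {arctan (- c k)..arctan (c k)} t :: ennreal) = indicator {-pi/2<..<pi/2} t"
    proof (cases "t \<in> {-pi/2<..<pi/2}")
      case True
      obtain k where k: "\<bar>tan t\<bar> < real k" using reals_Archimedean2 by blast
      have "arctan (- c k) \<le> arctan (tan t)" "arctan (tan t) \<le> arctan (c k)"
        using k by (auto simp: c_def simp del: arctan_tan intro!: arctan_monotone')
      then have *: "(indicator {arctan (- c k)..arctan (c k)} t :: ennreal) = 1"
        using True by (auto simp: arctan_tan)
      show ?thesis
      proof (rule antisym)
        show "(SUP k. indicator {arctan (- c k)..arctan (c k)} t :: ennreal) \<le> indicator {-pi/2<..<pi/2} t"
          by (rule SUP_least) (use True in \<open>auto simp: indicator_def\<close>)
        show "indicator {-pi/2<..<pi/2} t \<le> (SUP k. indicator {arctan (- c k)..arctan (c k)} t :: ennreal)"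
          by (rule SUP_upper2[of k]) (use * in \<open>auto simp: indicator_def\<close>)
      qed
    next
      case False
      have "(indicator {arctan (- c k)..arctan (c k)} t :: ennreal) = 0" for k
        using False arctan_bounded[of "c k"] arctan_bounded[of "- c k"] by (auto simp: indicator_def)
      then show ?thesis using False by simp
    qed
    then show "(SUP k. h t * indicator {arctan (- c k)..arctan (c k)} t) = h t * indicator {-pi/2<..<pi/2} t"
      by (simp add: SUP_mult_left_ennreal[symmetric])
  qed
  finally show ?thesis .
qed

text \<open>Only one-dimensional substitutions are used: the slope \<open>s = y / x\<close> at fixed
  \<open>x\<close>, then, after Fubini, \<open>x = c * r\<close> at fixed slope with
  \<open>c = cos (arctan s)\<close>, and finally \<open>s = tan t\<close>.\<close>

lemma nn_integral_right_half_plane: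
  fixes g :: "complex \<Rightarrow> ennreal"
  assumes [measurable]: "g \<in> borel_measurable borel"
  shows "(\<integral>\<^sup>+x. \<integral>\<^sup>+y. g (Complex x y) * indicator {0<..} x \<partial>lborel \<partial>lborel)
     = (\<integral>\<^sup>+r. \<integral>\<^sup>+t. g (of_real r * cis t) * ennreal r * indicator {-pi/2<..<pi/2} t \<partial>lborel \<partial>lborel)"
proof -
  have sq: "1 + s\<^sup>2 > 0" for s :: real by (simp add: add_pos_nonneg)
  have "(\<integral>\<^sup>+x. \<integral>\<^sup>+y. g (Complex x y) * indicator {0<..} x \<partial>lborel \<partial>lborel)
      = (\<integral>\<^sup>+x. \<integral>\<^sup>+s. g (Complex x (x * s)) * ennreal x \<partial>lborel \<partial>lborel)"
  proof (rule nn_integral_cong)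
    fix x :: real
    show "(\<integral>\<^sup>+y. g (Complex x y) * indicator {0<..} x \<partial>lborel) = (\<integral>\<^sup>+s. g (Complex x (x * s)) * ennreal x \<partial>lborel)"
    proof (cases "x > 0")
      case True
      then have "(\<integral>\<^sup>+y. g (Complex x y) * indicator {0<..} x \<partial>lborel) = (\<integral>\<^sup>+y. g (Complex x y) \<partial>lborel)"
        by simp
      also have "\<dots> = \<bar>x\<bar> * (\<integral>\<^sup>+s. g (Complex x (0 + x * s)) \<partial>lborel)"
        using True by (intro nn_integral_real_affine) auto
      also have "\<dots> = (\<integral>\<^sup>+s. g (Complex x (x * s)) * ennreal x \<partial>lborel)"
        using True by (subst nn_integral_multc) (auto simp: mult.commute)
      finally show ?thesis .
    qed (auto simp: ennreal_neg)
  qed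
  also have "\<dots> = (\<integral>\<^sup>+s. \<integral>\<^sup>+x. g (Complex x (x * s)) * ennreal x \<partial>lborel \<partial>lborel)"
    by (rule lborel_pair.Fubini') (simp add: case_prod_unfold)
  also have "\<dots> = (\<integral>\<^sup>+s. \<integral>\<^sup>+r. g (of_real r * cis (arctan s)) * ennreal r * ennreal (1 / (1 + s\<^sup>2)) \<partial>lborel \<partial>lborel)"
  proof (rule nn_integral_cong)
    fix s :: real
    \<comment> \<open>This is \<open>cos (arctan s)\<close>. One factor \<open>c\<close> comes from
      the substitution and one from the weight \<open>x = c * r\<close>; their product is the
      derivative of \<open>arctan\<close>.\<close>
    define c where "c = 1 / sqrt (1 + s\<^sup>2)"
    have c: "c > 0" "c * c = 1 / (1 + s\<^sup>2)" using sq[of s] by (auto simp: c_def real_sqrt_mult_self)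
    have cis: "Complex (c * r) (c * r * s) = of_real r * cis (arctan s)" for r
      by (simp add: complex_eq_iff cos_arctan sin_arctan c_def)
    have e: "ennreal c * ennreal (c * r) = ennreal r * ennreal (1 / (1 + s\<^sup>2))" for r
    proof (cases "r \<ge> 0")
      case True
      then have "ennreal c * ennreal (c * r) = ennreal (c * (c * r))"
        using c(1) by (intro ennreal_mult[symmetric]) auto
      also have "c * (c * r) = r * (1 / (1 + s\<^sup>2))"
        using c(2) by (metis mult.assoc mult.commute)
      also have "ennreal \<dots> = ennreal r * ennreal (1 / (1 + s\<^sup>2))"
        using True sq[of s] by (intro ennreal_mult) auto
      finally show ?thesis .
    next
      case False
      then have "c * r \<le> 0" using c(1) by (simp add: mult_le_0_iff)
      then show ?thesis using False by (simp add: ennreal_neg)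
    qed
    show "(\<integral>\<^sup>+x. g (Complex x (x * s)) * ennreal x \<partial>lborel)
       = (\<integral>\<^sup>+r. g (of_real r * cis (arctan s)) * ennreal r * ennreal (1 / (1 + s\<^sup>2)) \<partial>lborel)"
    proof -
      have "(\<integral>\<^sup>+x. g (Complex x (x * s)) * ennreal x \<partial>lborel)
          = \<bar>c\<bar> * (\<integral>\<^sup>+r. g (Complex (0 + c * r) ((0 + c * r) * s)) * ennreal (0 + c * r) \<partial>lborel)"
        using c(1) by (intro nn_integral_real_affine) auto
      also have "\<dots> = ennreal c * (\<integral>\<^sup>+r. g (of_real r * cis (arctan s)) * ennreal (c * r) \<partial>lborel)"
        using c(1) by (simp only: cis add_0 abs_of_pos)
      also have "\<dots> = (\<integral>\<^sup>+r. g (of_real r * cis (arctan s)) * (ennreal c * ennreal (c * r)) \<partial>lborel)"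
        by (subst nn_integral_cmult[symmetric]) (auto simp: ac_simps)
      finally show ?thesis by (simp add: e mult.assoc)
    qed
  qed
  also have "\<dots> = (\<integral>\<^sup>+r. \<integral>\<^sup>+s. g (of_real r * cis (arctan s)) * ennreal r * ennreal (1 / (1 + s\<^sup>2)) \<partial>lborel \<partial>lborel)"
    unfolding cis.ctr cos_arctan sin_arctan
    by (rule lborel_pair.Fubini') (simp add: case_prod_unfold)
  also have "\<dots> = (\<integral>\<^sup>+r. \<integral>\<^sup>+t. g (of_real r * cis t) * ennreal r * indicator {-pi/2<..<pi/2} t \<partial>lborel \<partial>lborel)"
  proof (rule nn_integral_cong)
    fix r :: real
    show "(\<integral>\<^sup>+s. g (of_real r * cis (arctan s)) * ennreal r * ennreal (1 / (1 + s\<^sup>2)) \<partial>lborel)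
       = (\<integral>\<^sup>+t. g (of_real r * cis t) * ennreal r * indicator {-pi/2<..<pi/2} t \<partial>lborel)"
      by (rule nn_integral_arctan[where h = "\<lambda>t. g (of_real r * cis t) * ennreal r"])
         (simp add: cis.ctr)
  qed
  finally show ?thesis .
qed

text \<open>Shifting by the multiple \<open>k * T\<close> with
  \<open>k = \<lfloor>a / T\<rfloor>\<close> moves the window to one starting at \<open>b\<close> in
  \<open>[0, T)\<close>; the part beyond \<open>T\<close> is wrapped back by one further
  period.\<close>

lemma nn_integral_periodic_shift:
  fixes h :: "real \<Rightarrow> ennreal"
  assumes [measurable]: "h \<in> borel_measurable borel" and per: "\<And>t. h (t + T) = h t" and T: "T > 0"
  shows "(\<integral>\<^sup>+t. h t * indicator {a..<a + T} t \<partial>lborel) = (\<integral>\<^sup>+t. h t * indicator {0..<T} t \<partial>lborel)"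
proof -
  have shift: "(\<integral>\<^sup>+t. f t \<partial>lborel) = (\<integral>\<^sup>+t. f (s + t) \<partial>lborel)"
    if [measurable]: "f \<in> borel_measurable borel" for f :: "real \<Rightarrow> ennreal" and s
    using nn_integral_real_affine[of f 1 s] by simp
  have per_nat: "h (t + real k * T) = h t" for t k
  proof (induction k)
    case (Suc k)
    have "h (t + real (Suc k) * T) = h ((t + real k * T) + T)"
      by (rule arg_cong[of _ _ h]) (simp add: algebra_simps)
    then show ?case using per Suc by simp
  qed simp
  have per_int: "h (of_int k * T + t) = h t" for t k
  proof (cases "k \<ge> 0")
    case True
    then show ?thesis using per_nat[of t "nat k"] by (simp add: add.commute)
  next
    case False
    then show ?thesis using per_nat[of "of_int k * T + t" "nat (- k)"] by simp
  qed
  define k where "k = \<lfloor>a / T\<rfloor>"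
  define b where "b = a - of_int k * T"
  have "of_int k \<le> a / T" "a / T < of_int k + 1" unfolding k_def by linarith+
  then have b: "0 \<le> b" "b < T" using T by (auto simp: b_def field_simps)
  have "(\<integral>\<^sup>+t. h t * indicator {a..<a + T} t \<partial>lborel)
      = (\<integral>\<^sup>+t. h (of_int k * T + t) * indicator {a..<a + T} (of_int k * T + t) \<partial>lborel)"
    by (rule shift) measurable
  also have "\<dots> = (\<integral>\<^sup>+t. h t * indicator {b..<T} t + h t * indicator {T..<b + T} t \<partial>lborel)"
    unfolding per_int by (intro nn_integral_cong) (use b in \<open>auto simp: indicator_def b_def\<close>)
  also have "\<dots> = (\<integral>\<^sup>+t. h t * indicator {b..<T} t \<partial>lborel) + (\<integral>\<^sup>+t. h t * indicator {T..<b + T} t \<partial>lborel)"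
    by (rule nn_integral_add) measurable
  also have "(\<integral>\<^sup>+t. h t * indicator {T..<b + T} t \<partial>lborel)
      = (\<integral>\<^sup>+t. h (T + t) * indicator {T..<b + T} (T + t) \<partial>lborel)"
    by (rule shift) measurable
  also have "\<dots> = (\<integral>\<^sup>+t. h t * indicator {0..<b} t \<partial>lborel)"
    using per by (intro nn_integral_cong) (auto simp: indicator_def add.commute)
  also have "(\<integral>\<^sup>+t. h t * indicator {b..<T} t \<partial>lborel) + \<dots>
      = (\<integral>\<^sup>+t. h t * indicator {b..<T} t + h t * indicator {0..<b} t \<partial>lborel)"
    by (rule nn_integral_add[symmetric]) measurable
  also have "\<dots> = (\<integral>\<^sup>+t. h t * indicator {0..<T} t \<partial>lborel)"
    by (intro nn_integral_cong) (use b in \<open>auto simp: indicator_def\<close>)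
  finally show ?thesis .
qed

lemma cis_borel_measurable[measurable]: "cis \<in> borel_measurable borel"
  by (intro borel_measurable_continuous_onI continuous_intros)

text \<open>The left half plane is the image of the right one under \<open>z \<mapsto> - z\<close>
  and covers the angles between \<open>pi/2\<close> and \<open>3*pi/2\<close>. The imaginary axis is
  a null set, and periodicity turns the window from \<open>-pi/2\<close> to \<open>3*pi/2\<close>
  into \<open>[0, 2 * pi)\<close>.\<close>

lemma nn_integral_polar:
  fixes g :: "complex \<Rightarrow> ennreal"
  assumes [measurable]: "g \<in> borel_measurable borel"
  shows "(\<integral>\<^sup>+z. g z \<partial>lborel)
     = (\<integral>\<^sup>+r. \<integral>\<^sup>+t. g (of_real r * cis t) * ennreal r * indicator {0..<2 * pi} t \<partial>lborel \<partial>lborel)"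
proof -
  have neg: "(\<integral>\<^sup>+t. f t \<partial>lborel) = (\<integral>\<^sup>+t. f (- t) \<partial>lborel)"
    if [measurable]: "f \<in> borel_measurable borel" for f :: "real \<Rightarrow> ennreal"
    using nn_integral_real_affine[of f "-1" 0] by simp
  have "(\<integral>\<^sup>+z. g z \<partial>lborel) = (\<integral>\<^sup>+x. \<integral>\<^sup>+y. g (Complex x y) \<partial>lborel \<partial>lborel)"
    by (rule nn_integral_complex) fact
  also have "\<dots> = (\<integral>\<^sup>+x. (\<integral>\<^sup>+y. g (Complex x y) * indicator {0<..} x \<partial>lborel)
       + (\<integral>\<^sup>+y. g (Complex x y) * indicator {..<0} x \<partial>lborel) \<partial>lborel)"
  proof (rule nn_integral_cong_AE)
    show "AE x in lborel. (\<integral>\<^sup>+y. g (Complex x y) \<partial>lborel)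
       = (\<integral>\<^sup>+y. g (Complex x y) * indicator {0<..} x \<partial>lborel)
        + (\<integral>\<^sup>+y. g (Complex x y) * indicator {..<0} x \<partial>lborel)"
      using AE_lborel_singleton[of "0::real"]
    proof eventually_elim
      case (elim x)
      then show ?case by (cases "x > 0") (auto simp: indicator_def)
    qed
  qed
  also have "\<dots> = (\<integral>\<^sup>+x. \<integral>\<^sup>+y. g (Complex x y) * indicator {0<..} x \<partial>lborel \<partial>lborel)
       + (\<integral>\<^sup>+x. \<integral>\<^sup>+y. g (Complex x y) * indicator {..<0} x \<partial>lborel \<partial>lborel)"
    by (rule nn_integral_add) measurable
  also have "(\<integral>\<^sup>+x. \<integral>\<^sup>+y. g (Complex x y) * indicator {..<0} x \<partial>lborel \<partial>lborel)
      = (\<integral>\<^sup>+x. \<integral>\<^sup>+y. g (Complex (- x) y) * indicator {..<0} (- x) \<partial>lborel \<partial>lborel)"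
    by (rule neg) measurable
  also have "\<dots> = (\<integral>\<^sup>+x. \<integral>\<^sup>+y. g (Complex (- x) (- y)) * indicator {..<0} (- x) \<partial>lborel \<partial>lborel)"
    by (intro nn_integral_cong neg) measurable
  also have "\<dots> = (\<integral>\<^sup>+x. \<integral>\<^sup>+y. g (- Complex x y) * indicator {0<..} x \<partial>lborel \<partial>lborel)"
    by (intro nn_integral_cong arg_cong2[of _ _ _ _ "(*)"] arg_cong[of _ _ g])
      (auto simp: indicator_def complex_eq_iff)
  also have "\<dots> = (\<integral>\<^sup>+r. \<integral>\<^sup>+t. g (- (of_real r * cis t)) * ennreal r * indicator {-pi/2<..<pi/2} t \<partial>lborel \<partial>lborel)"
    by (rule nn_integral_right_half_plane) measurable
  also have "\<dots> = (\<integral>\<^sup>+r. \<integral>\<^sup>+t. g (of_real r * cis t) * ennreal r * indicator {pi/2<..<3*pi/2} t \<partial>lborel \<partial>lborel)"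
  proof (rule nn_integral_cong)
    fix r :: real
    have "(\<integral>\<^sup>+t. g (of_real r * cis t) * ennreal r * indicator {pi/2<..<3*pi/2} t \<partial>lborel)
        = ennreal \<bar>1\<bar> * (\<integral>\<^sup>+t. g (of_real r * cis (pi + 1 * t)) * ennreal r * indicator {pi/2<..<3*pi/2} (pi + 1 * t) \<partial>lborel)"
      by (rule nn_integral_real_affine) auto
    also have "\<dots> = (\<integral>\<^sup>+t. g (- (of_real r * cis t)) * ennreal r * indicator {-pi/2<..<pi/2} t \<partial>lborel)"
      unfolding abs_one ennreal_1 mult_1
      by (intro nn_integral_cong) (auto simp: indicator_def cis_mult[symmetric])
    finally show "(\<integral>\<^sup>+t. g (- (of_real r * cis t)) * ennreal r * indicator {-pi/2<..<pi/2} t \<partial>lborel)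
      = (\<integral>\<^sup>+t. g (of_real r * cis t) * ennreal r * indicator {pi/2<..<3*pi/2} t \<partial>lborel)" by simp
  qed
  also have "(\<integral>\<^sup>+x. \<integral>\<^sup>+y. g (Complex x y) * indicator {0<..} x \<partial>lborel \<partial>lborel)
      = (\<integral>\<^sup>+r. \<integral>\<^sup>+t. g (of_real r * cis t) * ennreal r * indicator {-pi/2<..<pi/2} t \<partial>lborel \<partial>lborel)"
    by (rule nn_integral_right_half_plane) measurable
  also have "\<dots> + (\<integral>\<^sup>+r. \<integral>\<^sup>+t. g (of_real r * cis t) * ennreal r * indicator {pi/2<..<3*pi/2} t \<partial>lborel \<partial>lborel)
     = (\<integral>\<^sup>+r. (\<integral>\<^sup>+t. g (of_real r * cis t) * ennreal r * indicator {-pi/2<..<pi/2} t \<partial>lborel)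
         + (\<integral>\<^sup>+t. g (of_real r * cis t) * ennreal r * indicator {pi/2<..<3*pi/2} t \<partial>lborel) \<partial>lborel)"
    by (rule nn_integral_add[symmetric]) measurable
  also have "\<dots> = (\<integral>\<^sup>+r. \<integral>\<^sup>+t. g (of_real r * cis t) * ennreal r * indicator {0..<2*pi} t \<partial>lborel \<partial>lborel)"
  proof (rule nn_integral_cong)
    fix r :: real
    let ?h = "\<lambda>t. g (of_real r * cis t) * ennreal r"
    have "(\<integral>\<^sup>+t. ?h t * indicator {-pi/2<..<pi/2} t \<partial>lborel) + (\<integral>\<^sup>+t. ?h t * indicator {pi/2<..<3*pi/2} t \<partial>lborel)
       = (\<integral>\<^sup>+t. ?h t * indicator {-pi/2<..<pi/2} t + ?h t * indicator {pi/2<..<3*pi/2} t \<partial>lborel)"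
      by (rule nn_integral_add[symmetric]) measurable
    also have "\<dots> = (\<integral>\<^sup>+t. ?h t * indicator {-pi/2..<-pi/2 + 2 * pi} t \<partial>lborel)"
    proof (rule nn_integral_cong_AE)
      show "AE t in lborel. ?h t * indicator {-pi/2<..<pi/2} t + ?h t * indicator {pi/2<..<3*pi/2} t
          = ?h t * indicator {-pi/2..<-pi/2 + 2 * pi} t"
        using AE_lborel_singleton[of "pi/2"] AE_lborel_singleton[of "-pi/2"]
        by eventually_elim (auto simp: indicator_def)
    qed
    also have "\<dots> = (\<integral>\<^sup>+t. ?h t * indicator {0..<2*pi} t \<partial>lborel)"
      by (rule nn_integral_periodic_shift) (auto simp: cis_mult[symmetric])
    finally show "(\<integral>\<^sup>+t. ?h t * indicator {-pi/2<..<pi/2} t \<partial>lborel) + (\<integral>\<^sup>+t. ?h t * indicator {pi/2<..<3*pi/2} t \<partial>lborel)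
       = (\<integral>\<^sup>+t. ?h t * indicator {0..<2*pi} t \<partial>lborel)" .
  qed
  finally show ?thesis .
qed

text \<open>In polar coordinates the argument of \<open>c\<close> only shifts the angle, which
  periodicity absorbs. Its modulus contributes one factor from the radial substitution and one from
  the weight \<open>r\<close>.\<close>

lemma nn_integral_complex_scale:
  fixes g :: "complex \<Rightarrow> ennreal"
  assumes [measurable]: "g \<in> borel_measurable borel" and c: "c \<noteq> 0"
  shows "(\<integral>\<^sup>+z. g z \<partial>lborel) = ennreal ((cmod c)\<^sup>2) * (\<integral>\<^sup>+z. g (c * z) \<partial>lborel)"
proof -
  define \<rho> \<phi> where "\<rho> = cmod c" and "\<phi> = Arg c"
  have \<rho>: "\<rho> > 0" and ceq: "c = of_real \<rho> * cis \<phi>"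
    using c by (auto simp: \<rho>_def \<phi>_def cis_Arg complex_sgn_def scaleR_conv_of_real)
  have "(\<integral>\<^sup>+z. g z \<partial>lborel)
     = (\<integral>\<^sup>+r. \<integral>\<^sup>+t. g (of_real r * cis t) * ennreal r * indicator {0..<2 * pi} t \<partial>lborel \<partial>lborel)"
    by (rule nn_integral_polar) fact
  also have "\<dots> = (\<integral>\<^sup>+r. \<integral>\<^sup>+t. g (of_real r * cis (\<phi> + t)) * ennreal r * indicator {0..<2 * pi} t \<partial>lborel \<partial>lborel)"
  proof (rule nn_integral_cong)
    fix r :: real
    let ?h = "\<lambda>t. g (of_real r * cis t) * ennreal r"
    have "(\<integral>\<^sup>+t. ?h t * indicator {0..<2 * pi} t \<partial>lborel) = (\<integral>\<^sup>+t. ?h t * indicator {\<phi>..<\<phi> + 2 * pi} t \<partial>lborel)"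
      by (rule nn_integral_periodic_shift[symmetric]) (auto simp: cis_mult[symmetric])
    also have "\<dots> = ennreal \<bar>1\<bar> * (\<integral>\<^sup>+t. ?h (\<phi> + 1 * t) * indicator {\<phi>..<\<phi> + 2 * pi} (\<phi> + 1 * t) \<partial>lborel)"
      by (rule nn_integral_real_affine) auto
    also have "\<dots> = (\<integral>\<^sup>+t. ?h (\<phi> + t) * indicator {0..<2 * pi} t \<partial>lborel)"
      unfolding abs_one ennreal_1 mult_1 by (intro nn_integral_cong) (auto simp: indicator_def)
    finally show "(\<integral>\<^sup>+t. ?h t * indicator {0..<2 * pi} t \<partial>lborel) = (\<integral>\<^sup>+t. ?h (\<phi> + t) * indicator {0..<2 * pi} t \<partial>lborel)" .
  qed
  also have "\<dots> = \<bar>\<rho>\<bar> * (\<integral>\<^sup>+r. \<integral>\<^sup>+t. g (of_real (0 + \<rho> * r) * cis (\<phi> + t)) * ennreal (0 + \<rho> * r)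
      * indicator {0..<2 * pi} t \<partial>lborel \<partial>lborel)"
    using \<rho> by (intro nn_integral_real_affine) auto
  also have "\<dots> = \<rho> * (\<integral>\<^sup>+r. \<rho> * (\<integral>\<^sup>+t. g (c * (of_real r * cis t)) * ennreal r
      * indicator {0..<2 * pi} t \<partial>lborel) \<partial>lborel)"
  proof -
    have "(\<integral>\<^sup>+t. g (of_real (0 + \<rho> * r) * cis (\<phi> + t)) * ennreal (0 + \<rho> * r) * indicator {0..<2 * pi} t \<partial>lborel)
        = \<rho> * (\<integral>\<^sup>+t. g (c * (of_real r * cis t)) * ennreal r * indicator {0..<2 * pi} t \<partial>lborel)" for r
    proof -
      have A: "ennreal (0 + \<rho> * r) = \<rho> * ennreal r" using \<rho> by (simp add: ennreal_mult')
      have B: "of_real (0 + \<rho> * r) * cis (\<phi> + t) = c * (of_real r * cis t)" for t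
        by (simp add: ceq cis_mult[symmetric])
      show ?thesis unfolding A B by (subst nn_integral_cmult[symmetric]) (auto simp: ac_simps)
    qed
    then show ?thesis using \<rho> by simp
  qed
  also have "\<dots> = \<rho> * (\<rho> * (\<integral>\<^sup>+r. \<integral>\<^sup>+t. g (c * (of_real r * cis t)) * ennreal r
      * indicator {0..<2 * pi} t \<partial>lborel \<partial>lborel))"
    by (subst nn_integral_cmult) auto
  also have "(\<integral>\<^sup>+r. \<integral>\<^sup>+t. g (c * (of_real r * cis t)) * ennreal r * indicator {0..<2 * pi} t \<partial>lborel \<partial>lborel)
      = (\<integral>\<^sup>+z. g (c * z) \<partial>lborel)"
    by (rule nn_integral_polar[symmetric]) measurable
  finally show ?thesis
    using \<rho> by (simp add: \<rho>_def power2_eq_square ennreal_mult mult.assoc)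
qed

text \<open>The map \<open>t \<mapsto> m * t\<close> winds one period around \<open>m\<close> times;
  the factor \<open>m\<close> so gained cancels the one of the linear substitution.\<close>

lemma nn_integral_periodic_scale:
  fixes h :: "real \<Rightarrow> ennreal"
  assumes [measurable]: "h \<in> borel_measurable borel" and per: "\<And>t. h (t + T) = h t"
    and T: "T > 0" and m: "m > 0"
  shows "(\<integral>\<^sup>+t. h (real m * t) * indicator {0..<T} t \<partial>lborel) = (\<integral>\<^sup>+t. h t * indicator {0..<T} t \<partial>lborel)"
    (is "?L = ?I")
proof -
  have mult: "(\<integral>\<^sup>+t. h t * indicator {0..<real k * T} t \<partial>lborel) = of_nat k * ?I" for k
  proof (induction k)
    case (Suc k)
    have "(\<integral>\<^sup>+t. h t * indicator {0..<real (Suc k) * T} t \<partial>lborel)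
        = (\<integral>\<^sup>+t. h t * indicator {0..<real k * T} t + h t * indicator {real k * T..<real k * T + T} t \<partial>lborel)"
    proof (rule nn_integral_cong)
      fix t
      have pos: "0 \<le> t" if "T * real k \<le> t"
        using that T by (meson mult_nonneg_nonneg less_imp_le of_nat_0_le_iff order_trans)
      show "h t * indicator {0..<real (Suc k) * T} t
          = h t * indicator {0..<real k * T} t + h t * indicator {real k * T..<real k * T + T} t"
        using T pos by (auto simp: indicator_def algebra_simps)
    qed
    also have "\<dots> = of_nat k * ?I + ?I"
      by (subst nn_integral_add) (auto simp: Suc nn_integral_periodic_shift[OF assms(1) per T])
    finally show ?case by (simp add: algebra_simps)
  qed simp
  have "of_nat m * ?I = (\<integral>\<^sup>+t. h t * indicator {0..<real m * T} t \<partial>lborel)" by (rule mult[symmetric])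
  also have "\<dots> = ennreal \<bar>real m\<bar> * (\<integral>\<^sup>+t. h (0 + real m * t) * indicator {0..<real m * T} (0 + real m * t) \<partial>lborel)"
    using m by (intro nn_integral_real_affine) auto
  also have "\<dots> = of_nat m * ?L"
    using m T by (intro arg_cong2[of _ _ _ _ "(*)"] nn_integral_cong)
      (auto simp: indicator_def zero_le_mult_iff ennreal_of_nat_eq_real_of_nat)
  finally show ?thesis
    using m by (simp add: ennreal_mult_cancel_left ennreal_of_nat_eq_real_of_nat)
qed

text \<open>The jacobian of \<open>z \<mapsto> z ^ m\<close> is
  \<open>m ^ 2 * cmod z ^ (2 * m - 2)\<close>, and one factor \<open>m\<close> is used up because
  every nonzero point has \<open>m\<close> preimages. In polar coordinates the radius is substituted
  by \<open>r \<mapsto> r ^ m\<close>, the angle by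
  \<open>nn_integral_periodic_scale\<close>.\<close>

lemma nn_integral_unit_disc_power:
  fixes g :: "complex \<Rightarrow> ennreal"
  assumes [measurable]: "g \<in> borel_measurable borel" and m: "m > 0"
  shows "(\<integral>\<^sup>+z. g z * indicator (ball 0 1) z \<partial>lborel)
     = (\<integral>\<^sup>+z. g (z ^ m) * ennreal (real m * cmod z ^ (2 * m - 2)) * indicator (ball 0 1) z \<partial>lborel)"
proof -
  have [measurable]: "ball (0::complex) 1 \<in> sets borel" by simp
  define \<Theta> where "\<Theta> r = (\<integral>\<^sup>+t. g (of_real r * cis t) * indicator {0..<2 * pi} t \<partial>lborel)" for r
  have [measurable]: "\<Theta> \<in> borel_measurable borel" unfolding \<Theta>_def by measurable
  have pm: "(\<integral>\<^sup>+t. g (of_real (r ^ m) * cis (real m * t)) * indicator {0..<2 * pi} t \<partial>lborel) = \<Theta> (r ^ m)" for r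
    unfolding \<Theta>_def
    by (rule nn_integral_periodic_scale[where h = "\<lambda>t. g (of_real (r ^ m) * cis t)"])
       (use m in \<open>auto simp: cis_mult[symmetric]\<close>)
  have "(\<integral>\<^sup>+z. g z * indicator (ball 0 1) z \<partial>lborel)
     = (\<integral>\<^sup>+r. \<integral>\<^sup>+t. g (of_real r * cis t) * indicator (ball 0 1) (of_real r * cis t) * ennreal r
          * indicator {0..<2 * pi} t \<partial>lborel \<partial>lborel)"
    by (rule nn_integral_polar) measurable
  also have "\<dots> = (\<integral>\<^sup>+r. (\<Theta> r * ennreal r * indicator {..<1} r) * indicator {0..1} r \<partial>lborel)"
  proof (rule nn_integral_cong)
    fix r :: real
    have "(\<integral>\<^sup>+t. g (of_real r * cis t) * indicator (ball 0 1) (of_real r * cis t) * ennreal r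
          * indicator {0..<2 * pi} t \<partial>lborel)
        = (\<integral>\<^sup>+t. (ennreal r * indicator {..<1} r) * (g (of_real r * cis t) * indicator {0..<2 * pi} t) \<partial>lborel)"
      by (rule nn_integral_cong) (auto simp: indicator_def norm_mult ac_simps ennreal_neg)
    also have "\<dots> = (ennreal r * indicator {..<1} r) * \<Theta> r"
      unfolding \<Theta>_def by (rule nn_integral_cmult) measurable
    also have "\<dots> = (\<Theta> r * ennreal r * indicator {..<1} r) * indicator {0..1} r"
      by (auto simp: indicator_def ennreal_neg ac_simps)
    finally show "(\<integral>\<^sup>+t. g (of_real r * cis t) * indicator (ball 0 1) (of_real r * cis t) * ennreal r
          * indicator {0..<2 * pi} t \<partial>lborel) = (\<Theta> r * ennreal r * indicator {..<1} r) * indicator {0..1} r" .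
  qed
  also have "\<dots> = (\<integral>\<^sup>+r. (\<Theta> r * ennreal r * indicator {..<1} r) * indicator {0 ^ m..1 ^ m} r \<partial>lborel)"
    using m by (simp add: zero_power)
  also have "\<dots> = (\<integral>\<^sup>+r. (\<Theta> (r ^ m) * ennreal (r ^ m) * indicator {..<1} (r ^ m)) * ennreal (real m * r ^ (m - 1))
       * indicator {0..1} r \<partial>lborel)"
    by (rule nn_integral_substitution_aux)
       (auto intro!: derivative_eq_intros continuous_intros)
  also have "\<dots> = (\<integral>\<^sup>+r. \<integral>\<^sup>+t. (g ((of_real r * cis t) ^ m) * ennreal (real m * cmod (of_real r * cis t) ^ (2 * m - 2))
       * indicator (ball 0 1) (of_real r * cis t)) * ennreal r * indicator {0..<2 * pi} t \<partial>lborel \<partial>lborel)"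
  proof (rule nn_integral_cong)
    fix r :: real
    show "(\<Theta> (r ^ m) * ennreal (r ^ m) * indicator {..<1} (r ^ m)) * ennreal (real m * r ^ (m - 1)) * indicator {0..1} r
       = (\<integral>\<^sup>+t. (g ((of_real r * cis t) ^ m) * ennreal (real m * cmod (of_real r * cis t) ^ (2 * m - 2))
           * indicator (ball 0 1) (of_real r * cis t)) * ennreal r * indicator {0..<2 * pi} t \<partial>lborel)"
    proof (cases "r \<ge> 0 \<and> r < 1")
      case True
      have pw: "(of_real r * cis t) ^ m = of_real (r ^ m) * cis (real m * t)" for t
        by (simp add: power_mult_distrib Complex.DeMoivre)
      have lt: "r ^ m < 1" using True m by (auto simp: power_less_one_iff)
      have "r ^ m * (real m * r ^ (m - 1)) = real m * r ^ (2 * m - 2) * r"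
        using m by (cases m) (simp_all add: power_add[symmetric] mult_2)
      then have e: "ennreal (r ^ m) * ennreal (real m * r ^ (m - 1)) = ennreal (real m * r ^ (2 * m - 2)) * ennreal r"
        using True by (simp add: ennreal_mult[symmetric] del: of_nat_mult)
      have "(\<Theta> (r ^ m) * ennreal (r ^ m) * indicator {..<1} (r ^ m)) * ennreal (real m * r ^ (m - 1)) * indicator {0..1} r
         = \<Theta> (r ^ m) * (ennreal (r ^ m) * ennreal (real m * r ^ (m - 1)))"
        using True lt by (simp add: ac_simps)
      also have "\<dots>
         = ennreal (real m * r ^ (2 * m - 2)) * ennreal r * \<Theta> (r ^ m)"
        unfolding e by (simp add: ac_simps)
      also have "\<dots> = (\<integral>\<^sup>+t. ennreal (real m * r ^ (2 * m - 2)) * ennreal r *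
           (g (of_real (r ^ m) * cis (real m * t)) * indicator {0..<2 * pi} t) \<partial>lborel)"
        unfolding pm[symmetric] by (rule nn_integral_cmult[symmetric]) measurable
      also have "\<dots> = (\<integral>\<^sup>+t. (g ((of_real r * cis t) ^ m) * ennreal (real m * cmod (of_real r * cis t) ^ (2 * m - 2))
           * indicator (ball 0 1) (of_real r * cis t)) * ennreal r * indicator {0..<2 * pi} t \<partial>lborel)"
        unfolding pw using True by (intro nn_integral_cong) (auto simp: norm_mult ac_simps)
      finally show ?thesis .
    next
      case False
      then consider "r < 0" | "r \<ge> 1" by linarith
      then show ?thesis
        by cases (auto simp: ennreal_neg norm_mult indicator_def)
    qed
  qed
  also have "\<dots> = (\<integral>\<^sup>+z. g (z ^ m) * ennreal (real m * cmod z ^ (2 * m - 2)) * indicator (ball 0 1) z \<partial>lborel)"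
    by (rule nn_integral_polar[symmetric]) measurable
  finally show ?thesis .
qed

section \<open>The covering of the Hartogs triangle\<close>

locale hartogs_cover =
  fixes m n :: nat
  assumes m: "m > 0" and n: "n > 0"
begin

abbreviation H :: "(complex \<times> complex) set" where
  "H \<equiv> hartogs_triangle (real m / real n)"

abbreviation D2 :: "(complex \<times> complex) set" where
  "D2 \<equiv> ball 0 1 \<times> ball 0 1"

text \<open>The jacobian determinant of \<open>cover\<close> at \<open>(v, t)\<close> is \<open>m * t ^ N\<close>, up to sign.\<close>

definition cover :: "complex \<times> complex \<Rightarrow> complex \<times> complex" where
  "cover x = (fst x * snd x ^ n, snd x ^ m)"

definition N :: nat where "N = m + n - 1"

lemma N_pos: "N > 0"
  using m n by (auto simp: N_def)

lemma mem_H_iff: "(z1, t ^ m) \<in> H \<longleftrightarrow> cmod z1 < cmod t ^ n \<and> cmod t < 1"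
proof -
  have "cmod z1 powr (real m / real n) < cmod t ^ m \<longleftrightarrow> cmod z1 < cmod t ^ n"
  proof (cases "t = 0")
    case True
    then show ?thesis using m n by (simp add: zero_power not_less)
  next
    case False
    have "cmod t ^ m = (cmod t ^ n) powr (real m / real n)"
      using False n by (simp add: powr_realpow[symmetric] powr_powr)
    moreover have "real m / real n > 0" using m n by simp
    ultimately show ?thesis
      by (smt (verit) norm_ge_zero powr_less_mono2 powr_mono2 zero_le_power)
  qed
  then show ?thesis
    using m by (auto simp: hartogs_triangle_def norm_power power_less_one_iff)
qed

lemma cover_mem_H_iff: "cover x \<in> H \<longleftrightarrow> x \<in> ball 0 1 \<times> (ball 0 1 - {0})"
proof (cases "snd x = 0")
  case True
  then show ?thesis using n by (cases x) (auto simp: cover_def mem_H_iff zero_power)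
next
  case False
  then show ?thesis using n by (cases x) (auto simp: cover_def mem_H_iff norm_mult norm_power)
qed

lemma H_eq: "H = {z. cmod (fst z) powr (real m / real n) < cmod (snd z) \<and> cmod (snd z) < 1}"
  by (auto simp: hartogs_triangle_def)

lemma open_H: "open H"
proof -
  have c: "continuous_on UNIV (\<lambda>z::complex \<times> complex. cmod (fst z) powr (real m / real n))"
    using m n by (intro continuous_on_powr' continuous_intros) auto
  show ?thesis unfolding H_eq
    by (intro open_Collect_conj open_Collect_less c continuous_intros)
qed

lemma H_borel[measurable]: "H \<in> sets borel"
  by (rule borel_open[OF open_H])

lemma cover_measurable[measurable]: "cover \<in> borel_measurable borel"
  unfolding cover_def by (intro borel_measurable_continuous_onI continuous_intros)

text \<open>The substitution is done one coordinate at a time: \<open>z2 = t ^ m\<close> on the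
  disc, then \<open>z1 = v * t ^ n\<close> in the slice over \<open>t\<close>. The weights multiply
  to \<open>cmod t ^ (2 * n) * (m * cmod t ^ (2 * m - 2))\<close>, which has a single factor
  \<open>m\<close> because \<open>cover\<close> is \<open>m\<close>-to-one.\<close>

lemma nn_integral_cover:
  fixes g :: "complex \<times> complex \<Rightarrow> ennreal"
  assumes g[measurable]: "g \<in> borel_measurable borel"
  shows "(\<integral>\<^sup>+z. g z * indicator H z \<partial>lborel)
     = (\<integral>\<^sup>+x. g (cover x) * ennreal (real m * cmod (snd x) ^ (2 * N)) * indicator D2 x \<partial>lborel)"
proof -
  have [measurable]: "ball (0::complex) 1 \<in> sets borel" by simp
  have [measurable]: "(\<lambda>p. g (fst p * snd p ^ n, snd p ^ m)) \<in> borel_measurable (borel \<Otimes>\<^sub>M borel)"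
    using measurable_compose[OF cover_measurable g]
    by (simp add: borel_prod cover_def)
  have [measurable]: "D2 \<in> sets borel" by (intro borel_open open_Times open_ball)
  define G where "G z2 = (\<integral>\<^sup>+z1. g (z1, z2) * indicator H (z1, z2) \<partial>lborel)" for z2
  have gH: "(\<lambda>z. g z * indicator H z) \<in> borel_measurable (lborel \<Otimes>\<^sub>M lborel)"
    unfolding lborel_prod by measurable
  have [measurable]: "G \<in> borel_measurable borel"
    unfolding G_def
    using lborel.borel_measurable_nn_integral[of "\<lambda>z2 z1. g (z1, z2) * indicator H (z1, z2)" lborel]
      measurable_pair_swap[OF gH] by (simp add: case_prod_unfold)
  have fst_snd: "(\<integral>\<^sup>+x. f x \<partial>lborel) = (\<integral>\<^sup>+t. \<integral>\<^sup>+v. f (v, t) \<partial>lborel \<partial>lborel)"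
    if "f \<in> borel_measurable borel" for f :: "complex \<times> complex \<Rightarrow> ennreal"
    using lborel_pair.nn_integral_snd[of f] that by (simp add: lborel_prod)
  have "(\<integral>\<^sup>+z. g z * indicator H z \<partial>lborel) = (\<integral>\<^sup>+z2. G z2 \<partial>lborel)"
    unfolding G_def by (rule fst_snd) measurable
  also have "\<dots> = (\<integral>\<^sup>+z2. G z2 * indicator (ball 0 1) z2 \<partial>lborel)"
  proof (rule nn_integral_cong)
    fix z2
    show "G z2 = G z2 * indicator (ball 0 1) z2"
      by (auto simp: G_def indicator_def hartogs_triangle_def)
  qed
  also have "\<dots> = (\<integral>\<^sup>+t. G (t ^ m) * ennreal (real m * cmod t ^ (2 * m - 2)) * indicator (ball 0 1) t \<partial>lborel)"
    by (rule nn_integral_unit_disc_power) (use m in auto)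
  also have "\<dots> = (\<integral>\<^sup>+t. \<integral>\<^sup>+v. g (cover (v, t)) * ennreal (real m * cmod (snd (v, t)) ^ (2 * N)) * indicator D2 (v, t) \<partial>lborel \<partial>lborel)"
  proof (rule nn_integral_cong_AE)
    show "AE t in lborel. G (t ^ m) * ennreal (real m * cmod t ^ (2 * m - 2)) * indicator (ball 0 1) t
      = (\<integral>\<^sup>+v. g (cover (v, t)) * ennreal (real m * cmod (snd (v, t)) ^ (2 * N)) * indicator D2 (v, t) \<partial>lborel)"
      using AE_lborel_singleton[of "0::complex"]
    proof eventually_elim
      case (elim t)
      show ?case
      proof (cases "cmod t < 1")
        case True
        have mg: "(\<lambda>z1. g (z1, t ^ m) * indicator H (z1, t ^ m)) \<in> borel_measurable borel"
          using measurable_Pair1[OF gH, of "t ^ m"] by simp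
        have "G (t ^ m) = ennreal ((cmod (t ^ n))\<^sup>2) * (\<integral>\<^sup>+v. g (t ^ n * v, t ^ m) * indicator H (t ^ n * v, t ^ m) \<partial>lborel)"
          unfolding G_def by (rule nn_integral_complex_scale[OF mg]) (use elim in simp)
        also have "(\<integral>\<^sup>+v. g (t ^ n * v, t ^ m) * indicator H (t ^ n * v, t ^ m) \<partial>lborel)
           = (\<integral>\<^sup>+v. g (cover (v, t)) * indicator D2 (v, t) \<partial>lborel)"
          using elim True by (intro nn_integral_cong)
            (auto simp: cover_def mem_H_iff indicator_def norm_mult norm_power mult.commute)
        finally have G: "G (t ^ m) = ennreal ((cmod (t ^ n))\<^sup>2) * (\<integral>\<^sup>+v. g (cover (v, t)) * indicator D2 (v, t) \<partial>lborel)" .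
        have "(cmod (t ^ n))\<^sup>2 * (real m * cmod t ^ (2 * m - 2)) = real m * cmod t ^ (2 * N)"
        proof -
          have "2 * N = 2 * n + (2 * m - 2)" using m by (simp add: N_def)
          then show ?thesis by (simp add: norm_power power_add power_mult[symmetric] mult.commute[of n])
        qed
        then have e: "ennreal ((cmod (t ^ n))\<^sup>2) * ennreal (real m * cmod t ^ (2 * m - 2)) = ennreal (real m * cmod t ^ (2 * N))"
          by (simp add: ennreal_mult[symmetric] del: of_nat_mult)
        have "G (t ^ m) * ennreal (real m * cmod t ^ (2 * m - 2)) * indicator (ball 0 1) t
           = (ennreal ((cmod (t ^ n))\<^sup>2) * ennreal (real m * cmod t ^ (2 * m - 2))) * (\<integral>\<^sup>+v. g (cover (v, t)) * indicator D2 (v, t) \<partial>lborel)"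
          using True by (simp add: G ac_simps)
        also have "\<dots> = (\<integral>\<^sup>+v. ennreal (real m * cmod t ^ (2 * N)) * (g (cover (v, t)) * indicator D2 (v, t)) \<partial>lborel)"
          unfolding e
        proof (rule nn_integral_cmult[symmetric])
          have "(\<lambda>x. g (cover x) * indicator D2 x) \<in> borel_measurable (lborel \<Otimes>\<^sub>M lborel)"
            unfolding lborel_prod by measurable
          from measurable_Pair1[OF this, of t]
          show "(\<lambda>v. g (cover (v, t)) * indicator D2 (v, t)) \<in> borel_measurable lborel" by simp
        qed
        finally show ?thesis by (simp add: ac_simps)
      qed (auto simp: indicator_def)
    qed
  qed
  also have "\<dots> = (\<integral>\<^sup>+x. g (cover x) * ennreal (real m * cmod (snd x) ^ (2 * N)) * indicator D2 x \<partial>lborel)"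
  proof (rule fst_snd[symmetric])
    have "(\<lambda>x. ennreal (real m * cmod (snd x) ^ (2 * N))) \<in> borel_measurable (borel :: (complex \<times> complex) measure)"
      by (intro measurable_compose[OF _ measurable_ennreal] borel_measurable_continuous_onI continuous_intros)
    then show "(\<lambda>x. g (cover x) * ennreal (real m * cmod (snd x) ^ (2 * N)) * indicator D2 x) \<in> borel_measurable borel"
      by (intro borel_measurable_times_ennreal borel_measurable_indicator borel_open open_Times open_ball
          measurable_compose[OF cover_measurable g])
  qed
  finally show ?thesis .
qed

end

section \<open>The Bergman kernel of the disc\<close>

text \<open>As an identity of measures the formula for nonnegative functions carries over to Bochner
  integrals by \<open>integral_distr\<close> and \<open>integral_density\<close>. The
  \<open>max 0\<close> removes the negative radii that the real line also runs through.\<close>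

lemma lborel_complex_polar:
  "(lborel :: complex measure) = distr (density (lborel \<Otimes>\<^sub>M lborel)
      (\<lambda>x. ennreal (max 0 (fst x) * indicator {0..<2 * pi} (snd x)))) borel (\<lambda>x. of_real (fst x) * cis (snd x))"
proof (rule measure_eqI)
  let ?w = "\<lambda>x. ennreal (max 0 (fst x) * indicator {0..<2 * pi} (snd x))"
  have w[measurable]: "?w \<in> borel_measurable (lborel \<Otimes>\<^sub>M lborel)" by measurable
  have p[measurable]: "(\<lambda>x. of_real (fst x) * cis (snd x)) \<in> borel_measurable (lborel \<Otimes>\<^sub>M lborel)" by measurable
  fix A :: "complex set" assume "A \<in> sets lborel"
  then have [measurable]: "A \<in> sets borel" by simp
  have "emeasure lborel A = (\<integral>\<^sup>+z. indicator A z \<partial>lborel)" by simp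
  also have "\<dots> = (\<integral>\<^sup>+r. \<integral>\<^sup>+t. indicator A (of_real r * cis t) * ennreal r * indicator {0..<2 * pi} t \<partial>lborel \<partial>lborel)"
    by (rule nn_integral_polar) measurable
  also have "\<dots> = (\<integral>\<^sup>+r. \<integral>\<^sup>+t. ?w (r, t) * indicator A (of_real r * cis t) \<partial>lborel \<partial>lborel)"
    by (intro nn_integral_cong) (auto simp: indicator_def max_def ennreal_neg)
  also have "\<dots> = (\<integral>\<^sup>+x. ?w x * indicator A (of_real (fst x) * cis (snd x)) \<partial>(lborel \<Otimes>\<^sub>M lborel))"
    using lborel.nn_integral_fst[of "\<lambda>x. ?w x * indicator A (of_real (fst x) * cis (snd x))" lborel] by simp
  also have "\<dots> = (\<integral>\<^sup>+z. indicator A z \<partial>distr (density (lborel \<Otimes>\<^sub>M lborel) ?w) borel (\<lambda>x. of_real (fst x) * cis (snd x)))"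
    by (subst nn_integral_distr, simp, simp, subst nn_integral_density) auto
  finally show "emeasure lborel A = emeasure (distr (density (lborel \<Otimes>\<^sub>M lborel) ?w) borel (\<lambda>x. of_real (fst x) * cis (snd x))) A"
    by simp
qed simp

lemma integral_polar:
  fixes g :: "complex \<Rightarrow> complex"
  assumes "integrable lborel g"
  shows "integral\<^sup>L lborel g = (LINT r|lborel. LINT t|lborel. (max 0 r * indicator {0..<2 * pi} t) *\<^sub>R g (of_real r * cis t))"
proof -
  let ?w = "\<lambda>x. max 0 (fst x) * indicator {0..<2 * pi} (snd x) :: real"
  have [measurable]: "g \<in> borel_measurable borel" using assms by auto
  have p[measurable]: "(\<lambda>x. of_real (fst x) * cis (snd x)) \<in> borel_measurable (lborel \<Otimes>\<^sub>M lborel)" by measurable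
  have int: "integrable (lborel \<Otimes>\<^sub>M lborel) (\<lambda>x. ?w x *\<^sub>R g (of_real (fst x) * cis (snd x)))"
    using assms unfolding lborel_complex_polar
    by (subst (asm) integrable_distr_eq, simp, simp, subst (asm) integrable_density) auto
  have "integral\<^sup>L lborel g = (LINT x|(lborel \<Otimes>\<^sub>M lborel). ?w x *\<^sub>R g (of_real (fst x) * cis (snd x)))"
    unfolding lborel_complex_polar
    by (subst integral_distr, simp, simp, subst integral_density) auto
  also have "\<dots> = (LINT r|lborel. LINT t|lborel. ?w (r, t) *\<^sub>R g (of_real r * cis t))"
    using lborel_pair.integral_fst'[OF int] by simp
  finally show ?thesis by simp
qed

lemma unit_disc_integral_polar:
  fixes f :: "complex \<Rightarrow> complex"
  assumes "set_integrable lborel (ball 0 1) f"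
  shows "(LINT z:ball 0 1|lborel. f z)
    = (LINT r:{0<..<1}|lborel. of_real r * (LINT t:{0..2 * pi}|lborel. f (of_real r * cis t)))"
proof -
  have "(LINT z:ball 0 1|lborel. f z) = (LINT r|lborel. LINT t|lborel. (max 0 r * indicator {0..<2 * pi} t) *\<^sub>R
      (indicator (ball 0 1) (of_real r * cis t) *\<^sub>R f (of_real r * cis t)))"
    unfolding set_lebesgue_integral_def
    by (rule integral_polar) (use assms in \<open>simp add: set_integrable_def\<close>)
  also have "\<dots> = (LINT r:{0<..<1}|lborel. of_real r * (LINT t:{0..2 * pi}|lborel. f (of_real r * cis t)))"
    unfolding set_lebesgue_integral_def
  proof (rule Bochner_Integration.integral_cong)
    fix r :: real
    show "(LINT t|lborel. (max 0 r * indicator {0..<2 * pi} t) *\<^sub>R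
        (indicator (ball 0 1) (of_real r * cis t) *\<^sub>R f (of_real r * cis t)))
      = indicator {0<..<1} r *\<^sub>R (of_real r * (LINT t|lborel. indicator {0..2 * pi} t *\<^sub>R f (of_real r * cis t)))"
    proof (cases "r \<in> {0<..<1}")
      case True
      then have "(LINT t|lborel. (max 0 r * indicator {0..<2 * pi} t) *\<^sub>R
        (indicator (ball 0 1) (of_real r * cis t) *\<^sub>R f (of_real r * cis t)))
        = (LINT t|lborel. r *\<^sub>R (indicator {0..<2 * pi} t *\<^sub>R f (of_real r * cis t)))"
        by (intro Bochner_Integration.integral_cong) (auto simp: norm_mult)
      also have "\<dots> = r *\<^sub>R (LINT t|lborel. indicator {0..<2 * pi} t *\<^sub>R f (of_real r * cis t))"
        unfolding scaleR_conv_of_real by (rule integral_mult_right_zero)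
      also have "(LINT t|lborel. indicator {0..<2 * pi} t *\<^sub>R f (of_real r * cis t))
          = (LINT t|lborel. indicator {0..2 * pi} t *\<^sub>R f (of_real r * cis t))"
      proof -
        let ?g = "\<lambda>t. indicator {0..<2 * pi} t *\<^sub>R f (of_real r * cis t)"
        let ?h = "\<lambda>t. indicator {0..2 * pi} t *\<^sub>R f (of_real r * cis t)"
        have gh: "?g t = indicator {0..<2 * pi} t *\<^sub>R ?h t" "?h t = ?g t + indicator {2 * pi} t *\<^sub>R f (of_real r)" for t
          by (auto simp: indicator_def)
        \<comment> \<open>Measurability on an individual circle is not assumed. The two integrands
          are measurable together; if they are not, both integrals take the default value
          \<open>0\<close>.\<close>
        have "?g \<in> borel_measurable lborel \<longleftrightarrow> ?h \<in> borel_measurable lborel"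
        proof
          assume [measurable]: "?g \<in> borel_measurable lborel"
          show "?h \<in> borel_measurable lborel" by (subst gh(2)) measurable
        next
          assume [measurable]: "?h \<in> borel_measurable lborel"
          show "?g \<in> borel_measurable lborel" by (subst gh(1)) measurable
        qed
        moreover have "AE t in lborel. ?g t = ?h t"
          using AE_lborel_singleton[of "2 * pi"] by eventually_elim (auto simp: indicator_def)
        ultimately show ?thesis
          using integral_cong_AE[of ?g lborel ?h]
          by (metis (no_types, lifting) borel_measurable_integrable not_integrable_integral_eq)
      qed
      finally show ?thesis using True by (simp add: scaleR_conv_of_real)
    next
      case False
      then have z: "(max 0 r * indicator {0..<2 * pi} t) *\<^sub>R
        (indicator (ball 0 1) (of_real r * cis t) *\<^sub>R f (of_real r * cis t)) = 0" for t
        by (auto simp: norm_mult max_def indicator_def)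
      show ?thesis unfolding z using False by simp
    qed
  qed simp
  finally show ?thesis .
qed

section \<open>Taylor coefficients and mean values as integrals over circles and discs\<close>

text \<open>Cauchy's formula for the \<open>j\<close>-th derivative, rewritten as an integral over
  the angle.\<close>

lemma circle_coefficient:
  fixes f :: "complex \<Rightarrow> complex"
  assumes "continuous_on (cball 0 r) f" "f holomorphic_on ball 0 r" "r > 0"
  shows "(LINT t:{0..2 * pi}|lborel. cis (- real j * t) * f (of_real r * cis t))
     = 2 * pi * of_real r ^ j * ((deriv ^^ j) f 0 / fact j)"
proof -
  have c: "continuous_on {0..2 * pi} (\<lambda>t. f (of_real r * cis t))"
    by (rule continuous_on_compose2[OF assms(1)]) (use assms(3) in \<open>auto intro!: continuous_intros simp: norm_mult\<close>)
  have i: "set_integrable lborel {0..2 * pi} (\<lambda>t. cis (- real j * t) * f (of_real r * cis t))"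
    by (intro borel_integrable_atLeastAtMost' continuous_intros c)
  have "((\<lambda>u. f u / u ^ Suc j) has_contour_integral 2 * pi * \<i> / fact j * (deriv ^^ j) f 0) (circlepath 0 r)"
    using Cauchy_has_contour_integral_higher_derivative_circlepath[OF assms(1,2), of 0 j] assms(3) by simp
  then have "((\<lambda>t. f (0 + of_real r * cis t) / (0 + of_real r * cis t) ^ Suc j * of_real r * \<i> * cis t)
      has_integral 2 * pi * \<i> / fact j * (deriv ^^ j) f 0) {0..2 * pi}"
    unfolding circlepath_def
    by (subst (asm) has_contour_integral_part_circlepath_iff) auto
  \<comment> \<open>The factor \<open>- \<i>\<close> removes the \<open>\<i>\<close> of
    \<open>dz\<close>; \<open>of_real r ^ j\<close> removes the radius left over from the
    denominator.\<close>
  then have "((\<lambda>t. (- \<i> * of_real r ^ j) * (f (0 + of_real r * cis t) / (0 + of_real r * cis t) ^ Suc j * of_real r * \<i> * cis t))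
      has_integral (- \<i> * of_real r ^ j) * (2 * pi * \<i> / fact j * (deriv ^^ j) f 0)) {0..2 * pi}"
    by (rule has_integral_mult_right)
  moreover have "(- \<i> * of_real r ^ j) * (f (0 + of_real r * cis t) / (0 + of_real r * cis t) ^ Suc j * of_real r * \<i> * cis t)
      = cis (- real j * t) * f (of_real r * cis t)" for t
    using assms(3) by (simp add: power_mult_distrib Complex.DeMoivre cis_divide[symmetric] field_simps
        cis_inverse[symmetric])
  ultimately have "((\<lambda>t. cis (- real j * t) * f (of_real r * cis t))
      has_integral (2 * pi * of_real r ^ j * ((deriv ^^ j) f 0 / fact j))) {0..2 * pi}"
    by (simp add: mult_ac)
  then show ?thesis
    using set_borel_integral_eq_integral(2)[OF i] by (simp add: integral_unique)
qed

lemma nn_integral_FTC_interior: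
  fixes F f :: "real \<Rightarrow> real"
  assumes "a \<le> b" "continuous_on {a..b} F"
    and "\<And>x. x \<in> {a<..<b} \<Longrightarrow> (F has_real_derivative f x) (at x)"
    and "\<And>x. x \<in> {a<..<b} \<Longrightarrow> 0 \<le> f x"
  shows "(\<integral>\<^sup>+x. ennreal (f x) * indicator {a<..<b} x \<partial>lborel) = ennreal (F b - F a)"
proof -
  have "(f has_integral F b - F a) {a..b}"
    using assms by (intro fundamental_theorem_of_calculus_interior)
      (auto simp: has_real_derivative_iff_has_vector_derivative)
  then have "(f has_integral F b - F a) {a<..<b}"
    using has_integral_Icc_iff_Ioo by blast
  from nn_integral_has_integral_lebesgue[OF assms(4) this]
  show ?thesis
    by (simp add: ennreal_mult'' mult.commute ennreal_indicator)
qed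

lemma unit_disc_nn_integral_radial:
  fixes \<rho> :: "real \<Rightarrow> ennreal"
  assumes [measurable]: "\<rho> \<in> borel_measurable borel"
  shows "(\<integral>\<^sup>+z. \<rho> (cmod z) * indicator (ball 0 1) z \<partial>lborel)
    = ennreal (2 * pi) * (\<integral>\<^sup>+r. \<rho> r * ennreal r * indicator {0<..<1} r \<partial>lborel)"
proof -
  have [measurable]: "ball (0::complex) 1 \<in> sets borel" by simp
  have "(\<integral>\<^sup>+z. \<rho> (cmod z) * indicator (ball 0 1) z \<partial>lborel)
     = (\<integral>\<^sup>+r. \<integral>\<^sup>+t. \<rho> (cmod (of_real r * cis t)) * indicator (ball 0 1) (of_real r * cis t) * ennreal r
          * indicator {0..<2 * pi} t \<partial>lborel \<partial>lborel)"
    by (rule nn_integral_polar) measurable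
  also have "\<dots> = (\<integral>\<^sup>+r. ennreal (2 * pi) * (\<rho> r * ennreal r * indicator {0<..<1} r) \<partial>lborel)"
  proof (rule nn_integral_cong)
    fix r :: real
    have "(\<integral>\<^sup>+t. \<rho> (cmod (of_real r * cis t)) * indicator (ball 0 1) (of_real r * cis t) * ennreal r
          * indicator {0..<2 * pi} t \<partial>lborel)
       = (\<integral>\<^sup>+t. (\<rho> r * ennreal r * indicator {0<..<1} r) * indicator {0..<2 * pi} t \<partial>lborel)"
      by (intro nn_integral_cong) (auto simp: indicator_def norm_mult ennreal_neg)
    also have "\<dots> = (\<rho> r * ennreal r * indicator {0<..<1} r) * ennreal (2 * pi)"
      by (subst nn_integral_cmult_indicator) auto
    finally show "(\<integral>\<^sup>+t. \<rho> (cmod (of_real r * cis t)) * indicator (ball 0 1) (of_real r * cis t) * ennreal r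
          * indicator {0..<2 * pi} t \<partial>lborel) = ennreal (2 * pi) * (\<rho> r * ennreal r * indicator {0<..<1} r)"
      by (simp add: mult.commute)
  qed
  also have "\<dots> = ennreal (2 * pi) * (\<integral>\<^sup>+r. \<rho> r * ennreal r * indicator {0<..<1} r \<partial>lborel)"
    by (rule nn_integral_cmult) measurable
  finally show ?thesis .
qed

lemma set_integrable_iff_nn_integral:
  fixes f :: "'a \<Rightarrow> complex"
  assumes "set_borel_measurable M A f"
  shows "set_integrable M A f \<longleftrightarrow> (\<integral>\<^sup>+x. ennreal (cmod (f x)) * indicator A x \<partial>M) < \<infinity>"
proof -
  have "(\<integral>\<^sup>+x. ennreal (cmod (indicator A x *\<^sub>R f x)) \<partial>M) = (\<integral>\<^sup>+x. ennreal (cmod (f x)) * indicator A x \<partial>M)"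
    by (intro nn_integral_cong) (auto simp: indicator_def)
  then show ?thesis
    using assms by (simp add: set_integrable_def set_borel_measurable_def integrable_iff_bounded)
qed

text \<open>Integrability is not assumed: without it the integral on the left is the default
  \<open>0\<close>.\<close>

lemma set_integral_norm_bound_nn:
  fixes f :: "'a \<Rightarrow> complex"
  shows "ennreal (cmod (LINT x:A|M. f x)) \<le> (\<integral>\<^sup>+x. ennreal (cmod (f x)) * indicator A x \<partial>M)"
proof (cases "set_integrable M A f")
  case True
  have "(\<integral>\<^sup>+x. ennreal (cmod (indicator A x *\<^sub>R f x)) \<partial>M) = (\<integral>\<^sup>+x. ennreal (cmod (f x)) * indicator A x \<partial>M)"
    by (intro nn_integral_cong) (auto simp: indicator_def)
  then show ?thesis
    using integral_norm_bound_ennreal[of M "\<lambda>x. indicator A x *\<^sub>R f x"] True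
    by (simp add: set_integrable_def set_lebesgue_integral_def)
next
  case False
  then have "(LINT x:A|M. f x) = 0"
    unfolding set_integrable_def set_lebesgue_integral_def by (rule not_integrable_integral_eq)
  then show ?thesis by simp
qed

lemma set_borel_measurable_continuous:
  fixes f :: "'a::euclidean_space \<Rightarrow> complex"
  assumes "A \<in> sets borel" "continuous_on A f"
  shows "set_borel_measurable lborel A f"
  using borel_measurable_continuous_on_indicator[OF assms] by (simp add: set_borel_measurable_def)

lemma nn_integral_ball_affine:
  fixes h :: "complex \<Rightarrow> ennreal"
  assumes "(\<lambda>z. h z * indicator (ball c R) z) \<in> borel_measurable borel" and R: "R > 0"
  shows "(\<integral>\<^sup>+z. h z * indicator (ball c R) z \<partial>lborel)
      = ennreal (R\<^sup>2) * (\<integral>\<^sup>+z. h (c + of_real R * z) * indicator (ball 0 1) z \<partial>lborel)"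
proof -
  have "(\<integral>\<^sup>+z. h z * indicator (ball c R) z \<partial>lborel)
     = (\<integral>\<^sup>+z. h z * indicator (ball c R) z \<partial>density (distr lborel borel (\<lambda>x. c + R *\<^sub>R x)) (\<lambda>_. \<bar>R\<bar> ^ DIM(complex)))"
    using R by (subst lborel_affine[of R c]) auto
  also have "\<dots> = (\<integral>\<^sup>+z. ennreal (R\<^sup>2) * (h (c + R *\<^sub>R z) * indicator (ball c R) (c + R *\<^sub>R z)) \<partial>lborel)"
    using assms by (subst nn_integral_density, simp, simp, subst nn_integral_distr)
      (auto simp: power2_eq_square)
  also have "\<dots> = ennreal (R\<^sup>2) * (\<integral>\<^sup>+z. (h (c + R *\<^sub>R z) * indicator (ball c R) (c + R *\<^sub>R z)) \<partial>lborel)"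
    using assms(1) by (intro nn_integral_cmult) (auto intro: measurable_compose[rotated])
  also have "(\<integral>\<^sup>+z. (h (c + R *\<^sub>R z) * indicator (ball c R) (c + R *\<^sub>R z)) \<partial>lborel)
      = (\<integral>\<^sup>+z. h (c + of_real R * z) * indicator (ball 0 1) z \<partial>lborel)"
    using R by (intro nn_integral_cong)
      (auto simp: scaleR_conv_of_real indicator_def dist_norm norm_mult)
  finally show ?thesis .
qed

lemma integral_ball_affine:
  fixes h :: "complex \<Rightarrow> complex"
  assumes "set_borel_measurable lborel (ball c R) h" and R: "R > 0"
  shows "(LINT z:ball c R|lborel. h z) = of_real (R\<^sup>2) * (LINT z:ball 0 1|lborel. h (c + of_real R * z))"
proof -
  define g where "g = (\<lambda>z. indicator (ball c R) z *\<^sub>R h z)"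
  have [measurable]: "g \<in> borel_measurable borel" using assms by (simp add: set_borel_measurable_def g_def)
  have "integral\<^sup>L lborel g
     = integral\<^sup>L (density (distr lborel borel (\<lambda>x. c + R *\<^sub>R x)) (\<lambda>_. \<bar>R\<bar> ^ DIM(complex))) g"
    using R by (subst lborel_affine[of R c]) auto
  also have "\<dots> = (LINT z|lborel. R\<^sup>2 *\<^sub>R g (c + R *\<^sub>R z))"
    using R by (subst integral_density, simp, simp, simp, subst integral_distr)
      (auto simp: power2_eq_square)
  also have "\<dots> = (LINT z|lborel. of_real (R\<^sup>2) * (indicator (ball 0 1) z *\<^sub>R h (c + of_real R * z)))"
    using R by (intro Bochner_Integration.integral_cong)
      (auto simp: g_def scaleR_conv_of_real indicator_def dist_norm norm_mult)
  also have "\<dots> = of_real (R\<^sup>2) * (LINT z|lborel. (indicator (ball 0 1) z *\<^sub>R h (c + of_real R * z)))"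
    by (rule integral_mult_right_zero)
  finally show ?thesis by (simp add: set_lebesgue_integral_def g_def)
qed

text \<open>On each circle the factor \<open>cnj z ^ j\<close> selects the \<open>j\<close>-th
  Taylor coefficient; the radial integral of \<open>r ^ (2 * j + 1)\<close> gives the constant. The
  circles stay inside the open disc, so integrability of \<open>f\<close> is enough and no boundary
  values are required.\<close>

lemma disc_coefficient:
  fixes f :: "complex \<Rightarrow> complex"
  assumes hol: "f holomorphic_on ball 0 1" and int: "set_integrable lborel (ball 0 1) f"
  shows "(LINT z:ball 0 1|lborel. cnj z ^ j * f z) = pi / (real j + 1) * ((deriv ^^ j) f 0 / fact j)"
proof -
  define c where "c = (deriv ^^ j) f 0 / fact j"
  have inner: "(LINT t:{0..2 * pi}|lborel. cnj (of_real r * cis t) ^ j * f (of_real r * cis t))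
      = 2 * pi * of_real (r ^ (2 * j)) * c" if r: "r \<in> {0<..<1}" for r
  proof -
    have "cnj (of_real r * cis t) ^ j = of_real (r ^ j) * cis (- real j * t)" for t
      by (simp add: power_mult_distrib Complex.DeMoivre cis_cnj)
    then have "(LINT t:{0..2 * pi}|lborel. cnj (of_real r * cis t) ^ j * f (of_real r * cis t))
       = (LINT t:{0..2 * pi}|lborel. of_real (r ^ j) * (cis (- real j * t) * f (of_real r * cis t)))"
      by (simp add: mult.assoc)
    also have "\<dots> = of_real (r ^ j) * (LINT t:{0..2 * pi}|lborel. cis (- real j * t) * f (of_real r * cis t))"
      by (rule set_integral_mult_right)
    also have "(LINT t:{0..2 * pi}|lborel. cis (- real j * t) * f (of_real r * cis t))
        = 2 * pi * of_real r ^ j * c"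
      unfolding c_def
    proof (rule circle_coefficient)
      have "cball 0 r \<subseteq> ball (0::complex) 1" "ball 0 r \<subseteq> ball (0::complex) 1" using r by auto
      then show "continuous_on (cball 0 r) f" "f holomorphic_on ball 0 r"
        using hol holomorphic_on_subset holomorphic_on_imp_continuous_on by blast+
    qed (use r in auto)
    finally show ?thesis by (simp add: mult_2[of j] power_add)
  qed
  have "set_integrable lborel (ball 0 1) (\<lambda>z. cnj z ^ j * f z)"
  proof (rule set_integrable_bound[OF int])
    show "set_borel_measurable lborel (ball 0 1) (\<lambda>z. cnj z ^ j * f z)"
      by (intro set_borel_measurable_continuous continuous_intros holomorphic_on_imp_continuous_on hol) auto
    show "AE z in lborel. z \<in> ball 0 1 \<longrightarrow> cmod (cnj z ^ j * f z) \<le> cmod (f z)"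
      by (auto simp: norm_mult norm_power intro!: mult_left_le_one_le power_le_one AE_I2)
  qed
  from unit_disc_integral_polar[OF this]
  have "(LINT z:ball 0 1|lborel. cnj z ^ j * f z) = (LINT r:{0<..<1}|lborel. of_real r *
      (LINT t:{0..2 * pi}|lborel. cnj (of_real r * cis t) ^ j * f (of_real r * cis t)))" .
  also have "\<dots> = (LINT r:{0<..<1}|lborel. (2 * pi * c) * of_real (r ^ (2 * j + 1)))"
    by (rule set_lebesgue_integral_cong) (simp, intro allI impI, simp only: inner, simp)
  also have "\<dots> = (2 * pi * c) * (LINT r:{0<..<1}|lborel. of_real (r ^ (2 * j + 1)))"
    by (rule set_integral_mult_right)
  also have "(LINT r:{0<..<1}|lborel. complex_of_real (r ^ (2 * j + 1))) = of_real (1 / (2 * j + 2))"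
  proof -
    have pw: "((\<lambda>r. r ^ k) has_integral (1 ^ Suc k / Suc k - 0 ^ Suc k / Suc k)) {0..1::real}" for k
      by (intro fundamental_theorem_of_calculus)
         (auto simp: has_real_derivative_iff_has_vector_derivative[symmetric] simp del: power_Suc
           intro!: derivative_eq_intros)
    have *: "((\<lambda>r. r ^ (2 * j + 1)) has_integral (1 / (2 * j + 2))) {0<..<1::real}"
      using pw[of "2 * j + 1"] by (simp add: has_integral_Icc_iff_Ioo)
    have i: "set_integrable lborel {0<..<1::real} (\<lambda>r. r ^ (2 * j + 1))"
      by (rule set_integrable_subset[OF borel_integrable_atLeastAtMost'[of 0 1]]) (auto intro!: continuous_intros)
    show ?thesis
      unfolding set_integral_complex_of_real set_borel_integral_eq_integral(2)[OF i] integral_unique[OF *] ..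
  qed
  also have "2 * pi * c * of_real (1 / (2 * j + 2)) = pi / (real j + 1) * c"
  proof -
    have "1 + complex_of_nat j \<noteq> 0" by (metis of_nat_Suc of_nat_neq_0)
    moreover from this have "complex_of_nat j + 1 \<noteq> 0" by (simp add: add.commute)
    moreover have "2 + 2 * complex_of_nat j = 2 * (1 + complex_of_nat j)" by simp
    ultimately have "2 + 2 * complex_of_nat j \<noteq> 0" "complex_of_nat j + 1 \<noteq> 0"
      by (metis mult_eq_0_iff zero_neq_numeral)+
    then show ?thesis by (simp add: divide_simps)
  qed
  finally show ?thesis by (simp add: c_def)
qed

text \<open>The case \<open>j = 0\<close> of \<open>disc_coefficient\<close>, transported by the
  affine map from the unit disc to \<open>ball c R\<close>.\<close>

lemma ball_mean_value:
  fixes f :: "complex \<Rightarrow> complex"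
  assumes hol: "f holomorphic_on ball c R" and R: "R > 0" and int: "set_integrable lborel (ball c R) f"
  shows "(LINT z:ball c R|lborel. f z) = pi * of_real (R\<^sup>2) * f c"
proof -
  have mf: "set_borel_measurable lborel (ball c R) f"
    by (intro set_borel_measurable_continuous holomorphic_on_imp_continuous_on hol) auto
  define g where "g = (\<lambda>z. f (c + of_real R * z))"
  have gh: "g holomorphic_on ball 0 1"
    unfolding g_def using R
    by (intro holomorphic_on_compose_gen[OF _ hol, unfolded o_def] holomorphic_intros)
       (auto simp: dist_norm norm_mult)
  have mg: "set_borel_measurable lborel (ball 0 1) g"
    by (intro set_borel_measurable_continuous holomorphic_on_imp_continuous_on gh) auto
  have mh: "(\<lambda>z. ennreal (cmod (f z)) * indicator (ball c R) z) \<in> borel_measurable borel"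
  proof -
    have "(\<lambda>z. indicator (ball c R) z *\<^sub>R f z) \<in> borel_measurable borel"
      using mf by (simp add: set_borel_measurable_def)
    then have [measurable]: "(\<lambda>z. cmod (indicator (ball c R) z *\<^sub>R f z)) \<in> borel_measurable borel"
      by measurable
    have eq: "(\<lambda>z. ennreal (cmod (f z)) * indicator (ball c R) z) = (\<lambda>z. ennreal (cmod (indicator (ball c R) z *\<^sub>R f z)))"
      by (auto simp: indicator_def)
    show ?thesis by (subst eq) measurable
  qed
  have "set_integrable lborel (ball 0 1) g"
  proof -
    have "(\<integral>\<^sup>+z. ennreal (cmod (f z)) * indicator (ball c R) z \<partial>lborel) < \<infinity>"
      using int set_integrable_iff_nn_integral[OF mf] by simp
    then have "(\<integral>\<^sup>+z. ennreal (cmod (g z)) * indicator (ball 0 1) z \<partial>lborel) < \<infinity>"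
      using R unfolding nn_integral_ball_affine[OF mh R] by (auto simp: g_def ennreal_mult_less_top)
    then show ?thesis using set_integrable_iff_nn_integral[OF mg] by simp
  qed
  from disc_coefficient[OF gh this, of 0] show ?thesis
    unfolding integral_ball_affine[OF mf R] by (simp add: g_def)
qed

text \<open>The mean value property for the holomorphic function \<open>(f z)\<^sup>2\<close>, whose
  integrability is finiteness of the right-hand side; otherwise the bound is trivial.\<close>

lemma norm_square_le_ball_integral:
  fixes f :: "complex \<Rightarrow> complex"
  assumes hol: "f holomorphic_on ball c R" and R: "R > 0"
  shows "ennreal (pi * R\<^sup>2 * (cmod (f c))\<^sup>2) \<le> (\<integral>\<^sup>+z. ennreal ((cmod (f z))\<^sup>2) * indicator (ball c R) z \<partial>lborel)"
proof (cases "(\<integral>\<^sup>+z. ennreal ((cmod (f z))\<^sup>2) * indicator (ball c R) z \<partial>lborel) < \<infinity>")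
  case True
  have h2: "(\<lambda>z. (f z)\<^sup>2) holomorphic_on ball c R" by (intro holomorphic_intros hol)
  have "set_integrable lborel (ball c R) (\<lambda>z. (f z)\<^sup>2)"
    using True by (subst set_integrable_iff_nn_integral)
      (auto simp: norm_power intro!: set_borel_measurable_continuous holomorphic_on_imp_continuous_on h2)
  from ball_mean_value[OF h2 R this]
  have "ennreal (pi * R\<^sup>2 * (cmod (f c))\<^sup>2) = ennreal (cmod (LINT z:ball c R|lborel. (f z)\<^sup>2))"
    by (simp add: norm_mult norm_power)
  also have "\<dots> \<le> (\<integral>\<^sup>+z. ennreal ((cmod (f z))\<^sup>2) * indicator (ball c R) z \<partial>lborel)"
    using set_integral_norm_bound_nn[of lborel "ball c R" "\<lambda>z. (f z)\<^sup>2"] by (simp add: norm_power)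
  finally show ?thesis .
qed (simp add: not_less top_unique)

text \<open>The disc \<open>ball z (cmod z)\<close> avoids \<open>0\<close>, so the area bound gives
  \<open>pi * (cmod (z * g z))\<^sup>2\<close> at most the mass of the squared modulus of
  \<open>g\<close> near \<open>0\<close>. That mass tends to \<open>0\<close> by continuity of the
  finite measure \<open>\<mu>\<close> from above; hence \<open>z * g z\<close> tends to
  \<open>0\<close> and Riemann's theorem applies.\<close>

lemma L2_removable_singularity:
  fixes g :: "complex \<Rightarrow> complex"
  assumes hol: "g holomorphic_on ball 0 1 - {0}"
    and fin: "(\<integral>\<^sup>+z. ennreal ((cmod (g z))\<^sup>2) * indicator (ball 0 1) z \<partial>lborel) < \<infinity>"
  obtains h where "h holomorphic_on ball 0 1" "\<And>z. z \<in> ball 0 1 - {0} \<Longrightarrow> h z = g z"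
proof -
  let ?D = "ball (0::complex) 1"
  \<comment> \<open>The value \<open>g 0\<close> is arbitrary; on the punctured disc continuity
    makes \<open>w\<close> Borel.\<close>
  define w where "w = (\<lambda>z. ennreal ((cmod (g z))\<^sup>2) * indicator (?D - {0}) z)"
  have wm[measurable]: "w \<in> borel_measurable borel"
  proof -
    have "(\<lambda>z. indicator (?D - {0}) z *\<^sub>R g z) \<in> borel_measurable borel"
      by (intro borel_measurable_continuous_on_indicator holomorphic_on_imp_continuous_on hol) auto
    then have [measurable]: "(\<lambda>z. cmod (indicator (?D - {0}) z *\<^sub>R g z)) \<in> borel_measurable borel"
      by measurable
    have eq: "w = (\<lambda>z. ennreal ((cmod (indicator (?D - {0}) z *\<^sub>R g z))\<^sup>2))"
      by (auto simp: w_def indicator_def)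
    show ?thesis by (subst eq) measurable
  qed
  define \<mu> where "\<mu> = density lborel w"
  have mu: "emeasure \<mu> A = (\<integral>\<^sup>+z. w z * indicator A z \<partial>lborel)" if "A \<in> sets borel" for A
    using that by (simp add: \<mu>_def emeasure_density)
  have fin_mu: "emeasure \<mu> A \<noteq> \<infinity>" if "A \<in> sets borel" for A
  proof -
    have "emeasure \<mu> A \<le> (\<integral>\<^sup>+z. ennreal ((cmod (g z))\<^sup>2) * indicator ?D z \<partial>lborel)"
      unfolding mu[OF that] by (intro nn_integral_mono) (auto simp: w_def indicator_def)
    then show ?thesis using fin by (auto simp: top_unique)
  qed
  \<comment> \<open>The numerator \<open>2\<close> makes \<open>B k\<close> contain
    \<open>ball z (cmod z)\<close> as soon as \<open>cmod z < 1 / real (Suc k)\<close>.\<close>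
  define B where "B = (\<lambda>k. ball (0::complex) (2 / real (Suc k)))"
  have "(\<lambda>k. emeasure \<mu> (B k)) \<longlonglongrightarrow> emeasure \<mu> (\<Inter>k. B k)"
  proof (rule Lim_emeasure_decseq)
    show "decseq B" unfolding B_def decseq_def by (auto intro!: subset_ball frac_le)
    show "range B \<subseteq> sets \<mu>" by (auto simp: B_def \<mu>_def)
    show "emeasure \<mu> (B i) \<noteq> \<infinity>" for i by (rule fin_mu) (simp add: B_def)
  qed
  moreover have "(\<Inter>k. B k) = {0}"
  proof -
    have "z = 0" if "\<And>k. cmod z < 2 / real (Suc k)" for z
    proof (rule ccontr)
      assume "z \<noteq> 0"
      then obtain k where "2 / cmod z < real k" using reals_Archimedean2 by blast
      then have "2 < real k * cmod z" using \<open>z \<noteq> 0\<close> by (simp add: field_simps)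
      moreover have "cmod z + real k * cmod z < 2" using that[of k] by (simp add: field_simps)
      ultimately show False using norm_ge_zero[of z] by linarith
    qed
    then show ?thesis by (auto simp: B_def)
  qed
  moreover have "emeasure \<mu> {0} = 0"
  proof -
    have "w z * indicator {0} z = 0" for z by (auto simp: w_def indicator_def)
    then show ?thesis by (subst mu) simp_all
  qed
  ultimately have lim: "(\<lambda>k. emeasure \<mu> (B k)) \<longlonglongrightarrow> 0" by simp
  have "((\<lambda>z. (z - 0) * g z) \<longlongrightarrow> 0) (at 0)"
    unfolding tendsto_iff
  proof (intro allI impI)
    fix e :: real assume e: "e > 0"
    have "eventually (\<lambda>k. emeasure \<mu> (B k) < ennreal (pi * e\<^sup>2)) sequentially"
      using lim e by (intro order_tendstoD(2)) auto
    then obtain k where k: "emeasure \<mu> (B k) < ennreal (pi * e\<^sup>2)"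
      by (auto simp: eventually_sequentially)
    have "cmod (z * g z) < e" if z: "z \<noteq> 0" "cmod z < 1 / real (Suc k)" "cmod z < 1 / 2" for z
    proof -
      have sub: "ball z (cmod z) \<subseteq> B k" "ball z (cmod z) \<subseteq> ?D - {0}"
      proof -
        have *: "cmod x < 2 * cmod z" if "x \<in> ball z (cmod z)" for x
          using that norm_triangle_ineq4[of z "z - x"] by (auto simp: dist_norm)
        have "2 * cmod z \<le> 2 / real (Suc k)" "2 * cmod z < 1" using z by auto
        moreover have "0 \<notin> ball z (cmod z)" by (simp add: dist_norm)
        ultimately have "x \<in> B k \<and> x \<in> ?D - {0}" if "x \<in> ball z (cmod z)" for x
          using *[OF that] that by (auto simp: B_def)
        then show "ball z (cmod z) \<subseteq> B k" "ball z (cmod z) \<subseteq> ?D - {0}" by blast+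
      qed
      have "ennreal (pi * (cmod z)\<^sup>2 * (cmod (g z))\<^sup>2)
          \<le> (\<integral>\<^sup>+x. ennreal ((cmod (g x))\<^sup>2) * indicator (ball z (cmod z)) x \<partial>lborel)"
        by (rule norm_square_le_ball_integral) (use z holomorphic_on_subset[OF hol sub(2)] in auto)
      also have "\<dots> \<le> (\<integral>\<^sup>+x. w x * indicator (B k) x \<partial>lborel)"
        using sub by (intro nn_integral_mono) (auto simp: w_def indicator_def)
      also have "\<dots> = emeasure \<mu> (B k)" by (rule mu[symmetric]) (auto simp: B_def)
      also have "pi * (cmod z)\<^sup>2 * (cmod (g z))\<^sup>2 = pi * (cmod (z * g z))\<^sup>2"
        by (simp add: norm_mult power_mult_distrib)
      finally have "ennreal (pi * (cmod (z * g z))\<^sup>2) < ennreal (pi * e\<^sup>2)"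
        using k by (rule le_less_trans)
      then have "(cmod (z * g z))\<^sup>2 < e\<^sup>2"
        using e by (subst (asm) ennreal_less_iff) auto
      then show ?thesis using e by (simp add: power_less_imp_less_base)
    qed
    moreover have "eventually (\<lambda>z::complex. z \<noteq> 0 \<and> cmod z < 1 / real (Suc k) \<and> cmod z < 1 / 2) (at 0)"
      unfolding eventually_at by (intro exI[of _ "min (1 / real (Suc k)) (1/2)"]) auto
    ultimately show "eventually (\<lambda>z. dist ((z - 0) * g z) 0 < e) (at 0)"
      by (auto elim!: eventually_mono simp: dist_norm)
  qed
  moreover have "0 \<in> interior ?D" by simp
  ultimately obtain h where "h holomorphic_on ?D" "\<forall>z\<in>?D - {0}. h z = g z"
    using holomorphic_on_extend_lim[OF hol] by blast
  then show ?thesis using that by blast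
qed

lemma emeasure_unit_disc: "emeasure lborel (ball (0::complex) 1) = ennreal pi"
proof -
  have "(\<integral>\<^sup>+z. 1 * indicator (ball (0::complex) 1) z \<partial>lborel)
    = ennreal (2 * pi) * (\<integral>\<^sup>+r. 1 * ennreal r * indicator {0<..<1} r \<partial>lborel)"
    by (rule unit_disc_nn_integral_radial[where \<rho> = "\<lambda>_. 1"]) simp
  also have "(\<integral>\<^sup>+r. 1 * ennreal r * indicator {0<..<1} r \<partial>lborel) = ennreal (1\<^sup>2 / 2 - 0\<^sup>2 / 2)"
    unfolding mult_1
    by (rule nn_integral_FTC_interior) (auto intro!: continuous_intros derivative_eq_intros)
  also have "ennreal (2 * pi) * ennreal (1\<^sup>2 / 2 - 0\<^sup>2 / 2) = ennreal (2 * pi * (1\<^sup>2 / 2 - 0\<^sup>2 / 2))"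
    by (rule ennreal_mult[symmetric]) auto
  finally show ?thesis by simp
qed

lemma borel_measurable_norm_compose:
  fixes f :: "'a \<Rightarrow> 'b::real_normed_vector"
  assumes "f \<in> borel_measurable M"
  shows "(\<lambda>x. norm (f x)) \<in> borel_measurable M"
  by (rule measurable_compose[OF assms]) (intro borel_measurable_continuous_onI continuous_intros)

text \<open>The pointwise bound \<open>cmod (f z) \<le> 1 + (cmod (f z))\<^sup>2\<close> suffices,
  since the constant is integrable on \<open>A\<close>.\<close>

lemma L2_imp_integrable_finite_measure:
  fixes f :: "'a::euclidean_space \<Rightarrow> complex"
  assumes m: "set_borel_measurable lborel A f" and A: "A \<in> sets borel" "emeasure lborel A < \<infinity>"
    and fin: "(\<integral>\<^sup>+z. ennreal ((cmod (f z))\<^sup>2) * indicator A z \<partial>lborel) < \<infinity>"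
  shows "set_integrable lborel A f"
proof -
  define g where "g = (\<lambda>z. cmod (indicator A z *\<^sub>R f z))"
  have [measurable]: "g \<in> borel_measurable borel"
    unfolding g_def by (rule borel_measurable_norm_compose) (use m in \<open>simp add: set_borel_measurable_def\<close>)
  note A(1)[measurable]
  have "(\<integral>\<^sup>+z. ennreal (cmod (f z)) * indicator A z \<partial>lborel)
      \<le> (\<integral>\<^sup>+z. indicator A z + ennreal ((g z)\<^sup>2) \<partial>lborel)"
  proof (rule nn_integral_mono)
    fix z
    have "cmod (f z) \<le> 1 + (cmod (f z))\<^sup>2"
      using sum_squares_bound[of "cmod (f z)" 1] norm_ge_zero[of "f z"]
      by (simp only: mult_1_right one_power2)
    then have "ennreal (cmod (f z)) \<le> 1 + ennreal ((cmod (f z))\<^sup>2)"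
      by (metis ennreal_leI ennreal_plus ennreal_1 zero_le_one zero_le_power2)
    then show "ennreal (cmod (f z)) * indicator A z \<le> indicator A z + ennreal ((g z)\<^sup>2)"
      by (auto simp: g_def indicator_def)
  qed
  also have "\<dots> = emeasure lborel A + (\<integral>\<^sup>+z. ennreal ((g z)\<^sup>2) \<partial>lborel)"
    using A(1) by (subst nn_integral_add) auto
  also have "(\<integral>\<^sup>+z. ennreal ((g z)\<^sup>2) \<partial>lborel) = (\<integral>\<^sup>+z. ennreal ((cmod (f z))\<^sup>2) * indicator A z \<partial>lborel)"
    by (intro nn_integral_cong) (auto simp: g_def indicator_def)
  finally show ?thesis
    unfolding set_integrable_iff_nn_integral[OF m] using fin A(2)
    by (auto simp: less_top[symmetric] top_unique)
qed

lemma L2_imp_integrable_disc: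
  assumes m: "set_borel_measurable lborel (ball (0::complex) 1) f"
    and fin: "(\<integral>\<^sup>+z. ennreal ((cmod (f z))\<^sup>2) * indicator (ball 0 1) z \<partial>lborel) < \<infinity>"
  shows "set_integrable lborel (ball 0 1) f"
  by (rule L2_imp_integrable_finite_measure[OF m _ _ fin]) (simp_all add: emeasure_unit_disc)

text \<open>The kernel is the sum of the terms \<open>(j + 1) * (t * cnj s) ^ j / pi\<close>.
  Integrated against \<open>g\<close>, each of them gives one term of the Taylor series by
  \<open>disc_coefficient\<close>. Sum and integral may be exchanged because the terms are dominated
  by \<open>(j + 1) * cmod t ^ j\<close>, uniformly in \<open>s\<close>.\<close>

lemma bergman_disc_reproducing:
  fixes g :: "complex \<Rightarrow> complex"
  assumes hol: "g holomorphic_on ball 0 1" and int: "set_integrable lborel (ball 0 1) g"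
    and t: "cmod t < 1"
  shows "g t = (LINT s:ball 0 1|lborel. g s / (pi * (1 - t * cnj s)\<^sup>2))"
proof -
  define a where "a = (\<lambda>j. (deriv ^^ j) g 0 / fact j)"
  define F where "F = (\<lambda>j s. of_nat (Suc j) * t ^ j / pi * (indicator (ball 0 1) s *\<^sub>R (cnj s ^ j * g s)))"
  have norm_le: "cmod (cnj s ^ j * g s) \<le> cmod (g s)" if "s \<in> ball 0 1" for s j
    using that by (auto simp: norm_mult norm_power intro!: mult_left_le_one_le power_le_one)
  have intj: "set_integrable lborel (ball 0 1) (\<lambda>s. cnj s ^ j * g s)" for j
    by (rule set_integrable_bound[OF int])
      (auto intro!: set_borel_measurable_continuous continuous_intros norm_le AE_I2
        holomorphic_on_imp_continuous_on[OF hol])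
  have Fint: "integrable lborel (F j)" for j
    using intj[of j] unfolding F_def set_integrable_def by (rule integrable_mult_right)
  have Fval: "integral\<^sup>L lborel (F j) = a j * t ^ j" for j
  proof -
    have "integral\<^sup>L lborel (F j) = of_nat (Suc j) * t ^ j / pi * (LINT s:ball 0 1|lborel. cnj s ^ j * g s)"
      unfolding F_def set_lebesgue_integral_def by (rule integral_mult_right_zero)
    also have "\<dots> = of_nat (Suc j) * t ^ j / pi * (pi / (real j + 1) * a j)"
      unfolding disc_coefficient[OF hol int] a_def ..
    also have "\<dots> = a j * t ^ j"
    proof -
      have "1 + complex_of_nat j \<noteq> 0" by (metis of_nat_Suc of_nat_neq_0)
      then show ?thesis by (simp add: divide_simps add.commute)
    qed
    finally show ?thesis .
  qed
  have Fbound: "cmod (F j s) \<le> real (Suc j) * cmod t ^ j * (cmod (indicator (ball 0 1) s *\<^sub>R g s) / pi)" for j s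
  proof (cases "s \<in> ball 0 1")
    case True
    then have "cmod (F j s) = real (Suc j) * cmod t ^ j / pi * cmod (cnj s ^ j * g s)"
      by (simp add: F_def norm_mult norm_divide norm_power del: of_nat_Suc)
    also have "\<dots> \<le> real (Suc j) * cmod t ^ j / pi * cmod (g s)"
      by (intro mult_left_mono norm_le True) auto
    finally show ?thesis using True by simp
  qed (simp add: F_def)
  have geo: "(\<lambda>j. real (Suc j) * cmod t ^ j) sums (1 / (1 - cmod t)\<^sup>2)"
    using geometric_deriv_sums[of "cmod t"] t by simp
  have sumF: "summable (\<lambda>j. cmod (F j s))" for s
    by (rule summable_comparison_test'[where N = 0,
          OF summable_mult2[OF sums_summable[OF geo], of "cmod (indicator (ball 0 1) s *\<^sub>R g s) / pi"]])
       (simp only: Fbound real_norm_def abs_norm_cancel)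
  have sumI: "summable (\<lambda>j. \<integral>s. cmod (F j s) \<partial>lborel)"
  proof (rule summable_comparison_test'[OF summable_mult2[OF sums_summable[OF geo]]])
    fix j :: nat
    have gi: "integrable lborel (\<lambda>s. cmod (indicator (ball 0 1) s *\<^sub>R g s) / pi)"
      using int unfolding set_integrable_def by (intro integrable_divide integrable_norm)
    have "(\<integral>s. cmod (F j s) \<partial>lborel) \<le> (\<integral>s. real (Suc j) * cmod t ^ j * (cmod (indicator (ball 0 1) s *\<^sub>R g s) / pi) \<partial>lborel)"
      by (intro integral_mono integrable_norm Fint integrable_mult_right gi Fbound)
    also have "\<dots> = real (Suc j) * cmod t ^ j * (\<integral>s. cmod (indicator (ball 0 1) s *\<^sub>R g s) / pi \<partial>lborel)"
      by (rule integral_mult_right_zero)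
    finally show "norm (\<integral>s. cmod (F j s) \<partial>lborel)
        \<le> real (Suc j) * cmod t ^ j * (\<integral>s. cmod (indicator (ball 0 1) s *\<^sub>R g s) / pi \<partial>lborel)"
      by simp
  qed
  have "(\<lambda>j. integral\<^sup>L lborel (F j)) sums (\<integral>s. (\<Sum>j. F j s) \<partial>lborel)"
    by (rule sums_integral[OF Fint _ sumI]) (use sumF in auto)
  then have s1: "(\<lambda>j. a j * t ^ j) sums (\<integral>s. (\<Sum>j. F j s) \<partial>lborel)"
    unfolding Fval .
  have s2: "(\<lambda>j. a j * t ^ j) sums g t"
    using holomorphic_power_series[OF hol, of t] t by (simp add: a_def)
  have "(\<Sum>j. F j s) = indicator (ball 0 1) s *\<^sub>R (g s / (pi * (1 - t * cnj s)\<^sup>2))" for s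
  proof (cases "s \<in> ball 0 1")
    case True
    then have "cmod (t * cnj s) < 1"
      using t by (simp add: norm_mult) (metis mult_strict_mono' mult_1 norm_ge_zero)
    from sums_mult2[OF geometric_deriv_sums[OF this], of "g s / pi"]
    have "(\<lambda>j. F j s) sums (g s / (pi * (1 - t * cnj s)\<^sup>2))"
      using True by (simp add: F_def power_mult_distrib mult_ac del: of_nat_Suc)
    then show ?thesis using True by (simp add: sums_iff)
  qed (simp add: F_def)
  then have "(\<integral>s. (\<Sum>j. F j s) \<partial>lborel) = (LINT s:ball 0 1|lborel. g s / (pi * (1 - t * cnj s)\<^sup>2))"
    by (simp add: set_lebesgue_integral_def)
  then show ?thesis using sums_unique2[OF s1 s2] by simp
qed

text \<open>The holomorphic extension across \<open>0\<close> agrees with \<open>g\<close> almost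
  everywhere, so the formula for the full disc transfers.\<close>

lemma bergman_punctured_disc_reproducing:
  fixes g :: "complex \<Rightarrow> complex"
  assumes hol: "g holomorphic_on ball 0 1 - {0}"
    and fin: "(\<integral>\<^sup>+z. ennreal ((cmod (g z))\<^sup>2) * indicator (ball 0 1) z \<partial>lborel) < \<infinity>"
    and t: "cmod t < 1" "t \<noteq> 0"
  shows "g t = (LINT s:ball 0 1|lborel. g s / (pi * (1 - t * cnj s)\<^sup>2))"
proof -
  obtain h where h: "h holomorphic_on ball 0 1" and hg: "\<And>z. z \<in> ball 0 1 - {0} \<Longrightarrow> h z = g z"
    using L2_removable_singularity[OF hol fin] by blast
  have AE: "AE z in lborel. z \<in> ball 0 1 \<longrightarrow> h z = g z"
    using AE_lborel_singleton[of 0] by eventually_elim (use hg in auto)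
  have mh: "set_borel_measurable lborel (ball 0 1) h"
    by (intro set_borel_measurable_continuous holomorphic_on_imp_continuous_on h) auto
  have "(\<integral>\<^sup>+z. ennreal ((cmod (h z))\<^sup>2) * indicator (ball 0 1) z \<partial>lborel)
     = (\<integral>\<^sup>+z. ennreal ((cmod (g z))\<^sup>2) * indicator (ball 0 1) z \<partial>lborel)"
    using AE by (intro nn_integral_cong_AE) (auto elim!: eventually_mono simp: indicator_def)
  then have "set_integrable lborel (ball 0 1) h"
    using fin by (intro L2_imp_integrable_disc mh) simp
  from bergman_disc_reproducing[OF h this t(1)]
  have "g t = (LINT s:ball 0 1|lborel. h s / (pi * (1 - t * cnj s)\<^sup>2))"
    using hg[of t] t by simp
  also have "\<dots> = (LINT s:ball 0 1|lborel. g s / (pi * (1 - t * cnj s)\<^sup>2))"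
    unfolding set_lebesgue_integral_def
  proof (rule integral_cong_AE)
    have nz: "1 - t * cnj s \<noteq> 0" if "s \<in> ball 0 1" for s
    proof -
      have "cmod (t * cnj s) < 1"
        using that t by (simp add: norm_mult) (metis mult_strict_mono' mult_1 norm_ge_zero)
      then show ?thesis by auto
    qed
    have c: "continuous_on (ball 0 1) (\<lambda>s. h s / (pi * (1 - t * cnj s)\<^sup>2))"
      by (intro continuous_intros holomorphic_on_imp_continuous_on[OF h]) (use nz in auto)
    then show 1: "(\<lambda>s. indicator (ball 0 1) s *\<^sub>R (h s / (pi * (1 - t * cnj s)\<^sup>2))) \<in> borel_measurable lborel"
      using borel_measurable_continuous_on_indicator[OF _ c] by simp
    have c': "continuous_on (ball 0 1 - {0}) (\<lambda>s. g s / (pi * (1 - t * cnj s)\<^sup>2))"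
      by (intro continuous_intros holomorphic_on_imp_continuous_on[OF hol]) (use nz in auto)
    have [measurable]: "(\<lambda>s. indicator (ball 0 1 - {0}) s *\<^sub>R (g s / (pi * (1 - t * cnj s)\<^sup>2))) \<in> borel_measurable borel"
      using borel_measurable_continuous_on_indicator[OF _ c'] by simp
    \<comment> \<open>The origin is split off because \<open>g\<close> is continuous only on the
      punctured disc; there the integrand takes the arbitrary value \<open>g 0 / pi\<close>.\<close>
    have eq: "(\<lambda>s. indicator (ball 0 1) s *\<^sub>R (g s / (pi * (1 - t * cnj s)\<^sup>2)))
        = (\<lambda>s. indicator (ball 0 1 - {0}) s *\<^sub>R (g s / (pi * (1 - t * cnj s)\<^sup>2)) + indicator {0} s *\<^sub>R (g 0 / pi))"
      by (auto simp: indicator_def)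
    show "(\<lambda>s. indicator (ball 0 1) s *\<^sub>R (g s / (pi * (1 - t * cnj s)\<^sup>2))) \<in> borel_measurable lborel"
      by (subst eq) measurable
    show "AE s in lborel. indicator (ball 0 1) s *\<^sub>R (h s / (pi * (1 - t * cnj s)\<^sup>2))
        = indicator (ball 0 1) s *\<^sub>R (g s / (pi * (1 - t * cnj s)\<^sup>2))"
      using AE by eventually_elim (auto simp: indicator_def)
  qed
  finally show ?thesis .
qed

text \<open>\<open>(1 - \<bar>c\<bar>\<^sup>2) / \<bar>1 - c e\<^sup>i\<^sup>t\<bar>\<^sup>2\<close> is the real part of the holomorphic function
  \<open>(1 + c z) / (1 - c z)\<close> at \<open>z = e\<^sup>i\<^sup>t\<close>.\<close>

lemma nn_integral_inverse_norm_square_circle: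
  assumes c: "cmod c < 1"
  shows "(\<integral>\<^sup>+t. ennreal (1 / (cmod (1 - c * cis t))\<^sup>2) * indicator {0..<2 * pi} t \<partial>lborel)
     = ennreal (2 * pi / (1 - (cmod c)\<^sup>2))"
proof -
  define f where "f = (\<lambda>z. (1 + c * z) / (1 - c * z))"
  have nz: "1 - c * z \<noteq> 0" if "z \<in> cball 0 1" for z
  proof -
    have "cmod (c * z) \<le> cmod c * 1"
      using that unfolding norm_mult by (intro mult_left_mono) auto
    then show ?thesis using c by auto
  qed
  have f: "continuous_on (cball 0 1) f" "f holomorphic_on ball 0 1"
    unfolding f_def using nz by (auto intro!: continuous_intros holomorphic_intros)
  have I: "(LINT t:{0..2 * pi}|lborel. f (cis t)) = 2 * pi"
    using circle_coefficient[OF f, of 0] by (simp add: f_def)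
  have "continuous_on {0..2 * pi} (\<lambda>t. f (cis t))"
    by (rule continuous_on_compose2[OF f(1)]) (auto intro!: continuous_intros)
  then have i: "set_integrable lborel {0..2 * pi} (\<lambda>t. f (cis t))"
    by (rule borel_integrable_atLeastAtMost')
  have "(LINT t:{0..2 * pi}|lborel. Re (f (cis t))) = Re (LINT t:{0..2 * pi}|lborel. f (cis t))"
    using integral_Re[OF i[unfolded set_integrable_def]] by (simp add: set_lebesgue_integral_def)
  with I have L: "(LINT t:{0..2 * pi}|lborel. Re (f (cis t))) = 2 * pi" by simp
  have iR: "set_integrable lborel {0..2 * pi} (\<lambda>t. Re (f (cis t)))"
    using integrable_Re[OF i[unfolded set_integrable_def]] by (simp add: set_integrable_def)
  have Re_f: "Re (f (cis t)) = (1 - (cmod c)\<^sup>2) / (cmod (1 - c * cis t))\<^sup>2" for t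
  proof -
    let ?w = "c * cis t"
    have "Re ((1 + ?w) / (1 - ?w)) = Re ((1 + ?w) * cnj (1 - ?w)) / (cmod (1 - ?w))\<^sup>2"
      by (subst complex_div_cnj) (simp only: Re_divide_of_real of_real_power[symmetric])
    also have "Re ((1 + ?w) * cnj (1 - ?w)) = 1 - (cmod ?w)\<^sup>2"
    proof -
      have "Re ((1 + w) * cnj (1 - w)) = 1 - (cmod w)\<^sup>2" for w
        unfolding cmod_power2 by (simp add: power2_eq_square algebra_simps)
      then show ?thesis .
    qed
    finally show ?thesis by (simp add: f_def norm_mult)
  qed
  have c2: "1 - (cmod c)\<^sup>2 > 0" using c by (simp add: power_less_one_iff abs_square_less_1)
  have "(\<integral>\<^sup>+t. ennreal (1 / (cmod (1 - c * cis t))\<^sup>2) * indicator {0..<2 * pi} t \<partial>lborel)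
      = (\<integral>\<^sup>+t. ennreal (indicator {0..2 * pi} t *\<^sub>R Re (f (cis t)) / (1 - (cmod c)\<^sup>2)) \<partial>lborel)"
  proof (rule nn_integral_cong_AE)
    show "AE t in lborel. ennreal (1 / (cmod (1 - c * cis t))\<^sup>2) * indicator {0..<2 * pi} t
        = ennreal (indicator {0..2 * pi} t *\<^sub>R Re (f (cis t)) / (1 - (cmod c)\<^sup>2))"
      using AE_lborel_singleton[of "2 * pi"]
      by eventually_elim (use c2 in \<open>auto simp: indicator_def Re_f\<close>)
  qed
  also have "\<dots> = ennreal (\<integral>t. indicator {0..2 * pi} t *\<^sub>R Re (f (cis t)) / (1 - (cmod c)\<^sup>2) \<partial>lborel)"
    using iR c2 unfolding set_integrable_def
    by (intro nn_integral_eq_integral integrable_divide) (auto simp: Re_f)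
  also have "\<dots> = ennreal (2 * pi / (1 - (cmod c)\<^sup>2))"
    using L by (simp add: set_lebesgue_integral_def)
  finally show ?thesis .
qed

section \<open>Forelli-Rudin estimates for the disc kernel\<close>

text \<open>On the circle of radius \<open>r\<close> the integral over the angle is known exactly
  from \<open>nn_integral_inverse_norm_square_circle\<close> with
  \<open>c = cnj z * of_real r\<close>; only a one-dimensional integral has to be estimated
  afterwards.\<close>

lemma disc_nn_integral_radial_kernel:
  fixes \<rho> :: "real \<Rightarrow> ennreal"
  assumes [measurable]: "\<rho> \<in> borel_measurable borel" and z: "cmod z < 1"
  shows "(\<integral>\<^sup>+w. \<rho> (cmod w) * ennreal (1 / (cmod (1 - z * cnj w))\<^sup>2) * indicator (ball 0 1) w \<partial>lborel)
    = (\<integral>\<^sup>+r. \<rho> r * ennreal (2 * pi * r / (1 - (cmod z)\<^sup>2 * r\<^sup>2)) * indicator {0<..<1} r \<partial>lborel)"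
proof -
  have [measurable]: "ball (0::complex) 1 \<in> sets borel" by simp
  have [measurable]: "cnj \<in> borel_measurable borel"
    by (intro borel_measurable_continuous_onI continuous_intros)
  have kernel: "cmod (1 - z * cnj w) = cmod (1 - cnj z * w)" for w
    by (metis complex_cnj_cnj complex_cnj_diff complex_cnj_mult complex_cnj_one complex_mod_cnj)
  have "(\<integral>\<^sup>+w. \<rho> (cmod w) * ennreal (1 / (cmod (1 - z * cnj w))\<^sup>2) * indicator (ball 0 1) w \<partial>lborel)
     = (\<integral>\<^sup>+r. \<integral>\<^sup>+t. (\<rho> (cmod (of_real r * cis t)) * ennreal (1 / (cmod (1 - z * cnj (of_real r * cis t)))\<^sup>2)
         * indicator (ball 0 1) (of_real r * cis t)) * ennreal r * indicator {0..<2 * pi} t \<partial>lborel \<partial>lborel)"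
    by (rule nn_integral_polar) measurable
  also have "\<dots> = (\<integral>\<^sup>+r. \<rho> r * ennreal (2 * pi * r / (1 - (cmod z)\<^sup>2 * r\<^sup>2)) * indicator {0<..<1} r \<partial>lborel)"
  proof (rule nn_integral_cong)
    fix r :: real
    show "(\<integral>\<^sup>+t. (\<rho> (cmod (of_real r * cis t)) * ennreal (1 / (cmod (1 - z * cnj (of_real r * cis t)))\<^sup>2)
         * indicator (ball 0 1) (of_real r * cis t)) * ennreal r * indicator {0..<2 * pi} t \<partial>lborel)
       = \<rho> r * ennreal (2 * pi * r / (1 - (cmod z)\<^sup>2 * r\<^sup>2)) * indicator {0<..<1} r"
    proof (cases "r \<in> {0<..<1}")
      case True
      have lt: "cmod z * r < 1"
        using True z by (smt (verit, best) greaterThanLessThan_iff mult_left_le_one_le norm_ge_zero mult.commute)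
      have lt2: "(cmod z)\<^sup>2 * r\<^sup>2 < 1"
        using lt True by (simp add: power_mult_distrib[symmetric] abs_square_less_1)
      have "(\<integral>\<^sup>+t. (\<rho> (cmod (of_real r * cis t)) * ennreal (1 / (cmod (1 - z * cnj (of_real r * cis t)))\<^sup>2)
         * indicator (ball 0 1) (of_real r * cis t)) * ennreal r * indicator {0..<2 * pi} t \<partial>lborel)
        = (\<integral>\<^sup>+t. (\<rho> r * ennreal r) * (ennreal (1 / (cmod (1 - (cnj z * of_real r) * cis t))\<^sup>2) * indicator {0..<2 * pi} t) \<partial>lborel)"
        unfolding kernel using True by (intro nn_integral_cong) (auto simp: norm_mult ac_simps)
      also have "\<dots> = (\<rho> r * ennreal r) * (\<integral>\<^sup>+t. (ennreal (1 / (cmod (1 - (cnj z * of_real r) * cis t))\<^sup>2) * indicator {0..<2 * pi} t) \<partial>lborel)"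
        by (rule nn_integral_cmult) measurable
      also have "\<dots> = (\<rho> r * ennreal r) * ennreal (2 * pi / (1 - (cmod (cnj z * of_real r))\<^sup>2))"
        by (subst nn_integral_inverse_norm_square_circle) (use lt True in \<open>auto simp: norm_mult\<close>)
      also have "\<dots> = \<rho> r * (ennreal r * ennreal (2 * pi / (1 - (cmod z)\<^sup>2 * r\<^sup>2)))"
        using True by (simp add: norm_mult power_mult_distrib mult.assoc)
      also have "ennreal r * ennreal (2 * pi / (1 - (cmod z)\<^sup>2 * r\<^sup>2)) = ennreal (r * (2 * pi / (1 - (cmod z)\<^sup>2 * r\<^sup>2)))"
        using True lt2 by (intro ennreal_mult[symmetric]) auto
      finally show ?thesis using True by (simp add: mult_ac)
    next
      case False
      then have z: "(\<rho> (cmod (of_real r * cis t)) * ennreal (1 / (cmod (1 - z * cnj (of_real r * cis t)))\<^sup>2)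
         * indicator (ball 0 1) (of_real r * cis t)) * ennreal r = 0" for t
        by (auto simp: indicator_def norm_mult ennreal_neg)
      show ?thesis unfolding z using False by simp
    qed
  qed
  finally show ?thesis .
qed

text \<open>Near \<open>0\<close> only \<open>r powr (c + 1)\<close> matters, integrable because
  \<open>c > -2\<close>. For larger \<open>r\<close> the denominator is at least
  \<open>1 - r\<^sup>2\<close>, used for \<open>r < x\<close>, and at least
  \<open>1 - x\<^sup>2\<close>, used for \<open>r > x\<close>. Both choices have explicit
  antiderivatives; the first yields the power \<open>-s\<close> because \<open>s > 0\<close>, the
  second converges at \<open>1\<close> because \<open>s < 1\<close>.\<close>

lemma unit_interval_kernel_estimate:
  fixes s c :: real
  assumes s: "0 < s" "s < 1" and c: "c > -2"
  obtains C where "C \<ge> 0" "\<And>x. 0 \<le> x \<Longrightarrow> x < 1 \<Longrightarrow>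
    (\<integral>\<^sup>+r. ennreal (r powr c * (1 - r\<^sup>2) powr (-s)) * ennreal (2 * pi * r / (1 - x\<^sup>2 * r\<^sup>2)) * indicator {0<..<1} r \<partial>lborel)
      \<le> ennreal (C * (1 - x\<^sup>2) powr (-s))"
proof
  \<comment> \<open>Bounds \<open>r powr c\<close> on \<open>[1/2, 1)\<close> for either sign of
    \<open>c\<close>.\<close>
  define K where "K = 2 powr \<bar>c\<bar>"
  \<comment> \<open>The angular factor times the constants of the integrals of \<open>?I1\<close>,
    \<open>?I2\<close> and \<open>?I3\<close>; the \<open>8\<close> leaves slack over the product
    \<open>2 * 2\<close> of the bounds valid for \<open>r \<le> 1 / 2\<close>.\<close>
  define C where "C = 2 * pi * (8 / (c + 2) + K / (2 * s) + K / (2 * (1 - s)))"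
  have K: "K > 0" by (simp add: K_def)
  show "C \<ge> 0" using s c K by (auto simp: C_def intro!: add_nonneg_nonneg mult_nonneg_nonneg divide_nonneg_nonneg)
  fix x :: real assume x: "0 \<le> x" "x < 1"
  let ?I1 = "\<lambda>r. ennreal (8 * r powr (c + 1)) * indicator {0<..<1} r"
  let ?I2 = "\<lambda>r. ennreal (K * (r * (1 - r\<^sup>2) powr (-s - 1))) * indicator {0<..<x} r"
  let ?I3 = "\<lambda>r. ennreal (K / (1 - x\<^sup>2) * (r * (1 - r\<^sup>2) powr (-s))) * indicator {x<..<1} r"
  have x2: "1 - x\<^sup>2 > 0" using x by (simp add: abs_square_less_1)
  have main: "r powr c * (1 - r\<^sup>2) powr (-s) * (r / (1 - x\<^sup>2 * r\<^sup>2)) \<le>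
      8 * r powr (c + 1) + (if r < x then K * (r * (1 - r\<^sup>2) powr (-s - 1)) else K / (1 - x\<^sup>2) * (r * (1 - r\<^sup>2) powr (-s)))"
    if r: "0 < r" "r < 1" for r
  proof -
    have r2: "1 - r\<^sup>2 > 0" using r by (simp add: abs_square_less_1)
    have xr: "1 - x\<^sup>2 * r\<^sup>2 \<ge> 1 - r\<^sup>2" "1 - x\<^sup>2 * r\<^sup>2 \<ge> 1 - x\<^sup>2"
      using x r mult_left_le_one_le[of "r\<^sup>2" "x\<^sup>2"] mult_right_le_one_le[of "x\<^sup>2" "r\<^sup>2"]
      by (auto simp: power_le_one)
    have xr0: "1 - x\<^sup>2 * r\<^sup>2 > 0" using xr(1) r2 by linarith
    have rc: "r powr c * r = r powr (c + 1)" using r by (simp add: powr_add)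
    show ?thesis
    proof (cases "r \<le> 1 / 2")
      case True
      have "r\<^sup>2 \<le> (1 / 2)\<^sup>2" using True r by (intro power_mono) auto
      then have b: "1 - r\<^sup>2 \<ge> 1 / 2" by (simp add: power2_eq_square)
      have "(1 - r\<^sup>2) powr (-s) \<le> (1 / 2) powr (-s)" using b s by (intro powr_mono2') auto
      also have "\<dots> = 2 powr s" by (simp add: powr_minus_divide powr_divide)
      also have "\<dots> \<le> 2 powr 1" using s by (intro powr_mono) auto
      finally have p: "(1 - r\<^sup>2) powr (-s) \<le> 2" by simp
      have q: "1 / (1 - x\<^sup>2 * r\<^sup>2) \<le> 2" using xr b by (simp add: divide_simps)
      have "r powr c * (1 - r\<^sup>2) powr (-s) * (r / (1 - x\<^sup>2 * r\<^sup>2))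
          = r powr (c + 1) * ((1 - r\<^sup>2) powr (-s) * (1 / (1 - x\<^sup>2 * r\<^sup>2)))"
        by (simp add: rc[symmetric])
      also have "\<dots> \<le> r powr (c + 1) * (2 * 2)"
        using p q xr r2 by (intro mult_left_mono mult_mono) auto
      also have "\<dots> \<le> 8 * r powr (c + 1)" by simp
      finally show ?thesis using K r x2 by (auto intro: add_increasing2)
    next
      case False
      have "r powr c \<le> K"
      proof (cases "c \<ge> 0")
        case True
        then show ?thesis using r unfolding K_def
          by (intro order_trans[OF powr_le1 ge_one_powr_ge_zero]) auto
      next
        case neg: False
        then have "r powr c \<le> (1 / 2) powr c" using False by (intro powr_mono2') auto
        also have "\<dots> = 2 powr (-c)" by (simp add: powr_divide powr_minus_divide)
        also have "\<dots> = K" using neg by (simp add: K_def)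
        finally show ?thesis .
      qed
      then have k: "r powr c * (1 - r\<^sup>2) powr (-s) * (r / (1 - x\<^sup>2 * r\<^sup>2)) \<le> K * (1 - r\<^sup>2) powr (-s) * (r / (1 - x\<^sup>2 * r\<^sup>2))"
        using r xr r2 by (intro mult_right_mono) auto
      show ?thesis
      proof (cases "r < x")
        case True
        have "K * (1 - r\<^sup>2) powr (-s) * (r / (1 - x\<^sup>2 * r\<^sup>2)) \<le> K * (1 - r\<^sup>2) powr (-s) * (r / (1 - r\<^sup>2))"
          using r xr(1) xr0 r2 K by (intro mult_left_mono divide_left_mono mult_pos_pos) simp_all
        also have "\<dots> = K * (r * (1 - r\<^sup>2) powr (-s - 1))"
          using r2 by (simp add: powr_diff)
        finally show ?thesis using k True by (auto intro: add_increasing)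
      next
        case False
        have "K * (1 - r\<^sup>2) powr (-s) * (r / (1 - x\<^sup>2 * r\<^sup>2)) \<le> K * (1 - r\<^sup>2) powr (-s) * (r / (1 - x\<^sup>2))"
          using r xr(2) xr0 x2 K by (intro mult_left_mono divide_left_mono mult_pos_pos) simp_all
        also have "\<dots> = K / (1 - x\<^sup>2) * (r * (1 - r\<^sup>2) powr (-s))" by simp
        finally show ?thesis using k False by (auto intro: add_increasing)
      qed
    qed
  qed
  have "(\<integral>\<^sup>+r. ennreal (r powr c * (1 - r\<^sup>2) powr (-s)) * ennreal (2 * pi * r / (1 - x\<^sup>2 * r\<^sup>2)) * indicator {0<..<1} r \<partial>lborel)
     \<le> (\<integral>\<^sup>+r. ennreal (2 * pi) * (?I1 r + ?I2 r + ?I3 r) \<partial>lborel)"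
  proof (rule nn_integral_mono_AE)
    show "AE r in lborel. ennreal (r powr c * (1 - r\<^sup>2) powr (-s)) * ennreal (2 * pi * r / (1 - x\<^sup>2 * r\<^sup>2)) * indicator {0<..<1} r
        \<le> ennreal (2 * pi) * (?I1 r + ?I2 r + ?I3 r)"
      \<comment> \<open>At \<open>r = x\<close> neither \<open>?I2\<close> nor \<open>?I3\<close> is
        active.\<close>
      using AE_lborel_singleton[of x]
    proof eventually_elim
      case (elim r)
      show ?case
      proof (cases "r \<in> {0<..<1}")
        case True
        have r2: "1 - r\<^sup>2 > 0" using True by (simp add: abs_square_less_1)
        have "x\<^sup>2 * r\<^sup>2 \<le> r\<^sup>2"
          using x by (intro mult_left_le_one_le power_le_one) auto
        then have xr: "1 - x\<^sup>2 * r\<^sup>2 > 0" using r2 by linarith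
        let ?m = "if r < x then K * (r * (1 - r\<^sup>2) powr (-s - 1)) else K / (1 - x\<^sup>2) * (r * (1 - r\<^sup>2) powr (-s))"
        have m0: "?m \<ge> 0" using K True x2 by auto
        have "ennreal (r powr c * (1 - r\<^sup>2) powr (-s)) * ennreal (2 * pi * r / (1 - x\<^sup>2 * r\<^sup>2))
           = ennreal (2 * pi * (r powr c * (1 - r\<^sup>2) powr (-s) * (r / (1 - x\<^sup>2 * r\<^sup>2))))"
          using xr True by (subst ennreal_mult[symmetric]) (auto simp: mult_ac)
        also have "\<dots> \<le> ennreal (2 * pi * (8 * r powr (c + 1) + ?m))"
          using main[of r] True by (intro ennreal_leI mult_left_mono) auto
        also have "\<dots> = ennreal (2 * pi) * (ennreal (8 * r powr (c + 1)) + ennreal ?m)"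
          using m0 by (subst ennreal_mult) (auto simp: ennreal_plus)
        also have "ennreal ?m = ?I2 r + ?I3 r"
          using elim True by (auto simp: indicator_def)
        finally show ?thesis using True by (simp add: add.assoc)
      qed simp
    qed
  qed
  also have "\<dots> = ennreal (2 * pi) * ((\<integral>\<^sup>+r. ?I1 r \<partial>lborel) + (\<integral>\<^sup>+r. ?I2 r \<partial>lborel) + (\<integral>\<^sup>+r. ?I3 r \<partial>lborel))"
    by (subst nn_integral_cmult, measurable, subst nn_integral_add, measurable, subst nn_integral_add, measurable)
  also have "(\<integral>\<^sup>+r. ?I1 r \<partial>lborel) = ennreal (8 * 1 powr (c + 2) / (c + 2) - 8 * 0 powr (c + 2) / (c + 2))"
  proof (rule nn_integral_FTC_interior)
    show "continuous_on {0..1} (\<lambda>r. 8 * r powr (c + 2) / (c + 2))"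
      using c by (intro continuous_intros continuous_on_powr') auto
    show "((\<lambda>r. 8 * r powr (c + 2) / (c + 2)) has_real_derivative 8 * r powr (c + 1)) (at r)"
      if "r \<in> {0<..<1}" for r
      using c that by (auto intro!: derivative_eq_intros simp: add.commute)
  qed auto
  also have "(\<integral>\<^sup>+r. ?I2 r \<partial>lborel) = ennreal (K * (1 - x\<^sup>2) powr (-s) / (2 * s) - K * (1 - 0\<^sup>2) powr (-s) / (2 * s))"
  proof (rule nn_integral_FTC_interior)
    have pos: "1 - r\<^sup>2 > 0" if "0 \<le> r" "r \<le> x" for r using that x by (simp add: abs_square_less_1)
    then show "continuous_on {0..x} (\<lambda>r. K * (1 - r\<^sup>2) powr (-s) / (2 * s))"
      using s by (intro continuous_intros) (auto simp: less_imp_neq[symmetric])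
    show "((\<lambda>r. K * (1 - r\<^sup>2) powr (-s) / (2 * s)) has_real_derivative K * (r * (1 - r\<^sup>2) powr (-s - 1))) (at r)"
      if "r \<in> {0<..<x}" for r
      using pos[of r] that s by (auto intro!: derivative_eq_intros simp: powr_diff field_simps)
  qed (use x K in auto)
  also have "(\<integral>\<^sup>+r. ?I3 r \<partial>lborel) = ennreal ((- K / (1 - x\<^sup>2)) * (1 - 1\<^sup>2) powr (1 - s) / (2 * (1 - s))
       - (- K / (1 - x\<^sup>2)) * (1 - x\<^sup>2) powr (1 - s) / (2 * (1 - s)))"
  proof (rule nn_integral_FTC_interior)
    have pos: "1 - r\<^sup>2 > 0" if "x < r" "r < 1" for r using that x by (simp add: abs_square_less_1)
    show "continuous_on {x..1} (\<lambda>r. (- K / (1 - x\<^sup>2)) * (1 - r\<^sup>2) powr (1 - s) / (2 * (1 - s)))"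
      using s x x2 by (intro continuous_intros continuous_on_powr') (auto simp: abs_square_le_1)
    show "((\<lambda>r. (- K / (1 - x\<^sup>2)) * (1 - r\<^sup>2) powr (1 - s) / (2 * (1 - s))) has_real_derivative K / (1 - x\<^sup>2) * (r * (1 - r\<^sup>2) powr (-s))) (at r)"
      if "r \<in> {x<..<1}" for r
    proof -
      have d: "((\<lambda>r. (1 - r\<^sup>2) powr (1 - s)) has_real_derivative (1 - s) * (1 - r\<^sup>2) powr (-s) * (- (2 * r))) (at r)"
        using pos[of r] that s by (auto intro!: derivative_eq_intros simp: mult_ac)
      have "A / (2 * (1 - s)) * ((1 - s) * P * (- (2 * r))) = - A * (r * P)" for A P :: real
      proof -
        define q where "q = 1 - s"
        have "q \<noteq> 0" using s by (simp add: q_def)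
        then show ?thesis unfolding q_def[symmetric] by simp
      qed
      from this[of "- K / (1 - x\<^sup>2)" "(1 - r\<^sup>2) powr (-s)"]
      show ?thesis
        using DERIV_cmult[OF d, of "(- K / (1 - x\<^sup>2)) / (2 * (1 - s))"] by simp
    qed
  qed (use x K x2 in auto)
  also have "ennreal (2 * pi) * (ennreal (8 * 1 powr (c + 2) / (c + 2) - 8 * 0 powr (c + 2) / (c + 2))
      + ennreal (K * (1 - x\<^sup>2) powr (-s) / (2 * s) - K * (1 - 0\<^sup>2) powr (-s) / (2 * s))
      + ennreal ((- K / (1 - x\<^sup>2)) * (1 - 1\<^sup>2) powr (1 - s) / (2 * (1 - s)) - (- K / (1 - x\<^sup>2)) * (1 - x\<^sup>2) powr (1 - s) / (2 * (1 - s))))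
     \<le> ennreal (2 * pi) * (ennreal (8 / (c + 2) * (1 - x\<^sup>2) powr (-s)) + ennreal (K / (2 * s) * (1 - x\<^sup>2) powr (-s))
        + ennreal (K / (2 * (1 - s)) * (1 - x\<^sup>2) powr (-s)))"
  proof (intro mult_left_mono add_mono ennreal_leI)
    have "1 \<le> (1 - x\<^sup>2) powr (-s)"
      using powr_mono2'[of "-s" "1 - x\<^sup>2" 1] x2 s by simp
    then show "8 * 1 powr (c + 2) / (c + 2) - 8 * 0 powr (c + 2) / (c + 2) \<le> 8 / (c + 2) * (1 - x\<^sup>2) powr (-s)"
      using c by (simp add: divide_right_mono)
    show "K * (1 - x\<^sup>2) powr (-s) / (2 * s) - K * (1 - 0\<^sup>2) powr (-s) / (2 * s) \<le> K / (2 * s) * (1 - x\<^sup>2) powr (-s)"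
      using K s by simp
    show "(- K / (1 - x\<^sup>2)) * (1 - 1\<^sup>2) powr (1 - s) / (2 * (1 - s)) - (- K / (1 - x\<^sup>2)) * (1 - x\<^sup>2) powr (1 - s) / (2 * (1 - s))
        \<le> K / (2 * (1 - s)) * (1 - x\<^sup>2) powr (-s)"
      using x2 s by (simp add: powr_diff powr_minus_divide mult.commute)
  qed simp
  also have "\<dots> = ennreal (C * (1 - x\<^sup>2) powr (-s))"
    using K s c by (simp add: C_def ennreal_plus[symmetric] ennreal_mult[symmetric] distrib_right distrib_left
        mult.assoc del: ennreal_plus)
  finally show "(\<integral>\<^sup>+r. ennreal (r powr c * (1 - r\<^sup>2) powr (-s)) * ennreal (2 * pi * r / (1 - x\<^sup>2 * r\<^sup>2)) * indicator {0<..<1} r \<partial>lborel)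
      \<le> ennreal (C * (1 - x\<^sup>2) powr (-s))" .
qed

text \<open>The same power of \<open>1 - (cmod z)\<^sup>2\<close> is returned that was put in, which
  is the form required by Schur's test. The additional factor \<open>cmod w powr c\<close> is
  harmless away from \<open>0\<close> and accounts for the weights in \<open>t\<close>.\<close>

lemma disc_kernel_estimate:
  fixes s c :: real
  assumes "0 < s" "s < 1" "c > -2"
  obtains C where "C \<ge> 0" "\<And>z. cmod z < 1 \<Longrightarrow>
    (\<integral>\<^sup>+w. ennreal (cmod w powr c * (1 - (cmod w)\<^sup>2) powr (-s) / (cmod (1 - z * cnj w))\<^sup>2) * indicator (ball 0 1) w \<partial>lborel)
      \<le> ennreal (C * (1 - (cmod z)\<^sup>2) powr (-s))"
proof -
  obtain C where C: "C \<ge> 0" "\<And>x. 0 \<le> x \<Longrightarrow> x < 1 \<Longrightarrow>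
    (\<integral>\<^sup>+r. ennreal (r powr c * (1 - r\<^sup>2) powr (-s)) * ennreal (2 * pi * r / (1 - x\<^sup>2 * r\<^sup>2)) * indicator {0<..<1} r \<partial>lborel)
      \<le> ennreal (C * (1 - x\<^sup>2) powr (-s))"
    using unit_interval_kernel_estimate[OF assms] by blast
  have "(\<integral>\<^sup>+w. ennreal (cmod w powr c * (1 - (cmod w)\<^sup>2) powr (-s) / (cmod (1 - z * cnj w))\<^sup>2) * indicator (ball 0 1) w \<partial>lborel)
      \<le> ennreal (C * (1 - (cmod z)\<^sup>2) powr (-s))" if z: "cmod z < 1" for z
  proof -
    have "(\<integral>\<^sup>+w. ennreal (cmod w powr c * (1 - (cmod w)\<^sup>2) powr (-s) / (cmod (1 - z * cnj w))\<^sup>2) * indicator (ball 0 1) w \<partial>lborel)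
        = (\<integral>\<^sup>+w. ennreal (cmod w powr c * (1 - (cmod w)\<^sup>2) powr (-s)) * ennreal (1 / (cmod (1 - z * cnj w))\<^sup>2) * indicator (ball 0 1) w \<partial>lborel)"
      by (intro nn_integral_cong) (auto simp: ennreal_mult[symmetric])
    also have "\<dots> = (\<integral>\<^sup>+r. ennreal (r powr c * (1 - r\<^sup>2) powr (-s)) * ennreal (2 * pi * r / (1 - (cmod z)\<^sup>2 * r\<^sup>2)) * indicator {0<..<1} r \<partial>lborel)"
      by (rule disc_nn_integral_radial_kernel[where \<rho> = "\<lambda>r. ennreal (r powr c * (1 - r\<^sup>2) powr (-s))"]) (use z in auto)
    also have "\<dots> \<le> ennreal (C * (1 - (cmod z)\<^sup>2) powr (-s))" by (rule C(2)) (use z in auto)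
    finally show ?thesis .
  qed
  with C(1) that show ?thesis by blast
qed

section \<open>The Bergman kernel of the bidisc\<close>

definition bidisc_kernel :: "complex \<times> complex \<Rightarrow> complex \<times> complex \<Rightarrow> complex" where
  "bidisc_kernel x y = 1 / (pi * (1 - fst x * cnj (fst y))\<^sup>2) * (1 / (pi * (1 - snd x * cnj (snd y))\<^sup>2))"

lemma norm_one_minus_mult_cnj_ge:
  assumes "cmod s \<le> 1"
  shows "1 - cmod a \<le> cmod (1 - a * cnj s)"
proof -
  have "cmod (a * cnj s) \<le> cmod a * 1"
    using assms unfolding norm_mult by (intro mult_left_mono) auto
  then show ?thesis using norm_triangle_ineq2[of 1 "a * cnj s"] by simp
qed

lemma mult_cnj_neq_one:
  assumes "cmod s < 1" "cmod a < 1"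
  shows "a * cnj s \<noteq> 1"
  using norm_one_minus_mult_cnj_ge[of s a] assms by auto

lemma norm_disc_kernel_le:
  assumes "cmod s \<le> 1" "cmod a < 1"
  shows "cmod (1 / (pi * (1 - a * cnj s)\<^sup>2)) \<le> 1 / (pi * (1 - cmod a)\<^sup>2)"
  using assms norm_one_minus_mult_cnj_ge[of s a]
  by (simp add: norm_divide norm_mult norm_power) (intro divide_left_mono mult_left_mono power_mono mult_pos_pos, auto)

lemma norm_bidisc_kernel_le:
  assumes "cmod (fst y) \<le> 1" "cmod (snd y) \<le> 1" "cmod (fst x) < 1" "cmod (snd x) < 1"
  shows "cmod (bidisc_kernel x y) \<le> 1 / (pi * (1 - cmod (fst x))\<^sup>2) * (1 / (pi * (1 - cmod (snd x))\<^sup>2))"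
  unfolding bidisc_kernel_def norm_mult
  using assms by (intro mult_mono norm_disc_kernel_le) auto

lemma continuous_on_bidisc_kernel:
  assumes "cmod (fst x) < 1" "cmod (snd x) < 1"
  shows "continuous_on (ball 0 1 \<times> ball 0 1) (bidisc_kernel x)"
  unfolding bidisc_kernel_def using assms
  by (intro continuous_intros) (auto simp: mult_cnj_neq_one)

lemma emeasure_bidisc: "emeasure lborel (ball (0::complex) 1 \<times> ball (0::complex) 1) = ennreal (pi * pi)"
  unfolding lborel_prod[symmetric]
  by (subst lborel.emeasure_pair_measure_Times) (auto simp: emeasure_unit_disc ennreal_mult)

lemma borel_measurable_slice:
  fixes f :: "complex \<times> complex \<Rightarrow> 'a::topological_space"
  assumes "f \<in> borel_measurable borel"
  shows "(\<lambda>v. f (v, t)) \<in> borel_measurable borel" "(\<lambda>t. f (v, t)) \<in> borel_measurable borel"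
  by (rule measurable_compose[OF _ assms],
      intro borel_measurable_continuous_onI continuous_intros)+

lemma nn_integral_prod:
  fixes f :: "complex \<times> complex \<Rightarrow> ennreal"
  assumes "f \<in> borel_measurable borel"
  shows "(\<integral>\<^sup>+x. f x \<partial>lborel) = (\<integral>\<^sup>+v. \<integral>\<^sup>+t. f (v, t) \<partial>lborel \<partial>lborel)"
    and "(\<integral>\<^sup>+x. f x \<partial>lborel) = (\<integral>\<^sup>+t. \<integral>\<^sup>+v. f (v, t) \<partial>lborel \<partial>lborel)"
proof -
  have m: "f \<in> borel_measurable (lborel \<Otimes>\<^sub>M lborel)" using assms by (simp add: lborel_prod)
  show "(\<integral>\<^sup>+x. f x \<partial>lborel) = (\<integral>\<^sup>+v. \<integral>\<^sup>+t. f (v, t) \<partial>lborel \<partial>lborel)"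
    using lborel.nn_integral_fst[OF m] by (simp add: lborel_prod)
  show "(\<integral>\<^sup>+x. f x \<partial>lborel) = (\<integral>\<^sup>+t. \<integral>\<^sup>+v. f (v, t) \<partial>lborel \<partial>lborel)"
    using lborel_pair.nn_integral_snd[of f] m by (simp add: lborel_prod)
qed

text \<open>One-variable reproducing formulas are applied in turn: on the disc in \<open>v\<close>
  at the given \<open>t\<close>, then on the punctured disc in \<open>t\<close> for almost every
  first coordinate. The convention \<open>F (v, 0) = 0\<close> fixes the values on the null set
  where nothing is known.\<close>

lemma bidisc_reproducing:
  fixes F :: "complex \<times> complex \<Rightarrow> complex"
  assumes cont: "continuous_on (ball 0 1 \<times> (ball 0 1 - {0})) F"
    and hol1: "\<And>t. t \<in> ball 0 1 - {0} \<Longrightarrow> (\<lambda>v. F (v, t)) holomorphic_on ball 0 1"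
    and hol2: "\<And>v. v \<in> ball 0 1 \<Longrightarrow> (\<lambda>t. F (v, t)) holomorphic_on ball 0 1 - {0}"
    and zero: "\<And>v. F (v, 0) = 0"
    and fin: "(\<integral>\<^sup>+x. ennreal ((cmod (F x))\<^sup>2) * indicator (ball 0 1 \<times> ball 0 1) x \<partial>lborel) < \<infinity>"
    and vt: "cmod v < 1" "cmod t < 1" "t \<noteq> 0"
  shows "set_integrable lborel (ball 0 1 \<times> ball 0 1) (\<lambda>y. bidisc_kernel (v, t) y * F y)"
    and "F (v, t) = (LINT y:ball 0 1 \<times> ball 0 1|lborel. bidisc_kernel (v, t) y * F y)"
proof -
  let ?D = "ball (0::complex) 1" and ?D2 = "ball (0::complex) 1 \<times> ball (0::complex) 1"
  have D2: "?D2 \<in> sets borel" by (intro borel_open open_Times open_ball)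
  have D2': "?D \<times> (?D - {0}) \<in> sets borel" by (intro borel_open open_Times open_ball open_Diff) auto
  have ind: "indicator ?D2 x *\<^sub>R F x = indicator (?D \<times> (?D - {0})) x *\<^sub>R F x" for x
    using zero by (cases x) (auto simp: indicator_def)
  have mF': "(\<lambda>x. indicator ?D2 x *\<^sub>R F x) \<in> borel_measurable borel"
    unfolding ind by (rule borel_measurable_continuous_on_indicator[OF D2' cont])
  then have mF: "set_borel_measurable lborel ?D2 F" by (simp add: set_borel_measurable_def)
  have intF: "set_integrable lborel ?D2 F"
    by (rule L2_imp_integrable_finite_measure[OF mF D2 _ fin]) (simp add: emeasure_bidisc)
  have sq: "(\<lambda>x. ennreal ((cmod (indicator ?D2 x *\<^sub>R F x))\<^sup>2)) \<in> borel_measurable borel"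
    by (intro measurable_compose[OF _ measurable_ennreal] borel_measurable_power borel_measurable_norm_compose mF')
  have sq_eq: "(\<lambda>x. ennreal ((cmod (indicator ?D2 x *\<^sub>R F x))\<^sup>2)) = (\<lambda>x. ennreal ((cmod (F x))\<^sup>2) * indicator ?D2 x)"
    by (auto simp: indicator_def)
  have msq: "(\<lambda>x. ennreal ((cmod (F x))\<^sup>2) * indicator ?D2 x) \<in> borel_measurable borel"
    using sq unfolding sq_eq .
  \<comment> \<open>This is needed for the one given \<open>t\<close>, where Fubini's almost
    everywhere statement says nothing. The area bound in the second variable, integrated over
    \<open>v\<close>, controls the slice by the full integral.\<close>
  have q_fin: "(\<integral>\<^sup>+v. ennreal ((cmod (F (v, t)))\<^sup>2) * indicator ?D v \<partial>lborel) < \<infinity>"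
    if t: "t \<in> ?D - {0}" for t
  proof -
    \<comment> \<open>The largest radius for which \<open>ball t R\<close> stays in the punctured
      disc.\<close>
    define R where "R = min (cmod t) (1 - cmod t)"
    have R: "R > 0" using t by (simp add: R_def)
    have sub: "ball t R \<subseteq> ?D - {0}"
    proof
      fix x assume x: "x \<in> ball t R"
      then have "cmod x < 1" using norm_triangle_ineq2[of x t] by (auto simp: R_def dist_norm norm_minus_commute)
      then show "x \<in> ?D - {0}" using x by (auto simp: R_def dist_norm)
    qed
    have "ennreal (pi * R\<^sup>2) * (\<integral>\<^sup>+v. ennreal ((cmod (F (v, t)))\<^sup>2) * indicator ?D v \<partial>lborel)
       = (\<integral>\<^sup>+v. ennreal (pi * R\<^sup>2) * (ennreal ((cmod (F (v, t)))\<^sup>2) * indicator ?D2 (v, t)) \<partial>lborel)"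
    proof -
      have "(\<lambda>v. ennreal ((cmod (F (v, t)))\<^sup>2) * indicator ?D2 (v, t)) \<in> borel_measurable lborel"
        using borel_measurable_slice(1)[OF msq, of t] by simp
      moreover have "(\<integral>\<^sup>+v. ennreal ((cmod (F (v, t)))\<^sup>2) * indicator ?D v \<partial>lborel)
          = (\<integral>\<^sup>+v. ennreal ((cmod (F (v, t)))\<^sup>2) * indicator ?D2 (v, t) \<partial>lborel)"
        using t by (intro nn_integral_cong) (auto simp: indicator_def)
      ultimately show ?thesis by (simp only: nn_integral_cmult)
    qed
    also have "\<dots> \<le> (\<integral>\<^sup>+v. \<integral>\<^sup>+s. ennreal ((cmod (F (v, s)))\<^sup>2) * indicator ?D2 (v, s) \<partial>lborel \<partial>lborel)"
    proof (rule nn_integral_mono)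
      fix v
      show "ennreal (pi * R\<^sup>2) * (ennreal ((cmod (F (v, t)))\<^sup>2) * indicator ?D2 (v, t))
         \<le> (\<integral>\<^sup>+s. ennreal ((cmod (F (v, s)))\<^sup>2) * indicator ?D2 (v, s) \<partial>lborel)"
      proof (cases "v \<in> ?D")
        case True
        have "ennreal (pi * R\<^sup>2) * (ennreal ((cmod (F (v, t)))\<^sup>2) * indicator ?D2 (v, t))
            \<le> ennreal (pi * R\<^sup>2 * (cmod (F (v, t)))\<^sup>2)"
          by (auto simp: indicator_def ennreal_mult)
        also have "\<dots> \<le> (\<integral>\<^sup>+s. ennreal ((cmod (F (v, s)))\<^sup>2) * indicator (ball t R) s \<partial>lborel)"
          using hol2[OF True] sub R by (intro norm_square_le_ball_integral) (auto intro: holomorphic_on_subset)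
        also have "\<dots> \<le> (\<integral>\<^sup>+s. ennreal ((cmod (F (v, s)))\<^sup>2) * indicator ?D2 (v, s) \<partial>lborel)"
          using sub True by (intro nn_integral_mono) (auto simp: indicator_def)
        finally show ?thesis .
      qed simp
    qed
    also have "\<dots> < \<infinity>" using fin unfolding nn_integral_prod(1)[OF msq] .
    finally show ?thesis using R by (auto simp: ennreal_mult_less_top)
  qed
  have step1: "F (v, t) = (LINT s:?D|lborel. F (s, t) / (pi * (1 - v * cnj s)\<^sup>2))"
  proof -
    have t: "t \<in> ?D - {0}" using vt by auto
    show ?thesis
      by (rule bergman_disc_reproducing[OF hol1[OF t] L2_imp_integrable_disc vt(1)])
         (auto intro!: set_borel_measurable_continuous holomorphic_on_imp_continuous_on hol1 q_fin[simplified] simp: t vt)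
  qed
  \<comment> \<open>Almost every \<open>s\<close> suffices here, because \<open>s\<close> is
    integrated out in the next step.\<close>
  have AE2: "AE s in lborel. s \<in> ?D \<longrightarrow> F (s, t) = (LINT u:?D|lborel. F (s, u) / (pi * (1 - t * cnj u)\<^sup>2))"
  proof -
    have m: "(\<lambda>s. \<integral>\<^sup>+u. ennreal ((cmod (F (s, u)))\<^sup>2) * indicator ?D2 (s, u) \<partial>lborel) \<in> borel_measurable lborel"
      using lborel.borel_measurable_nn_integral_fst[of "\<lambda>x. ennreal ((cmod (F x))\<^sup>2) * indicator ?D2 x" lborel] msq
      by (simp add: lborel_prod)
    have "AE s in lborel. (\<integral>\<^sup>+u. ennreal ((cmod (F (s, u)))\<^sup>2) * indicator ?D2 (s, u) \<partial>lborel) \<noteq> \<infinity>"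
      using fin unfolding nn_integral_prod(1)[OF msq] by (intro nn_integral_PInf_AE m) auto
    then show ?thesis
    proof eventually_elim
      case (elim s)
      show ?case
      proof
        assume s: "s \<in> ?D"
        have "(\<integral>\<^sup>+u. ennreal ((cmod (F (s, u)))\<^sup>2) * indicator ?D u \<partial>lborel)
           = (\<integral>\<^sup>+u. ennreal ((cmod (F (s, u)))\<^sup>2) * indicator ?D2 (s, u) \<partial>lborel)"
          using s by (intro nn_integral_cong) (auto simp: indicator_def)
        then show "F (s, t) = (LINT u:?D|lborel. F (s, u) / (pi * (1 - t * cnj u)\<^sup>2))"
          using elim by (intro bergman_punctured_disc_reproducing[OF hol2[OF s] _ vt(2,3)]) (simp add: less_top)
      qed
    qed
  qed
  define h where "h = (\<lambda>y. indicator ?D2 y *\<^sub>R (bidisc_kernel (v, t) y * F y))"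
  have mh: "h \<in> borel_measurable borel"
  proof -
    have "continuous_on (?D \<times> (?D - {0})) (\<lambda>y. bidisc_kernel (v, t) y * F y)"
      using vt by (intro continuous_intros cont continuous_on_subset[OF continuous_on_bidisc_kernel]) auto
    from borel_measurable_continuous_on_indicator[OF D2' this]
    moreover have "h = (\<lambda>y. indicator (?D \<times> (?D - {0})) y *\<^sub>R (bidisc_kernel (v, t) y * F y))"
      using zero by (intro ext) (auto simp: h_def indicator_def)
    ultimately show ?thesis by simp
  qed
  show 1: "set_integrable lborel ?D2 (\<lambda>y. bidisc_kernel (v, t) y * F y)"
  proof -
    define B where "B = 1 / (pi * (1 - cmod v)\<^sup>2) * (1 / (pi * (1 - cmod t)\<^sup>2))"
    have "integrable lborel (\<lambda>y. of_real B * (indicator ?D2 y *\<^sub>R F y))"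
      using intF unfolding set_integrable_def by (rule integrable_mult_right)
    then have "integrable lborel h"
    proof (rule Bochner_Integration.integrable_bound)
      show "AE y in lborel. norm (h y) \<le> norm (of_real B * (indicator ?D2 y *\<^sub>R F y))"
      proof (rule AE_I2)
        fix y :: "complex \<times> complex"
        have "cmod (bidisc_kernel (v, t) y) \<le> \<bar>B\<bar>" if "y \<in> ?D2"
          using norm_bidisc_kernel_le[of y "(v, t)"] vt that unfolding B_def by (cases y) auto
        then show "norm (h y) \<le> norm (of_real B * (indicator ?D2 y *\<^sub>R F y))"
          by (auto simp: h_def norm_mult indicator_def intro!: mult_right_mono)
      qed
    qed (use mh in simp)
    then show ?thesis by (simp add: set_integrable_def h_def)
  qed
  then have inth: "integrable (lborel \<Otimes>\<^sub>M lborel) h" by (simp add: set_integrable_def h_def lborel_prod)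
  have "(LINT y:?D2|lborel. bidisc_kernel (v, t) y * F y) = (LINT s|lborel. LINT u|lborel. h (s, u))"
    using lborel_pair.integral_fst'[OF inth] by (simp add: set_lebesgue_integral_def h_def lborel_prod)
  also have "\<dots> = (LINT s|lborel. indicator ?D s *\<^sub>R (F (s, t) / (pi * (1 - v * cnj s)\<^sup>2)))"
  proof (rule integral_cong_AE)
    show "(\<lambda>s. LINT u|lborel. h (s, u)) \<in> borel_measurable lborel"
      using lborel_pair.integrable_fst'[OF inth] by auto
    have t: "t \<in> ?D - {0}" using vt by auto
    show "(\<lambda>s. indicator ?D s *\<^sub>R (F (s, t) / (pi * (1 - v * cnj s)\<^sup>2))) \<in> borel_measurable lborel"
      using vt by (simp, intro borel_measurable_continuous_on_indicator continuous_intros holomorphic_on_imp_continuous_on hol1[OF t])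
        (auto simp: mult_cnj_neq_one)
    show "AE s in lborel. (LINT u|lborel. h (s, u)) = indicator ?D s *\<^sub>R (F (s, t) / (pi * (1 - v * cnj s)\<^sup>2))"
      using AE2
    proof eventually_elim
      case (elim s)
      have "(LINT u|lborel. h (s, u)) = (LINT u|lborel. (indicator ?D s / (pi * (1 - v * cnj s)\<^sup>2)) *
          (indicator ?D u *\<^sub>R (F (s, u) / (pi * (1 - t * cnj u)\<^sup>2))))"
        by (intro Bochner_Integration.integral_cong) (auto simp: h_def bidisc_kernel_def indicator_def)
      also have "\<dots> = (indicator ?D s / (pi * (1 - v * cnj s)\<^sup>2)) * (LINT u:?D|lborel. F (s, u) / (pi * (1 - t * cnj u)\<^sup>2))"
        unfolding set_lebesgue_integral_def by (rule integral_mult_right_zero)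
      finally show ?case using elim by (auto simp: indicator_def)
    qed
  qed
  also have "\<dots> = F (v, t)" using step1 by (simp add: set_lebesgue_integral_def)
  finally show "F (v, t) = (LINT y:?D2|lborel. bidisc_kernel (v, t) y * F y)" by simp
qed

section \<open>Holomorphic functions of two variables\<close>

lemma holomorphic2_on_slices:
  assumes "holomorphic2_on F (A \<times> B)"
  shows "t \<in> B \<Longrightarrow> (\<lambda>v. F (v, t)) holomorphic_on A" "v \<in> A \<Longrightarrow> (\<lambda>t. F (v, t)) holomorphic_on B"
proof -
  show "(\<lambda>v. F (v, t)) holomorphic_on A" if t: "t \<in> B"
    unfolding holomorphic_on_def
  proof
    fix v assume "v \<in> A"
    with assms t obtain a b where d: "(F has_derivative (\<lambda>h. a * fst h + b * snd h)) (at (v, t))"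
      unfolding holomorphic2_on_def by blast
    have "((\<lambda>v. (v, t)) has_derivative (\<lambda>h. (h, 0))) (at v within A)"
      by (auto intro!: derivative_eq_intros)
    from has_derivative_compose[OF this d]
    have "((\<lambda>v. F (v, t)) has_derivative (\<lambda>h. a * h)) (at v within A)" by simp
    then show "(\<lambda>v. F (v, t)) field_differentiable at v within A"
      unfolding field_differentiable_def has_field_derivative_def by blast
  qed
  show "(\<lambda>t. F (v, t)) holomorphic_on B" if v: "v \<in> A"
    unfolding holomorphic_on_def
  proof
    fix t assume "t \<in> B"
    with assms v obtain a b where d: "(F has_derivative (\<lambda>h. a * fst h + b * snd h)) (at (v, t))"
      unfolding holomorphic2_on_def by blast
    have "((\<lambda>t. (v, t)) has_derivative (\<lambda>h. (0, h))) (at t within B)"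
      by (auto intro!: derivative_eq_intros)
    from has_derivative_compose[OF this d]
    have "((\<lambda>t. F (v, t)) has_derivative (\<lambda>h. b * h)) (at t within B)" by simp
    then show "(\<lambda>t. F (v, t)) field_differentiable at t within B"
      unfolding field_differentiable_def has_field_derivative_def by blast
  qed
qed

lemma holomorphic2_on_imp_continuous_on:
  assumes "holomorphic2_on F A"
  shows "continuous_on A F"
proof (rule continuous_at_imp_continuous_on, rule ballI)
  fix z assume "z \<in> A"
  with assms obtain a b where "(F has_derivative (\<lambda>h. a * fst h + b * snd h)) (at z)"
    unfolding holomorphic2_on_def by blast
  then show "isCont F z" by (rule has_derivative_continuous)
qed

lemma holomorphic2_on_cong:
  assumes "holomorphic2_on F A" "open A" "\<And>z. z \<in> A \<Longrightarrow> F z = G z"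
  shows "holomorphic2_on G A"
  unfolding holomorphic2_on_def
proof
  fix z assume z: "z \<in> A"
  with assms obtain a b where "(F has_derivative (\<lambda>h. a * fst h + b * snd h)) (at z)"
    unfolding holomorphic2_on_def by blast
  then have "(G has_derivative (\<lambda>h. a * fst h + b * snd h)) (at z)"
    by (rule has_derivative_transform_within_open[OF _ assms(2) z]) (use assms(3) in auto)
  then show "\<exists>a b. (G has_derivative (\<lambda>h. a * fst h + b * snd h)) (at z)" by blast
qed

lemma holomorphic2_on_compose:
  assumes "holomorphic2_on F B" "\<And>z. z \<in> A \<Longrightarrow> (u z, v z) \<in> B"
    and "holomorphic2_on u A" "holomorphic2_on v A"
  shows "holomorphic2_on (\<lambda>z. F (u z, v z)) A"
  unfolding holomorphic2_on_def
proof
  fix z assume z: "z \<in> A"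
  obtain a b where F: "(F has_derivative (\<lambda>h. a * fst h + b * snd h)) (at (u z, v z))"
    using assms(1) assms(2)[OF z] unfolding holomorphic2_on_def by blast
  obtain a1 b1 where u: "(u has_derivative (\<lambda>h. a1 * fst h + b1 * snd h)) (at z)"
    using assms(3) z unfolding holomorphic2_on_def by blast
  obtain a2 b2 where v: "(v has_derivative (\<lambda>h. a2 * fst h + b2 * snd h)) (at z)"
    using assms(4) z unfolding holomorphic2_on_def by blast
  from has_derivative_compose[OF has_derivative_Pair[OF u v] F]
  have "((\<lambda>z. F (u z, v z)) has_derivative (\<lambda>h. (a * a1 + b * a2) * fst h + (a * b1 + b * b2) * snd h)) (at z)"
    by (simp add: algebra_simps)
  then show "\<exists>a b. ((\<lambda>z. F (u z, v z)) has_derivative (\<lambda>h. a * fst h + b * snd h)) (at z)" by blast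
qed

lemma holomorphic2_on_field_compose:
  assumes "g holomorphic_on B" "open B" "\<And>z. z \<in> A \<Longrightarrow> u z \<in> B" "holomorphic2_on u A"
  shows "holomorphic2_on (\<lambda>z. g (u z)) A"
  unfolding holomorphic2_on_def
proof
  fix z assume z: "z \<in> A"
  obtain a b where u: "(u has_derivative (\<lambda>h. a * fst h + b * snd h)) (at z)"
    using assms(4) z unfolding holomorphic2_on_def by blast
  have "(g has_field_derivative deriv g (u z)) (at (u z))"
    using assms(1,2) assms(3)[OF z] by (rule holomorphic_derivI)
  then have "(g has_derivative (\<lambda>h. deriv g (u z) * h)) (at (u z))"
    by (simp add: has_field_derivative_def)
  from has_derivative_compose[OF u this]
  have "((\<lambda>z. g (u z)) has_derivative (\<lambda>h. (deriv g (u z) * a) * fst h + (deriv g (u z) * b) * snd h)) (at z)"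
    by (simp add: algebra_simps)
  then show "\<exists>a b. ((\<lambda>z. g (u z)) has_derivative (\<lambda>h. a * fst h + b * snd h)) (at z)" by blast
qed

lemma holomorphic2_on_fst: "holomorphic2_on fst A" and holomorphic2_on_snd: "holomorphic2_on snd A"
proof -
  have "(fst has_derivative (\<lambda>h. 1 * fst h + 0 * snd h)) (at z)" for z :: "complex \<times> complex"
    using bounded_linear_imp_has_derivative[OF bounded_linear_fst] by simp
  then show "holomorphic2_on fst A" unfolding holomorphic2_on_def by blast
  have "(snd has_derivative (\<lambda>h. 0 * fst h + 1 * snd h)) (at z)" for z :: "complex \<times> complex"
    using bounded_linear_imp_has_derivative[OF bounded_linear_snd] by simp
  then show "holomorphic2_on snd A" unfolding holomorphic2_on_def by blast
qed

lemma holomorphic2_on_mult: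
  assumes "holomorphic2_on f A" "holomorphic2_on g A"
  shows "holomorphic2_on (\<lambda>z. f z * g z) A"
  unfolding holomorphic2_on_def
proof
  fix z assume z: "z \<in> A"
  obtain a b where u: "(f has_derivative (\<lambda>h. a * fst h + b * snd h)) (at z)"
    using assms(1) z unfolding holomorphic2_on_def by blast
  obtain c d where v: "(g has_derivative (\<lambda>h. c * fst h + d * snd h)) (at z)"
    using assms(2) z unfolding holomorphic2_on_def by blast
  from has_derivative_mult[OF u v]
  have "((\<lambda>z. f z * g z) has_derivative (\<lambda>h. (f z * c + a * g z) * fst h + (f z * d + b * g z) * snd h)) (at z)"
    by (simp add: algebra_simps)
  then show "\<exists>a b. ((\<lambda>z. f z * g z) has_derivative (\<lambda>h. a * fst h + b * snd h)) (at z)" by blast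
qed

lemma holomorphic2_on_const: "holomorphic2_on (\<lambda>z. c) A"
proof -
  have "((\<lambda>z. c) has_derivative (\<lambda>h. 0 * fst h + 0 * snd h)) (at z)" for z :: "complex \<times> complex" by simp
  then show ?thesis unfolding holomorphic2_on_def by blast
qed

lemma holomorphic2_on_add:
  assumes "holomorphic2_on f A" "holomorphic2_on g A"
  shows "holomorphic2_on (\<lambda>z. f z + g z) A"
  unfolding holomorphic2_on_def
proof
  fix z assume z: "z \<in> A"
  obtain a b where u: "(f has_derivative (\<lambda>h. a * fst h + b * snd h)) (at z)"
    using assms(1) z unfolding holomorphic2_on_def by blast
  obtain c d where v: "(g has_derivative (\<lambda>h. c * fst h + d * snd h)) (at z)"
    using assms(2) z unfolding holomorphic2_on_def by blast
  from has_derivative_add[OF u v]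
  have "((\<lambda>z. f z + g z) has_derivative (\<lambda>h. (a + c) * fst h + (b + d) * snd h)) (at z)"
    by (simp add: algebra_simps)
  then show "\<exists>a b. ((\<lambda>z. f z + g z) has_derivative (\<lambda>h. a * fst h + b * snd h)) (at z)" by blast
qed

lemma holomorphic2_on_sum:
  assumes "\<And>i. i \<in> I \<Longrightarrow> holomorphic2_on (f i) A"
  shows "holomorphic2_on (\<lambda>z. \<Sum>i\<in>I. f i z) A"
  using assms
  by (induction I rule: infinite_finite_induct) (auto intro: holomorphic2_on_const holomorphic2_on_add)

section \<open>Deck transformations, descent of holomorphic functions and invariance of
  integrals\<close>

context hartogs_cover
begin

abbreviation D2' :: "(complex \<times> complex) set" where
  "D2' \<equiv> ball 0 1 \<times> (ball 0 1 - {0})"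

definition roots :: "complex set" where "roots = {\<eta>. \<eta> ^ m = 1}"

text \<open>The deck transformations of \<open>cover\<close>, cf. \<open>cover_rot\<close> and
  \<open>cover_eq_imp_rot\<close>: division by \<open>\<eta> ^ n\<close> compensates the factor that
  \<open>\<eta> * snd x\<close> brings into the first coordinate of \<open>cover\<close>.\<close>

definition rot :: "complex \<Rightarrow> complex \<times> complex \<Rightarrow> complex \<times> complex" where
  "rot \<eta> x = (fst x / \<eta> ^ n, \<eta> * snd x)"

lemma finite_roots: "finite roots" and card_roots: "card roots = m"
  unfolding roots_def using m card_roots_unity_eq[of m] finite_roots_unity[of m] by auto

lemma norm_roots: "\<eta> \<in> roots \<Longrightarrow> cmod \<eta> = 1"
  unfolding roots_def using m by (auto dest: power_eq_1_iff)

lemma one_in_roots: "1 \<in> roots"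
  by (simp add: roots_def)

lemma roots_nonzero: "\<eta> \<in> roots \<Longrightarrow> \<eta> \<noteq> 0"
  using norm_roots by force

lemma roots_mult: "\<eta> \<in> roots \<Longrightarrow> \<zeta> \<in> roots \<Longrightarrow> \<eta> * \<zeta> \<in> roots"
  and roots_divide: "\<eta> \<in> roots \<Longrightarrow> \<zeta> \<in> roots \<Longrightarrow> \<eta> / \<zeta> \<in> roots"
  by (auto simp: roots_def power_mult_distrib power_divide)

lemma cover_rot: "\<eta> \<in> roots \<Longrightarrow> cover (rot \<eta> x) = cover x"
  using roots_nonzero[of \<eta>] by (auto simp: cover_def rot_def power_mult_distrib roots_def)

lemma norm_rot: "\<eta> \<in> roots \<Longrightarrow> cmod (fst (rot \<eta> x)) = cmod (fst x)" "\<eta> \<in> roots \<Longrightarrow> cmod (snd (rot \<eta> x)) = cmod (snd x)"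
  by (auto simp: rot_def norm_divide norm_mult norm_power norm_roots)

lemma rot_mem_iff:
  assumes "\<eta> \<in> roots"
  shows "rot \<eta> x \<in> D2 \<longleftrightarrow> x \<in> D2" "rot \<eta> x \<in> D2' \<longleftrightarrow> x \<in> D2'"
  using norm_rot[OF assms, of x] roots_nonzero[OF assms] by (auto simp: mem_Times_iff rot_def)

lemma rot_rot: "\<eta> \<in> roots \<Longrightarrow> \<zeta> \<in> roots \<Longrightarrow> rot \<eta> (rot \<zeta> x) = rot (\<eta> * \<zeta>) x"
  by (simp add: rot_def power_mult_distrib)

lemma cover_eq_imp_rot:
  assumes "cover x = cover y" "snd x \<noteq> 0"
  obtains \<eta> where "\<eta> \<in> roots" "y = rot \<eta> x"
proof
  define \<eta> where "\<eta> = snd y / snd x"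
  have sy: "snd y ^ m = snd x ^ m" using assms(1) by (simp add: cover_def)
  then have "snd y \<noteq> 0" using assms(2) m by (metis power_eq_0_iff)
  then show "\<eta> \<in> roots" "y = rot \<eta> x"
    using assms sy by (auto simp: \<eta>_def roots_def rot_def cover_def power_divide prod_eq_iff field_simps)
qed

text \<open>The preimage is built from the principal branch of the \<open>m\<close>-th root of
  \<open>snd z\<close>, which is nonzero on \<open>H\<close>.\<close>

lemma H_subset_cover:
  assumes "z \<in> H"
  obtains x where "x \<in> D2'" "cover x = z"
proof
  have "snd z \<noteq> 0" using assms by (auto simp: H_eq)
  define t where "t = exp (Ln (snd z) / m)"
  have t: "t \<noteq> 0" "t ^ m = snd z"
    using \<open>snd z \<noteq> 0\<close> m by (simp_all add: t_def exp_of_nat_mult[symmetric])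
  then show c: "cover (fst z / t ^ n, t) = z" by (simp add: cover_def)
  show "(fst z / t ^ n, t) \<in> D2'"
    using assms cover_mem_H_iff[of "(fst z / t ^ n, t)"] by (simp only: c)
qed

lemma open_D2': "open D2'" and open_D2: "open D2"
  by (auto intro!: open_Times open_Diff)

text \<open>A function on \<open>H\<close> is holomorphic as soon as its pullback is: compose with a local inverse of
  \<open>cover\<close>, built from a branch of the \<open>m\<close>-th root near the given point.\<close>

lemma holomorphic2_on_descend:
  assumes F: "holomorphic2_on F D2'" and f: "\<And>x. x \<in> D2' \<Longrightarrow> f (cover x) = F x"
  shows "holomorphic2_on f H"
  unfolding holomorphic2_on_def
proof
  fix z0 assume z0: "z0 \<in> H"
  then obtain x0 where x0: "x0 \<in> D2'" "cover x0 = z0" by (rule H_subset_cover)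
  define t0 where "t0 = snd x0"
  have t0: "t0 \<noteq> 0" "t0 ^ m = snd z0" using x0 by (auto simp: t0_def cover_def)
  \<comment> \<open>Dividing by \<open>t0 ^ m\<close> makes the quotient \<open>1\<close> at
    \<open>z0\<close>, away from the branch cut of \<open>Ln\<close>, whatever the position of
    \<open>snd z0\<close>.\<close>
  define A where "A = {z \<in> H. snd z / t0 ^ m \<notin> \<real>\<^sub>\<le>\<^sub>0}"
  have A: "open A"
  proof -
    have "A = H \<inter> (\<lambda>z. snd z / t0 ^ m) -` (- \<real>\<^sub>\<le>\<^sub>0)" by (auto simp: A_def)
    moreover have "open ((\<lambda>z::complex \<times> complex. snd z / t0 ^ m) -` (- \<real>\<^sub>\<le>\<^sub>0))"
      by (intro open_vimage continuous_intros) (use t0 in \<open>auto simp: open_Compl\<close>)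
    ultimately show ?thesis using open_H by auto
  qed
  have z0A: "z0 \<in> A" using z0 t0 by (auto simp: A_def)
  define \<tau> where "\<tau> = (\<lambda>z::complex \<times> complex. t0 * exp (Ln (snd z / t0 ^ m) / m))"
  have Anz: "snd z / t0 ^ m \<noteq> 0" if "z \<in> A" for z using that t0 by (auto simp: A_def)
  have \<tau>: "\<tau> z ^ m = snd z" "\<tau> z \<noteq> 0" if "z \<in> A" for z
    using Anz[OF that] t0(1) m
    by (auto simp: \<tau>_def power_mult_distrib exp_of_nat_mult[symmetric])
  have "(\<lambda>z. t0 * exp (Ln z / m)) holomorphic_on (- \<real>\<^sub>\<le>\<^sub>0)"
    by (intro holomorphic_intros) (use m in auto)
  from holomorphic2_on_field_compose[OF this, of A "\<lambda>z. 1 / t0 ^ m * snd z"]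
  have h\<tau>: "holomorphic2_on \<tau> A"
    using holomorphic2_on_mult[OF holomorphic2_on_const[of "1 / t0 ^ m"] holomorphic2_on_snd, of A]
    by (simp add: \<tau>_def A_def open_Compl)
  have "(\<lambda>w. 1 / w ^ n) holomorphic_on (- {0})" by (intro holomorphic_intros) auto
  from holomorphic2_on_mult[OF holomorphic2_on_fst holomorphic2_on_field_compose[OF this _ _ h\<tau>]]
  have hv: "holomorphic2_on (\<lambda>z. fst z * (1 / \<tau> z ^ n)) A" using \<tau> by auto
  have cov: "cover (fst z * (1 / \<tau> z ^ n), \<tau> z) = z" if "z \<in> A" for z
    using \<tau>[OF that] by (simp add: cover_def)
  have mem: "(fst z * (1 / \<tau> z ^ n), \<tau> z) \<in> D2'" if "z \<in> A" for z
    using that cover_mem_H_iff[of "(fst z * (1 / \<tau> z ^ n), \<tau> z)"] unfolding cov[OF that] by (simp add: A_def)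
  have "holomorphic2_on (\<lambda>z. F (fst z * (1 / \<tau> z ^ n), \<tau> z)) A"
    by (rule holomorphic2_on_compose[OF F mem hv h\<tau>])
  then have "holomorphic2_on f A"
    by (rule holomorphic2_on_cong[OF _ A]) (metis f mem cov)
  then show "\<exists>a b. (f has_derivative (\<lambda>h. a * fst h + b * snd h)) (at z0)"
    using z0A unfolding holomorphic2_on_def by blast
qed

lemma holomorphic2_on_cover:
  assumes "holomorphic2_on f H"
  shows "holomorphic2_on (\<lambda>x. f (cover x)) D2'"
  unfolding cover_def
proof (rule holomorphic2_on_compose[OF assms])
  show "(fst x * snd x ^ n, snd x ^ m) \<in> H" if "x \<in> D2'" for x
    using that cover_mem_H_iff[of x] by (simp add: cover_def)
  have p: "holomorphic2_on (\<lambda>x. snd x ^ k) D2'" for k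
    by (rule holomorphic2_on_field_compose[OF _ open_UNIV _ holomorphic2_on_snd, of "\<lambda>w. w ^ k"])
      (auto intro!: holomorphic_intros)
  show "holomorphic2_on (\<lambda>x. fst x * snd x ^ n) D2'" "holomorphic2_on (\<lambda>x. snd x ^ m) D2'"
    by (intro holomorphic2_on_mult holomorphic2_on_fst p)+
qed

lemma D2_borel[measurable]: "D2 \<in> sets borel" and D2'_borel: "D2' \<in> sets borel"
  using open_D2 open_D2' by (auto intro: borel_open)

lemma weight_measurable[measurable]:
  "(\<lambda>x. real m * cmod (snd x) ^ (2 * N)) \<in> borel_measurable (borel :: (complex \<times> complex) measure)"
  by (intro borel_measurable_continuous_onI continuous_intros)

lemma indicator_weight_measurable:
  "(\<lambda>x. indicator D2 x * (real m * cmod (snd x) ^ (2 * N))) \<in> borel_measurable lborel"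
  using borel_measurable_times[OF borel_measurable_indicator[OF D2_borel] weight_measurable] by simp

text \<open>The change of variables as an identity of measures, from which the version for
  complex-valued integrals follows.\<close>

lemma lborel_H_eq_distr:
  "density lborel (indicator H) = distr (density lborel (\<lambda>x. ennreal (indicator D2 x * (real m * cmod (snd x) ^ (2 * N))))) borel cover"
proof (rule measure_eqI)
  fix A :: "(complex \<times> complex) set" assume "A \<in> sets (density lborel (indicator H))"
  then have [measurable]: "A \<in> sets borel" by simp
  have w: "(\<lambda>x. ennreal (indicator D2 x * (real m * cmod (snd x) ^ (2 * N)))) \<in> borel_measurable lborel"
    by (rule measurable_compose[OF indicator_weight_measurable measurable_ennreal])
  have "emeasure (density lborel (indicator H)) A = (\<integral>\<^sup>+z. indicator A z * indicator H z \<partial>lborel)"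
    by (subst emeasure_density) (auto simp: mult.commute)
  also have "\<dots> = (\<integral>\<^sup>+x. indicator A (cover x) * ennreal (real m * cmod (snd x) ^ (2 * N)) * indicator D2 x \<partial>lborel)"
    by (rule nn_integral_cover) measurable
  also have "\<dots> = (\<integral>\<^sup>+x. ennreal (indicator D2 x * (real m * cmod (snd x) ^ (2 * N))) * indicator (cover -` A) x \<partial>lborel)"
    by (intro nn_integral_cong) (auto simp: indicator_def)
  also have "\<dots> = emeasure (distr (density lborel (\<lambda>x. ennreal (indicator D2 x * (real m * cmod (snd x) ^ (2 * N))))) borel cover) A"
    using measurable_sets[OF cover_measurable, of A] by (subst emeasure_distr, simp, simp, subst emeasure_density[OF w]) auto
  finally show "emeasure (density lborel (indicator H)) A = \<dots>" .
qed simp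

lemma integral_cover:
  fixes g :: "complex \<times> complex \<Rightarrow> complex"
  assumes "set_borel_measurable lborel H g"
  shows "set_integrable lborel H g \<longleftrightarrow> set_integrable lborel D2 (\<lambda>x. of_real (real m * cmod (snd x) ^ (2 * N)) * g (cover x))"
    and "(LINT z:H|lborel. g z) = (LINT x:D2|lborel. of_real (real m * cmod (snd x) ^ (2 * N)) * g (cover x))"
proof -
  let ?w = "\<lambda>x::complex \<times> complex. indicator D2 x * (real m * cmod (snd x) ^ (2 * N))"
  define g' where "g' = (\<lambda>z. indicator H z *\<^sub>R g z)"
  have g'[measurable]: "g' \<in> borel_measurable borel" using assms by (simp add: set_borel_measurable_def g'_def)
  have gc: "(\<lambda>x. g' (cover x)) \<in> borel_measurable lborel"
    using measurable_compose[OF cover_measurable g'] by simp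
  have w: "?w \<in> borel_measurable lborel"
    by (rule indicator_weight_measurable)
  \<comment> \<open>Points of \<open>D2\<close> with second coordinate \<open>0\<close> are mapped
    outside \<open>H\<close>, but there the weight vanishes since \<open>N > 0\<close>.\<close>
  have eq: "?w x *\<^sub>R g' (cover x) = indicator D2 x *\<^sub>R (of_real (real m * cmod (snd x) ^ (2 * N)) * g (cover x))" for x
  proof (cases "snd x = 0")
    case True
    then show ?thesis using N_pos by (simp add: zero_power)
  next
    case False
    then show ?thesis using cover_mem_H_iff[of x]
      by (cases x) (auto simp: g'_def indicator_def scaleR_conv_of_real)
  qed
  have g'H: "(\<lambda>z. indicator H z *\<^sub>R g z) = (\<lambda>z. indicator H z *\<^sub>R g' z)" by (auto simp: g'_def indicator_def)
  have "set_integrable lborel H g \<longleftrightarrow> integrable lborel (\<lambda>z. indicator H z *\<^sub>R g' z)"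
    unfolding set_integrable_def g'H ..
  also have "\<dots> \<longleftrightarrow> integrable (density lborel (indicator H)) g'"
    using integrable_density[of g' lborel "indicator H"] by (simp add: ennreal_indicator)
  also have "\<dots> \<longleftrightarrow> integrable (density lborel ?w) (\<lambda>x. g' (cover x))"
    unfolding lborel_H_eq_distr by (rule integrable_distr_eq) auto
  also have "\<dots> \<longleftrightarrow> integrable lborel (\<lambda>x. ?w x *\<^sub>R g' (cover x))"
    by (rule integrable_density[OF gc w]) auto
  finally show "set_integrable lborel H g \<longleftrightarrow> set_integrable lborel D2 (\<lambda>x. of_real (real m * cmod (snd x) ^ (2 * N)) * g (cover x))"
    unfolding eq set_integrable_def .
  have "(LINT z:H|lborel. g z) = integral\<^sup>L lborel (\<lambda>z. indicator H z *\<^sub>R g' z)"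
    unfolding set_lebesgue_integral_def g'H ..
  also have "\<dots> = integral\<^sup>L (density lborel (indicator H)) g'"
    using integral_density[of g' lborel "indicator H"] by (simp add: ennreal_indicator)
  also have "\<dots> = integral\<^sup>L (density lborel ?w) (\<lambda>x. g' (cover x))"
    unfolding lborel_H_eq_distr by (rule integral_distr) auto
  also have "\<dots> = integral\<^sup>L lborel (\<lambda>x. ?w x *\<^sub>R g' (cover x))"
    by (rule integral_density[OF gc w]) auto
  finally show "(LINT z:H|lborel. g z) = (LINT x:D2|lborel. of_real (real m * cmod (snd x) ^ (2 * N)) * g (cover x))"
    unfolding eq set_lebesgue_integral_def .
qed

lemma rot_measurable[measurable]: "\<eta> \<in> roots \<Longrightarrow> rot \<eta> \<in> borel_measurable borel"
  unfolding rot_def by (intro borel_measurable_continuous_onI continuous_intros) (use roots_nonzero in auto)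

text \<open>Each coordinate is multiplied by a number of modulus \<open>1\<close>, so
  \<open>nn_integral_complex_scale\<close> has factor \<open>1\<close> in both.\<close>

lemma distr_rot:
  assumes \<eta>: "\<eta> \<in> roots"
  shows "distr lborel borel (rot \<eta>) = lborel"
proof (rule measure_eqI)
  fix A :: "(complex \<times> complex) set" assume "A \<in> sets (distr lborel borel (rot \<eta>))"
  then have A[measurable]: "A \<in> sets borel" by simp
  have iA: "(indicator A :: _ \<Rightarrow> ennreal) \<in> borel_measurable borel" by simp
  have Ar: "rot \<eta> -` A \<in> sets borel" using measurable_sets[OF rot_measurable[OF \<eta>] A] by simp
  have "emeasure (distr lborel borel (rot \<eta>)) A = (\<integral>\<^sup>+x. indicator (rot \<eta> -` A) x \<partial>lborel)"
    using Ar rot_measurable[OF \<eta>] by (subst emeasure_distr) auto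
  also have "\<dots> = (\<integral>\<^sup>+v. \<integral>\<^sup>+t. indicator A (v / \<eta> ^ n, \<eta> * t) \<partial>lborel \<partial>lborel)"
    using Ar by (subst nn_integral_prod(1)) (auto simp: rot_def indicator_def)
  also have "\<dots> = (\<integral>\<^sup>+v. \<integral>\<^sup>+t. indicator A (v / \<eta> ^ n, t) \<partial>lborel \<partial>lborel)"
  proof (rule nn_integral_cong)
    fix v
    show "(\<integral>\<^sup>+t. indicator A (v / \<eta> ^ n, \<eta> * t) \<partial>lborel) = (\<integral>\<^sup>+t. indicator A (v / \<eta> ^ n, t) \<partial>lborel)"
      using nn_integral_complex_scale[of "\<lambda>t. indicator A (v / \<eta> ^ n, t)" \<eta>]
        borel_measurable_slice(2)[OF iA] roots_nonzero[OF \<eta>] norm_roots[OF \<eta>] by simp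
  qed
  also have "\<dots> = (\<integral>\<^sup>+v. \<integral>\<^sup>+t. indicator A (v, t) \<partial>lborel \<partial>lborel)"
  proof -
    have "(\<lambda>v. \<integral>\<^sup>+t. indicator A (v, t) \<partial>lborel) \<in> borel_measurable lborel"
      using lborel.borel_measurable_nn_integral_fst[of "indicator A" lborel] iA by (simp add: lborel_prod)
    then show ?thesis
      using nn_integral_complex_scale[of "\<lambda>v. \<integral>\<^sup>+t. indicator A (v, t) \<partial>lborel" "1 / \<eta> ^ n"]
        roots_nonzero[OF \<eta>] norm_roots[OF \<eta>] by (simp add: norm_divide norm_power)
  qed
  also have "\<dots> = (\<integral>\<^sup>+x. indicator A x \<partial>lborel)" by (subst nn_integral_prod(1)) auto
  finally show "emeasure (distr lborel borel (rot \<eta>)) A = emeasure lborel A" by simp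
qed simp

lemma integral_rot:
  fixes g :: "complex \<times> complex \<Rightarrow> complex"
  assumes \<eta>: "\<eta> \<in> roots" and "set_borel_measurable lborel D2 g"
  shows "(LINT x:D2|lborel. g (rot \<eta> x)) = (LINT x:D2|lborel. g x)"
    and "set_integrable lborel D2 (\<lambda>x. g (rot \<eta> x)) \<longleftrightarrow> set_integrable lborel D2 g"
proof -
  have ind: "indicator D2 (rot \<eta> x) = (indicator D2 x :: real)" for x
    using rot_mem_iff[OF \<eta>, of x] by (simp add: indicator_def)
  have g: "(\<lambda>x. indicator D2 x *\<^sub>R g x) \<in> borel_measurable borel"
    using assms(2) by (simp add: set_borel_measurable_def)
  have r: "rot \<eta> \<in> measurable lborel borel" using rot_measurable[OF \<eta>] by simp
  show "(LINT x:D2|lborel. g (rot \<eta> x)) = (LINT x:D2|lborel. g x)"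
    using integral_distr[OF r g] unfolding distr_rot[OF \<eta>] by (simp add: set_lebesgue_integral_def ind)
  show "set_integrable lborel D2 (\<lambda>x. g (rot \<eta> x)) \<longleftrightarrow> set_integrable lborel D2 g"
    using integrable_distr_eq[OF r g] unfolding distr_rot[OF \<eta>] by (simp add: set_integrable_def ind)
qed

end

section \<open>Passage between \<open>lebesgue_on\<close> and Borel set integrals\<close>

text \<open>The spaces and operators are defined with \<open>lebesgue_on\<close>, the computations
  use \<open>lborel\<close>; for functions that are Borel on \<open>A\<close> the completion changes
  nothing.\<close>

lemma lebesgue_on_integral_eq:
  fixes f :: "'a::euclidean_space \<Rightarrow> 'b::{banach, second_countable_topology}"
  assumes A: "A \<in> sets borel" and f: "set_borel_measurable lborel A f"
  shows "f \<in> borel_measurable (lebesgue_on A)"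
    and "integrable (lebesgue_on A) f \<longleftrightarrow> set_integrable lborel A f"
    and "integral\<^sup>L (lebesgue_on A) f = (LINT x:A|lborel. f x)"
proof -
  have A': "A \<inter> space lebesgue \<in> sets lebesgue" using A by simp
  have m: "(\<lambda>x. indicator A x *\<^sub>R f x) \<in> borel_measurable lborel"
    using f by (simp add: set_borel_measurable_def)
  show "f \<in> borel_measurable (lebesgue_on A)"
    unfolding borel_measurable_restrict_space_iff[OF A'] using m by (rule measurable_completion)
  show "integrable (lebesgue_on A) f \<longleftrightarrow> set_integrable lborel A f"
    unfolding integrable_restrict_space[OF A'] set_integrable_def by (rule integrable_completion[OF m])
  show "integral\<^sup>L (lebesgue_on A) f = (LINT x:A|lborel. f x)"
    unfolding integral_restrict_space[OF A'] set_lebesgue_integral_def by (rule integral_completion[OF m])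
qed

lemma set_borel_measurable_mult:
  fixes f g :: "'a \<Rightarrow> complex"
  assumes "set_borel_measurable M A f" "set_borel_measurable M A g"
  shows "set_borel_measurable M A (\<lambda>x. f x * g x)"
proof -
  have "(\<lambda>x. (indicator A x *\<^sub>R f x) * (indicator A x *\<^sub>R g x)) \<in> borel_measurable M"
    using assms unfolding set_borel_measurable_def by (rule borel_measurable_times)
  moreover have "(\<lambda>x. (indicator A x *\<^sub>R f x) * (indicator A x *\<^sub>R g x)) = (\<lambda>x. indicator A x *\<^sub>R (f x * g x))"
    by (auto simp: indicator_def)
  ultimately show ?thesis by (simp add: set_borel_measurable_def)
qed

lemma set_integrable_sum_const:
  fixes f :: "'i \<Rightarrow> 'a \<Rightarrow> complex"
  assumes "\<And>i. i \<in> I \<Longrightarrow> set_integrable M A (f i)"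
  shows "set_integrable M A (\<lambda>x. c * (\<Sum>i\<in>I. f i x))"
    and "(LINT x:A|M. c * (\<Sum>i\<in>I. f i x)) = c * (\<Sum>i\<in>I. LINT x:A|M. f i x)"
proof -
  have eq: "indicator A x *\<^sub>R (c * (\<Sum>i\<in>I. f i x)) = c * (\<Sum>i\<in>I. indicator A x *\<^sub>R f i x)" for x
    by (simp add: scaleR_sum_right mult_scaleR_right[symmetric] del: mult_scaleR_right)
  show "set_integrable M A (\<lambda>x. c * (\<Sum>i\<in>I. f i x))"
    using assms unfolding set_integrable_def eq by (intro integrable_mult_right Bochner_Integration.integrable_sum) auto
  show "(LINT x:A|M. c * (\<Sum>i\<in>I. f i x)) = c * (\<Sum>i\<in>I. LINT x:A|M. f i x)"
  proof -
    have "(LINT x:A|M. c * (\<Sum>i\<in>I. f i x)) = c * (LINT x|M. (\<Sum>i\<in>I. indicator A x *\<^sub>R f i x))"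
      unfolding set_lebesgue_integral_def eq by (rule integral_mult_right_zero)
    also have "(LINT x|M. (\<Sum>i\<in>I. indicator A x *\<^sub>R f i x)) = (\<Sum>i\<in>I. LINT x|M. indicator A x *\<^sub>R f i x)"
      using assms unfolding set_integrable_def by (rule Bochner_Integration.integral_sum)
    finally show ?thesis by (simp add: set_lebesgue_integral_def)
  qed
qed

lemma set_integrable_bounded_mult:
  fixes f g :: "'a \<Rightarrow> complex"
  assumes g: "set_integrable M A g" and f: "set_borel_measurable M A f" and B: "\<And>x. x \<in> A \<Longrightarrow> cmod (f x) \<le> B"
  shows "set_integrable M A (\<lambda>x. f x * g x)"
proof (rule set_integrable_bound)
  show "set_integrable M A (\<lambda>x. of_real B * g x)"
    using set_integrable_sum_const(1)[of "{()}" M A "\<lambda>_. g" "of_real B"] g by simp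
  have "set_borel_measurable M A g"
    using g unfolding set_integrable_def set_borel_measurable_def by auto
  then show "set_borel_measurable M A (\<lambda>x. f x * g x)" by (rule set_borel_measurable_mult[OF f])
  show "AE x in M. x \<in> A \<longrightarrow> norm (f x * g x) \<le> norm (of_real B * g x)"
    using B by (auto simp: norm_mult intro!: mult_right_mono order_trans[OF _ abs_ge_self])
qed

section \<open>The Bergman kernel of the Hartogs triangle\<close>

lemma cnj_bidisc_kernel: "cnj (bidisc_kernel x y) = bidisc_kernel y x"
  by (simp add: bidisc_kernel_def mult.commute)

context hartogs_cover
begin

text \<open>Bell's transformation formula: the Bergman kernel of \<open>H\<close> at \<open>cover x\<close>, \<open>cover y\<close> is the sum
  of the kernel of the bidisc over the fibre of \<open>cover y\<close>, divided by the jacobians at both points.\<close>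

definition kern :: "complex \<times> complex \<Rightarrow> complex \<times> complex \<Rightarrow> complex" where
  "kern x y = bidisc_kernel x y / (snd x * cnj (snd y)) ^ N"

definition cover_kernel :: "complex \<times> complex \<Rightarrow> complex \<times> complex \<Rightarrow> complex" where
  "cover_kernel x y = 1 / of_nat m ^ 2 * (\<Sum>\<eta>\<in>roots. kern x (rot \<eta> y))"

text \<open>Any preimage will do: \<open>cover_kernel\<close> is invariant under deck
  transformations in each argument by \<open>cover_kernel_rot\<close>, so
  \<open>hartogs_kernel\<close> does not depend on the choice.\<close>

definition lift :: "complex \<times> complex \<Rightarrow> complex \<times> complex" where
  "lift z = (SOME x. cover x = z)"

definition hartogs_kernel :: "complex \<times> complex \<Rightarrow> complex \<times> complex \<Rightarrow> complex" where
  "hartogs_kernel z w = (if z \<in> H \<and> w \<in> H then cover_kernel (lift z) (lift w) else 0)"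

lemma roots_mult_cnj: "\<eta> \<in> roots \<Longrightarrow> \<eta> * cnj \<eta> = 1"
  using norm_roots[of \<eta>] by (simp add: complex_norm_square[symmetric])

text \<open>Rotating both arguments multiplies each product of a coordinate with a conjugate by
  \<open>\<eta> * cnj \<eta>\<close> or a power of its inverse, which is \<open>1\<close>.\<close>

lemma kern_rot_rot:
  assumes "\<eta> \<in> roots"
  shows "kern (rot \<eta> x) (rot \<eta> y) = kern x y"
proof -
  have "\<eta> ^ n * cnj (\<eta> ^ n) = 1"
    using roots_mult_cnj[OF assms] by (simp add: power_mult_distrib[symmetric])
  then have 1: "fst x / \<eta> ^ n * cnj (fst y / \<eta> ^ n) = fst x * cnj (fst y)"
    by simp
  have "\<eta> * snd x * cnj (\<eta> * snd y) = (\<eta> * cnj \<eta>) * (snd x * cnj (snd y))" by simp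
  then have 2: "\<eta> * snd x * cnj (\<eta> * snd y) = snd x * cnj (snd y)"
    using roots_mult_cnj[OF assms] by simp
  show ?thesis unfolding kern_def bidisc_kernel_def rot_def fst_conv snd_conv 1 2 ..
qed

lemma sum_roots_rotate:
  assumes "\<zeta> \<in> roots"
  shows "(\<Sum>\<eta>\<in>roots. g (\<eta> * \<zeta>)) = (\<Sum>\<eta>\<in>roots. g \<eta>)"
  by (rule sum.reindex_bij_witness[of _ "\<lambda>\<eta>. \<eta> / \<zeta>" "\<lambda>\<eta>. \<eta> * \<zeta>"])
    (use assms roots_nonzero[OF assms] in \<open>auto intro: roots_mult roots_divide\<close>)

text \<open>In the second argument the sum over the roots is merely permuted. In the first, both
  arguments are rotated simultaneously and the rotation of the second is then undone.\<close>

lemma cover_kernel_rot: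
  assumes "\<zeta> \<in> roots"
  shows "cover_kernel x (rot \<zeta> y) = cover_kernel x y" "cover_kernel (rot \<zeta> x) y = cover_kernel x y"
proof -
  show r: "cover_kernel x (rot \<zeta> y) = cover_kernel x y" for x y
    using sum_roots_rotate[OF assms, of "\<lambda>\<eta>. kern x (rot \<eta> y)"] by (simp add: cover_kernel_def rot_rot assms)
  have "cover_kernel (rot \<zeta> x) y = cover_kernel (rot \<zeta> x) (rot \<zeta> y)" by (rule r[symmetric])
  also have "\<dots> = 1 / of_nat m ^ 2 * (\<Sum>\<eta>\<in>roots. kern (rot \<zeta> x) (rot \<zeta> (rot \<eta> y)))"
    by (simp add: cover_kernel_def rot_rot assms mult.commute)
  also have "\<dots> = cover_kernel x y" by (simp add: kern_rot_rot assms cover_kernel_def)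
  finally show "cover_kernel (rot \<zeta> x) y = cover_kernel x y" .
qed

lemma hartogs_kernel_cover:
  assumes "x \<in> D2'" "y \<in> D2'"
  shows "hartogs_kernel (cover x) (cover y) = cover_kernel x y"
proof -
  have H: "cover x \<in> H" "cover y \<in> H" using assms cover_mem_H_iff by auto
  have lift: "cover (lift (cover x)) = cover x" for x unfolding lift_def by (rule someI[of _ x]) simp
  have nz: "snd x \<noteq> 0" "snd y \<noteq> 0" using assms by auto
  obtain \<eta> where \<eta>: "\<eta> \<in> roots" "lift (cover x) = rot \<eta> x"
    using lift[symmetric] nz(1) by (rule cover_eq_imp_rot)
  obtain \<zeta> where \<zeta>: "\<zeta> \<in> roots" "lift (cover y) = rot \<zeta> y"
    using lift[symmetric] nz(2) by (rule cover_eq_imp_rot)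
  show ?thesis using H \<eta> \<zeta> by (simp add: hartogs_kernel_def cover_kernel_rot)
qed

lemma cnj_kern: "cnj (kern x y) = kern y x"
  by (simp add: kern_def cnj_bidisc_kernel mult.commute)

lemma holomorphic2_on_kern:
  assumes "b \<in> D2'"
  shows "holomorphic2_on (\<lambda>y. kern y b) D2'"
proof -
  have "(\<lambda>v. 1 / (pi * (1 - v * cnj (fst b))\<^sup>2)) holomorphic_on ball 0 1"
    using assms by (intro holomorphic_intros) (auto simp: mult_cnj_neq_one)
  then have 1: "holomorphic2_on (\<lambda>y. 1 / (pi * (1 - fst y * cnj (fst b))\<^sup>2)) D2'"
    by (rule holomorphic2_on_field_compose[OF _ open_ball _ holomorphic2_on_fst]) auto
  have "(\<lambda>t. 1 / (pi * (1 - t * cnj (snd b))\<^sup>2) / (t * cnj (snd b)) ^ N) holomorphic_on ball 0 1 - {0}"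
    using assms by (intro holomorphic_intros) (auto simp: mult_cnj_neq_one)
  then have 2: "holomorphic2_on (\<lambda>y. 1 / (pi * (1 - snd y * cnj (snd b))\<^sup>2) / (snd y * cnj (snd b)) ^ N) D2'"
    by (rule holomorphic2_on_field_compose[OF _ _ _ holomorphic2_on_snd]) (auto intro: open_Diff)
  show ?thesis using holomorphic2_on_mult[OF 1 2] by (simp add: kern_def bidisc_kernel_def mult.assoc)
qed

lemma holomorphic2_on_rot: "\<eta> \<in> roots \<Longrightarrow> holomorphic2_on f D2' \<Longrightarrow> holomorphic2_on (\<lambda>y. f (rot \<eta> y)) D2'"
  unfolding rot_def
proof (rule holomorphic2_on_compose)
  assume \<eta>: "\<eta> \<in> roots"
  show "(fst y / \<eta> ^ n, \<eta> * snd y) \<in> D2'" if "y \<in> D2'" for y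
    using rot_mem_iff(2)[OF \<eta>, of y] that by (simp add: rot_def)
  show "holomorphic2_on (\<lambda>y. fst y / \<eta> ^ n) D2'"
    using holomorphic2_on_mult[OF holomorphic2_on_fst holomorphic2_on_const[of "1 / \<eta> ^ n"]] by simp
  show "holomorphic2_on (\<lambda>y. \<eta> * snd y) D2'"
    by (intro holomorphic2_on_mult holomorphic2_on_const holomorphic2_on_snd)
qed

text \<open>Conjugation exchanges the arguments of \<open>kern\<close>, so the pullback depends
  holomorphically on its second argument and descends to \<open>H\<close>.\<close>

lemma holomorphic2_on_cnj_hartogs_kernel:
  assumes "z \<in> H"
  shows "holomorphic2_on (\<lambda>w. cnj (hartogs_kernel z w)) H"
proof -
  obtain x where x: "x \<in> D2'" "cover x = z" using assms by (rule H_subset_cover)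
  have "holomorphic2_on (\<lambda>y. 1 / of_nat m ^ 2 * (\<Sum>\<eta>\<in>roots. kern (rot \<eta> y) x)) D2'"
    by (intro holomorphic2_on_mult holomorphic2_on_const holomorphic2_on_sum holomorphic2_on_rot holomorphic2_on_kern x)
  then show ?thesis
    by (rule holomorphic2_on_descend)
      (simp add: x(2)[symmetric] hartogs_kernel_cover[OF x(1)] cover_kernel_def cnj_kern)
qed

lemma hartogs_kernel_measurable:
  assumes "z \<in> H"
  shows "set_borel_measurable lborel H (hartogs_kernel z)"
proof (rule set_borel_measurable_continuous[OF H_borel])
  have "continuous_on H (\<lambda>w. cnj (cnj (hartogs_kernel z w)))"
    by (intro continuous_intros holomorphic2_on_imp_continuous_on holomorphic2_on_cnj_hartogs_kernel assms)
  then show "continuous_on H (hartogs_kernel z)" by simp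
qed

text \<open>For fixed \<open>x\<close> the only singularity in \<open>y\<close> is the factor
  \<open>cmod (snd y) ^ N\<close> in the denominator, exactly balanced in the square by the weight
  \<open>cmod (snd y) ^ (2 * N)\<close> of the pulled back measure.\<close>

lemma norm_cover_kernel_le:
  assumes x: "x \<in> D2'"
  obtains B where "B \<ge> 0" "\<And>y. y \<in> D2' \<Longrightarrow> cmod (cover_kernel x y) * cmod (snd y) ^ N \<le> B"
proof
  define A where "A = 1 / (pi * (1 - cmod (fst x))\<^sup>2) * (1 / (pi * (1 - cmod (snd x))\<^sup>2)) / cmod (snd x) ^ N"
  have A: "A \<ge> 0" by (simp add: A_def)
  show "1 / real m ^ 2 * (\<Sum>\<eta>\<in>roots. A) \<ge> 0" using A by (intro mult_nonneg_nonneg sum_nonneg) auto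
  fix y assume y: "y \<in> D2'"
  have k: "cmod (kern x (rot \<eta> y)) * cmod (snd y) ^ N \<le> A" if \<eta>: "\<eta> \<in> roots" for \<eta>
  proof -
    have "cmod (kern x (rot \<eta> y)) * cmod (snd y) ^ N = cmod (bidisc_kernel x (rot \<eta> y)) / cmod (snd x) ^ N"
      using x y norm_rot(2)[OF \<eta>, of y]
      by (auto simp: kern_def norm_divide norm_mult norm_power power_mult_distrib)
    also have "\<dots> \<le> A"
      unfolding A_def using x y norm_rot[OF \<eta>, of y]
      by (intro divide_right_mono norm_bidisc_kernel_le) (auto simp: less_imp_le)
    finally show ?thesis .
  qed
  have "cmod (cover_kernel x y) * cmod (snd y) ^ N \<le> 1 / real m ^ 2 * (\<Sum>\<eta>\<in>roots. cmod (kern x (rot \<eta> y))) * cmod (snd y) ^ N"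
    by (intro mult_right_mono) (auto simp: cover_kernel_def norm_mult norm_divide norm_power intro!: divide_right_mono norm_sum)
  also have "\<dots> = 1 / real m ^ 2 * (\<Sum>\<eta>\<in>roots. cmod (kern x (rot \<eta> y)) * cmod (snd y) ^ N)"
    by (simp add: sum_distrib_right)
  also have "\<dots> \<le> 1 / real m ^ 2 * (\<Sum>\<eta>\<in>roots. A)"
    by (intro mult_left_mono sum_mono k) auto
  finally show "cmod (cover_kernel x y) * cmod (snd y) ^ N \<le> 1 / real m ^ 2 * (\<Sum>\<eta>\<in>roots. A)" .
qed

text \<open>The identity that moves the whole problem to the bidisc. The weight cancels the
  conjugate jacobian in \<open>kern\<close>, so every root of unity contributes a rotated copy of
  the same integrand \<open>G\<close>. Rotations preserve the measure, and the \<open>m\<close>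
  equal integrals cancel the constant: \<open>1 / m ^ 2\<close> from the kernel, \<open>m\<close>
  from the weight, \<open>m\<close> from the sum.\<close>

lemma integral_hartogs_kernel:
  assumes f: "set_borel_measurable lborel H f" and x: "x \<in> D2'"
    and int: "set_integrable lborel D2 (\<lambda>y. snd y ^ N * f (cover y))"
  shows "set_integrable lborel H (\<lambda>w. hartogs_kernel (cover x) w * f w)"
    and "(LINT w:H|lborel. hartogs_kernel (cover x) w * f w)
      = (LINT y:D2|lborel. bidisc_kernel x y * (snd y ^ N * f (cover y))) / snd x ^ N"
proof -
  have zH: "cover x \<in> H" using x cover_mem_H_iff by auto
  have mK: "set_borel_measurable lborel H (\<lambda>w. hartogs_kernel (cover x) w * f w)"
    by (intro set_borel_measurable_mult hartogs_kernel_measurable zH f)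
  define G where "G = (\<lambda>y. bidisc_kernel x y / snd x ^ N * (snd y ^ N * f (cover y)))"
  have bm: "set_borel_measurable lborel D2 (\<lambda>y. bidisc_kernel x y / snd x ^ N)"
    using x by (intro set_borel_measurable_continuous D2_borel continuous_intros continuous_on_bidisc_kernel) auto
  have intG: "set_integrable lborel D2 G"
    unfolding G_def
  proof (rule set_integrable_bounded_mult[OF int bm])
    show "cmod (bidisc_kernel x y / snd x ^ N)
        \<le> 1 / (pi * (1 - cmod (fst x))\<^sup>2) * (1 / (pi * (1 - cmod (snd x))\<^sup>2)) / cmod (snd x) ^ N" if "y \<in> D2" for y
      unfolding norm_divide norm_power
      using x that by (intro divide_right_mono norm_bidisc_kernel_le) (auto simp: less_imp_le)
  qed
  then have mG: "set_borel_measurable lborel D2 G"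
    unfolding set_integrable_def set_borel_measurable_def by auto
  have eq: "of_real (real m * cmod (snd y) ^ (2 * N)) * (hartogs_kernel (cover x) (cover y) * f (cover y))
      = 1 / of_nat m * (\<Sum>\<eta>\<in>roots. G (rot \<eta> y))" if y: "y \<in> D2" for y
  proof (cases "snd y = 0")
    case True
    then have "G (rot \<eta> y) = 0" for \<eta> using N_pos by (simp add: G_def rot_def zero_power)
    then show ?thesis using True N_pos by (simp add: zero_power)
  next
    case False
    with y have y': "y \<in> D2'" by (cases y) auto
    have "of_real (cmod (snd y) ^ (2 * N)) * kern x (rot \<eta> y) * f (cover y) = G (rot \<eta> y)" if \<eta>: "\<eta> \<in> roots" for \<eta>
    proof -
      let ?s = "\<eta> * snd y"
      have s: "?s \<noteq> 0" using False roots_nonzero[OF \<eta>] by simp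
      \<comment> \<open>As \<open>\<eta>\<close> has modulus \<open>1\<close>, the weight is also
        the \<open>N\<close>-th power of \<open>?s * cnj ?s\<close>; the conjugate half cancels and
        the other half stays as the holomorphic factor of \<open>G (rot \<eta> y)\<close>.\<close>
      have "?s * cnj ?s = complex_of_real ((cmod (snd y))\<^sup>2)"
        using complex_norm_square[of ?s] norm_roots[OF \<eta>] by (simp add: norm_mult)
      then have "complex_of_real (cmod (snd y) ^ (2 * N)) = (?s * cnj ?s) ^ N"
        by (simp add: power_mult)
      then show ?thesis
        using s x by (simp add: kern_def G_def cover_rot[OF \<eta>] power_mult_distrib) (simp add: rot_def power_mult_distrib field_simps)
    qed
    then show ?thesis
      using m by (simp add: hartogs_kernel_cover[OF x y'] cover_kernel_def sum_distrib_left sum_distrib_right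
          power2_eq_square mult_ac divide_simps)
  qed
  have introt: "set_integrable lborel D2 (\<lambda>y. G (rot \<eta> y))" if "\<eta> \<in> roots" for \<eta>
    using integral_rot(2)[OF that mG] intG by simp
  have sums: "set_integrable lborel D2 (\<lambda>y. 1 / of_nat m * (\<Sum>\<eta>\<in>roots. G (rot \<eta> y)))"
    "(LINT y:D2|lborel. 1 / of_nat m * (\<Sum>\<eta>\<in>roots. G (rot \<eta> y)))
      = 1 / of_nat m * (\<Sum>\<eta>\<in>roots. LINT y:D2|lborel. G (rot \<eta> y))"
    by (rule set_integrable_sum_const, rule introt, assumption)+
  have "set_integrable lborel D2 (\<lambda>y. of_real (real m * cmod (snd y) ^ (2 * N)) * (hartogs_kernel (cover x) (cover y) * f (cover y)))
     \<longleftrightarrow> set_integrable lborel D2 (\<lambda>y. 1 / of_nat m * (\<Sum>\<eta>\<in>roots. G (rot \<eta> y)))"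
    unfolding set_integrable_def using eq by (intro Bochner_Integration.integrable_cong) (auto simp: indicator_def)
  then show "set_integrable lborel H (\<lambda>w. hartogs_kernel (cover x) w * f w)"
    using sums(1) integral_cover(1)[OF mK] by simp
  have "(LINT w:H|lborel. hartogs_kernel (cover x) w * f w)
     = (LINT y:D2|lborel. of_real (real m * cmod (snd y) ^ (2 * N)) * (hartogs_kernel (cover x) (cover y) * f (cover y)))"
    by (rule integral_cover(2)[OF mK])
  also have "\<dots> = (LINT y:D2|lborel. 1 / of_nat m * (\<Sum>\<eta>\<in>roots. G (rot \<eta> y)))"
    unfolding set_lebesgue_integral_def using eq by (intro Bochner_Integration.integral_cong) (auto simp: indicator_def)
  also have "\<dots> = 1 / of_nat m * (\<Sum>\<eta>\<in>roots. LINT y:D2|lborel. G y)"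
    unfolding sums(2) using integral_rot(1)[OF _ mG] by simp
  also have "\<dots> = (LINT y:D2|lborel. G y)"
    using m by (simp add: card_roots)
  also have "\<dots> = (LINT y:D2|lborel. 1 / snd x ^ N * (bidisc_kernel x y * (snd y ^ N * f (cover y))))"
    by (simp add: G_def mult_ac)
  also have "\<dots> = (LINT y:D2|lborel. bidisc_kernel x y * (snd y ^ N * f (cover y))) / snd x ^ N"
    by (subst set_integral_mult_right) simp
  finally show "(LINT w:H|lborel. hartogs_kernel (cover x) w * f w)
      = (LINT y:D2|lborel. bidisc_kernel x y * (snd y ^ N * f (cover y))) / snd x ^ N" .
qed

end

lemma set_borel_measurable_holomorphic2:
  assumes "A \<in> sets borel" "holomorphic2_on f A"
  shows "set_borel_measurable lborel A f"
  using assms by (intro set_borel_measurable_continuous holomorphic2_on_imp_continuous_on)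

lemma Lp_space_iff_nn_integral:
  assumes A: "A \<in> sets borel" and f: "set_borel_measurable lborel A f"
  shows "f \<in> Lp_space p A \<longleftrightarrow> (\<integral>\<^sup>+x. ennreal (cmod (f x) powr p) * indicator A x \<partial>lborel) < \<infinity>"
    and "f \<in> Lp_space p A \<Longrightarrow>
      ennreal (integral\<^sup>L (lebesgue_on A) (\<lambda>z. cmod (f z) powr p)) = (\<integral>\<^sup>+x. ennreal (cmod (f x) powr p) * indicator A x \<partial>lborel)"
proof -
  have A': "A \<inter> space lebesgue \<in> sets lebesgue" using A by simp
  have mf: "f \<in> borel_measurable (lebesgue_on A)" by (rule lebesgue_on_integral_eq[OF A f])
  then have mp: "(\<lambda>x. cmod (f x) powr p) \<in> borel_measurable (lebesgue_on A)" by measurable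
  have nn: "(\<integral>\<^sup>+x. ennreal (cmod (f x) powr p) \<partial>lebesgue_on A) = (\<integral>\<^sup>+x. ennreal (cmod (f x) powr p) * indicator A x \<partial>lborel)"
    unfolding nn_integral_restrict_space[OF A'] nn_integral_completion ..
  have int: "integrable (lebesgue_on A) (\<lambda>x. cmod (f x) powr p) \<longleftrightarrow> (\<integral>\<^sup>+x. ennreal (cmod (f x) powr p) * indicator A x \<partial>lborel) < \<infinity>"
    using mp unfolding integrable_iff_bounded nn[symmetric] by simp
  show "f \<in> Lp_space p A \<longleftrightarrow> (\<integral>\<^sup>+x. ennreal (cmod (f x) powr p) * indicator A x \<partial>lborel) < \<infinity>"
    using mf int by (simp add: Lp_space_def)
  show "ennreal (integral\<^sup>L (lebesgue_on A) (\<lambda>z. cmod (f z) powr p)) = (\<integral>\<^sup>+x. ennreal (cmod (f x) powr p) * indicator A x \<partial>lborel)"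
    if "f \<in> Lp_space p A"
    using that unfolding nn[symmetric] by (intro nn_integral_eq_integral[symmetric]) (auto simp: Lp_space_def)
qed

context hartogs_cover
begin

lemma nn_integral_cover_set:
  fixes g :: "complex \<times> complex \<Rightarrow> ennreal"
  assumes "(\<lambda>z. g z * indicator H z) \<in> borel_measurable borel"
  shows "(\<integral>\<^sup>+z. g z * indicator H z \<partial>lborel)
     = (\<integral>\<^sup>+x. g (cover x) * ennreal (real m * cmod (snd x) ^ (2 * N)) * indicator D2 x \<partial>lborel)"
proof -
  have "(\<integral>\<^sup>+z. g z * indicator H z \<partial>lborel) = (\<integral>\<^sup>+z. (g z * indicator H z) * indicator H z \<partial>lborel)"
    by (intro nn_integral_cong) (auto simp: indicator_def)
  also have "\<dots> = (\<integral>\<^sup>+x. (g (cover x) * indicator H (cover x)) * ennreal (real m * cmod (snd x) ^ (2 * N)) * indicator D2 x \<partial>lborel)"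
    by (rule nn_integral_cover[OF assms])
  also have "\<dots> = (\<integral>\<^sup>+x. g (cover x) * ennreal (real m * cmod (snd x) ^ (2 * N)) * indicator D2 x \<partial>lborel)"
  proof (rule nn_integral_cong)
    fix x :: "complex \<times> complex"
    show "(g (cover x) * indicator H (cover x)) * ennreal (real m * cmod (snd x) ^ (2 * N)) * indicator D2 x
        = g (cover x) * ennreal (real m * cmod (snd x) ^ (2 * N)) * indicator D2 x"
    proof (cases "snd x = 0")
      case True
      then show ?thesis using N_pos by (simp add: zero_power)
    next
      case False
      then show ?thesis using cover_mem_H_iff[of x] by (cases x) (auto simp: indicator_def)
    qed
  qed
  finally show ?thesis .
qed

lemma norm_powr_H_measurable:
  assumes "set_borel_measurable lborel H f"
  shows "(\<lambda>z. ennreal (cmod (f z) powr p) * indicator H z) \<in> borel_measurable borel"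
proof -
  define g where "g = (\<lambda>z. cmod (indicator H z *\<^sub>R f z))"
  have [measurable]: "g \<in> borel_measurable borel"
    unfolding g_def by (rule borel_measurable_norm_compose) (use assms in \<open>simp add: set_borel_measurable_def\<close>)
  have "(\<lambda>z. ennreal (g z powr p) * indicator H z) \<in> borel_measurable borel" by measurable
  moreover have "(\<lambda>z. ennreal (g z powr p) * indicator H z) = (\<lambda>z. ennreal (cmod (f z) powr p) * indicator H z)"
    by (auto simp: g_def indicator_def)
  ultimately show ?thesis by simp
qed

text \<open>Multiplied by \<open>snd y ^ N\<close> the pulled back kernel is bounded, and the bidisc
  has finite measure.\<close>

lemma cnj_hartogs_kernel_mem:
  assumes z: "z \<in> H"
  shows "(\<lambda>w. cnj (hartogs_kernel z w)) \<in> Bergman_space 2 H"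
proof -
  have hol: "holomorphic2_on (\<lambda>w. cnj (hartogs_kernel z w)) H"
    by (rule holomorphic2_on_cnj_hartogs_kernel[OF z])
  obtain x where x: "x \<in> D2'" "cover x = z" using z by (rule H_subset_cover)
  obtain B where B: "B \<ge> 0" "\<And>y. y \<in> D2' \<Longrightarrow> cmod (cover_kernel x y) * cmod (snd y) ^ N \<le> B"
    using norm_cover_kernel_le[OF x(1)] by blast
  note mK = set_borel_measurable_holomorphic2[OF H_borel hol]
  have "(\<integral>\<^sup>+w. ennreal (cmod (cnj (hartogs_kernel z w)) powr 2) * indicator H w \<partial>lborel)
     = (\<integral>\<^sup>+y. ennreal (cmod (cnj (hartogs_kernel z (cover y))) powr 2) * ennreal (real m * cmod (snd y) ^ (2 * N)) * indicator D2 y \<partial>lborel)"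
    by (rule nn_integral_cover_set[OF norm_powr_H_measurable[OF mK]])
  also have "\<dots> \<le> (\<integral>\<^sup>+y. ennreal (real m * B\<^sup>2) * indicator D2 y \<partial>lborel)"
  proof (rule nn_integral_mono)
    fix y :: "complex \<times> complex"
    show "ennreal (cmod (cnj (hartogs_kernel z (cover y))) powr 2) * ennreal (real m * cmod (snd y) ^ (2 * N)) * indicator D2 y
        \<le> ennreal (real m * B\<^sup>2) * indicator D2 y"
    proof (cases "y \<in> D2'")
      case True
      have "cmod (cnj (hartogs_kernel z (cover y))) powr 2 * (real m * cmod (snd y) ^ (2 * N))
          = real m * (cmod (cover_kernel x y) * cmod (snd y) ^ N)\<^sup>2"
        unfolding x(2)[symmetric] hartogs_kernel_cover[OF x(1) True]
        by (simp add: powr_numeral power_mult_distrib power_mult[symmetric] mult.commute[of N])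
      also have "\<dots> \<le> real m * B\<^sup>2" using B(2)[OF True] by (intro mult_left_mono power_mono) auto
      finally show ?thesis using True by (auto simp: ennreal_mult[symmetric] indicator_def intro!: ennreal_leI)
    next
      case False
      then have "y \<notin> D2 \<or> snd y = 0" by (cases y) auto
      then show ?thesis using N_pos by (auto simp: zero_power indicator_def)
    qed
  qed
  also have "\<dots> = ennreal (real m * B\<^sup>2) * emeasure lborel D2"
    by (rule nn_integral_cmult_indicator) simp
  also have "\<dots> < \<infinity>" by (simp add: emeasure_bidisc ennreal_mult_less_top)
  finally show ?thesis
    using hol Lp_space_iff_nn_integral(1)[OF H_borel mK] by (simp add: Bergman_space_def)
qed

lemma pullback_L2:
  assumes f: "f \<in> Bergman_space 2 H"
  shows "(\<integral>\<^sup>+x. ennreal ((cmod (snd x ^ N * f (cover x)))\<^sup>2) * indicator D2 x \<partial>lborel) < \<infinity>"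
proof -
  have hol: "holomorphic2_on f H" and fL: "f \<in> Lp_space 2 H" using f by (auto simp: Bergman_space_def)
  note mf = set_borel_measurable_holomorphic2[OF H_borel hol]
  have "(\<integral>\<^sup>+x. ennreal ((cmod (snd x ^ N * f (cover x)))\<^sup>2) * indicator D2 x \<partial>lborel)
     \<le> (\<integral>\<^sup>+x. ennreal (cmod (f (cover x)) powr 2) * ennreal (real m * cmod (snd x) ^ (2 * N)) * indicator D2 x \<partial>lborel)"
  proof (rule nn_integral_mono)
    fix x :: "complex \<times> complex"
    have "(cmod (snd x ^ N * f (cover x)))\<^sup>2 = cmod (f (cover x)) powr 2 * (1 * cmod (snd x) ^ (2 * N))"
      by (simp add: powr_numeral norm_mult norm_power power_mult_distrib power_mult[symmetric] mult.commute[of N])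
    also have "\<dots> \<le> cmod (f (cover x)) powr 2 * (real m * cmod (snd x) ^ (2 * N))"
      using m by (intro mult_left_mono mult_right_mono) auto
    finally show "ennreal ((cmod (snd x ^ N * f (cover x)))\<^sup>2) * indicator D2 x
       \<le> ennreal (cmod (f (cover x)) powr 2) * ennreal (real m * cmod (snd x) ^ (2 * N)) * indicator D2 x"
      by (auto simp: ennreal_mult[symmetric] indicator_def intro!: ennreal_leI)
  qed
  also have "\<dots> = (\<integral>\<^sup>+w. ennreal (cmod (f w) powr 2) * indicator H w \<partial>lborel)"
    by (rule nn_integral_cover_set[OF norm_powr_H_measurable[OF mf], symmetric])
  also have "\<dots> < \<infinity>" using fL Lp_space_iff_nn_integral(1)[OF H_borel mf] by simp
  finally show ?thesis .
qed

text \<open>Multiplying \<open>f (cover x)\<close> by the jacobian, up to its constant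
  \<open>m\<close>, turns square integrability on \<open>H\<close> into unweighted square
  integrability on the bidisc. There \<open>bidisc_reproducing\<close> applies, and
  \<open>integral_hartogs_kernel\<close> carries the formula back.\<close>

lemma hartogs_kernel_reproducing:
  assumes f: "f \<in> Bergman_space 2 H" and z: "z \<in> H"
  shows "f z = integral\<^sup>L (lebesgue_on H) (\<lambda>w. hartogs_kernel z w * f w)"
proof -
  obtain x where x: "x \<in> D2'" "cover x = z" using z by (rule H_subset_cover)
  have hol: "holomorphic2_on f H" using f by (auto simp: Bergman_space_def)
  note mf = set_borel_measurable_holomorphic2[OF H_borel hol]
  define F where "F = (\<lambda>x. snd x ^ N * f (cover x))"
  have holF: "holomorphic2_on F D2'"
  proof -
    have "holomorphic2_on (\<lambda>x. snd x ^ N) D2'"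
      by (rule holomorphic2_on_field_compose[OF _ open_UNIV _ holomorphic2_on_snd, of "\<lambda>w. w ^ N"])
        (auto intro!: holomorphic_intros)
    then show ?thesis unfolding F_def by (rule holomorphic2_on_mult[OF _ holomorphic2_on_cover[OF hol]])
  qed
  have zero: "F (v, 0) = 0" for v using N_pos by (simp add: F_def)
  have finF: "(\<integral>\<^sup>+x. ennreal ((cmod (F x))\<^sup>2) * indicator D2 x \<partial>lborel) < \<infinity>"
    unfolding F_def by (rule pullback_L2[OF f])
  have xx: "cmod (fst x) < 1" "cmod (snd x) < 1" "snd x \<noteq> 0" "(fst x, snd x) = x" using x by auto
  have mD: "set_borel_measurable lborel D2 F"
  proof -
    have "(\<lambda>x. indicator D2 x *\<^sub>R F x) = (\<lambda>x. indicator D2' x *\<^sub>R F x)"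
      using zero by (intro ext) (auto simp: indicator_def)
    then show ?thesis
      using borel_measurable_continuous_on_indicator[OF D2'_borel holomorphic2_on_imp_continuous_on[OF holF]]
      by (simp add: set_borel_measurable_def)
  qed
  have intF: "set_integrable lborel D2 F"
    by (rule L2_imp_integrable_finite_measure[OF mD D2_borel _ finF]) (simp add: emeasure_bidisc)
  have "F x = (LINT y:D2|lborel. bidisc_kernel x y * F y)"
    using bidisc_reproducing(2)[OF holomorphic2_on_imp_continuous_on[OF holF] holomorphic2_on_slices[OF holF] zero finF xx(1-3)]
    unfolding xx(4) .
  then have "f z = (LINT y:D2|lborel. bidisc_kernel x y * F y) / snd x ^ N"
    using x(2) xx(3) by (simp add: F_def field_simps)
  also have "\<dots> = (LINT w:H|lborel. hartogs_kernel z w * f w)"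
    using integral_hartogs_kernel(2)[OF mf x(1) intF[unfolded F_def]] by (simp add: F_def x(2))
  also have "\<dots> = integral\<^sup>L (lebesgue_on H) (\<lambda>w. hartogs_kernel z w * f w)"
    by (rule lebesgue_on_integral_eq(3)[symmetric, OF H_borel])
      (intro set_borel_measurable_mult hartogs_kernel_measurable z mf)
  finally show ?thesis .
qed

text \<open>The definite description needs uniqueness: any two kernels with the defining property
  reproduce each other's conjugates, so each equals the conjugate transpose of
  \<open>hartogs_kernel\<close>. Off \<open>H\<close> both vanish.\<close>

lemma Bergman_kernel_eq: "Bergman_kernel H = hartogs_kernel"
proof -
  define P where "P = (\<lambda>K. (\<forall>z\<in>H. (\<lambda>w. cnj (K z w)) \<in> Bergman_space 2 H \<and>
      (\<forall>f\<in>Bergman_space 2 H. f z = integral\<^sup>L (lebesgue_on H) (\<lambda>w. K z w * f w))) \<and>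
      (\<forall>z w. z \<notin> H \<or> w \<notin> H \<longrightarrow> K z w = 0))"
  have P: "P hartogs_kernel"
    using cnj_hartogs_kernel_mem hartogs_kernel_reproducing unfolding P_def by (auto simp: hartogs_kernel_def)
  have mem: "(\<lambda>w. cnj (K z w)) \<in> Bergman_space 2 H" if "P K" "z \<in> H" for K z
    using that unfolding P_def by blast
  have rep: "f z = integral\<^sup>L (lebesgue_on H) (\<lambda>w. K z w * f w)" if "P K" "z \<in> H" "f \<in> Bergman_space 2 H" for K z f
    using that unfolding P_def by blast
  have zero: "K z w = 0" if "P K" "z \<notin> H \<or> w \<notin> H" for K z w
    using that unfolding P_def by blast
  \<comment> \<open>Evaluates the inner product of the two kernel functions in two ways. Used with
    \<open>K\<close> and with \<open>hartogs_kernel\<close> itself, it identifies both.\<close>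
  have swap: "K z w = cnj (hartogs_kernel w z)" if K: "P K" and z: "z \<in> H" and w: "w \<in> H" for K z w
  proof -
    have "cnj (K z w) = integral\<^sup>L (lebesgue_on H) (\<lambda>u. hartogs_kernel w u * cnj (K z u))"
      by (rule rep[OF P w mem[OF K z]])
    also have "\<dots> = cnj (integral\<^sup>L (lebesgue_on H) (\<lambda>u. K z u * cnj (hartogs_kernel w u)))"
    proof -
      have "(\<lambda>u. hartogs_kernel w u * cnj (K z u)) = (\<lambda>u. cnj (K z u * cnj (hartogs_kernel w u)))"
        by (simp add: mult.commute)
      then show ?thesis by (simp only: Bochner_Integration.integral_cnj)
    qed
    also have "integral\<^sup>L (lebesgue_on H) (\<lambda>u. K z u * cnj (hartogs_kernel w u)) = cnj (hartogs_kernel w z)"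
      by (rule rep[OF K z mem[OF P w], symmetric])
    finally show ?thesis by (metis complex_cnj_cnj)
  qed
  have "K = hartogs_kernel" if K: "P K" for K
  proof (intro ext)
    fix z w
    show "K z w = hartogs_kernel z w"
      using swap[OF K, of z w] swap[OF P, of z w] zero[OF K, of z w] zero[OF P, of z w]
      by (cases "z \<in> H \<and> w \<in> H") auto
  qed
  then have "(THE K. P K) = hartogs_kernel" by (rule the_equality[of P, OF P])
  then show ?thesis unfolding Bergman_kernel_def P_def .
qed

end

section \<open>Boundedness by Schur's test\<close>

text \<open>Taylor remainders of \<open>1 / (1 - a)\<^sup>2\<close> of orders one and two in exact
  algebraic form. With \<open>b\<close> and \<open>c\<close> between \<open>\<rho>\<close> and
  \<open>2\<close> in modulus, the constants \<open>4\<close> and \<open>6\<close> bound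
  \<open>cmod (c + b)\<close> and \<open>cmod (c + 2 * b)\<close>.\<close>

lemma inverse_square_remainders:
  fixes a k :: complex
  assumes "cmod (1 - a) \<ge> \<rho>" "cmod (1 - (a + k)) \<ge> \<rho>" "cmod a \<le> 1" "cmod (a + k) \<le> 1" "\<rho> > 0"
  shows "cmod (1 / (1 - (a + k))\<^sup>2 - 1 / (1 - a)\<^sup>2) \<le> 4 / \<rho> ^ 4 * cmod k"
    and "cmod (1 / (1 - (a + k))\<^sup>2 - 1 / (1 - a)\<^sup>2 - 2 / (1 - a) ^ 3 * k) \<le> 6 / \<rho> ^ 5 * (cmod k)\<^sup>2"
    and "cmod (1 / (1 - a)\<^sup>2) \<le> 1 / \<rho>\<^sup>2"
proof -
  define b c where "b = 1 - (a + k)" and "c = 1 - a"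
  have k: "k = c - b" by (simp add: b_def c_def)
  have nz: "b \<noteq> 0" "c \<noteq> 0" using assms by (auto simp: b_def c_def)
  have lo: "cmod b \<ge> \<rho>" "cmod c \<ge> \<rho>" using assms by (auto simp: b_def c_def)
  have hi: "cmod b \<le> 2" "cmod c \<le> 2"
    using assms norm_triangle_ineq4[of 1 "a + k"] norm_triangle_ineq4[of 1 a] by (auto simp: b_def c_def)
  have e1: "1 / b\<^sup>2 - 1 / c\<^sup>2 = k * (c + b) / (b\<^sup>2 * c\<^sup>2)"
    using nz unfolding k by (simp add: field_simps power2_eq_square)
  have e2: "1 / b\<^sup>2 - 1 / c\<^sup>2 - 2 / c ^ 3 * k = k\<^sup>2 * (c + 2 * b) / (b\<^sup>2 * c ^ 3)"
    using nz unfolding k by (simp add: field_simps power2_eq_square power3_eq_cube)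
  have "cmod (1 / b\<^sup>2 - 1 / c\<^sup>2) = cmod k * cmod (c + b) / ((cmod b)\<^sup>2 * (cmod c)\<^sup>2)"
    unfolding e1 by (simp add: norm_mult norm_divide norm_power)
  also have "\<dots> \<le> cmod k * 4 / (\<rho>\<^sup>2 * \<rho>\<^sup>2)"
    using lo hi assms(5) norm_triangle_ineq[of c b] by (intro frac_le mult_mono power_mono) auto
  also have "\<dots> = 4 / \<rho> ^ 4 * cmod k" by (simp add: power2_eq_square power4_eq_xxxx mult.assoc)
  finally show "cmod (1 / (1 - (a + k))\<^sup>2 - 1 / (1 - a)\<^sup>2) \<le> 4 / \<rho> ^ 4 * cmod k"
    by (simp add: b_def c_def)
  have "cmod (1 / b\<^sup>2 - 1 / c\<^sup>2 - 2 / c ^ 3 * k) = (cmod k)\<^sup>2 * cmod (c + 2 * b) / ((cmod b)\<^sup>2 * cmod c ^ 3)"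
    unfolding e2 by (simp add: norm_mult norm_divide norm_power)
  also have "\<dots> \<le> (cmod k)\<^sup>2 * 6 / (\<rho>\<^sup>2 * \<rho> ^ 3)"
    using lo hi assms(5) norm_triangle_ineq[of c "2 * b"] by (intro frac_le mult_mono power_mono) (auto simp: norm_mult)
  also have "\<dots> = 6 / \<rho> ^ 5 * (cmod k)\<^sup>2" by (simp add: power_add[symmetric])
  finally show "cmod (1 / (1 - (a + k))\<^sup>2 - 1 / (1 - a)\<^sup>2 - 2 / (1 - a) ^ 3 * k) \<le> 6 / \<rho> ^ 5 * (cmod k)\<^sup>2"
    by (simp add: b_def c_def)
  show "cmod (1 / (1 - a)\<^sup>2) \<le> 1 / \<rho>\<^sup>2"
    using lo(2) assms(5) unfolding c_def[symmetric]
    by (simp add: norm_divide norm_power) (intro divide_left_mono power_mono mult_pos_pos zero_less_power, auto)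
qed

text \<open>A quadratic remainder bound uniform in \<open>y\<close>, so that it can be integrated.
  With primes for the values at \<open>x + h\<close>, linear parts \<open>d\<close>,
  \<open>f\<close> and remainders \<open>e\<close>, \<open>g\<close>, the product rule leaves
  \<open>(q' - q) * (s' - s) + e * s + q * g\<close>. The margin \<open>2 * \<rho>\<close> keeps
  both \<open>x\<close> and \<open>x + h\<close> at distance at least \<open>\<rho>\<close> from the
  boundary.\<close>

lemma bidisc_kernel_remainder:
  fixes x h :: "complex \<times> complex"
  assumes r: "\<rho> > 0" "cmod (fst x) + 2 * \<rho> \<le> 1" "cmod (snd x) + 2 * \<rho> \<le> 1" and h: "norm h \<le> \<rho>"
    and y: "y \<in> ball 0 1 \<times> ball 0 1"
  defines "a \<equiv> fst x * cnj (fst y)" and "b \<equiv> snd x * cnj (snd y)"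
  shows "cmod (bidisc_kernel (x + h) y - bidisc_kernel x y
      - (2 * cnj (fst y) / (1 - a) ^ 3 * (1 / (1 - b)\<^sup>2) / pi\<^sup>2 * fst h
        + 1 / (1 - a)\<^sup>2 * (2 * cnj (snd y) / (1 - b) ^ 3) / pi\<^sup>2 * snd h))
    \<le> ((4 / \<rho> ^ 4)\<^sup>2 + 2 * (6 / \<rho> ^ 5 * (1 / \<rho>\<^sup>2))) / pi\<^sup>2 * (norm h)\<^sup>2"
proof -
  define k l where "k = fst h * cnj (fst y)" and "l = snd h * cnj (snd y)"
  have hk: "cmod (fst h) \<le> norm h" "cmod (snd h) \<le> norm h" by (metis norm_fst_le norm_snd_le prod.collapse)+
  have y1: "cmod (fst y) \<le> 1" "cmod (snd y) \<le> 1" using y by (cases y; auto)+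
  have kl: "cmod k \<le> norm h" "cmod l \<le> norm h"
    using hk y1 by (auto simp: k_def l_def norm_mult intro: order_trans[OF mult_right_le_one_le])
  have fs: "cmod (fst x + fst h) \<le> cmod (fst x) + norm h" "cmod (snd x + snd h) \<le> cmod (snd x) + norm h"
    using norm_triangle_ineq[of "fst x" "fst h"] norm_triangle_ineq[of "snd x" "snd h"] hk by auto
  have ak: "a + k = (fst x + fst h) * cnj (fst y)" "b + l = (snd x + snd h) * cnj (snd y)"
    by (simp_all add: a_def b_def k_def l_def algebra_simps)
  have le1: "cmod (u * cnj w) \<le> 1" if "cmod u \<le> 1" "cmod w \<le> 1" for u w
    using that by (auto simp: norm_mult intro: mult_le_one)
  have A: "cmod (1 - a) \<ge> \<rho>" "cmod (1 - (a + k)) \<ge> \<rho>" "cmod a \<le> 1" "cmod (a + k) \<le> 1"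
    unfolding ak unfolding a_def
    using norm_one_minus_mult_cnj_ge[OF y1(1), of "fst x"] norm_one_minus_mult_cnj_ge[OF y1(1), of "fst x + fst h"] r h fs y1
    by (auto intro!: le1)
  have B: "cmod (1 - b) \<ge> \<rho>" "cmod (1 - (b + l)) \<ge> \<rho>" "cmod b \<le> 1" "cmod (b + l) \<le> 1"
    unfolding ak unfolding b_def
    using norm_one_minus_mult_cnj_ge[OF y1(2), of "snd x"] norm_one_minus_mult_cnj_ge[OF y1(2), of "snd x + snd h"] r h fs y1
    by (auto intro!: le1)
  define q q' d e where "q = 1 / (1 - a)\<^sup>2" and "q' = 1 / (1 - (a + k))\<^sup>2" and "d = 2 / (1 - a) ^ 3 * k" and "e = q' - q - d"
  define s s' f g where "s = 1 / (1 - b)\<^sup>2" and "s' = 1 / (1 - (b + l))\<^sup>2" and "f = 2 / (1 - b) ^ 3 * l" and "g = s' - s - f"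
  have bq: "cmod (q' - q) \<le> 4 / \<rho> ^ 4 * cmod k" "cmod e \<le> 6 / \<rho> ^ 5 * (cmod k)\<^sup>2" "cmod q \<le> 1 / \<rho>\<^sup>2"
    unfolding e_def q_def q'_def d_def by (rule inverse_square_remainders[OF A r(1)])+
  have bs: "cmod (s' - s) \<le> 4 / \<rho> ^ 4 * cmod l" "cmod g \<le> 6 / \<rho> ^ 5 * (cmod l)\<^sup>2" "cmod s \<le> 1 / \<rho>\<^sup>2"
    unfolding g_def s_def s'_def f_def by (rule inverse_square_remainders[OF B r(1)])+
  have bq': "cmod (q' - q) \<le> 4 / \<rho> ^ 4 * norm h" "cmod e \<le> 6 / \<rho> ^ 5 * (norm h)\<^sup>2"
    by (rule order_trans[OF bq(1)], use kl r(1) in \<open>intro mult_left_mono; simp\<close>)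
       (rule order_trans[OF bq(2)], use kl r(1) in \<open>intro mult_left_mono power_mono; simp\<close>)
  have bs': "cmod (s' - s) \<le> 4 / \<rho> ^ 4 * norm h" "cmod g \<le> 6 / \<rho> ^ 5 * (norm h)\<^sup>2"
    by (rule order_trans[OF bs(1)], use kl r(1) in \<open>intro mult_left_mono; simp\<close>)
       (rule order_trans[OF bs(2)], use kl r(1) in \<open>intro mult_left_mono power_mono; simp\<close>)
  have "bidisc_kernel (x + h) y - bidisc_kernel x y
      - (2 * cnj (fst y) / (1 - a) ^ 3 * (1 / (1 - b)\<^sup>2) / pi\<^sup>2 * fst h
        + 1 / (1 - a)\<^sup>2 * (2 * cnj (snd y) / (1 - b) ^ 3) / pi\<^sup>2 * snd h)
     = (q' * s' - q * s - (d * s + q * f)) / pi\<^sup>2"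
    unfolding bidisc_kernel_def fst_add snd_add ak[symmetric] a_def[symmetric] b_def[symmetric]
      q_def q'_def s_def s'_def d_def f_def k_def l_def
    by (simp add: power2_eq_square diff_divide_distrib add_divide_distrib mult_ac)
  also have "\<dots> = ((q' - q) * (s' - s) + e * s + q * g) / pi\<^sup>2"
    by (simp add: e_def g_def algebra_simps)
  also have "cmod \<dots> = cmod ((q' - q) * (s' - s) + e * s + q * g) / pi\<^sup>2"
    by (simp add: norm_divide norm_power)
  also have "\<dots> \<le> ((4 / \<rho> ^ 4 * norm h) * (4 / \<rho> ^ 4 * norm h) + 6 / \<rho> ^ 5 * (norm h)\<^sup>2 * (1 / \<rho>\<^sup>2)
       + 1 / \<rho>\<^sup>2 * (6 / \<rho> ^ 5 * (norm h)\<^sup>2)) / pi\<^sup>2"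
  proof (intro divide_right_mono)
    have "cmod ((q' - q) * (s' - s) + e * s + q * g) \<le> cmod (q' - q) * cmod (s' - s) + cmod e * cmod s + cmod q * cmod g"
      by (metis norm_triangle_le norm_mult add_mono order_refl norm_triangle_ineq)
    also have "\<dots> \<le> (4 / \<rho> ^ 4 * norm h) * (4 / \<rho> ^ 4 * norm h) + 6 / \<rho> ^ 5 * (norm h)\<^sup>2 * (1 / \<rho>\<^sup>2)
       + 1 / \<rho>\<^sup>2 * (6 / \<rho> ^ 5 * (norm h)\<^sup>2)"
      using bq' bs' bq(3) bs(3) r(1) by (intro add_mono mult_mono) auto
    finally show "cmod ((q' - q) * (s' - s) + e * s + q * g) \<le> \<dots>" .
  qed simp
  also have "\<dots> = ((4 / \<rho> ^ 4)\<^sup>2 + 2 * (6 / \<rho> ^ 5 * (1 / \<rho>\<^sup>2))) / pi\<^sup>2 * (norm h)\<^sup>2"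
  proof -
    have "((X * k) * (X * k) + Z * k\<^sup>2 * W + W * (Z * k\<^sup>2)) / P = (X\<^sup>2 + 2 * (Z * W)) / P * k\<^sup>2" for X Z W P k :: real
      by (simp add: power2_eq_square add_divide_distrib algebra_simps)
    then show ?thesis .
  qed
  finally show ?thesis .
qed

text \<open>Differentiation under the integral sign: the candidate derivative integrates that of the
  kernel, and the error is at most \<open>M * J * (norm h)\<^sup>2\<close> by
  \<open>bidisc_kernel_remainder\<close>, with \<open>J\<close> the L1 norm of
  \<open>\<Phi>\<close>.\<close>

lemma holomorphic2_on_bidisc_integral:
  fixes \<Phi> :: "complex \<times> complex \<Rightarrow> complex"
  assumes \<Phi>: "set_integrable lborel (ball 0 1 \<times> ball 0 1) \<Phi>"
  shows "holomorphic2_on (\<lambda>x. LINT y:ball 0 1 \<times> ball 0 1|lborel. bidisc_kernel x y * \<Phi> y) (ball 0 1 \<times> ball 0 1)"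
  unfolding holomorphic2_on_def
proof
  let ?D2 = "ball (0::complex) 1 \<times> ball (0::complex) 1"
  fix x assume x: "x \<in> ?D2"
  define \<rho> where "\<rho> = (1 - max (cmod (fst x)) (cmod (snd x))) / 2"
  have lt: "cmod (fst x) < 1" "cmod (snd x) < 1" using x by (cases x; auto)+
  have \<rho>: "\<rho> > 0" "cmod (fst x) + 2 * \<rho> \<le> 1" "cmod (snd x) + 2 * \<rho> \<le> 1" using lt by (auto simp: \<rho>_def max_def field_simps)
  define M where "M = ((4 / \<rho> ^ 4)\<^sup>2 + 2 * (6 / \<rho> ^ 5 * (1 / \<rho>\<^sup>2))) / pi\<^sup>2"
  have M: "M \<ge> 0" using \<rho> by (simp add: M_def)
  have D2: "?D2 \<in> sets borel" by (intro borel_open open_Times open_ball)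
  have intk: "set_integrable lborel ?D2 (\<lambda>y. c y * \<Phi> y)" if c: "continuous_on ?D2 c" "\<And>y. y \<in> ?D2 \<Longrightarrow> cmod (c y) \<le> B" for c B
    by (rule set_integrable_bounded_mult[OF \<Phi> set_borel_measurable_continuous[OF D2 c(1)] c(2)])
  have intbk: "set_integrable lborel ?D2 (\<lambda>y. bidisc_kernel u y * \<Phi> y)" if u: "cmod (fst u) < 1" "cmod (snd u) < 1" for u
    by (rule intk[OF continuous_on_bidisc_kernel[OF u]], rule norm_bidisc_kernel_le) (use u in auto)
  define A where "A = (\<lambda>y. 2 * cnj (fst y) / (1 - fst x * cnj (fst y)) ^ 3 * (1 / (1 - snd x * cnj (snd y))\<^sup>2) / pi\<^sup>2)"
  define B where "B = (\<lambda>y. 1 / (1 - fst x * cnj (fst y))\<^sup>2 * (2 * cnj (snd y) / (1 - snd x * cnj (snd y)) ^ 3) / pi\<^sup>2)"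
  have low: "cmod (1 - fst x * cnj (fst y)) \<ge> \<rho>" "cmod (1 - snd x * cnj (snd y)) \<ge> \<rho>"
     "cmod (fst y) \<le> 1" "cmod (snd y) \<le> 1" if "y \<in> ?D2" for y
    using norm_one_minus_mult_cnj_ge[of "fst y" "fst x"] norm_one_minus_mult_cnj_ge[of "snd y" "snd x"] that \<rho>
    by (cases y; auto)+
  have cA: "continuous_on ?D2 A" "continuous_on ?D2 B"
    unfolding A_def B_def using lt by (auto intro!: continuous_intros simp: mult_cnj_neq_one)
  have bA: "cmod (A y) \<le> 2 * 1 / \<rho> ^ 3 * (1 / \<rho>\<^sup>2) / pi\<^sup>2"
    and bB: "cmod (B y) \<le> 1 / \<rho>\<^sup>2 * (2 * 1 / \<rho> ^ 3) / pi\<^sup>2" if "y \<in> ?D2" for y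
  proof -
    have "cmod (A y) = 2 * cmod (fst y) / cmod (1 - fst x * cnj (fst y)) ^ 3 * (1 / (cmod (1 - snd x * cnj (snd y)))\<^sup>2) / pi\<^sup>2"
      unfolding A_def by (simp add: norm_mult norm_divide norm_power)
    also have "\<dots> \<le> 2 * 1 / \<rho> ^ 3 * (1 / \<rho>\<^sup>2) / pi\<^sup>2"
      using low[OF that] \<rho>(1) by (intro divide_right_mono mult_mono frac_le power_mono) auto
    finally show "cmod (A y) \<le> 2 * 1 / \<rho> ^ 3 * (1 / \<rho>\<^sup>2) / pi\<^sup>2" .
    have "cmod (B y) = 1 / (cmod (1 - fst x * cnj (fst y)))\<^sup>2 * (2 * cmod (snd y) / cmod (1 - snd x * cnj (snd y)) ^ 3) / pi\<^sup>2"
      unfolding B_def by (simp add: norm_mult norm_divide norm_power)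
    also have "\<dots> \<le> 1 / \<rho>\<^sup>2 * (2 * 1 / \<rho> ^ 3) / pi\<^sup>2"
      using low[OF that] \<rho>(1) by (intro divide_right_mono mult_mono frac_le power_mono) auto
    finally show "cmod (B y) \<le> 1 / \<rho>\<^sup>2 * (2 * 1 / \<rho> ^ 3) / pi\<^sup>2" .
  qed
  define a b where "a = (LINT y:?D2|lborel. A y * \<Phi> y)" and "b = (LINT y:?D2|lborel. B y * \<Phi> y)"
  note iA = intk[OF cA(1) bA] and iB = intk[OF cA(2) bB]
  let ?F = "\<lambda>x. LINT y:?D2|lborel. bidisc_kernel x y * \<Phi> y"
  define J where "J = (LINT y|lborel. cmod (indicator ?D2 y *\<^sub>R \<Phi> y))"
  have bound: "cmod (?F (x + h) - ?F x - (a * fst h + b * snd h)) \<le> M * J * (norm h)\<^sup>2" if h: "norm h \<le> \<rho>" for h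
  proof -
    have "cmod (fst (x + h)) \<le> cmod (fst x) + norm h" "cmod (snd (x + h)) \<le> cmod (snd x) + norm h"
      using norm_triangle_ineq[of "fst x" "fst h"] norm_triangle_ineq[of "snd x" "snd h"]
        norm_fst_le[of "fst h" "snd h"] norm_snd_le[of "snd h" "fst h"] by auto
    then have xh: "cmod (fst (x + h)) < 1" "cmod (snd (x + h)) < 1" using \<rho> h by linarith+
    define f1 f2 f3 f4 where "f1 = (\<lambda>y. indicator ?D2 y *\<^sub>R (bidisc_kernel (x + h) y * \<Phi> y))"
      and "f2 = (\<lambda>y. indicator ?D2 y *\<^sub>R (bidisc_kernel x y * \<Phi> y))"
      and "f3 = (\<lambda>y. indicator ?D2 y *\<^sub>R (A y * \<Phi> y))" and "f4 = (\<lambda>y. indicator ?D2 y *\<^sub>R (B y * \<Phi> y))"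
    have ints: "integrable lborel f1" "integrable lborel f2" "integrable lborel f3" "integrable lborel f4"
      using intbk[OF xh] intbk[OF lt] iA iB by (simp_all add: set_integrable_def f1_def f2_def f3_def f4_def)
    define g where "g = (\<lambda>y. f1 y - f2 y - (f3 y * fst h + f4 y * snd h))"
    have g: "integrable lborel g" using ints by (simp add: g_def)
    have "?F (x + h) = integral\<^sup>L lborel f1" "?F x = integral\<^sup>L lborel f2"
      "a = integral\<^sup>L lborel f3" "b = integral\<^sup>L lborel f4"
      by (simp_all only: set_lebesgue_integral_def f1_def f2_def f3_def f4_def a_def b_def)
    then have "?F (x + h) - ?F x - (a * fst h + b * snd h) = integral\<^sup>L lborel g"
      using ints by (simp add: g_def)
    then have "cmod (?F (x + h) - ?F x - (a * fst h + b * snd h)) = cmod (integral\<^sup>L lborel g)" by simp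
    also have "\<dots> \<le> (LINT y|lborel. cmod (g y))" by (rule integral_norm_bound)
    also have "\<dots> \<le> (LINT y|lborel. M * (norm h)\<^sup>2 * cmod (indicator ?D2 y *\<^sub>R \<Phi> y))"
    proof (rule integral_mono)
      show "integrable lborel (\<lambda>y. M * (norm h)\<^sup>2 * cmod (indicator ?D2 y *\<^sub>R \<Phi> y))"
        using \<Phi> unfolding set_integrable_def by (intro integrable_mult_right integrable_norm)
      show "integrable lborel (\<lambda>y. cmod (g y))" by (rule integrable_norm[OF g])
      fix y
      show "cmod (g y) \<le> M * (norm h)\<^sup>2 * cmod (indicator ?D2 y *\<^sub>R \<Phi> y)"
      proof (cases "y \<in> ?D2")
        case True
        then have eq: "g y = (bidisc_kernel (x + h) y - bidisc_kernel x y - (A y * fst h + B y * snd h)) * \<Phi> y"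
          by (simp add: g_def f1_def f2_def f3_def f4_def algebra_simps)
        have "cmod (bidisc_kernel (x + h) y - bidisc_kernel x y - (A y * fst h + B y * snd h)) \<le> M * (norm h)\<^sup>2"
          using bidisc_kernel_remainder[OF \<rho> h True] unfolding M_def A_def B_def .
        then show ?thesis
          unfolding eq norm_mult[of _ "\<Phi> y"] using True by (simp add: mult_right_mono)
      qed (simp add: g_def f1_def f2_def f3_def f4_def)
    qed
    also have "\<dots> = M * (norm h)\<^sup>2 * J" unfolding J_def by (rule integral_mult_right_zero)
    finally show ?thesis by (simp add: mult_ac)
  qed
  have J: "J \<ge> 0" by (simp add: J_def)
  have "((\<lambda>h. norm (?F (x + h) - ?F x - (a * fst h + b * snd h)) / norm h) \<longlongrightarrow> 0) (at 0)"
  proof (rule Lim_null_comparison)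
    have "eventually (\<lambda>h::complex \<times> complex. norm h \<le> \<rho>) (at 0)"
      unfolding eventually_at using \<rho>(1) by (intro exI[of _ \<rho>]) auto
    then show "eventually (\<lambda>h. norm (norm (?F (x + h) - ?F x - (a * fst h + b * snd h)) / norm h) \<le> M * J * norm h) (at 0)"
    proof eventually_elim
      case (elim h)
      show ?case
      proof (cases "h = 0")
        case False
        then show ?thesis using bound[OF elim] by (simp add: divide_le_eq power2_eq_square mult_ac)
      qed (use M J in simp)
    qed
    show "((\<lambda>h::complex \<times> complex. M * J * norm h) \<longlongrightarrow> 0) (at 0)"
      by (auto intro!: tendsto_eq_intros)
  qed
  moreover have "bounded_linear (\<lambda>h. a * fst h + b * snd h)"
    by (intro bounded_linear_add bounded_linear_const_mult bounded_linear_fst bounded_linear_snd)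
  ultimately have "(?F has_derivative (\<lambda>h. a * fst h + b * snd h)) (at x)"
    unfolding has_derivative_at by blast
  then show "\<exists>a b. (?F has_derivative (\<lambda>h. a * fst h + b * snd h)) (at x)" by blast
qed

section \<open>Weighted Hoelder inequality and Schur's test on the bidisc\<close>

text \<open>Here \<open>w\<close> is to be the kernel and \<open>g\<close> the test function of
  Schur's test; \<open>g\<close> must be positive only where \<open>w\<close> does not vanish,
  because the test function degenerates on a null set and outside the bidisc. The proof is Young's
  inequality with both factors normalised.\<close>

lemma holder_weighted:
  fixes w g u :: "'a \<Rightarrow> real"
  assumes p: "p > 1" and q: "q = p / (p - 1)"
    and [measurable]: "w \<in> borel_measurable M" "g \<in> borel_measurable M" "u \<in> borel_measurable M"
    and nonneg: "\<And>x. w x \<ge> 0" "\<And>x. u x \<ge> 0" "\<And>x. w x \<noteq> 0 \<Longrightarrow> g x > 0"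
    and XY: "X \<ge> 0" "Y \<ge> 0"
    and X: "(\<integral>\<^sup>+x. ennreal (w x * g x powr q) \<partial>M) \<le> ennreal X"
    and Y: "(\<integral>\<^sup>+x. ennreal (w x * g x powr (-p) * u x powr p) \<partial>M) \<le> ennreal Y"
  shows "(\<integral>\<^sup>+x. ennreal (w x * u x) \<partial>M) \<le> ennreal (X powr (1 / q) * Y powr (1 / p))"
proof -
  have q1: "q > 1" "1 / p + 1 / q = 1" using p by (auto simp: q divide_simps)
  \<comment> \<open>The bounds are enlarged to positive \<open>X'\<close>, \<open>Y'\<close> because
    the normalisation divides by them; a limit removes the enlargement at the end.\<close>
  have pos: "(\<integral>\<^sup>+x. ennreal (w x * u x) \<partial>M) \<le> ennreal (X' powr (1 / q) * Y' powr (1 / p))"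
    if X': "X < X'" and Y': "Y < Y'" for X' Y'
  proof -
    have XY': "X' > 0" "Y' > 0" using XY X' Y' by auto
    define c where "c = X' powr (1 / q) * Y' powr (1 / p)"
    have c: "c > 0" using XY' by (simp add: c_def)
    have young: "w x * u x \<le> c / (q * X') * (w x * g x powr q) + c / (p * Y') * (w x * g x powr (-p) * u x powr p)" for x
    proof (cases "w x = 0")
      case False
      then have g: "g x > 0" by (rule nonneg)
      define a b where "a = g x / X' powr (1 / q)" and "b = u x / g x / Y' powr (1 / p)"
      have ab: "a \<ge> 0" "b \<ge> 0" using g nonneg(2)[of x] XY' by (auto simp: a_def b_def)
      have "u x = c * (a * b)" using g XY' by (simp add: a_def b_def c_def)
      also have "a * b \<le> a powr q / q + b powr p / p"
        using Youngs_inequality[of q p a b] p q1 ab by (simp add: add.commute)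
      also have "a powr q = g x powr q / X'"
        using g XY' q1 by (simp add: a_def powr_divide powr_powr)
      also have "b powr p = g x powr (-p) * u x powr p / Y'"
        using g XY' p nonneg(2)[of x] by (simp add: b_def powr_divide powr_mult powr_powr powr_minus_divide)
      finally have "u x \<le> c * (g x powr q / X' / q + g x powr (-p) * u x powr p / Y' / p)"
        using c by simp
      then have "w x * u x \<le> w x * (c * (g x powr q / X' / q + g x powr (-p) * u x powr p / Y' / p))"
        using nonneg(1) by (rule mult_left_mono)
      also have "\<dots> = c / (q * X') * (w x * g x powr q) + c / (p * Y') * (w x * g x powr (-p) * u x powr p)"
        by (simp add: distrib_left mult_ac)
      finally show ?thesis .
    qed simp
    have "(\<integral>\<^sup>+x. ennreal (w x * u x) \<partial>M) \<le> (\<integral>\<^sup>+x. ennreal (c / (q * X')) * ennreal (w x * g x powr q)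
        + ennreal (c / (p * Y')) * ennreal (w x * g x powr (-p) * u x powr p) \<partial>M)"
    proof (rule nn_integral_mono)
      fix x
      have "ennreal (w x * u x) \<le> ennreal (c / (q * X') * (w x * g x powr q) + c / (p * Y') * (w x * g x powr (-p) * u x powr p))"
        by (rule ennreal_leI[OF young])
      also have "\<dots> = ennreal (c / (q * X')) * ennreal (w x * g x powr q) + ennreal (c / (p * Y')) * ennreal (w x * g x powr (-p) * u x powr p)"
      proof -
        have "c / (q * X') \<ge> 0" "c / (p * Y') \<ge> 0" using c XY' p q1 by auto
        then show ?thesis using nonneg(1)[of x]
          by (subst ennreal_plus) (simp_all add: ennreal_mult' mult_nonneg_nonneg del: times_divide_eq_left)
      qed
      finally show "ennreal (w x * u x) \<le> ennreal (c / (q * X')) * ennreal (w x * g x powr q)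
        + ennreal (c / (p * Y')) * ennreal (w x * g x powr (-p) * u x powr p)" .
    qed
    also have "\<dots> = ennreal (c / (q * X')) * (\<integral>\<^sup>+x. ennreal (w x * g x powr q) \<partial>M)
        + ennreal (c / (p * Y')) * (\<integral>\<^sup>+x. ennreal (w x * g x powr (-p) * u x powr p) \<partial>M)"
      by (subst nn_integral_add, measurable, subst nn_integral_cmult, measurable, subst nn_integral_cmult, measurable)
    also have "\<dots> \<le> ennreal (c / (q * X')) * ennreal X' + ennreal (c / (p * Y')) * ennreal Y'"
      using X' Y' by (intro add_mono mult_left_mono order_trans[OF X] order_trans[OF Y] ennreal_leI) auto
    also have "\<dots> = ennreal (c / q + c / p)"
      using XY' c p q1 by (simp add: ennreal_mult[symmetric] ennreal_plus[symmetric] del: ennreal_plus)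
    also have "c / q + c / p = c * (1 / p + 1 / q)" by (simp add: algebra_simps)
    finally show ?thesis using q1 by (simp add: c_def)
  qed
  have lim: "(\<lambda>k. ennreal ((X + 1 / real (Suc k)) powr (1 / q) * (Y + 1 / real (Suc k)) powr (1 / p)))
      \<longlonglongrightarrow> ennreal ((X + 0) powr (1 / q) * (Y + 0) powr (1 / p))"
  proof -
    have z: "(\<lambda>k. 1 / real (Suc k)) \<longlonglongrightarrow> 0" by (rule LIMSEQ_Suc[OF lim_1_over_n])
    show ?thesis
      by (intro tendsto_ennrealI tendsto_mult tendsto_powr' tendsto_add tendsto_const z) (use XY p q1 in auto)
  qed
  show ?thesis
    using LIMSEQ_le_const[OF lim, of "\<integral>\<^sup>+x. ennreal (w x * u x) \<partial>M"] pos by simp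
qed

lemma measurable_fst_borel[measurable (raw)]:
  fixes f :: "'c \<Rightarrow> 'a::second_countable_topology \<times> 'b::second_countable_topology"
  assumes "f \<in> borel_measurable M"
  shows "(\<lambda>x. fst (f x)) \<in> borel_measurable M" "(\<lambda>x. snd (f x)) \<in> borel_measurable M"
  using assms unfolding borel_prod[symmetric] by measurable

lemma cnj_borel_measurable[measurable]: "cnj \<in> borel_measurable borel"
  by (intro borel_measurable_continuous_onI continuous_intros)

lemma bidisc_kernel_measurable[measurable (raw)]:
  assumes [measurable]: "f \<in> borel_measurable M" "g \<in> borel_measurable M"
  shows "(\<lambda>x. bidisc_kernel (f x) (g x)) \<in> borel_measurable M"
  unfolding bidisc_kernel_def by measurable

lemma norm_bidisc_kernel_eq:
  "cmod (bidisc_kernel x y) = 1 / (cmod (1 - fst x * cnj (fst y)))\<^sup>2 * (1 / (cmod (1 - snd x * cnj (snd y)))\<^sup>2) / pi\<^sup>2"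
  by (simp add: bidisc_kernel_def norm_mult norm_divide norm_power power2_eq_square mult_ac)

text \<open>The integrand is a product, so this is \<open>disc_kernel_estimate\<close> in each
  variable, with exponent \<open>0\<close> in the first and \<open>c\<close> in the second.\<close>

lemma bidisc_kernel_estimate:
  fixes s c :: real
  assumes s: "0 < s" "s < 1" and c: "c > -2"
  obtains C where "C > 0" "\<And>x. x \<in> ball 0 1 \<times> ball 0 1 \<Longrightarrow>
    (\<integral>\<^sup>+y. ennreal (cmod (bidisc_kernel x y) * cmod (snd y) powr c * ((1 - (cmod (fst y))\<^sup>2) * (1 - (cmod (snd y))\<^sup>2)) powr (-s))
        * indicator (ball 0 1 \<times> ball 0 1) y \<partial>lborel)
      \<le> ennreal (C * ((1 - (cmod (fst x))\<^sup>2) * (1 - (cmod (snd x))\<^sup>2)) powr (-s))"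
proof -
  define E where "E = (\<lambda>c z w. ennreal (cmod w powr c * (1 - (cmod w)\<^sup>2) powr (-s) / (cmod (1 - z * cnj w))\<^sup>2) * indicator (ball 0 1) w)"
  have D[measurable]: "ball (0::complex) 1 \<in> sets borel" by simp
  have mE[measurable]: "E c z \<in> borel_measurable borel" for c z unfolding E_def by measurable
  obtain C1 where C1: "C1 \<ge> 0" "\<And>z. cmod z < 1 \<Longrightarrow> (\<integral>\<^sup>+w. E 0 z w \<partial>lborel) \<le> ennreal (C1 * (1 - (cmod z)\<^sup>2) powr (-s))"
    unfolding E_def using disc_kernel_estimate[OF s, of 0] by auto
  obtain C2 where C2: "C2 \<ge> 0" "\<And>z. cmod z < 1 \<Longrightarrow> (\<integral>\<^sup>+w. E c z w \<partial>lborel) \<le> ennreal (C2 * (1 - (cmod z)\<^sup>2) powr (-s))"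
    unfolding E_def using disc_kernel_estimate[OF s c] by auto
  have pos: "1 - (cmod z)\<^sup>2 > 0" if "cmod z < 1" for z :: complex using that by (simp add: abs_square_less_1)
  have "(\<integral>\<^sup>+y. ennreal (cmod (bidisc_kernel x y) * cmod (snd y) powr c * ((1 - (cmod (fst y))\<^sup>2) * (1 - (cmod (snd y))\<^sup>2)) powr (-s))
        * indicator (ball 0 1 \<times> ball 0 1) y \<partial>lborel)
      \<le> ennreal ((C1 * C2 / pi\<^sup>2 + 1) * ((1 - (cmod (fst x))\<^sup>2) * (1 - (cmod (snd x))\<^sup>2)) powr (-s))"
    if x: "x \<in> ball 0 1 \<times> ball 0 1" for x
  proof -
    have x': "cmod (fst x) < 1" "cmod (snd x) < 1" using x by (cases x; auto)+
    let ?I = "\<lambda>y. ennreal (cmod (bidisc_kernel x y) * cmod (snd y) powr c * ((1 - (cmod (fst y))\<^sup>2) * (1 - (cmod (snd y))\<^sup>2)) powr (-s))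
        * indicator (ball 0 1 \<times> ball 0 1) y"
    have DD: "ball (0::complex) 1 \<times> ball (0::complex) 1 \<in> sets borel" by (intro borel_open open_Times open_ball)
    have "?I \<in> borel_measurable borel"
      by (intro borel_measurable_times_ennreal borel_measurable_indicator DD) measurable
    then have "(\<integral>\<^sup>+y. ?I y \<partial>lborel) = (\<integral>\<^sup>+v. \<integral>\<^sup>+t. ?I (v, t) \<partial>lborel \<partial>lborel)"
      by (rule nn_integral_prod)
    also have "\<dots> = (\<integral>\<^sup>+v. \<integral>\<^sup>+t. ennreal (1 / pi\<^sup>2) * E 0 (fst x) v * E c (snd x) t \<partial>lborel \<partial>lborel)"
    proof (rule nn_integral_cong_AE)
      show "AE v in lborel. (\<integral>\<^sup>+t. ?I (v, t) \<partial>lborel) = (\<integral>\<^sup>+t. ennreal (1 / pi\<^sup>2) * E 0 (fst x) v * E c (snd x) t \<partial>lborel)"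
        \<comment> \<open>Since \<open>0 powr 0 = 0\<close>, the factor \<open>cmod v powr 0\<close>
          in \<open>E 0\<close> is not \<open>1\<close> at \<open>v = 0\<close>.\<close>
        using AE_lborel_singleton[of "0::complex"]
      proof eventually_elim
        case (elim v)
        show ?case
        proof (rule nn_integral_cong)
          fix t
          show "?I (v, t) = ennreal (1 / pi\<^sup>2) * E 0 (fst x) v * E c (snd x) t"
          proof (cases "cmod v < 1 \<and> cmod t < 1")
            case True
            have "cmod (bidisc_kernel x (v, t)) * cmod t powr c * ((1 - (cmod v)\<^sup>2) * (1 - (cmod t)\<^sup>2)) powr (-s)
               = 1 / pi\<^sup>2 * (cmod v powr 0 * (1 - (cmod v)\<^sup>2) powr (-s) / (cmod (1 - fst x * cnj v))\<^sup>2)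
                 * (cmod t powr c * (1 - (cmod t)\<^sup>2) powr (-s) / (cmod (1 - snd x * cnj t))\<^sup>2)"
              using True elim pos[of v] pos[of t] by (simp add: norm_bidisc_kernel_eq powr_mult mult_ac)
            also have "ennreal \<dots> = ennreal (1 / pi\<^sup>2) * E 0 (fst x) v * E c (snd x) t"
              using True by (simp only: E_def) (simp add: ennreal_mult[symmetric] del: powr_zero_eq_one)
            finally show ?thesis using True by simp
          qed (auto simp: E_def indicator_def)
        qed
      qed
    qed
    also have "\<dots> = ennreal (1 / pi\<^sup>2) * ((\<integral>\<^sup>+v. E 0 (fst x) v \<partial>lborel) * (\<integral>\<^sup>+t. E c (snd x) t \<partial>lborel))"
      by (simp add: nn_integral_cmult nn_integral_multc mult.assoc)
    also have "\<dots> \<le> ennreal (1 / pi\<^sup>2) * (ennreal (C1 * (1 - (cmod (fst x))\<^sup>2) powr (-s)) * ennreal (C2 * (1 - (cmod (snd x))\<^sup>2) powr (-s)))"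
      by (intro mult_left_mono mult_mono C1(2) C2(2) x') auto
    also have "\<dots> = ennreal (C1 * C2 / pi\<^sup>2 * ((1 - (cmod (fst x))\<^sup>2) * (1 - (cmod (snd x))\<^sup>2)) powr (-s))"
      using C1(1) C2(1) pos[OF x'(1)] pos[OF x'(2)] by (simp add: ennreal_mult[symmetric] powr_mult mult_ac)
    also have "\<dots> \<le> ennreal ((C1 * C2 / pi\<^sup>2 + 1) * ((1 - (cmod (fst x))\<^sup>2) * (1 - (cmod (snd x))\<^sup>2)) powr (-s))"
      by (intro ennreal_leI mult_right_mono) auto
    finally show ?thesis .
  qed
  moreover have "C1 * C2 / pi\<^sup>2 + 1 > 0" using C1(1) C2(1) by (intro add_nonneg_pos) auto
  ultimately show ?thesis using that by blast
qed

text \<open>With \<open>\<beta> = m * \<alpha>\<close> the weight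
  \<open>cmod (snd y) powr (N + \<beta>)\<close> combines \<open>snd y ^ N\<close> and the lifted
  symbol. The power \<open>2 * N - N * p\<close> on the output side is the lifted measure after
  division of the projection by \<open>snd x ^ N\<close>. The two Schur estimates are integrals of
  powers of \<open>cmod (snd y)\<close> against the kernel, and their convergence at
  \<open>0\<close> amounts to \<open>low\<close> and \<open>up\<close> respectively.\<close>

lemma bidisc_schur_test:
  fixes p \<beta> :: real and N :: nat
  assumes p: "p > 1" and up: "N * p < 2 * real N + 2" and low: "2 * real N + 2 < p * (N + 2 + \<beta>)"
  obtains C where "C \<ge> 0"
    "\<And>u :: complex \<times> complex \<Rightarrow> real. u \<in> borel_measurable borel \<Longrightarrow> (\<And>y. u y \<ge> 0) \<Longrightarrow>
      (\<integral>\<^sup>+y. ennreal (u y powr p * cmod (snd y) powr (2 * N)) * indicator (ball 0 1 \<times> ball 0 1) y \<partial>lborel) < \<infinity> \<Longrightarrow>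
      (\<integral>\<^sup>+y. ennreal (cmod (snd y) powr (N + \<beta>) * u y) * indicator (ball 0 1 \<times> ball 0 1) y \<partial>lborel) < \<infinity>"
    "\<And>u T :: complex \<times> complex \<Rightarrow> real. u \<in> borel_measurable borel \<Longrightarrow> (\<And>y. u y \<ge> 0) \<Longrightarrow> (\<And>x. T x \<ge> 0) \<Longrightarrow>
      (\<And>x. x \<in> ball 0 1 \<times> ball 0 1 \<Longrightarrow> ennreal (T x) \<le> (\<integral>\<^sup>+y. ennreal (cmod (bidisc_kernel x y) * (cmod (snd y) powr (N + \<beta>) * u y))
          * indicator (ball 0 1 \<times> ball 0 1) y \<partial>lborel)) \<Longrightarrow>
      (\<integral>\<^sup>+x. ennreal (T x powr p * cmod (snd x) powr (2 * N - N * p)) * indicator (ball 0 1 \<times> ball 0 1) x \<partial>lborel)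
        \<le> ennreal C * (\<integral>\<^sup>+y. ennreal (u y powr p * cmod (snd y) powr (2 * N)) * indicator (ball 0 1 \<times> ball 0 1) y \<partial>lborel)"
proof -
  let ?D2 = "ball (0::complex) 1 \<times> ball (0::complex) 1"
  have [measurable]: "?D2 \<in> sets borel" by (intro borel_open open_Times open_ball)
  define q where "q = p / (p - 1)"
  have q: "q > 1" "1 / p + 1 / q = 1" using p by (auto simp: q_def divide_simps)
  \<comment> \<open>Chosen so that \<open>N + \<beta> + a * p = 2 * N\<close>: Hoelder then leaves
    precisely the power of the lifted measure on \<open>u powr p\<close>.\<close>
  define a where "a = (N - \<beta>) / p"
  \<comment> \<open>Gives the boundary factor \<open>P\<close> the exponents \<open>1 / p\<close>
    and \<open>1 / q\<close> in the two estimates; both lie in \<open>(0, 1)\<close> as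
    \<open>disc_kernel_estimate\<close> requires.\<close>
  define \<epsilon> where "\<epsilon> = 1 / (p * q)"
  define P where "P = (\<lambda>y::complex \<times> complex. (1 - (cmod (fst y))\<^sup>2) * (1 - (cmod (snd y))\<^sup>2))"
  define g where "g = (\<lambda>y. cmod (snd y) powr (-a) * P y powr (-\<epsilon>))"
  have P: "0 < P y" "P y \<le> 1" if "y \<in> ?D2" for y
  proof -
    have "0 < 1 - (cmod (fst y))\<^sup>2" "0 < 1 - (cmod (snd y))\<^sup>2" using that by (cases y; simp add: abs_square_less_1)+
    then show "0 < P y" "P y \<le> 1" by (auto simp: P_def intro!: mult_le_one)
  qed
  have [measurable]: "P \<in> borel_measurable borel" "g \<in> borel_measurable borel" unfolding P_def g_def by measurable
  \<comment> \<open>This is \<open>low\<close> after solving for the exponent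
    \<open>a * q = (N - \<beta>) / (p - 1)\<close>.\<close>
  have c1: "N + \<beta> - a * q > -2"
  proof -
    have "(N - \<beta>) / (p - 1) < N + \<beta> + 2" using p low by (simp add: divide_less_eq algebra_simps)
    moreover have "a * q = (N - \<beta>) / (p - 1)" using p by (simp add: a_def q_def)
    ultimately show ?thesis by simp
  qed
  have ap: "N + \<beta> + a * p = 2 * N" using p by (simp add: a_def)
  obtain C1 where C1: "C1 > 0" "\<And>x. x \<in> ?D2 \<Longrightarrow>
    (\<integral>\<^sup>+y. ennreal (cmod (bidisc_kernel x y) * cmod (snd y) powr (N + \<beta> - a * q) * P y powr (- (1 / p))) * indicator ?D2 y \<partial>lborel)
      \<le> ennreal (C1 * P x powr (- (1 / p)))"
    using bidisc_kernel_estimate[of "1 / p" "N + \<beta> - a * q"] p c1 unfolding P_def by auto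
  obtain C2 where C2: "C2 > 0" "\<And>x. x \<in> ?D2 \<Longrightarrow>
    (\<integral>\<^sup>+y. ennreal (cmod (bidisc_kernel x y) * cmod (snd y) powr (2 * N - N * p) * P y powr (- (1 / q))) * indicator ?D2 y \<partial>lborel)
      \<le> ennreal (C2 * P x powr (- (1 / q)))"
    using bidisc_kernel_estimate[of "1 / q" "2 * N - N * p"] q up unfolding P_def by auto
  have \<epsilon>: "\<epsilon> * q = 1 / p" "\<epsilon> * p = 1 / q" using p q by (auto simp: \<epsilon>_def)
  define w where "w = (\<lambda>x y. cmod (bidisc_kernel x y) * cmod (snd y) powr (N + \<beta>) * indicator ?D2 y)"
  have w[measurable]: "w x \<in> borel_measurable borel" for x unfolding w_def by measurable
  have w0: "w x y \<ge> 0" for x y by (simp add: w_def)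
  have wg: "g y > 0" if "w x y \<noteq> 0" for x y
    using that P(1)[of y] by (auto simp: w_def g_def indicator_def split: if_splits)
  have wq: "(\<integral>\<^sup>+y. ennreal (w x y * g y powr q) \<partial>lborel) \<le> ennreal (C1 * P x powr (- (1 / p)))" if x: "x \<in> ?D2" for x
  proof -
    have "w x y * g y powr q = cmod (bidisc_kernel x y) * cmod (snd y) powr (N + \<beta> - a * q) * P y powr (- (1 / p)) * indicator ?D2 y" for y
    proof (cases "y \<in> ?D2 \<and> snd y \<noteq> 0")
      case True
      then have "g y powr q = cmod (snd y) powr (- (a * q)) * P y powr (- (1 / p))"
        using P(1)[of y] by (simp add: g_def powr_mult powr_powr \<epsilon>(1)[symmetric])
      then show ?thesis using True by (simp add: w_def powr_diff powr_minus_divide)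
    qed (auto simp: w_def)
    then have "(\<integral>\<^sup>+y. ennreal (w x y * g y powr q) \<partial>lborel)
       = (\<integral>\<^sup>+y. ennreal (cmod (bidisc_kernel x y) * cmod (snd y) powr (N + \<beta> - a * q) * P y powr (- (1 / p))) * indicator ?D2 y \<partial>lborel)"
      by (intro nn_integral_cong) (auto simp: indicator_def)
    then show ?thesis using C1(2)[OF x] by simp
  qed
  have wp: "w x y * g y powr (-p) * (u::real) powr p = cmod (bidisc_kernel x y) * P y powr (1 / q) * (u powr p * cmod (snd y) powr (2 * N)) * indicator ?D2 y" for x y u
  proof (cases "y \<in> ?D2 \<and> snd y \<noteq> 0")
    case True
    have "g y powr (-p) = cmod (snd y) powr (a * p) * P y powr (1 / q)"
      using True P(1)[of y] by (simp add: g_def powr_mult powr_powr \<epsilon>(2)[symmetric])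
    moreover have "cmod (snd y) powr (N + \<beta>) * cmod (snd y) powr (a * p) = cmod (snd y) powr (2 * N)"
      unfolding powr_add[symmetric] ap ..
    ultimately show ?thesis using True by (simp add: w_def mult_ac)
  qed (auto simp: w_def)
  define Yn where "Yn = (\<lambda>u x. \<integral>\<^sup>+y. ennreal (w x y * g y powr (-p) * (u y :: real) powr p) \<partial>lborel)"
  have holder: "(\<integral>\<^sup>+y. ennreal (w x y * u y) \<partial>lborel) \<le> ennreal ((C1 * P x powr (- (1 / p))) powr (1 / q) * Y powr (1 / p))"
    if x: "x \<in> ?D2" and u[measurable]: "u \<in> borel_measurable borel" and u0: "\<And>y. u y \<ge> 0" and Y: "Y \<ge> 0" "Yn u x \<le> ennreal Y" for x u Y
    by (rule holder_weighted[OF p q_def, of "w x" lborel g u])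
       (use w0 wg u0 wq[OF x] Y C1(1) in \<open>auto simp: Yn_def\<close>)
  show ?thesis
  proof (rule that)
    show "C1 powr (p - 1) * C2 \<ge> 0" using C1(1) C2(1) by simp
  next
    fix u :: "complex \<times> complex \<Rightarrow> real"
    assume u[measurable]: "u \<in> borel_measurable borel" and u0: "\<And>y. u y \<ge> 0"
      and fin: "(\<integral>\<^sup>+y. ennreal (u y powr p * cmod (snd y) powr (2 * N)) * indicator ?D2 y \<partial>lborel) < \<infinity>"
    \<comment> \<open>The kernel is constant at the origin, so Hoelder at this single point already
      gives integrability of the weighted function.\<close>
    have bk0: "cmod (bidisc_kernel 0 y) = 1 / pi\<^sup>2" for y by (simp add: norm_bidisc_kernel_eq)
    have "Yn u 0 \<le> (\<integral>\<^sup>+y. ennreal (1 / pi\<^sup>2) * (ennreal (u y powr p * cmod (snd y) powr (2 * N)) * indicator ?D2 y) \<partial>lborel)"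
      unfolding Yn_def wp bk0
    proof (rule nn_integral_mono)
      fix y
      show "ennreal (1 / pi\<^sup>2 * P y powr (1 / q) * (u y powr p * cmod (snd y) powr (2 * N)) * indicator ?D2 y)
         \<le> ennreal (1 / pi\<^sup>2) * (ennreal (u y powr p * cmod (snd y) powr (2 * N)) * indicator ?D2 y)"
      proof (cases "y \<in> ?D2")
        case True
        have "P y powr (1 / q) \<le> 1" using P[OF True] q by (intro powr_le1) auto
        then have "1 / pi\<^sup>2 * P y powr (1 / q) * (u y powr p * cmod (snd y) powr (2 * N)) \<le> 1 / pi\<^sup>2 * 1 * (u y powr p * cmod (snd y) powr (2 * N))"
          by (intro mult_right_mono mult_left_mono) auto
        then show ?thesis using True by (simp add: ennreal_mult[symmetric] ennreal_leI)
      qed simp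
    qed
    also have "\<dots> < \<infinity>" using fin by (subst nn_integral_cmult) (auto simp: ennreal_mult_less_top)
    finally have Yfin: "Yn u 0 < \<infinity>" .
    then have "Yn u 0 \<le> ennreal (enn2real (Yn u 0))" by simp
    moreover have "0 \<in> ?D2" by (simp add: zero_prod_def)
    ultimately have "(\<integral>\<^sup>+y. ennreal (w 0 y * u y) \<partial>lborel)
        \<le> ennreal ((C1 * P 0 powr (- (1 / p))) powr (1 / q) * enn2real (Yn u 0) powr (1 / p))"
      by (intro holder u u0) auto
    then have "(\<integral>\<^sup>+y. ennreal (w 0 y * u y) \<partial>lborel) < \<infinity>" by (rule le_less_trans) simp
    also have "(\<integral>\<^sup>+y. ennreal (w 0 y * u y) \<partial>lborel)
        = (\<integral>\<^sup>+y. ennreal (1 / pi\<^sup>2) * (ennreal (cmod (snd y) powr (N + \<beta>) * u y) * indicator ?D2 y) \<partial>lborel)"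
      using u0 by (intro nn_integral_cong) (auto simp: w_def bk0 indicator_def ennreal_mult[symmetric])
    also have "\<dots> = ennreal (1 / pi\<^sup>2) * (\<integral>\<^sup>+y. ennreal (cmod (snd y) powr (N + \<beta>) * u y) * indicator ?D2 y \<partial>lborel)"
      by (rule nn_integral_cmult) measurable
    finally show "(\<integral>\<^sup>+y. ennreal (cmod (snd y) powr (N + \<beta>) * u y) * indicator ?D2 y \<partial>lborel) < \<infinity>"
      by (auto simp: ennreal_mult_less_top)
  next
    fix u :: "complex \<times> complex \<Rightarrow> real" and T :: "complex \<times> complex \<Rightarrow> real"
    assume u[measurable]: "u \<in> borel_measurable borel" and u0: "\<And>y. u y \<ge> 0" and T0: "\<And>x. T x \<ge> 0"
      and T: "\<And>x. x \<in> ?D2 \<Longrightarrow> ennreal (T x) \<le> (\<integral>\<^sup>+y. ennreal (cmod (bidisc_kernel x y) * (cmod (snd y) powr (N + \<beta>) * u y))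
          * indicator ?D2 y \<partial>lborel)"
    let ?K = "\<lambda>x. C1 powr (p - 1) * (cmod (snd x) powr (2 * N - N * p) * P x powr (- (1 / q)))"
    have point: "ennreal (T x powr p * cmod (snd x) powr (2 * N - N * p)) * indicator ?D2 x \<le> ennreal (?K x) * indicator ?D2 x * Yn u x" for x
    proof (cases "x \<in> ?D2 \<and> snd x \<noteq> 0")
      case True
      then have x: "x \<in> ?D2" by simp
      have K: "?K x > 0" using C1(1) True P(1)[OF x] by simp
      show ?thesis
      proof (cases "Yn u x = \<infinity>")
        \<comment> \<open>The coefficient \<open>?K x\<close> is positive, so the right-hand side is
          infinite.\<close>
        case inf: True
        have "C1 \<noteq> 0" "P x \<noteq> 0" using C1(1) P(1)[OF x] by auto
        then show ?thesis using inf x True by (simp add: ennreal_mult_top)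
      next
        case False
        define Y where "Y = enn2real (Yn u x)"
        have Y: "Y \<ge> 0" "Yn u x = ennreal Y" using False by (auto simp: Y_def less_top)
        have "(\<integral>\<^sup>+y. ennreal (cmod (bidisc_kernel x y) * (cmod (snd y) powr (N + \<beta>) * u y)) * indicator ?D2 y \<partial>lborel)
           = (\<integral>\<^sup>+y. ennreal (w x y * u y) \<partial>lborel)"
          by (intro nn_integral_cong) (auto simp: w_def indicator_def mult.assoc)
        then have "ennreal (T x) \<le> ennreal ((C1 * P x powr (- (1 / p))) powr (1 / q) * Y powr (1 / p))"
          using T[OF x] holder[OF x u u0 Y(1)] Y(2) by (simp add: order_trans)
        then have "T x \<le> (C1 * P x powr (- (1 / p))) powr (1 / q) * Y powr (1 / p)"
          by (subst (asm) ennreal_le_iff) auto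
        then have "T x powr p \<le> ((C1 * P x powr (- (1 / p))) powr (1 / q) * Y powr (1 / p)) powr p"
          using T0 p by (intro powr_mono2) auto
        also have "\<dots> = C1 powr (p / q) * P x powr (- (1 / q)) * Y"
          using C1(1) P(1)[OF x] Y(1) p by (simp add: powr_mult powr_powr)
        also have "p / q = p - 1" using p by (simp add: q_def)
        finally have "T x powr p * cmod (snd x) powr (2 * N - N * p)
            \<le> C1 powr (p - 1) * P x powr (- (1 / q)) * Y * cmod (snd x) powr (2 * N - N * p)"
          by (rule mult_right_mono) simp
        then have "T x powr p * cmod (snd x) powr (2 * N - N * p) \<le> ?K x * Y"
          by (simp add: mult_ac)
        then show ?thesis using x Y K by (simp add: ennreal_mult[symmetric] ennreal_leI)
      qed
    qed auto
    have "(\<integral>\<^sup>+x. ennreal (T x powr p * cmod (snd x) powr (2 * N - N * p)) * indicator ?D2 x \<partial>lborel)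
       \<le> (\<integral>\<^sup>+x. ennreal (?K x) * indicator ?D2 x * Yn u x \<partial>lborel)"
      by (intro nn_integral_mono point)
    also have "\<dots> = (\<integral>\<^sup>+x. \<integral>\<^sup>+y. ennreal (?K x) * indicator ?D2 x * ennreal (w x y * g y powr (-p) * u y powr p) \<partial>lborel \<partial>lborel)"
      unfolding Yn_def by (intro nn_integral_cong nn_integral_cmult[symmetric]) measurable
    also have "\<dots> = (\<integral>\<^sup>+y. \<integral>\<^sup>+x. ennreal (?K x) * indicator ?D2 x * ennreal (w x y * g y powr (-p) * u y powr p) \<partial>lborel \<partial>lborel)"
      unfolding w_def by (rule lborel_pair.Fubini') measurable
    also have "\<dots> \<le> (\<integral>\<^sup>+y. ennreal (C1 powr (p - 1) * C2) * (ennreal (u y powr p * cmod (snd y) powr (2 * N)) * indicator ?D2 y) \<partial>lborel)"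
    proof (rule nn_integral_mono)
      fix y
      show "(\<integral>\<^sup>+x. ennreal (?K x) * indicator ?D2 x * ennreal (w x y * g y powr (-p) * u y powr p) \<partial>lborel)
         \<le> ennreal (C1 powr (p - 1) * C2) * (ennreal (u y powr p * cmod (snd y) powr (2 * N)) * indicator ?D2 y)"
      proof (cases "y \<in> ?D2")
        case True
        define B where "B = C1 powr (p - 1) * (P y powr (1 / q) * (u y powr p * cmod (snd y) powr (2 * N)))"
        have B: "B \<ge> 0" by (simp add: B_def)
        \<comment> \<open>After Fubini the integration runs over the first argument of the kernel,
          whereas the estimate for \<open>C2\<close> integrates the second.\<close>
        have sym: "cmod (bidisc_kernel x y) = cmod (bidisc_kernel y x)" for x
          by (metis cnj_bidisc_kernel complex_mod_cnj)
        have "(\<integral>\<^sup>+x. ennreal (?K x) * indicator ?D2 x * ennreal (w x y * g y powr (-p) * u y powr p) \<partial>lborel)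
          = (\<integral>\<^sup>+x. ennreal B * (ennreal (cmod (bidisc_kernel y x) * cmod (snd x) powr (2 * N - N * p) * P x powr (- (1 / q))) * indicator ?D2 x) \<partial>lborel)"
          unfolding wp sym using True C1(1)
          by (intro nn_integral_cong) (auto simp: B_def indicator_def ennreal_mult[symmetric] mult_ac)
        also have "\<dots> = ennreal B * (\<integral>\<^sup>+x. ennreal (cmod (bidisc_kernel y x) * cmod (snd x) powr (2 * N - N * p) * P x powr (- (1 / q))) * indicator ?D2 x \<partial>lborel)"
          by (rule nn_integral_cmult) measurable
        also have "\<dots> \<le> ennreal B * ennreal (C2 * P y powr (- (1 / q)))"
          by (intro mult_left_mono C2(2) True) auto
        also have "\<dots> = ennreal (C1 powr (p - 1) * C2) * (ennreal (u y powr p * cmod (snd y) powr (2 * N)) * indicator ?D2 y)"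
          using True B C2(1) P(1)[OF True] by (simp add: ennreal_mult[symmetric] B_def powr_minus_divide)
        finally show ?thesis .
      qed (simp add: w_def)
    qed
    also have "\<dots> = ennreal (C1 powr (p - 1) * C2) * (\<integral>\<^sup>+y. ennreal (u y powr p * cmod (snd y) powr (2 * N)) * indicator ?D2 y \<partial>lborel)"
      by (rule nn_integral_cmult) measurable
    finally show "(\<integral>\<^sup>+x. ennreal (T x powr p * cmod (snd x) powr (2 * N - N * p)) * indicator ?D2 x \<partial>lborel)
        \<le> ennreal (C1 powr (p - 1) * C2) * (\<integral>\<^sup>+y. ennreal (u y powr p * cmod (snd y) powr (2 * N)) * indicator ?D2 y \<partial>lborel)" .
  qed
qed

section \<open>Transfer of the bidisc estimate to the Hartogs triangle\<close>

text \<open>Elements of \<open>Lp_space\<close> are only Lebesgue measurable, while composition with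
  \<open>cover\<close> calls for Borel functions. Real and imaginary parts are replaced
  separately.\<close>

lemma lebesgue_on_borel_representative:
  fixes f :: "'a::euclidean_space \<Rightarrow> complex"
  assumes A: "A \<in> sets borel" and f: "f \<in> borel_measurable (lebesgue_on A)"
  obtains f' where "f' \<in> borel_measurable borel" "AE x in lebesgue_on A. f x = f' x"
proof -
  have A': "A \<inter> space lebesgue \<in> sets lebesgue" using A by simp
  have g: "(\<lambda>x. indicator A x *\<^sub>R f x) \<in> borel_measurable lebesgue"
    using f unfolding borel_measurable_restrict_space_iff[OF A'] .
  have "(\<lambda>x. Re (indicator A x *\<^sub>R f x)) \<in> borel_measurable lebesgue"
    by (rule measurable_compose[OF g]) (intro borel_measurable_continuous_onI continuous_intros)
  then obtain u where u: "u \<in> borel_measurable lborel" "AE x in lborel. Re (indicator A x *\<^sub>R f x) = u x"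
    by (blast dest: completion_ex_borel_measurable_real)
  have "(\<lambda>x. Im (indicator A x *\<^sub>R f x)) \<in> borel_measurable lebesgue"
    by (rule measurable_compose[OF g]) (intro borel_measurable_continuous_onI continuous_intros)
  then obtain v where v: "v \<in> borel_measurable lborel" "AE x in lborel. Im (indicator A x *\<^sub>R f x) = v x"
    by (blast dest: completion_ex_borel_measurable_real)
  have "AE x in lborel. x \<in> A \<longrightarrow> f x = Complex (u x) (v x)"
    using u(2) v(2) by eventually_elim (auto simp: complex_eq_iff)
  then have "AE x in lebesgue_on A. f x = Complex (u x) (v x)"
    unfolding AE_restrict_space_iff[OF A'] by (rule AE_completion)
  moreover have "(\<lambda>x. Complex (u x) (v x)) \<in> borel_measurable borel"
    using u(1) v(1) measurable_Complex[of u borel v] by simp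
  ultimately show ?thesis using that by blast
qed

context hartogs_cover
begin

lemma norm_cover_powr:
  fixes \<alpha> :: real
  shows "cmod (snd (cover y)) powr \<alpha> = cmod (snd y) powr (m * \<alpha>)"
proof (cases "snd y = 0")
  case True
  then show ?thesis using m by (simp add: cover_def zero_power)
next
  case False
  then show ?thesis by (simp add: cover_def norm_power powr_realpow[symmetric] powr_powr)
qed

lemma norm_power_N: "cmod (snd y) powr (2 * N) = cmod (snd y) ^ (2 * N)"
  using N_pos by (cases "snd y = 0") (auto simp: powr_realpow[symmetric] zero_power)

text \<open>Kept as an abstraction over a pair, so that folding \<open>symb_def\<close> matches the
  symbol in the theorem literally.\<close>

definition symb :: "real \<Rightarrow> complex \<times> complex \<Rightarrow> complex" where
  "symb \<alpha> = (\<lambda>(z1, z2). complex_of_real (norm z2 powr \<alpha>))"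

lemma symb_eq: "symb \<alpha> z = complex_of_real (cmod (snd z) powr \<alpha>)"
  by (simp add: symb_def case_prod_unfold)

lemma symb_measurable[measurable]: "symb \<alpha> \<in> borel_measurable borel"
  unfolding symb_eq[abs_def] by measurable

lemma borel_imp_set_borel:
  fixes f :: "complex \<times> complex \<Rightarrow> complex"
  assumes "f \<in> borel_measurable borel" "A \<in> sets borel"
  shows "set_borel_measurable lborel A f"
  using assms unfolding set_borel_measurable_def by simp

lemma nn_integral_norm_cover:
  fixes f :: "complex \<times> complex \<Rightarrow> complex"
  assumes "set_borel_measurable lborel H f"
  shows "(\<integral>\<^sup>+z. ennreal (cmod (f z) powr p) * indicator H z \<partial>lborel)
    = ennreal m * (\<integral>\<^sup>+y. ennreal (cmod (f (cover y)) powr p * cmod (snd y) powr (2 * N)) * indicator D2' y \<partial>lborel)"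
proof -
  have mf: "(\<lambda>z. ennreal (cmod (f z) powr p) * indicator H z) \<in> borel_measurable borel"
    by (rule norm_powr_H_measurable[OF assms])
  have "(\<integral>\<^sup>+z. ennreal (cmod (f z) powr p) * indicator H z \<partial>lborel)
    = (\<integral>\<^sup>+y. ennreal (cmod (f (cover y)) powr p) * ennreal (real m * cmod (snd y) ^ (2 * N)) * indicator D2 y \<partial>lborel)"
    by (rule nn_integral_cover_set[OF mf])
  also have "\<dots> = (\<integral>\<^sup>+y. ennreal m * ((ennreal (cmod (f (cover y)) powr p) * indicator H (cover y)) * ennreal (cmod (snd y) powr (2 * N))) \<partial>lborel)"
  proof (rule nn_integral_cong)
    fix y :: "complex \<times> complex"
    show "ennreal (cmod (f (cover y)) powr p) * ennreal (real m * cmod (snd y) ^ (2 * N)) * indicator D2 y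
       = ennreal m * ((ennreal (cmod (f (cover y)) powr p) * indicator H (cover y)) * ennreal (cmod (snd y) powr (2 * N)))"
      unfolding norm_power_N using N_pos cover_mem_H_iff[of y]
      by (cases "snd y = 0"; cases y) (auto simp: zero_power indicator_def ennreal_mult mult_ac)
  qed
  also have "\<dots> = ennreal m * (\<integral>\<^sup>+y. (ennreal (cmod (f (cover y)) powr p) * indicator H (cover y)) * ennreal (cmod (snd y) powr (2 * N)) \<partial>lborel)"
  proof (rule nn_integral_cmult)
    have "(\<lambda>y. ennreal (cmod (snd y) powr (2 * N))) \<in> borel_measurable (borel :: (complex \<times> complex) measure)" by measurable
    from borel_measurable_times_ennreal[OF measurable_compose[OF cover_measurable mf] this]
    show "(\<lambda>y. (ennreal (cmod (f (cover y)) powr p) * indicator H (cover y)) * ennreal (cmod (snd y) powr (2 * N))) \<in> borel_measurable lborel"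
      by simp
  qed
  also have "(\<integral>\<^sup>+y. (ennreal (cmod (f (cover y)) powr p) * indicator H (cover y)) * ennreal (cmod (snd y) powr (2 * N)) \<partial>lborel)
     = (\<integral>\<^sup>+y. ennreal (cmod (f (cover y)) powr p * cmod (snd y) powr (2 * N)) * indicator D2' y \<partial>lborel)"
    using cover_mem_H_iff by (intro nn_integral_cong) (auto simp: indicator_def ennreal_mult)
  finally show ?thesis .
qed

lemma D2'_le_D2_integral:
  "(\<integral>\<^sup>+y. f y * indicator D2' y \<partial>lborel) \<le> (\<integral>\<^sup>+y. f y * indicator D2 y \<partial>lborel)"
  by (intro nn_integral_mono) (auto simp: indicator_def)

lemma D2_eq_D2'_integral:
  assumes "\<And>y. snd y = 0 \<Longrightarrow> f y = 0"
  shows "(\<integral>\<^sup>+y. f y * indicator D2 y \<partial>lborel) = (\<integral>\<^sup>+y. f y * indicator D2' y \<partial>lborel)"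
  using assms by (intro nn_integral_cong) (auto simp: indicator_def)

text \<open>For each fixed \<open>z\<close> the exchange of \<open>f\<close> and \<open>f'\<close>
  alters the integrand only on a null set, so the identities hold at every point of \<open>H\<close>
  and not just almost everywhere.\<close>

lemma Toeplitz_eq:
  assumes f: "f \<in> borel_measurable (lebesgue_on H)" and f': "f' \<in> borel_measurable borel"
    and AE: "AE z in lebesgue_on H. f z = f' z" and z: "z \<in> H"
  shows "Toeplitz H (symb \<alpha>) f z = (LINT w:H|lborel. hartogs_kernel z w * (symb \<alpha> w * f' w))"
    and "integrable (lebesgue_on H) (\<lambda>w. Bergman_kernel H z w * (symb \<alpha> w * f w))
      \<longleftrightarrow> set_integrable lborel H (\<lambda>w. hartogs_kernel z w * (symb \<alpha> w * f' w))"
proof -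
  have [measurable]: "hartogs_kernel z \<in> borel_measurable (lebesgue_on H)" "symb \<alpha> \<in> borel_measurable (lebesgue_on H)"
     "f' \<in> borel_measurable (lebesgue_on H)"
    using lebesgue_on_integral_eq(1)[OF H_borel] hartogs_kernel_measurable[OF z]
      borel_imp_set_borel[OF symb_measurable H_borel] borel_imp_set_borel[OF f' H_borel] by blast+
  note f[measurable]
  have mb: "set_borel_measurable lborel H (\<lambda>w. hartogs_kernel z w * (symb \<alpha> w * f' w))"
    by (intro set_borel_measurable_mult hartogs_kernel_measurable z borel_imp_set_borel f' symb_measurable H_borel)
  have AE': "AE w in lebesgue_on H. hartogs_kernel z w * (symb \<alpha> w * f w) = hartogs_kernel z w * (symb \<alpha> w * f' w)"
    using AE by eventually_elim simp
  have "Toeplitz H (symb \<alpha>) f z = integral\<^sup>L (lebesgue_on H) (\<lambda>w. hartogs_kernel z w * (symb \<alpha> w * f w))"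
    by (simp add: Toeplitz_def Bergman_projection_def Bergman_kernel_eq)
  also have "\<dots> = integral\<^sup>L (lebesgue_on H) (\<lambda>w. hartogs_kernel z w * (symb \<alpha> w * f' w))"
    by (rule integral_cong_AE[OF _ _ AE']) measurable
  also have "\<dots> = (LINT w:H|lborel. hartogs_kernel z w * (symb \<alpha> w * f' w))"
    by (rule lebesgue_on_integral_eq(3)[OF H_borel mb])
  finally show "Toeplitz H (symb \<alpha>) f z = (LINT w:H|lborel. hartogs_kernel z w * (symb \<alpha> w * f' w))" .
  have "integrable (lebesgue_on H) (\<lambda>w. Bergman_kernel H z w * (symb \<alpha> w * f w))
     \<longleftrightarrow> integrable (lebesgue_on H) (\<lambda>w. hartogs_kernel z w * (symb \<alpha> w * f' w))"
    unfolding Bergman_kernel_eq by (rule integrable_cong_AE[OF _ _ AE']) measurable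
  also have "\<dots> \<longleftrightarrow> set_integrable lborel H (\<lambda>w. hartogs_kernel z w * (symb \<alpha> w * f' w))"
    by (rule lebesgue_on_integral_eq(2)[OF H_borel mb])
  finally show "integrable (lebesgue_on H) (\<lambda>w. Bergman_kernel H z w * (symb \<alpha> w * f w))
      \<longleftrightarrow> set_integrable lborel H (\<lambda>w. hartogs_kernel z w * (symb \<alpha> w * f' w))" .
qed

lemma Lp_space_cong_AE:
  assumes f: "f \<in> borel_measurable (lebesgue_on H)" and f': "f' \<in> borel_measurable (lebesgue_on H)"
    and AE: "AE z in lebesgue_on H. f z = f' z"
  shows "f \<in> Lp_space p H \<longleftrightarrow> f' \<in> Lp_space p H" "Lp_norm p H f = Lp_norm p H f'"
proof -
  note f[measurable] f'[measurable]
  have AE': "AE z in lebesgue_on H. cmod (f z) powr p = cmod (f' z) powr p" using AE by eventually_elim simp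
  show "f \<in> Lp_space p H \<longleftrightarrow> f' \<in> Lp_space p H"
    using integrable_cong_AE[OF _ _ AE'] f f' by (simp add: Lp_space_def)
  show "Lp_norm p H f = Lp_norm p H f'"
    unfolding Lp_norm_def by (subst integral_cong_AE[OF _ _ AE']) auto
qed

lemma powr_inverse_mono:
  assumes "ennreal a \<le> ennreal C * ennreal b" "a \<ge> 0" "b \<ge> 0" "C \<ge> 0" "p > 0"
  shows "a powr (1 / p) \<le> C powr (1 / p) * b powr (1 / p)"
proof -
  have "a \<le> C * b" using assms by (simp add: ennreal_mult[symmetric])
  then have "a powr (1 / p) \<le> (C * b) powr (1 / p)" using assms by (intro powr_mono2) auto
  then show ?thesis using assms by (simp add: powr_mult)
qed

text \<open>The transform pulls back to \<open>F x / snd x ^ N\<close>, where \<open>F\<close> is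
  the bidisc projection of \<open>\<Phi>\<close>. Thus \<open>bidisc_schur_test\<close> with
  \<open>u = cmod (f' (cover y))\<close> gives convergence of the integral and the norm bound, and
  \<open>F\<close> descends to a holomorphic function after the division.\<close>

lemma Toeplitz_bounded:
  fixes p \<alpha> :: real
  assumes p: "p > 1" and up: "real N * p < 2 * real N + 2" and low: "2 * real N + 2 < p * (real N + 2 + m * \<alpha>)"
  shows "Toeplitz_maps_boundedly p H (symb \<alpha>)"
proof -
  have low': "2 * real N + 2 < p * (real (N + 2) + m * \<alpha>)" using low by (simp add: algebra_simps)
  obtain C where C: "C \<ge> 0"
    "\<And>u :: complex \<times> complex \<Rightarrow> real. u \<in> borel_measurable borel \<Longrightarrow> (\<And>y. u y \<ge> 0) \<Longrightarrow>
      (\<integral>\<^sup>+y. ennreal (u y powr p * cmod (snd y) powr (2 * N)) * indicator D2 y \<partial>lborel) < \<infinity> \<Longrightarrow>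
      (\<integral>\<^sup>+y. ennreal (cmod (snd y) powr (N + m * \<alpha>) * u y) * indicator D2 y \<partial>lborel) < \<infinity>"
    "\<And>u T :: complex \<times> complex \<Rightarrow> real. u \<in> borel_measurable borel \<Longrightarrow> (\<And>y. u y \<ge> 0) \<Longrightarrow> (\<And>x. T x \<ge> 0) \<Longrightarrow>
      (\<And>x. x \<in> D2 \<Longrightarrow> ennreal (T x) \<le> (\<integral>\<^sup>+y. ennreal (cmod (bidisc_kernel x y) * (cmod (snd y) powr (N + m * \<alpha>) * u y))
          * indicator D2 y \<partial>lborel)) \<Longrightarrow>
      (\<integral>\<^sup>+x. ennreal (T x powr p * cmod (snd x) powr (2 * N - N * p)) * indicator D2 x \<partial>lborel)
        \<le> ennreal C * (\<integral>\<^sup>+y. ennreal (u y powr p * cmod (snd y) powr (2 * N)) * indicator D2 y \<partial>lborel)"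
    using bidisc_schur_test[OF p up low'] by blast
  show ?thesis
    unfolding Toeplitz_maps_boundedly_def
  \<comment> \<open>Lifting multiplies the p-th powers of both norms by the same factor
    \<open>m\<close>, so the constant of Schur's test needs only the p-th root.\<close>
  proof (intro exI[of _ "C powr (1 / p)"] ballI conjI)
    fix f assume f: "f \<in> Lp_space p H"
    then have mf: "f \<in> borel_measurable (lebesgue_on H)" by (simp add: Lp_space_def)
    obtain f' where f': "f' \<in> borel_measurable borel" and AE: "AE z in lebesgue_on H. f z = f' z"
      using lebesgue_on_borel_representative[OF H_borel mf] by blast
    have sf': "set_borel_measurable lborel H f'" by (rule borel_imp_set_borel[OF f' H_borel])
    have mf': "f' \<in> borel_measurable (lebesgue_on H)" by (rule lebesgue_on_integral_eq(1)[OF H_borel sf'])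
    have f'L: "f' \<in> Lp_space p H" using Lp_space_cong_AE(1)[OF mf mf' AE] f by simp
    define u where "u = (\<lambda>y. cmod (f' (cover y)))"
    have u[measurable]: "u \<in> borel_measurable borel"
      unfolding u_def by (intro borel_measurable_norm_compose measurable_compose[OF cover_measurable f'])
    have u0: "u y \<ge> 0" for y by (simp add: u_def)
    define J where "J = (\<integral>\<^sup>+y. ennreal (u y powr p * cmod (snd y) powr (2 * N)) * indicator D2 y \<partial>lborel)"
    have J: "(\<integral>\<^sup>+z. ennreal (cmod (f' z) powr p) * indicator H z \<partial>lborel) = ennreal m * J"
      unfolding nn_integral_norm_cover[OF sf'] J_def u_def by (subst D2_eq_D2'_integral) auto
    have Jfin: "J < \<infinity>"
      using f'L m unfolding Lp_space_iff_nn_integral(1)[OF H_borel sf'] J by (auto simp: ennreal_mult_less_top)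
    define \<Phi> where "\<Phi> = (\<lambda>y. snd y ^ N * (symb \<alpha> (cover y) * f' (cover y)))"
    have mc: "(\<lambda>y. symb \<alpha> (cover y)) \<in> borel_measurable borel" "(\<lambda>y. f' (cover y)) \<in> borel_measurable borel"
      by (rule measurable_compose[OF cover_measurable symb_measurable] measurable_compose[OF cover_measurable f'])+
    have m\<Phi>: "\<Phi> \<in> borel_measurable borel"
      unfolding \<Phi>_def using mc by measurable
    have norm\<Phi>: "cmod (\<Phi> y) = cmod (snd y) powr (N + m * \<alpha>) * u y" for y
    proof (cases "snd y = 0")
      case True
      then show ?thesis using N_pos by (simp add: \<Phi>_def zero_power)
    next
      case False
      then show ?thesis
        by (simp add: \<Phi>_def u_def norm_mult norm_power symb_eq norm_cover_powr powr_add powr_realpow)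
    qed
    have int\<Phi>: "set_integrable lborel D2 \<Phi>"
      unfolding set_integrable_iff_nn_integral[OF borel_imp_set_borel[OF m\<Phi> D2_borel]] norm\<Phi>
      using C(2)[OF u u0] Jfin unfolding J_def by simp
    define F where "F = (\<lambda>x. LINT y:D2|lborel. bidisc_kernel x y * \<Phi> y)"
    define g where "g = (\<lambda>z. LINT w:H|lborel. hartogs_kernel z w * (symb \<alpha> w * f' w))"
    have sphi: "set_borel_measurable lborel H (\<lambda>w. symb \<alpha> w * f' w)"
      by (intro set_borel_measurable_mult borel_imp_set_borel symb_measurable f' H_borel)
    have gF: "g (cover x) = F x / snd x ^ N" if "x \<in> D2'" for x
      using integral_hartogs_kernel(2)[OF sphi that] int\<Phi> by (simp add: g_def F_def \<Phi>_def)
    have intK: "set_integrable lborel H (\<lambda>w. hartogs_kernel z w * (symb \<alpha> w * f' w))" if z: "z \<in> H" for z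
    proof -
      obtain x where x: "x \<in> D2'" "cover x = z" using z by (rule H_subset_cover)
      show ?thesis using integral_hartogs_kernel(1)[OF sphi x(1)] int\<Phi> x(2) by (simp add: \<Phi>_def)
    qed
    have holF: "holomorphic2_on F D2'"
      using holomorphic2_on_bidisc_integral[OF int\<Phi>] unfolding F_def holomorphic2_on_def by auto
    have holg: "holomorphic2_on g H"
    proof (rule holomorphic2_on_descend)
      have "(\<lambda>t. 1 / t ^ N) holomorphic_on - {0}" by (intro holomorphic_intros) auto
      then have "holomorphic2_on (\<lambda>x. 1 / snd x ^ N) D2'"
        by (rule holomorphic2_on_field_compose[OF _ _ _ holomorphic2_on_snd]) auto
      from holomorphic2_on_mult[OF holF this]
      show "holomorphic2_on (\<lambda>x. F x / snd x ^ N) D2'" by simp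
    qed (rule gF)
    have sg: "set_borel_measurable lborel H g" by (rule set_borel_measurable_holomorphic2[OF H_borel holg])
    have T: "ennreal (cmod (F x)) \<le> (\<integral>\<^sup>+y. ennreal (cmod (bidisc_kernel x y) * (cmod (snd y) powr (N + m * \<alpha>) * u y)) * indicator D2 y \<partial>lborel)" for x
      using set_integral_norm_bound_nn[of lborel D2 "\<lambda>y. bidisc_kernel x y * \<Phi> y"] by (simp add: F_def norm_mult norm\<Phi>)
    have "(\<integral>\<^sup>+z. ennreal (cmod (g z) powr p) * indicator H z \<partial>lborel)
      = ennreal m * (\<integral>\<^sup>+x. ennreal (cmod (g (cover x)) powr p * cmod (snd x) powr (2 * N)) * indicator D2' x \<partial>lborel)"
      by (rule nn_integral_norm_cover[OF sg])
    also have "(\<integral>\<^sup>+x. ennreal (cmod (g (cover x)) powr p * cmod (snd x) powr (2 * N)) * indicator D2' x \<partial>lborel)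
      = (\<integral>\<^sup>+x. ennreal (cmod (F x) powr p * cmod (snd x) powr (2 * N - N * p)) * indicator D2' x \<partial>lborel)"
    proof (rule nn_integral_cong)
      fix x :: "complex \<times> complex"
      show "ennreal (cmod (g (cover x)) powr p * cmod (snd x) powr (2 * N)) * indicator D2' x
         = ennreal (cmod (F x) powr p * cmod (snd x) powr (2 * N - N * p)) * indicator D2' x"
      proof (cases "x \<in> D2'")
        case True
        then have "snd x \<noteq> 0" by auto
        then have "cmod (g (cover x)) powr p * cmod (snd x) powr (2 * N) = cmod (F x) powr p * cmod (snd x) powr (2 * N - N * p)"
          unfolding gF[OF True] by (simp add: norm_divide norm_power powr_divide powr_realpow[symmetric] powr_powr powr_diff)
        then show ?thesis by simp
      qed simp
    qed
    also have "\<dots> \<le> (\<integral>\<^sup>+x. ennreal (cmod (F x) powr p * cmod (snd x) powr (2 * N - N * p)) * indicator D2 x \<partial>lborel)"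
      by (rule D2'_le_D2_integral)
    also have "\<dots> \<le> ennreal C * J"
      unfolding J_def by (rule C(3)[OF u u0 _ T]) simp
    finally have le: "(\<integral>\<^sup>+z. ennreal (cmod (g z) powr p) * indicator H z \<partial>lborel)
       \<le> ennreal C * (\<integral>\<^sup>+z. ennreal (cmod (f' z) powr p) * indicator H z \<partial>lborel)"
      unfolding J by (simp add: mult_left_mono mult.left_commute)
    have f'fin: "(\<integral>\<^sup>+z. ennreal (cmod (f' z) powr p) * indicator H z \<partial>lborel) < \<infinity>"
      using f'L Lp_space_iff_nn_integral(1)[OF H_borel sf'] by simp
    then have "ennreal C * (\<integral>\<^sup>+z. ennreal (cmod (f' z) powr p) * indicator H z \<partial>lborel) < \<infinity>"
      by (simp add: ennreal_mult_less_top)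
    with le have "(\<integral>\<^sup>+z. ennreal (cmod (g z) powr p) * indicator H z \<partial>lborel) < \<infinity>" by (rule le_less_trans)
    then have gL: "g \<in> Lp_space p H" using Lp_space_iff_nn_integral(1)[OF H_borel sg] by simp
    show "AE z in lebesgue_on H. integrable (lebesgue_on H) (\<lambda>w. Bergman_kernel H z w * (symb \<alpha> w * f w))"
      using Toeplitz_eq(2)[OF mf f' AE] intK by (intro AE_I2) simp
    show "\<exists>g\<in>Bergman_space p H. (AE z in lebesgue_on H. Toeplitz H (symb \<alpha>) f z = g z) \<and> Lp_norm p H g \<le> C powr (1 / p) * Lp_norm p H f"
    proof (intro bexI[of _ g] conjI)
      show "g \<in> Bergman_space p H" using holg gL by (simp add: Bergman_space_def)
      show "AE z in lebesgue_on H. Toeplitz H (symb \<alpha>) f z = g z"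
        using Toeplitz_eq(1)[OF mf f' AE] by (intro AE_I2) (simp add: g_def)
      have "ennreal (integral\<^sup>L (lebesgue_on H) (\<lambda>z. cmod (g z) powr p))
          \<le> ennreal C * ennreal (integral\<^sup>L (lebesgue_on H) (\<lambda>z. cmod (f' z) powr p))"
        using le unfolding Lp_space_iff_nn_integral(2)[OF H_borel sg gL] Lp_space_iff_nn_integral(2)[OF H_borel sf' f'L] .
      then have "Lp_norm p H g \<le> C powr (1 / p) * Lp_norm p H f'"
        unfolding Lp_norm_def by (rule powr_inverse_mono) (use C(1) p in auto)
      then show "Lp_norm p H g \<le> C powr (1 / p) * Lp_norm p H f"
        using Lp_space_cong_AE(2)[OF mf mf' AE] by simp
    qed
  qed
qed

end

section \<open>Necessary conditions from monomials\<close>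

text \<open>The critical exponent \<open>-2\<close> gives logarithmic divergence as the truncation
  is removed; this is the source of the unbounded quantities in the counterexamples at
  \<open>t = 0\<close>.\<close>

lemma disc_nn_integral_powr_truncated:
  assumes \<epsilon>: "0 < \<epsilon>" "\<epsilon> < 1"
  shows "(\<integral>\<^sup>+t. ennreal (cmod t powr (-2) * indicator {\<epsilon><..} (cmod t)) * indicator (ball 0 1) t \<partial>lborel) = ennreal (2 * pi * ln (1 / \<epsilon>))"
proof -
  have "(\<integral>\<^sup>+t. ennreal (cmod t powr (-2) * indicator {\<epsilon><..} (cmod t)) * indicator (ball 0 1) t \<partial>lborel)
    = ennreal (2 * pi) * (\<integral>\<^sup>+r. ennreal (r powr (-2) * indicator {\<epsilon><..} r) * ennreal r * indicator {0<..<1} r \<partial>lborel)"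
    by (rule unit_disc_nn_integral_radial[where \<rho> = "\<lambda>r. ennreal (r powr (-2) * indicator {\<epsilon><..} r)"]) measurable
  also have "(\<integral>\<^sup>+r. ennreal (r powr (-2) * indicator {\<epsilon><..} r) * ennreal r * indicator {0<..<1} r \<partial>lborel)
    = (\<integral>\<^sup>+r. ennreal (1 / r) * indicator {\<epsilon><..<1} r \<partial>lborel)"
    using \<epsilon> by (intro nn_integral_cong)
      (auto simp: indicator_def ennreal_mult[symmetric] powr_minus_divide powr_numeral power2_eq_square)
  also have "\<dots> = ennreal (ln 1 - ln \<epsilon>)"
    by (rule nn_integral_FTC_interior) (use \<epsilon> in \<open>auto intro!: continuous_intros derivative_eq_intros\<close>)
  also have "ennreal (2 * pi) * ennreal (ln 1 - ln \<epsilon>) = ennreal (2 * pi * (ln 1 - ln \<epsilon>))"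
    using \<epsilon> by (intro ennreal_mult[symmetric]) (auto simp: ln_le_zero_iff)
  finally show ?thesis using \<epsilon> by (simp add: ln_div)
qed

lemma disc_nn_integral_powr:
  assumes e: "e > -2"
  shows "(\<integral>\<^sup>+t. ennreal (cmod t powr e) * indicator (ball 0 1) t \<partial>lborel) = ennreal (2 * pi / (e + 2))"
proof -
  have "(\<integral>\<^sup>+t. ennreal (cmod t powr e) * indicator (ball 0 1) t \<partial>lborel)
    = ennreal (2 * pi) * (\<integral>\<^sup>+r. ennreal (r powr e) * ennreal r * indicator {0<..<1} r \<partial>lborel)"
    by (rule unit_disc_nn_integral_radial[where \<rho> = "\<lambda>r. ennreal (r powr e)"]) measurable
  also have "(\<integral>\<^sup>+r. ennreal (r powr e) * ennreal r * indicator {0<..<1} r \<partial>lborel)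
    = (\<integral>\<^sup>+r. ennreal (r powr (e + 1)) * indicator {0<..<1} r \<partial>lborel)"
    by (intro nn_integral_cong) (auto simp: indicator_def ennreal_mult[symmetric] powr_add)
  also have "\<dots> = ennreal (1 powr (e + 2) / (e + 2) - 0 powr (e + 2) / (e + 2))"
  proof (rule nn_integral_FTC_interior)
    show "continuous_on {0..1} (\<lambda>r. r powr (e + 2) / (e + 2))"
      using e by (intro continuous_intros continuous_on_powr') auto
    show "((\<lambda>r. r powr (e + 2) / (e + 2)) has_real_derivative r powr (e + 1)) (at r)" if "r \<in> {0<..<1}" for r
      using e that by (auto intro!: derivative_eq_intros simp: add.commute)
  qed auto
  also have "ennreal (2 * pi) * ennreal (1 powr (e + 2) / (e + 2) - 0 powr (e + 2) / (e + 2)) = ennreal (2 * pi * (1 / (e + 2)))"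
    using e by (subst ennreal_mult) auto
  finally show ?thesis by simp
qed

text \<open>On the unit disc a smaller exponent gives a larger function, so truncations of the
  critical power \<open>-2\<close> are arbitrarily large minorants.\<close>

lemma disc_nn_integral_powr_infinite:
  assumes e: "e \<le> -2"
  shows "(\<integral>\<^sup>+t. ennreal (cmod t powr e) * indicator (ball 0 1) t \<partial>lborel) = \<infinity>"
proof (rule ccontr)
  assume "\<not> ?thesis"
  then obtain K where K: "K \<ge> 0" "(\<integral>\<^sup>+t. ennreal (cmod t powr e) * indicator (ball 0 1) t \<partial>lborel) = ennreal K"
    by (cases "\<integral>\<^sup>+t. ennreal (cmod t powr e) * indicator (ball 0 1) t \<partial>lborel") auto
  have "2 * pi * L \<le> K" if L: "L > 0" for L
  proof -
    have "ennreal (2 * pi * L) = (\<integral>\<^sup>+t. ennreal (cmod t powr (-2) * indicator {exp (- L)<..} (cmod t)) * indicator (ball 0 1) t \<partial>lborel)"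
      using disc_nn_integral_powr_truncated[of "exp (- L)"] L by (simp add: ln_div)
    also have "\<dots> \<le> (\<integral>\<^sup>+t. ennreal (cmod t powr e) * indicator (ball 0 1) t \<partial>lborel)"
    proof (rule nn_integral_mono)
      fix t :: complex
      have "cmod t powr (-2) \<le> cmod t powr e" if "cmod t < 1"
        using that e by (intro powr_mono') auto
      then show "ennreal (cmod t powr (-2) * indicator {exp (- L)<..} (cmod t)) * indicator (ball 0 1) t \<le> ennreal (cmod t powr e) * indicator (ball 0 1) t"
        by (auto simp: indicator_def intro!: ennreal_leI)
    qed
    finally show ?thesis using K by simp
  qed
  from this[of "K + 1"] K(1) have "2 * pi * (K + 1) \<le> K" by simp
  moreover have "1 * (K + 1) \<le> 2 * pi * (K + 1)" using K(1) pi_gt3 by (intro mult_right_mono) auto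
  ultimately show False by simp
qed

text \<open>The Bergman projection of a radial function is its mean: on every circle the conjugate
  of the kernel is holomorphic inside, so its mean is the value at the centre.\<close>

lemma radial_disc_kernel_integral:
  fixes \<kappa> :: "real \<Rightarrow> real"
  assumes int: "set_integrable lborel (ball 0 1) (\<lambda>s. complex_of_real (\<kappa> (cmod s)))" and x: "cmod x < 1"
  shows "set_integrable lborel (ball 0 1) (\<lambda>s. 1 / (pi * (1 - x * cnj s)\<^sup>2) * of_real (\<kappa> (cmod s)))"
    and "(LINT s:ball 0 1|lborel. 1 / (pi * (1 - x * cnj s)\<^sup>2) * of_real (\<kappa> (cmod s)))
    = 1 / pi * (LINT s:ball 0 1|lborel. complex_of_real (\<kappa> (cmod s)))"
proof -
  show i: "set_integrable lborel (ball 0 1) (\<lambda>s. 1 / (pi * (1 - x * cnj s)\<^sup>2) * of_real (\<kappa> (cmod s)))"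
  proof (rule set_integrable_bounded_mult[OF int])
    show "set_borel_measurable lborel (ball 0 1) (\<lambda>s. 1 / (pi * (1 - x * cnj s)\<^sup>2))"
      using x by (intro set_borel_measurable_continuous continuous_intros) (auto simp: mult_cnj_neq_one)
    show "cmod (1 / (pi * (1 - x * cnj s)\<^sup>2)) \<le> 1 / (pi * (1 - cmod x)\<^sup>2)" if "s \<in> ball 0 1" for s
      using that x by (intro norm_disc_kernel_le) auto
  qed
  \<comment> \<open>The value \<open>2\<close> is the circle length \<open>2 * pi\<close> divided by
    the \<open>pi\<close> in the kernel.\<close>
  have circ: "(LINT t:{0..2 * pi}|lborel. 1 / (pi * (1 - x * cnj (of_real r * cis t))\<^sup>2)) = 2" if r: "0 < r" "r < 1" for r
  proof -
    define f where "f = (\<lambda>z. 1 / (1 - cnj x * z)\<^sup>2)"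
    have ne: "cnj x * z \<noteq> 1" if "cmod z \<le> r" for z
      using norm_one_minus_mult_cnj_ge[of "cnj z" "cnj x"] that r x by auto
    have f: "continuous_on (cball 0 r) f" "f holomorphic_on ball 0 r"
      unfolding f_def using ne by (auto intro!: continuous_intros holomorphic_intros)
    have L: "(LINT t:{0..2 * pi}|lborel. f (of_real r * cis t)) = 2 * pi"
      using circle_coefficient[OF f r(1), of 0] by (simp add: f_def)
    have "1 / (pi * (1 - x * cnj (of_real r * cis t))\<^sup>2) = 1 / pi * cnj (f (of_real r * cis t))" for t
      by (simp add: f_def)
    then have "(LINT t:{0..2 * pi}|lborel. 1 / (pi * (1 - x * cnj (of_real r * cis t))\<^sup>2))
       = 1 / pi * (LINT t:{0..2 * pi}|lborel. cnj (f (of_real r * cis t)))"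
      by (simp only: set_integral_mult_right)
    also have "(LINT t:{0..2 * pi}|lborel. cnj (f (of_real r * cis t))) = cnj (LINT t:{0..2 * pi}|lborel. f (of_real r * cis t))"
      unfolding set_lebesgue_integral_def Bochner_Integration.integral_cnj[symmetric] by simp
    finally show ?thesis by (simp add: L)
  qed
  have "(LINT s:ball 0 1|lborel. 1 / (pi * (1 - x * cnj s)\<^sup>2) * of_real (\<kappa> (cmod s)))
     = (LINT r:{0<..<1}|lborel. of_real r * (LINT t:{0..2 * pi}|lborel. 1 / (pi * (1 - x * cnj (of_real r * cis t))\<^sup>2) * of_real (\<kappa> (cmod (of_real r * cis t)))))"
    by (rule unit_disc_integral_polar[OF i])
  also have "\<dots> = (LINT r:{0<..<1}|lborel. 1 / pi * (of_real r * (LINT t:{0..2 * pi}|lborel. complex_of_real (\<kappa> (cmod (of_real r * cis t))))))"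
  proof (rule set_lebesgue_integral_cong, simp, intro allI impI)
    fix r :: real assume r: "r \<in> {0<..<1}"
    have "(LINT t:{0..2 * pi}|lborel. 1 / (pi * (1 - x * cnj (of_real r * cis t))\<^sup>2) * of_real (\<kappa> (cmod (of_real r * cis t))))
       = (LINT t:{0..2 * pi}|lborel. of_real (\<kappa> r) * (1 / (pi * (1 - x * cnj (of_real r * cis t))\<^sup>2)))"
      using r by (simp add: norm_mult mult.commute)
    also have "\<dots> = of_real (\<kappa> r) * 2"
      by (subst set_integral_mult_right) (use circ r in simp)
    finally have 1: "(LINT t:{0..2 * pi}|lborel. 1 / (pi * (1 - x * cnj (of_real r * cis t))\<^sup>2) * of_real (\<kappa> (cmod (of_real r * cis t)))) = of_real (\<kappa> r) * 2" .
    have "(LINT t:{0..2 * pi}|lborel. complex_of_real (\<kappa> (cmod (of_real r * cis t)))) = (LINT t:{0..2 * pi}|lborel. complex_of_real (\<kappa> r))"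
      using r by (simp add: norm_mult)
    also have "\<dots> = 2 * pi * of_real (\<kappa> r)"
      by (simp add: set_lebesgue_integral_def scaleR_conv_of_real)
    finally show "of_real r * (LINT t:{0..2 * pi}|lborel. 1 / (pi * (1 - x * cnj (of_real r * cis t))\<^sup>2) * of_real (\<kappa> (cmod (of_real r * cis t))))
      = 1 / pi * (of_real r * (LINT t:{0..2 * pi}|lborel. complex_of_real (\<kappa> (cmod (of_real r * cis t)))))"
      unfolding 1 by simp
  qed
  also have "\<dots> = 1 / pi * (LINT r:{0<..<1}|lborel. of_real r * (LINT t:{0..2 * pi}|lborel. complex_of_real (\<kappa> (cmod (of_real r * cis t)))))"
    by (rule set_integral_mult_right)
  also have "(LINT r:{0<..<1}|lborel. of_real r * (LINT t:{0..2 * pi}|lborel. complex_of_real (\<kappa> (cmod (of_real r * cis t)))))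
     = (LINT s:ball 0 1|lborel. complex_of_real (\<kappa> (cmod s)))"
    by (rule unit_disc_integral_polar[OF int, symmetric])
  finally show "(LINT s:ball 0 1|lborel. 1 / (pi * (1 - x * cnj s)\<^sup>2) * of_real (\<kappa> (cmod s)))
    = 1 / pi * (LINT s:ball 0 1|lborel. complex_of_real (\<kappa> (cmod s)))" .
qed

lemma set_integral_bidisc_product:
  fixes f g :: "complex \<Rightarrow> complex"
  assumes "set_integrable lborel A f" "set_integrable lborel B g"
  shows "set_integrable lborel (A \<times> B) (\<lambda>x. f (fst x) * g (snd x))"
    and "(LINT x:A \<times> B|lborel. f (fst x) * g (snd x)) = (LINT v:A|lborel. f v) * (LINT t:B|lborel. g t)"
proof -
  let ?f = "\<lambda>v. indicator A v *\<^sub>R f v" and ?g = "\<lambda>t. indicator B t *\<^sub>R g t"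
  have fg: "integrable lborel ?f" "integrable lborel ?g" using assms by (simp_all add: set_integrable_def)
  have eq: "indicator (A \<times> B) x *\<^sub>R (f (fst x) * g (snd x)) = ?f (fst x) * ?g (snd x)" for x
    by (cases x) (auto simp: indicator_def)
  have i: "integrable (lborel \<Otimes>\<^sub>M lborel) (\<lambda>x. ?f (fst x) * ?g (snd x))"
  proof (rule lborel_pair.Fubini_integrable)
    have "(\<lambda>x. ?f (fst x)) \<in> borel_measurable (lborel \<Otimes>\<^sub>M lborel)" "(\<lambda>x. ?g (snd x)) \<in> borel_measurable (lborel \<Otimes>\<^sub>M lborel)"
      using measurable_compose[OF measurable_fst borel_measurable_integrable[OF fg(1)]]
        measurable_compose[OF measurable_snd borel_measurable_integrable[OF fg(2)]] by blast+
    then show "(\<lambda>x. ?f (fst x) * ?g (snd x)) \<in> borel_measurable (lborel \<Otimes>\<^sub>M lborel)"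
      by (rule borel_measurable_times)
    have "(\<integral>y. cmod (?f (fst (x, y)) * ?g (snd (x, y))) \<partial>lborel) = cmod (?f x) * (\<integral>y. cmod (?g y) \<partial>lborel)" for x
      unfolding fst_conv snd_conv norm_mult by (rule integral_mult_right_zero)
    then show "integrable lborel (\<lambda>x. \<integral>y. cmod (?f (fst (x, y)) * ?g (snd (x, y))) \<partial>lborel)"
      using integrable_mult_left[OF integrable_norm[OF fg(1)]] by simp
    show "AE x in lborel. integrable lborel (\<lambda>y. ?f (fst (x, y)) * ?g (snd (x, y)))"
      unfolding fst_conv snd_conv by (intro AE_I2 integrable_mult_right fg(2))
  qed
  show "set_integrable lborel (A \<times> B) (\<lambda>x. f (fst x) * g (snd x))"
    using i unfolding set_integrable_def eq by (simp add: lborel_prod)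
  have "(LINT x:A \<times> B|lborel. f (fst x) * g (snd x)) = (LINT v|lborel. LINT t|lborel. ?f v * ?g t)"
    using lborel_pair.integral_fst'[OF i] unfolding set_lebesgue_integral_def eq by (simp add: lborel_prod)
  also have "\<dots> = (LINT v:A|lborel. f v) * (LINT t:B|lborel. g t)"
    unfolding set_lebesgue_integral_def integral_mult_right_zero integral_mult_left_zero ..
  finally show "(LINT x:A \<times> B|lborel. f (fst x) * g (snd x)) = (LINT v:A|lborel. f v) * (LINT t:B|lborel. g t)" .
qed

lemma nn_integral_product:
  fixes f g :: "complex \<Rightarrow> ennreal"
  assumes [measurable]: "f \<in> borel_measurable borel" "g \<in> borel_measurable borel"
  shows "(\<integral>\<^sup>+x. f (fst x) * g (snd x) \<partial>lborel) = (\<integral>\<^sup>+v. f v \<partial>lborel) * (\<integral>\<^sup>+t. g t \<partial>lborel)"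
  by (subst nn_integral_prod(1)) (simp_all add: nn_integral_cmult nn_integral_multc)

context hartogs_cover
begin

text \<open>This is where coprimality enters. From \<open>n * x = m * y + 1\<close> follows
  \<open>m * (y + 1) = N + n * (x - 1)\<close>, because \<open>N = m + n - 1\<close>.\<close>

lemma monomial_exponents:
  assumes "coprime m n"
  obtains r Q :: nat where "m * Q = N + n * r" "Q > 0"
proof -
  obtain x y where xy: "n * x = m * y + 1"
    using bezout_nat[of n m] n assms by (auto simp: coprime_iff_gcd_eq_1 gcd.commute)
  then have "x > 0" by (cases x) auto
  then have "n * x = n + n * (x - 1)" by (cases x) auto
  then have "m * (y + 1) = N + n * (x - 1)" using xy m n by (simp add: N_def)
  then show ?thesis using that[of "y + 1" "x - 1"] by simp
qed

text \<open>Testing on \<open>w1\<^sup>r cnj w2\<^sup>Q\<close> times a radial function of \<open>w2\<close>. The relation \<open>m Q = N + n r\<close> makes the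
  pullback of the weighted test function a monomial in \<open>v\<close> times a radial function of \<open>t\<close>, so that its
  Toeplitz transform pulls back to a multiple of \<open>v\<^sup>r t\<^sup>-\<^sup>N\<close>.\<close>

lemma monomial_test:
  fixes p \<alpha> :: real
  assumes bdd: "Toeplitz_maps_boundedly p H (symb \<alpha>)" and p: "p \<ge> 1"
    and rQ: "m * Q = N + n * r" "Q > 0"
  obtains C where "C \<ge> 0"
    "\<And>c \<kappa>. \<kappa> \<in> borel_measurable borel \<Longrightarrow> (\<And>t :: real. \<kappa> t \<ge> (0 :: real)) \<Longrightarrow> \<kappa> 0 = 0 \<Longrightarrow> c \<ge> 0 \<Longrightarrow>
      (\<integral>\<^sup>+t. ennreal (\<kappa> (cmod t)) * indicator (ball 0 1) t \<partial>lborel) = ennreal (pi * c) \<Longrightarrow>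
      (\<integral>\<^sup>+t. ennreal (\<kappa> (cmod t) powr p * cmod t powr (2 * N - (N + m * \<alpha>) * p)) * indicator (ball 0 1) t \<partial>lborel) < \<infinity> \<Longrightarrow>
      ennreal (c powr p) * (\<integral>\<^sup>+t. ennreal (cmod t powr (2 * N - N * p)) * indicator (ball 0 1) t \<partial>lborel)
        \<le> ennreal C * (\<integral>\<^sup>+t. ennreal (\<kappa> (cmod t) powr p * cmod t powr (2 * N - (N + m * \<alpha>) * p)) * indicator (ball 0 1) t \<partial>lborel)"
proof -
  let ?D = "ball (0::complex) 1"
  have [measurable]: "?D \<in> sets borel" by simp
  obtain C0 where C0: "\<And>f. f \<in> Lp_space p H \<Longrightarrow> \<exists>g\<in>Bergman_space p H. (AE z in lebesgue_on H. Toeplitz H (symb \<alpha>) f z = g z) \<and> Lp_norm p H g \<le> C0 * Lp_norm p H f"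
    using bdd unfolding Toeplitz_maps_boundedly_def by blast
  \<comment> \<open>The integral of the p-th power of \<open>v ^ r\<close> over the disc. It occurs
    for the test function and for its transform, and cancels at the end.\<close>
  define A where "A = 2 * pi / (r * p + 2)"
  have A: "A > 0" using p by (simp add: A_def add_nonneg_pos)
  have Aint: "(\<integral>\<^sup>+v. ennreal ((cmod v ^ r) powr p) * indicator ?D v \<partial>lborel) = ennreal A"
  proof -
    have "(\<integral>\<^sup>+v. ennreal ((cmod v ^ r) powr p) * indicator ?D v \<partial>lborel) = (\<integral>\<^sup>+v. ennreal (cmod v powr (r * p)) * indicator ?D v \<partial>lborel)"
      using AE_lborel_singleton[of "0::complex"]
      by (intro nn_integral_cong_AE, eventually_elim) (simp add: powr_realpow[symmetric] powr_powr)
    also have "\<dots> = ennreal A" unfolding A_def using p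
      by (intro disc_nn_integral_powr) (auto intro: order.strict_trans2[of _ 0])
    finally show ?thesis .
  qed
  show ?thesis
  proof (rule that[of "\<bar>C0\<bar> powr p"])
    fix c :: real and \<kappa> :: "real \<Rightarrow> real"
    assume \<kappa>[measurable]: "\<kappa> \<in> borel_measurable borel" and \<kappa>0: "\<And>t. \<kappa> t \<ge> 0" and \<kappa>z: "\<kappa> 0 = 0" and c: "c \<ge> 0"
      and c_eq: "(\<integral>\<^sup>+t. ennreal (\<kappa> (cmod t)) * indicator ?D t \<partial>lborel) = ennreal (pi * c)"
      and fin: "(\<integral>\<^sup>+t. ennreal (\<kappa> (cmod t) powr p * cmod t powr (2 * N - (N + m * \<alpha>) * p)) * indicator ?D t \<partial>lborel) < \<infinity>"
    define J where "J = (\<integral>\<^sup>+t. ennreal (\<kappa> (cmod t) powr p * cmod t powr (2 * N - (N + m * \<alpha>) * p)) * indicator ?D t \<partial>lborel)"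
    define I where "I = (\<integral>\<^sup>+t. ennreal (cmod t powr (2 * N - N * p)) * indicator ?D t \<partial>lborel)"
    \<comment> \<open>The radius \<open>1 / m\<close> recovers \<open>cmod t\<close> from
      \<open>cmod (snd w) = cmod t ^ m\<close>. The denominator removes the moduli of the
      antiholomorphic monomial and of the symbol, so that \<open>fc\<close> comes out as
      \<open>fst y ^ r\<close> times \<open>\<kappa>\<close>.\<close>
    define f where "f = (\<lambda>w. fst w ^ r * cnj (snd w) ^ Q *
       complex_of_real (\<kappa> (cmod (snd w) powr (1 / m)) / (cmod (snd w) ^ (2 * Q) * cmod (snd w) powr \<alpha>)))"
    have f: "f \<in> borel_measurable borel" unfolding f_def by measurable
    have sf: "set_borel_measurable lborel H f" by (rule borel_imp_set_borel[OF f H_borel])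
    have mf: "f \<in> borel_measurable (lebesgue_on H)" by (rule lebesgue_on_integral_eq(1)[OF H_borel sf])
    have root: "cmod (snd (cover y)) powr (1 / m) = cmod (snd y)" for y
      using m unfolding norm_cover_powr by (cases "snd y = 0") auto
    have fc: "snd y ^ N * (symb \<alpha> (cover y) * f (cover y)) = fst y ^ r * of_real (\<kappa> (cmod (snd y)))" for y
    proof (cases "snd y = 0")
      case True
      then have "snd y ^ N = 0" using N_pos by simp
      moreover have "fst y ^ r * complex_of_real (\<kappa> (cmod (snd y))) = 0"
        by (simp only: True norm_zero \<kappa>z of_real_0 mult_zero_right)
      ultimately show ?thesis by (simp only: mult_zero_left)
    next
      case y: False
      let ?t = "snd y"
      have "snd y ^ N * (symb \<alpha> (cover y) * f (cover y))
        = fst y ^ r * complex_of_real (\<kappa> (cmod ?t)) * ((?t ^ N * ?t ^ (n * r)) * cnj ?t ^ (m * Q)) / complex_of_real (cmod ?t ^ (m * (2 * Q)))"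
      proof -
        define a where "a = complex_of_real (cmod (snd (cover y)) powr \<alpha>)"
        have a: "a \<noteq> 0" using y by (simp add: a_def cover_def)
        have "symb \<alpha> (cover y) * f (cover y)
          = fst (cover y) ^ r * cnj (snd (cover y)) ^ Q * complex_of_real (\<kappa> (cmod ?t)) / complex_of_real (cmod (snd (cover y)) ^ (2 * Q))"
          using a unfolding symb_eq f_def root by (simp add: a_def)
        moreover have "fst (cover y) ^ r = fst y ^ r * ?t ^ (n * r)" "cnj (snd (cover y)) ^ Q = cnj ?t ^ (m * Q)"
          "cmod (snd (cover y)) ^ (2 * Q) = cmod ?t ^ (m * (2 * Q))"
          by (simp_all add: cover_def power_mult_distrib power_mult norm_power)
        ultimately show ?thesis by (simp only: mult_ac times_divide_eq_right times_divide_eq_left)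
      qed
      also have "?t ^ N * ?t ^ (n * r) = ?t ^ (m * Q)" unfolding power_add[symmetric] rQ(1)[symmetric] ..
      also have "?t ^ (m * Q) * cnj ?t ^ (m * Q) = complex_of_real (cmod ?t ^ (m * (2 * Q)))"
      proof -
        have "?t ^ (m * Q) * cnj ?t ^ (m * Q) = (?t * cnj ?t) ^ (m * Q)" by (simp only: power_mult_distrib)
        also have "?t * cnj ?t = complex_of_real ((cmod ?t)\<^sup>2)" by (rule complex_norm_square[symmetric])
        also have "complex_of_real ((cmod ?t)\<^sup>2) ^ (m * Q) = complex_of_real (cmod ?t ^ (m * (2 * Q)))"
          by (simp only: of_real_power power_mult[symmetric] mult.left_commute)
        finally show ?thesis .
      qed
      finally show ?thesis using y by simp
    qed
    have normf: "cmod (f (cover y)) = cmod (fst y) ^ r * (\<kappa> (cmod (snd y)) * cmod (snd y) powr (- (N + m * \<alpha>)))" if y: "snd y \<noteq> 0" for y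
    proof -
      have "cmod (snd y) powr (N + m * \<alpha>) * cmod (f (cover y)) = cmod (snd y ^ N * (symb \<alpha> (cover y) * f (cover y)))"
        using y by (simp add: norm_mult norm_power symb_eq norm_cover_powr powr_add powr_realpow)
      also have "\<dots> = cmod (fst y) ^ r * \<kappa> (cmod (snd y))"
        unfolding fc using \<kappa>0 by (simp add: norm_mult norm_power)
      finally have "cmod (f (cover y)) = cmod (fst y) ^ r * \<kappa> (cmod (snd y)) / cmod (snd y) powr (N + m * \<alpha>)"
        using y by (simp add: eq_divide_eq mult.commute)
      then show ?thesis by (simp only: powr_minus_divide times_divide_eq_right mult_1_right mult.assoc)
    qed
    have Hf: "(\<integral>\<^sup>+z. ennreal (cmod (f z) powr p) * indicator H z \<partial>lborel) = ennreal m * (ennreal A * J)"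
    proof -
      have "(\<integral>\<^sup>+z. ennreal (cmod (f z) powr p) * indicator H z \<partial>lborel)
        = ennreal m * (\<integral>\<^sup>+y. ennreal (cmod (f (cover y)) powr p * cmod (snd y) powr (2 * N)) * indicator D2' y \<partial>lborel)"
        by (rule nn_integral_norm_cover[OF sf])
      also have "(\<integral>\<^sup>+y. ennreal (cmod (f (cover y)) powr p * cmod (snd y) powr (2 * N)) * indicator D2' y \<partial>lborel)
         = (\<integral>\<^sup>+y. (ennreal ((cmod (fst y) ^ r) powr p) * indicator ?D (fst y)) *
            (ennreal (\<kappa> (cmod (snd y)) powr p * cmod (snd y) powr (2 * N - (N + m * \<alpha>) * p)) * indicator ?D (snd y)) \<partial>lborel)"
      proof (rule nn_integral_cong)
        fix y :: "complex \<times> complex"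
        show "ennreal (cmod (f (cover y)) powr p * cmod (snd y) powr (2 * N)) * indicator D2' y
          = (ennreal ((cmod (fst y) ^ r) powr p) * indicator ?D (fst y)) *
            (ennreal (\<kappa> (cmod (snd y)) powr p * cmod (snd y) powr (2 * N - (N + m * \<alpha>) * p)) * indicator ?D (snd y))"
        proof (cases "snd y = 0")
          case True
          then show ?thesis by (cases y) auto
        next
          case False
          have "cmod (f (cover y)) powr p * cmod (snd y) powr (2 * N)
            = (cmod (fst y) ^ r) powr p * (\<kappa> (cmod (snd y)) powr p * cmod (snd y) powr (2 * N - (N + m * \<alpha>) * p))"
          proof -
            have gen: "(X * (K * B powr (- e))) powr p * B powr s = X powr p * (K powr p * B powr (s - e * p))"
              if "X \<ge> 0" "K \<ge> 0" "B > 0" for X K B e s :: real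
              using that by (simp add: powr_mult powr_divide powr_powr powr_diff powr_minus_divide)
            show ?thesis unfolding normf[OF False] by (rule gen) (use \<kappa>0 False in auto)
          qed
          then show ?thesis using False by (cases y) (auto simp: indicator_def ennreal_mult)
        qed
      qed
      also have "\<dots> = ennreal A * J"
        by (subst nn_integral_product[where f = "\<lambda>v. ennreal ((cmod v ^ r) powr p) * indicator ?D v" and
              g = "\<lambda>t. ennreal (\<kappa> (cmod t) powr p * cmod t powr (2 * N - (N + m * \<alpha>) * p)) * indicator ?D t"])
          (auto simp: Aint J_def)
      finally show ?thesis .
    qed
    have fL: "f \<in> Lp_space p H"
      unfolding Lp_space_iff_nn_integral(1)[OF H_borel sf] Hf using fin by (simp add: J_def ennreal_mult_less_top)
    obtain g where g: "g \<in> Bergman_space p H" "AE z in lebesgue_on H. Toeplitz H (symb \<alpha>) f z = g z" "Lp_norm p H g \<le> C0 * Lp_norm p H f"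
      using C0[OF fL] by blast
    have sg: "set_borel_measurable lborel H g"
      using g(1) by (intro set_borel_measurable_holomorphic2[OF H_borel]) (simp add: Bergman_space_def)
    have gL: "g \<in> Lp_space p H" using g(1) by (simp add: Bergman_space_def)
    have si\<kappa>: "set_integrable lborel ?D (\<lambda>s. complex_of_real (\<kappa> (cmod s)))"
    proof -
      have "(\<lambda>s. indicator ?D s *\<^sub>R complex_of_real (\<kappa> (cmod s))) \<in> borel_measurable lborel" by measurable
      then show ?thesis
        by (subst set_integrable_iff_nn_integral) (use \<kappa>0 c_eq in \<open>auto simp: set_borel_measurable_def\<close>)
    qed
    have I\<kappa>: "(LINT s:?D|lborel. complex_of_real (\<kappa> (cmod s))) = of_real (pi * c)"
    proof -
      have "integral\<^sup>L lborel (\<lambda>s. indicator ?D s *\<^sub>R \<kappa> (cmod s)) = pi * c"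
      proof (rule integral_eq_nn_integral[THEN trans])
        have "(\<integral>\<^sup>+s. ennreal (indicator ?D s *\<^sub>R \<kappa> (cmod s)) \<partial>lborel) = ennreal (pi * c)"
          unfolding c_eq[symmetric] by (intro nn_integral_cong) (auto simp: indicator_def)
        then show "enn2real (\<integral>\<^sup>+s. ennreal (indicator ?D s *\<^sub>R \<kappa> (cmod s)) \<partial>lborel) = pi * c" using c by simp
      qed (use \<kappa>0 in auto)
      then show ?thesis
        unfolding set_lebesgue_integral_def by (simp add: scaleR_conv_of_real flip: of_real_mult)
    qed
    have pw: "(\<lambda>v. v ^ r) holomorphic_on ?D" "set_integrable lborel ?D (\<lambda>v. v ^ r)"
    proof -
      show h: "(\<lambda>v. v ^ r) holomorphic_on ?D" by (intro holomorphic_intros)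
      have "(\<integral>\<^sup>+v. ennreal ((cmod (v ^ r))\<^sup>2) * indicator ?D v \<partial>lborel) \<le> (\<integral>\<^sup>+v. 1 * indicator ?D v \<partial>lborel)"
        by (intro nn_integral_mono) (auto simp: indicator_def norm_power ennreal_le_1 intro!: power_le_one)
      then show "set_integrable lborel ?D (\<lambda>v. v ^ r)"
        by (intro L2_imp_integrable_disc set_borel_measurable_continuous continuous_intros)
          (auto simp: emeasure_unit_disc intro: le_less_trans)
    qed
    \<comment> \<open>An explicit version of the transform, given at every point. The Bergman space
      function \<open>g\<close> agrees with it almost everywhere, which suffices for the
      norms.\<close>
    define Gf where "Gf = (\<lambda>z. LINT w:H|lborel. hartogs_kernel z w * (symb \<alpha> w * f w))"
    have sphi: "set_borel_measurable lborel H (\<lambda>w. symb \<alpha> w * f w)"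
      by (intro set_borel_measurable_mult borel_imp_set_borel symb_measurable f H_borel)
    have Gf: "Gf (cover x) = of_real c * fst x ^ r * (1 / snd x ^ N)" if x: "x \<in> D2'" for x
    proof -
      have xx: "cmod (fst x) < 1" "cmod (snd x) < 1" using x by auto
      have "set_integrable lborel D2 (\<lambda>y. snd y ^ N * (symb \<alpha> (cover y) * f (cover y)))"
        unfolding fc by (rule set_integral_bidisc_product(1)[OF pw(2) si\<kappa>])
      then have "Gf (cover x) = (LINT y:D2|lborel. bidisc_kernel x y * (fst y ^ r * of_real (\<kappa> (cmod (snd y))))) / snd x ^ N"
        using integral_hartogs_kernel(2)[OF sphi x] by (simp add: Gf_def fc)
      also have "(LINT y:D2|lborel. bidisc_kernel x y * (fst y ^ r * of_real (\<kappa> (cmod (snd y)))))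
         = (LINT y:D2|lborel. (fst y ^ r / (pi * (1 - fst x * cnj (fst y))\<^sup>2)) * (1 / (pi * (1 - snd x * cnj (snd y))\<^sup>2) * of_real (\<kappa> (cmod (snd y)))))"
        by (simp add: bidisc_kernel_def mult_ac)
      also have "\<dots> = (LINT v:?D|lborel. v ^ r / (pi * (1 - fst x * cnj v)\<^sup>2)) * (LINT t:?D|lborel. 1 / (pi * (1 - snd x * cnj t)\<^sup>2) * of_real (\<kappa> (cmod t)))"
      proof (rule set_integral_bidisc_product(2)[OF _ radial_disc_kernel_integral(1)[OF si\<kappa> xx(2)]])
        have "set_integrable lborel ?D (\<lambda>v. 1 / (pi * (1 - fst x * cnj v)\<^sup>2) * v ^ r)"
        proof (rule set_integrable_bounded_mult[OF pw(2)])
          show "set_borel_measurable lborel ?D (\<lambda>s. 1 / (pi * (1 - fst x * cnj s)\<^sup>2))"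
            using xx by (intro set_borel_measurable_continuous continuous_intros) (auto simp: mult_cnj_neq_one)
          show "cmod (1 / (pi * (1 - fst x * cnj s)\<^sup>2)) \<le> 1 / (pi * (1 - cmod (fst x))\<^sup>2)" if "s \<in> ?D" for s
            using that xx by (intro norm_disc_kernel_le) auto
        qed
        then show "set_integrable lborel ?D (\<lambda>v. v ^ r / (pi * (1 - fst x * cnj v)\<^sup>2))" by simp
      qed
      also have "\<dots> = fst x ^ r * of_real c"
        unfolding bergman_disc_reproducing[OF pw xx(1), symmetric] radial_disc_kernel_integral(2)[OF si\<kappa> xx(2)] I\<kappa> by simp
      finally show ?thesis by simp
    qed
    have holGf: "holomorphic2_on Gf H"
    proof (rule holomorphic2_on_descend)
      have "(\<lambda>t. 1 / t ^ N) holomorphic_on - {0}" by (intro holomorphic_intros) auto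
      then have 1: "holomorphic2_on (\<lambda>x. 1 / snd x ^ N) D2'"
        by (rule holomorphic2_on_field_compose[OF _ _ _ holomorphic2_on_snd]) auto
      have 2: "holomorphic2_on (\<lambda>x. fst x ^ r) D2'"
        by (rule holomorphic2_on_field_compose[OF _ open_UNIV _ holomorphic2_on_fst, of "\<lambda>w. w ^ r"])
          (auto intro!: holomorphic_intros)
      show "holomorphic2_on (\<lambda>x. of_real c * fst x ^ r * (1 / snd x ^ N)) D2'"
        by (intro holomorphic2_on_mult holomorphic2_on_const 1 2)
    qed (rule Gf)
    have sGf: "set_borel_measurable lborel H Gf" by (rule set_borel_measurable_holomorphic2[OF H_borel holGf])
    have HGf: "(\<integral>\<^sup>+z. ennreal (cmod (Gf z) powr p) * indicator H z \<partial>lborel) = ennreal m * (ennreal A * (ennreal (c powr p) * I))"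
    proof -
      have "(\<integral>\<^sup>+z. ennreal (cmod (Gf z) powr p) * indicator H z \<partial>lborel)
        = ennreal m * (\<integral>\<^sup>+y. ennreal (cmod (Gf (cover y)) powr p * cmod (snd y) powr (2 * N)) * indicator D2' y \<partial>lborel)"
        by (rule nn_integral_norm_cover[OF sGf])
      also have "(\<integral>\<^sup>+y. ennreal (cmod (Gf (cover y)) powr p * cmod (snd y) powr (2 * N)) * indicator D2' y \<partial>lborel)
         = (\<integral>\<^sup>+y. (ennreal ((cmod (fst y) ^ r) powr p) * indicator ?D (fst y)) *
            (ennreal (c powr p) * (ennreal (cmod (snd y) powr (2 * N - N * p)) * indicator ?D (snd y))) \<partial>lborel)"
      proof (rule nn_integral_cong)
        fix y :: "complex \<times> complex"
        show "ennreal (cmod (Gf (cover y)) powr p * cmod (snd y) powr (2 * N)) * indicator D2' y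
          = (ennreal ((cmod (fst y) ^ r) powr p) * indicator ?D (fst y)) *
            (ennreal (c powr p) * (ennreal (cmod (snd y) powr (2 * N - N * p)) * indicator ?D (snd y)))"
        proof (cases "y \<in> D2'")
          case True
          then have nz: "snd y \<noteq> 0" by auto
          have "cmod (Gf (cover y)) powr p * cmod (snd y) powr (2 * N)
            = (cmod (fst y) ^ r) powr p * (c powr p * cmod (snd y) powr (2 * N - N * p))"
            unfolding Gf[OF True] using c nz
            by (simp add: norm_mult norm_divide norm_power powr_mult powr_divide powr_realpow[symmetric, of "cmod (snd y)"] powr_powr powr_diff)
          then show ?thesis using True by (cases y) (auto simp: indicator_def ennreal_mult)
        next
          case False
          then show ?thesis by (cases y) (auto simp: indicator_def)
        qed
      qed
      also have "\<dots> = ennreal A * (ennreal (c powr p) * I)"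
        by (subst nn_integral_product[where f = "\<lambda>v. ennreal ((cmod v ^ r) powr p) * indicator ?D v" and
              g = "\<lambda>t. ennreal (c powr p) * (ennreal (cmod t powr (2 * N - N * p)) * indicator ?D t)"])
          (auto simp: Aint I_def nn_integral_cmult)
      finally show ?thesis .
    qed
    have Hg: "(\<integral>\<^sup>+z. ennreal (cmod (g z) powr p) * indicator H z \<partial>lborel) = (\<integral>\<^sup>+z. ennreal (cmod (Gf z) powr p) * indicator H z \<partial>lborel)"
    proof -
      have "AE z in lebesgue_on H. g z = Gf z"
        using g(2) AE_space
        by eventually_elim (use Toeplitz_eq(1)[OF mf f] in \<open>simp add: Gf_def\<close>)
      then have "AE z in lborel. z \<in> H \<longrightarrow> g z = Gf z"
        using H_borel by (simp add: AE_restrict_space_iff AE_completion_iff)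
      then show ?thesis by (intro nn_integral_cong_AE, eventually_elim) (auto simp: indicator_def)
    qed
    have "ennreal (integral\<^sup>L (lebesgue_on H) (\<lambda>z. cmod (g z) powr p))
        \<le> ennreal (\<bar>C0\<bar> powr p) * ennreal (integral\<^sup>L (lebesgue_on H) (\<lambda>z. cmod (f z) powr p))"
    proof -
      \<comment> \<open>The constant \<open>C0\<close> of the boundedness statement may be negative,
        so its absolute value is taken before raising to the power \<open>p\<close>.\<close>
      define X Y where "X = integral\<^sup>L (lebesgue_on H) (\<lambda>z. cmod (g z) powr p)" and "Y = integral\<^sup>L (lebesgue_on H) (\<lambda>z. cmod (f z) powr p)"
      have XY: "X \<ge> 0" "Y \<ge> 0" by (auto simp: X_def Y_def)
      have "X powr (1 / p) \<le> C0 * Y powr (1 / p)" using g(3) by (simp add: Lp_norm_def X_def Y_def)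
      also have "\<dots> \<le> \<bar>C0\<bar> * Y powr (1 / p)" by (intro mult_right_mono) auto
      finally have "(X powr (1 / p)) powr p \<le> (\<bar>C0\<bar> * Y powr (1 / p)) powr p" using p by (intro powr_mono2) auto
      then have "X \<le> \<bar>C0\<bar> powr p * Y" using p XY by (simp add: powr_powr powr_mult)
      then show ?thesis using XY unfolding X_def[symmetric] Y_def[symmetric]
        by (simp add: ennreal_mult[symmetric] ennreal_leI)
    qed
    then have "ennreal m * (ennreal A * (ennreal (c powr p) * I)) \<le> ennreal (\<bar>C0\<bar> powr p) * (ennreal m * (ennreal A * J))"
      unfolding Lp_space_iff_nn_integral(2)[OF H_borel sg gL] Lp_space_iff_nn_integral(2)[OF H_borel sf fL] Hg HGf Hf .
    then have "ennreal (m * A) * (ennreal (c powr p) * I) \<le> ennreal (m * A) * (ennreal (\<bar>C0\<bar> powr p) * J)"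
      using A by (simp add: ennreal_mult mult_ac)
    then show "ennreal (c powr p) * I \<le> ennreal (\<bar>C0\<bar> powr p) * J"
      using A m by (subst (asm) ennreal_mult_le_mult_iff) auto
  qed simp
qed

text \<open>The transform of every admissible test function is a multiple of
  \<open>v ^ r / t ^ N\<close>. A harmless \<open>\<kappa>\<close> with nonzero mean thus forces
  this function into Lp of the lifted measure.\<close>

lemma Toeplitz_bounded_imp_upper:
  fixes p \<alpha> :: real
  assumes bdd: "Toeplitz_maps_boundedly p H (symb \<alpha>)" and p: "p \<ge> 1" and \<alpha>: "\<alpha> \<ge> 0" and co: "coprime m n"
  shows "real N * p < 2 * real N + 2"
proof (rule ccontr)
  assume "\<not> ?thesis"
  then have le: "real (2 * N) - real N * p \<le> -2" by simp
  obtain r Q where rQ: "m * Q = N + n * r" "Q > 0" using monomial_exponents[OF co] .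
  obtain C where C: "C \<ge> 0"
    "\<And>c \<kappa>. \<kappa> \<in> borel_measurable borel \<Longrightarrow> (\<And>t :: real. \<kappa> t \<ge> (0 :: real)) \<Longrightarrow> \<kappa> 0 = 0 \<Longrightarrow> c \<ge> 0 \<Longrightarrow>
      (\<integral>\<^sup>+t. ennreal (\<kappa> (cmod t)) * indicator (ball 0 1) t \<partial>lborel) = ennreal (pi * c) \<Longrightarrow>
      (\<integral>\<^sup>+t. ennreal (\<kappa> (cmod t) powr p * cmod t powr (2 * N - (N + m * \<alpha>) * p)) * indicator (ball 0 1) t \<partial>lborel) < \<infinity> \<Longrightarrow>
      ennreal (c powr p) * (\<integral>\<^sup>+t. ennreal (cmod t powr (2 * N - N * p)) * indicator (ball 0 1) t \<partial>lborel)
        \<le> ennreal C * (\<integral>\<^sup>+t. ennreal (\<kappa> (cmod t) powr p * cmod t powr (2 * N - (N + m * \<alpha>) * p)) * indicator (ball 0 1) t \<partial>lborel)"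
    using monomial_test[OF bdd p rQ] by blast
  \<comment> \<open>With \<open>\<kappa> t = t powr e\<close> the negative power in the norm of the
    test function is cancelled and the integrand is just \<open>cmod t powr (2 * N)\<close>.\<close>
  define e where "e = N + m * \<alpha>"
  have e: "e \<ge> 0" using \<alpha> by (simp add: e_def)
  have "(x powr e) powr p * x powr (2 * N - e * p) = x powr (2 * N)" if "x \<ge> 0" for x :: real
    using that by (cases "x = 0") (simp_all add: powr_powr powr_add[symmetric])
  then have J: "(\<integral>\<^sup>+t. ennreal ((cmod t powr e) powr p * cmod t powr (2 * N - e * p)) * indicator (ball 0 1) t \<partial>lborel) < \<infinity>"
    using disc_nn_integral_powr[of "real (2 * N)"] by simp
  have "ennreal ((2 / (e + 2)) powr p) * (\<integral>\<^sup>+t. ennreal (cmod t powr (2 * N - N * p)) * indicator (ball 0 1) t \<partial>lborel)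
     \<le> ennreal C * (\<integral>\<^sup>+t. ennreal ((cmod t powr e) powr p * cmod t powr (2 * N - e * p)) * indicator (ball 0 1) t \<partial>lborel)"
    unfolding e_def
  proof (rule C(2))
    show "(\<integral>\<^sup>+t. ennreal (cmod t powr (N + m * \<alpha>)) * indicator (ball 0 1) t \<partial>lborel) = ennreal (pi * (2 / (N + m * \<alpha> + 2)))"
      using disc_nn_integral_powr[of e] e by (simp add: e_def mult.commute)
  qed (use e J in \<open>auto simp: e_def\<close>)
  also have "\<dots> < \<infinity>" using J by (simp add: ennreal_mult_less_top)
  finally show False
    unfolding disc_nn_integral_powr_infinite[OF le] using e by (simp add: ennreal_mult_top)
qed

text \<open>If the bound fails, \<open>\<kappa> t = t powr (-2)\<close> truncated at
  \<open>\<epsilon>\<close> has mean \<open>M\<close> of the size of a logarithm, while the p-th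
  power integral of the test function is at most \<open>pi * M\<close>. Boundedness would give
  \<open>M powr p\<close> at most a constant times \<open>M\<close>, impossible for large
  \<open>M\<close> as \<open>p > 1\<close>.\<close>

lemma Toeplitz_bounded_imp_lower:
  fixes p \<alpha> :: real
  assumes bdd: "Toeplitz_maps_boundedly p H (symb \<alpha>)" and p: "p > 1" and \<alpha>: "\<alpha> \<ge> 0" and co: "coprime m n"
  shows "2 * real N + 2 < p * (real N + 2 + m * \<alpha>)"
proof (rule ccontr)
  assume "\<not> ?thesis"
  then have le: "-2 \<le> real (2 * N) - (N + m * \<alpha>) * p - 2 * p" by (simp add: algebra_simps)
  obtain r Q where rQ: "m * Q = N + n * r" "Q > 0" using monomial_exponents[OF co] .
  have p1: "p \<ge> 1" using p by simp
  obtain C where C: "C \<ge> 0"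
    "\<And>c \<kappa>. \<kappa> \<in> borel_measurable borel \<Longrightarrow> (\<And>t :: real. \<kappa> t \<ge> (0 :: real)) \<Longrightarrow> \<kappa> 0 = 0 \<Longrightarrow> c \<ge> 0 \<Longrightarrow>
      (\<integral>\<^sup>+t. ennreal (\<kappa> (cmod t)) * indicator (ball 0 1) t \<partial>lborel) = ennreal (pi * c) \<Longrightarrow>
      (\<integral>\<^sup>+t. ennreal (\<kappa> (cmod t) powr p * cmod t powr (2 * N - (N + m * \<alpha>) * p)) * indicator (ball 0 1) t \<partial>lborel) < \<infinity> \<Longrightarrow>
      ennreal (c powr p) * (\<integral>\<^sup>+t. ennreal (cmod t powr (2 * N - N * p)) * indicator (ball 0 1) t \<partial>lborel)
        \<le> ennreal C * (\<integral>\<^sup>+t. ennreal (\<kappa> (cmod t) powr p * cmod t powr (2 * N - (N + m * \<alpha>) * p)) * indicator (ball 0 1) t \<partial>lborel)"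
    using monomial_test[OF bdd p1 rQ] by blast
  have bound: "M powr (p - 1) \<le> C * (real N + 1)" if M: "M > 0" for M :: real
  proof -
    \<comment> \<open>Solves \<open>2 * pi * ln (1 / \<epsilon>) = pi * M\<close>, so that
      \<open>M\<close> is the mean of \<open>\<kappa>\<close> over the disc.\<close>
    define \<epsilon> where "\<epsilon> = exp (- (M / 2))"
    have \<epsilon>: "0 < \<epsilon>" "\<epsilon> < 1" using M by (auto simp: \<epsilon>_def)
    have ln\<epsilon>: "2 * pi * ln (1 / \<epsilon>) = pi * M" by (simp add: \<epsilon>_def ln_div)
    note tr = disc_nn_integral_powr_truncated[OF \<epsilon>, unfolded ln\<epsilon>]
    define \<kappa> where "\<kappa> = (\<lambda>x::real. x powr (-2) * indicator {\<epsilon><..} x)"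
    let ?J = "\<integral>\<^sup>+t. ennreal (\<kappa> (cmod t) powr p * cmod t powr (2 * N - (N + m * \<alpha>) * p)) * indicator (ball 0 1) t \<partial>lborel"
    have "?J \<le> (\<integral>\<^sup>+t. ennreal (cmod t powr (-2) * indicator {\<epsilon><..} (cmod t)) * indicator (ball 0 1) t \<partial>lborel)"
    proof (rule nn_integral_mono)
      fix t :: complex
      show "ennreal (\<kappa> (cmod t) powr p * cmod t powr (2 * N - (N + m * \<alpha>) * p)) * indicator (ball 0 1) t
         \<le> ennreal (cmod t powr (-2) * indicator {\<epsilon><..} (cmod t)) * indicator (ball 0 1) t"
      proof (cases "\<epsilon> < cmod t \<and> cmod t < 1")
        case True
        have "(cmod t powr (-2)) powr p * cmod t powr (2 * N - (N + m * \<alpha>) * p) = cmod t powr (real (2 * N) - (N + m * \<alpha>) * p - 2 * p)"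
          unfolding powr_powr powr_add[symmetric] by (simp add: algebra_simps)
        also have "\<dots> \<le> cmod t powr (-2)" using True le by (intro powr_mono') auto
        finally show ?thesis using True by (simp add: \<kappa>_def ennreal_leI)
      qed (auto simp: \<kappa>_def indicator_def)
    qed
    also have "\<dots> = ennreal (pi * M)" by (rule tr)
    finally have J: "?J \<le> ennreal (pi * M)" .
    have "ennreal (M powr p) * ennreal (pi / (real N + 1)) \<le> ennreal (M powr p) * (\<integral>\<^sup>+t. ennreal (cmod t powr (real (2 * N) - real N * p)) * indicator (ball 0 1) t \<partial>lborel)"
    proof (rule mult_left_mono)
      have "ennreal (pi / (real N + 1)) = (\<integral>\<^sup>+t. ennreal (cmod t powr (real (2 * N))) * indicator (ball 0 1) t \<partial>lborel)"
      proof -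
        have "2 * pi / (real (2 * N) + 2) = pi / (real N + 1)"
          using nonzero_mult_divide_mult_cancel_left[of 2 pi "real N + 1"] by (simp only: of_nat_mult of_nat_numeral distrib_left mult_1_right mult_1 semiring_norm) simp
        then show ?thesis using disc_nn_integral_powr[of "real (2 * N)"] by simp
      qed
      also have "\<dots> \<le> (\<integral>\<^sup>+t. ennreal (cmod t powr (real (2 * N) - real N * p)) * indicator (ball 0 1) t \<partial>lborel)"
      proof (rule nn_integral_mono)
        fix t :: complex
        have "real (2 * N) - real N * p \<le> real (2 * N)" using p by simp
        then have "cmod t powr real (2 * N) \<le> cmod t powr (real (2 * N) - real N * p)" if "cmod t \<le> 1"
          using that by (intro powr_mono') simp_all
        then show "ennreal (cmod t powr real (2 * N)) * indicator (ball 0 1) t \<le> ennreal (cmod t powr (real (2 * N) - real N * p)) * indicator (ball 0 1) t"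
          by (cases "cmod t < 1") (simp_all add: ennreal_leI)
      qed
      finally show "ennreal (pi / (real N + 1)) \<le> \<dots>" .
    qed simp
    also have "\<dots> \<le> ennreal C * ?J"
    proof (rule C(2))
      show "(\<integral>\<^sup>+t. ennreal (\<kappa> (cmod t)) * indicator (ball 0 1) t \<partial>lborel) = ennreal (pi * M)"
        using tr by (simp add: \<kappa>_def)
      show "?J < \<infinity>" using J by (rule le_less_trans) simp
      show "\<kappa> \<in> borel_measurable borel" unfolding \<kappa>_def by measurable
    qed (use M \<epsilon> in \<open>auto simp: \<kappa>_def\<close>)
    also have "\<dots> \<le> ennreal C * ennreal (pi * M)" by (intro mult_left_mono J) simp
    finally have "M powr p * (pi / (real N + 1)) \<le> C * (pi * M)"
      using C(1) M by (simp add: ennreal_mult[symmetric])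
    then have "pi * (M powr p) \<le> pi * (C * (real N + 1) * M)" by (simp add: field_simps)
    then have "M powr p \<le> C * (real N + 1) * M" by (rule mult_left_le_imp_le) simp
    moreover have "M powr p = M powr (p - 1) * M" using M by (simp add: powr_diff)
    ultimately show ?thesis using M by simp
  qed
  \<comment> \<open>Exceeds the bound on \<open>M powr (p - 1)\<close> by one; it is attained at
    \<open>M = K powr (1 / (p - 1))\<close>.\<close>
  define K where "K = C * (real N + 1) + 1"
  have K: "K > 0" using C(1) by (simp add: K_def add_nonneg_pos)
  have "(K powr (1 / (p - 1))) powr (p - 1) \<le> C * (real N + 1)" using K by (intro bound) simp
  then show False using K p by (simp add: powr_powr K_def)
qed

end

section \<open>The exponent \<open>p = 1\<close>\<close>

text \<open>The one-variable mean value property is applied in the second and then in the first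
  variable; almost every slice is integrable by Fubini.\<close>

lemma ball_product_mean_value:
  fixes f :: "complex \<times> complex \<Rightarrow> complex"
  assumes hol: "holomorphic2_on f (ball a R \<times> ball b S)" and R: "R > 0" and S: "S > 0"
    and int: "set_integrable lborel (ball a R \<times> ball b S) f"
  shows "(LINT x:ball a R \<times> ball b S|lborel. f x) = (pi * complex_of_real (R\<^sup>2)) * (pi * complex_of_real (S\<^sup>2)) * f (a, b)"
proof -
  define h where "h = (\<lambda>x. indicator (ball a R \<times> ball b S) x *\<^sub>R f x)"
  have h: "integrable (lborel \<Otimes>\<^sub>M lborel) h" using int by (simp add: set_integrable_def h_def lborel_prod)
  have bb: "b \<in> ball b S" using S by simp
  define k where "k = (\<lambda>v. indicator (ball a R) v *\<^sub>R ((pi * complex_of_real (S\<^sup>2)) * f (v, b)))"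
  have hb: "(\<lambda>v. f (v, b)) holomorphic_on ball a R" by (rule holomorphic2_on_slices(1)[OF hol bb])
  have k: "k \<in> borel_measurable lborel"
    unfolding k_def by (simp, intro borel_measurable_continuous_on_indicator continuous_intros holomorphic_on_imp_continuous_on hb) auto
  have m: "(\<lambda>v. LINT t|lborel. h (v, t)) \<in> borel_measurable lborel"
    by (rule borel_measurable_integrable[OF lborel_pair.integrable_fst'[OF h]])
  have AE: "AE v in lborel. (LINT t|lborel. h (v, t)) = k v"
    using lborel_pair.AE_integrable_fst'[OF h]
  proof eventually_elim
    case (elim v)
    show ?case
    proof (cases "v \<in> ball a R")
      case True
      have i: "set_integrable lborel (ball b S) (\<lambda>t. f (v, t))"
        using elim True by (simp add: set_integrable_def h_def indicator_times)
      have "(LINT t|lborel. h (v, t)) = (LINT t:ball b S|lborel. f (v, t))"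
        using True by (simp add: set_lebesgue_integral_def h_def indicator_times)
      then show ?thesis
        using ball_mean_value[OF holomorphic2_on_slices(2)[OF hol True] S i] True by (simp add: k_def)
    qed (simp add: h_def k_def indicator_times)
  qed
  \<comment> \<open>Integrability of the slice at the centre \<open>b\<close> is inherited from the
    inner integral, with which it agrees almost everywhere.\<close>
  have ik: "integrable lborel k"
    using lborel_pair.integrable_fst'[OF h] integrable_cong_AE[OF m k AE] by simp
  have ik': "set_integrable lborel (ball a R) (\<lambda>v. (pi * complex_of_real (S\<^sup>2)) * f (v, b))"
    using ik by (simp add: set_integrable_def k_def)
  have "(LINT x:ball a R \<times> ball b S|lborel. f x) = (LINT v|lborel. LINT t|lborel. h (v, t))"
    using lborel_pair.integral_fst'[OF h] by (simp add: set_lebesgue_integral_def h_def lborel_prod)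
  also have "\<dots> = integral\<^sup>L lborel k" by (rule integral_cong_AE[OF m k AE])
  also have "\<dots> = (LINT v:ball a R|lborel. (pi * complex_of_real (S\<^sup>2)) * f (v, b))"
    by (simp only: set_lebesgue_integral_def k_def)
  also have "\<dots> = pi * complex_of_real (R\<^sup>2) * ((pi * complex_of_real (S\<^sup>2)) * f (a, b))"
    using ball_mean_value[OF holomorphic_on_mult[OF holomorphic_on_const hb] R ik'] by simp
  finally show ?thesis by (simp add: mult.assoc)
qed

lemma emeasure_ball_complex: "R > 0 \<Longrightarrow> emeasure lborel (ball (c::complex) R) = ennreal (pi * R\<^sup>2)"
  using nn_integral_ball_affine[of "\<lambda>_. 1" c R] borel_measurable_indicator[of "ball c R" borel]
  by (simp add: emeasure_unit_disc ennreal_mult'[symmetric] mult.commute)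

text \<open>After integration over the angle the radial integrand has a logarithm as antiderivative.
  The resulting growth as \<open>\<sigma>\<close> tends to \<open>1\<close> is what rules out
  \<open>p = 1\<close>.\<close>

lemma disc_nn_integral_inverse_square:
  assumes \<sigma>: "0 < \<sigma>" "\<sigma> < 1"
  shows "(\<integral>\<^sup>+t. ennreal (1 / (cmod (1 - t * complex_of_real \<sigma>))\<^sup>2) * indicator (ball 0 1) t \<partial>lborel) = ennreal (pi / \<sigma>\<^sup>2 * - ln (1 - \<sigma>\<^sup>2))"
proof -
  have "cmod (1 - t * complex_of_real \<sigma>) = cmod (1 - complex_of_real \<sigma> * cnj t)" for t
    by (metis complex_cnj_complex_of_real complex_cnj_diff complex_cnj_mult complex_cnj_one complex_mod_cnj mult.commute)
  then have "(\<integral>\<^sup>+t. ennreal (1 / (cmod (1 - t * complex_of_real \<sigma>))\<^sup>2) * indicator (ball 0 1) t \<partial>lborel)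
    = (\<integral>\<^sup>+t. 1 * ennreal (1 / (cmod (1 - complex_of_real \<sigma> * cnj t))\<^sup>2) * indicator (ball 0 1) t \<partial>lborel)" by simp
  also have "\<dots> = (\<integral>\<^sup>+r. 1 * ennreal (2 * pi * r / (1 - (cmod (complex_of_real \<sigma>))\<^sup>2 * r\<^sup>2)) * indicator {0<..<1} r \<partial>lborel)"
    by (rule disc_nn_integral_radial_kernel[where \<rho> = "\<lambda>_. 1"]) (use \<sigma> in auto)
  also have "\<dots> = (\<integral>\<^sup>+r. ennreal (2 * pi * r / (1 - \<sigma>\<^sup>2 * r\<^sup>2)) * indicator {0<..<1} r \<partial>lborel)"
    by simp
  also have "\<dots> = ennreal (pi / \<sigma>\<^sup>2 * - ln (1 - \<sigma>\<^sup>2 * 1\<^sup>2) - pi / \<sigma>\<^sup>2 * - ln (1 - \<sigma>\<^sup>2 * 0\<^sup>2))"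
  proof (rule nn_integral_FTC_interior)
    have pos: "1 - \<sigma>\<^sup>2 * r\<^sup>2 > 0" if "0 \<le> r" "r \<le> 1" for r
    proof -
      have "\<sigma>\<^sup>2 * r\<^sup>2 \<le> \<sigma>\<^sup>2" using that by (intro mult_right_le_one_le) (auto simp: power_le_one)
      moreover have "\<sigma>\<^sup>2 < 1" using \<sigma> by (simp add: abs_square_less_1)
      ultimately show ?thesis by linarith
    qed
    show "continuous_on {0..1} (\<lambda>r. pi / \<sigma>\<^sup>2 * - ln (1 - \<sigma>\<^sup>2 * r\<^sup>2))"
      using pos by (intro continuous_intros) (auto simp: less_imp_neq[symmetric])
    show "((\<lambda>r. pi / \<sigma>\<^sup>2 * - ln (1 - \<sigma>\<^sup>2 * r\<^sup>2)) has_real_derivative 2 * pi * r / (1 - \<sigma>\<^sup>2 * r\<^sup>2)) (at r)"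
      if "r \<in> {0<..<1}" for r
      using pos[of r] that \<sigma> by (auto intro!: derivative_eq_intros simp: power4_eq_xxxx power2_eq_square)
    show "0 \<le> 2 * pi * r / (1 - \<sigma>\<^sup>2 * r\<^sup>2)" if "r \<in> {0<..<1}" for r
      using pos[of r] that by auto
  qed simp
  finally show ?thesis by simp
qed

context hartogs_cover
begin

text \<open>Hermitian symmetry, obtained by letting the kernel functions at \<open>z\<close> and
  \<open>w\<close> reproduce each other.\<close>

lemma cnj_hartogs_kernel:
  assumes "z \<in> H" "w \<in> H"
  shows "cnj (hartogs_kernel z w) = hartogs_kernel w z"
proof -
  have "cnj (hartogs_kernel z w) = integral\<^sup>L (lebesgue_on H) (\<lambda>u. hartogs_kernel w u * cnj (hartogs_kernel z u))"
    by (rule hartogs_kernel_reproducing[OF cnj_hartogs_kernel_mem[OF assms(1)] assms(2)])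
  also have "(\<lambda>u. hartogs_kernel w u * cnj (hartogs_kernel z u)) = (\<lambda>u. cnj (hartogs_kernel z u * cnj (hartogs_kernel w u)))"
    by (simp add: mult.commute)
  also have "integral\<^sup>L (lebesgue_on H) \<dots> = cnj (integral\<^sup>L (lebesgue_on H) (\<lambda>u. hartogs_kernel z u * cnj (hartogs_kernel w u)))"
    by (rule Bochner_Integration.integral_cnj)
  also have "integral\<^sup>L (lebesgue_on H) (\<lambda>u. hartogs_kernel z u * cnj (hartogs_kernel w u)) = cnj (hartogs_kernel w z)"
    by (rule hartogs_kernel_reproducing[OF cnj_hartogs_kernel_mem[OF assms(2)] assms(1), symmetric])
  finally show ?thesis by simp
qed

lemma hartogs_kernel_measurable_left:
  assumes "w \<in> H"
  shows "set_borel_measurable lborel H (\<lambda>z. hartogs_kernel z w)"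
proof -
  have "(\<lambda>z. indicator H z *\<^sub>R hartogs_kernel z w) = (\<lambda>z. indicator H z *\<^sub>R cnj (hartogs_kernel w z))"
    using cnj_hartogs_kernel[OF assms] by (intro ext) (auto simp: indicator_def)
  then show ?thesis
    using set_borel_measurable_holomorphic2[OF H_borel holomorphic2_on_cnj_hartogs_kernel[OF assms]]
    by (simp add: set_borel_measurable_def)
qed

text \<open>The second radius is at most \<open>1 / 4\<close>, so \<open>cmod w > 1 / 4\<close>. The
  first radius is chosen for \<open>cmod v powr (m / n) < 1 / 4\<close> and does not depend on
  \<open>\<rho>\<close>.\<close>

lemma polydisc_subset_H:
  assumes \<rho>: "1 / 2 < \<rho>" "\<rho> < 1"
  shows "ball 0 ((1 / 4) powr (n / m)) \<times> ball (complex_of_real \<rho>) ((1 - \<rho>) / 2) \<subseteq> H"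
    and "w \<in> ball (complex_of_real \<rho>) ((1 - \<rho>) / 2) \<Longrightarrow> cmod w > 1 / 4"
proof -
  have w2: "1 / 4 < cmod w" "cmod w < 1" if "w \<in> ball (complex_of_real \<rho>) ((1 - \<rho>) / 2)" for w
    using that \<rho> norm_triangle_ineq2[of "complex_of_real \<rho>" w] norm_triangle_ineq2[of w "complex_of_real \<rho>"]
    by (auto simp: dist_norm norm_minus_commute)
  then show "w \<in> ball (complex_of_real \<rho>) ((1 - \<rho>) / 2) \<Longrightarrow> cmod w > 1 / 4" by blast
  have w1: "cmod v powr (m / n) < 1 / 4" if "cmod v < (1 / 4) powr (n / m)" for v :: complex
  proof -
    have "cmod v powr (m / n) < ((1 / 4) powr (n / m)) powr (m / n)"
      using that m n by (intro powr_less_mono2) auto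
    then show ?thesis using m n by (simp add: powr_powr)
  qed
  show "ball 0 ((1 / 4) powr (n / m)) \<times> ball (complex_of_real \<rho>) ((1 - \<rho>) / 2) \<subseteq> H"
  proof
    fix x :: "complex \<times> complex" assume "x \<in> ball 0 ((1 / 4) powr (n / m)) \<times> ball (complex_of_real \<rho>) ((1 - \<rho>) / 2)"
    then show "x \<in> H" using w1[of "fst x"] w2[of "snd x"] unfolding H_eq by (cases x) auto
  qed
qed

text \<open>For \<open>p = 1\<close>, normalized indicators of polydiscs around \<open>(0, \<rho>)\<close>, divided by the symbol, are mapped
  to the kernel function at \<open>(0, \<rho>)\<close> by the mean value property, so boundedness would bound the
  \<open>L\<^sup>1\<close> norms of the kernel functions.\<close>

lemma Toeplitz_bounded_L1_imp_kernel_bounded: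
  fixes \<alpha> :: real
  assumes bdd: "Toeplitz_maps_boundedly 1 H (symb \<alpha>)" and \<alpha>: "\<alpha> \<ge> 0"
  obtains K where "K \<ge> 0" "\<And>\<rho>. 1 / 2 < \<rho> \<Longrightarrow> \<rho> < 1 \<Longrightarrow>
    (\<integral>\<^sup>+z. ennreal (cmod (hartogs_kernel z (0, complex_of_real \<rho>)) powr 1) * indicator H z \<partial>lborel) \<le> ennreal K"
proof -
  obtain C0 where C0: "\<And>f. f \<in> Lp_space 1 H \<Longrightarrow> \<exists>g\<in>Bergman_space 1 H. (AE z in lebesgue_on H. Toeplitz H (symb \<alpha>) f z = g z) \<and> Lp_norm 1 H g \<le> C0 * Lp_norm 1 H f"
    using bdd unfolding Toeplitz_maps_boundedly_def by blast
  have "(\<integral>\<^sup>+z. ennreal (cmod (hartogs_kernel z (0, complex_of_real \<rho>)) powr 1) * indicator H z \<partial>lborel) \<le> ennreal (\<bar>C0\<bar> * 4 powr \<alpha>)"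
    if \<rho>: "1 / 2 < \<rho>" "\<rho> < 1" for \<rho>
  proof -
    define R S where "R = (1 / 4) powr (n / m :: real)" and "S = (1 - \<rho>) / 2"
    have RS: "R > 0" "S > 0" using \<rho> by (auto simp: R_def S_def)
    define U where "U = ball (0::complex) R \<times> ball (complex_of_real \<rho>) S"
    have UH: "U \<subseteq> H" using polydisc_subset_H(1)[OF \<rho>] by (simp add: U_def R_def S_def)
    have U[measurable]: "U \<in> sets borel" unfolding U_def by (intro borel_open open_Times open_ball)
    define V where "V = (pi * R\<^sup>2) * (pi * S\<^sup>2)"
    have V: "V > 0" using RS by (simp add: V_def)
    have eU: "emeasure lborel U = ennreal V"
      unfolding U_def lborel_prod[symmetric] V_def using RS
      by (subst lborel.emeasure_pair_measure_Times) (auto simp: emeasure_ball_complex ennreal_mult)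
    let ?b = "(0::complex, complex_of_real \<rho>)"
    have bU: "?b \<in> U" using RS by (simp add: U_def)
    then have bH: "?b \<in> H" using UH by blast
    \<comment> \<open>The volume \<open>V\<close> is not divided out here; it reappears as a factor
      of the transform and of the norm bound, and cancels in the last step.\<close>
    define f where "f = (\<lambda>w. complex_of_real (indicator U w * cmod (snd w) powr (- \<alpha>)))"
    have f: "f \<in> borel_measurable borel" unfolding f_def by measurable
    have sf: "set_borel_measurable lborel H f" by (rule borel_imp_set_borel[OF f H_borel])
    have mf: "f \<in> borel_measurable (lebesgue_on H)" by (rule lebesgue_on_integral_eq(1)[OF H_borel sf])
    have Hf: "(\<integral>\<^sup>+z. ennreal (cmod (f z) powr 1) * indicator H z \<partial>lborel) \<le> ennreal (4 powr \<alpha> * V)"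
    proof -
      have "(\<integral>\<^sup>+z. ennreal (cmod (f z) powr 1) * indicator H z \<partial>lborel) \<le> (\<integral>\<^sup>+z. ennreal (4 powr \<alpha>) * indicator U z \<partial>lborel)"
      proof (rule nn_integral_mono)
        fix z
        have "cmod (snd z) powr (- \<alpha>) \<le> 4 powr \<alpha>" if "z \<in> U"
        proof -
          have "cmod (snd z) > 1 / 4" using polydisc_subset_H(2)[OF \<rho>, of "snd z"] that by (auto simp: U_def S_def)
          then have "cmod (snd z) powr (- \<alpha>) \<le> (1 / 4) powr (- \<alpha>)" using \<alpha> by (intro powr_mono2') auto
          then show ?thesis by (simp add: powr_divide powr_minus_divide)
        qed
        then show "ennreal (cmod (f z) powr 1) * indicator H z \<le> ennreal (4 powr \<alpha>) * indicator U z"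
          by (auto simp: f_def indicator_def intro!: ennreal_leI)
      qed
      also have "\<dots> = ennreal (4 powr \<alpha> * V)"
        using V by (subst nn_integral_cmult_indicator) (auto simp: eU ennreal_mult)
      finally show ?thesis .
    qed
    have fL: "f \<in> Lp_space 1 H"
      unfolding Lp_space_iff_nn_integral(1)[OF H_borel sf] using Hf by (rule le_less_trans) simp
    obtain g where g: "g \<in> Bergman_space 1 H" "AE z in lebesgue_on H. Toeplitz H (symb \<alpha>) f z = g z" "Lp_norm 1 H g \<le> C0 * Lp_norm 1 H f"
      using C0[OF fL] by blast
    have sg: "set_borel_measurable lborel H g"
      using g(1) by (intro set_borel_measurable_holomorphic2[OF H_borel]) (simp add: Bergman_space_def)
    have gL: "g \<in> Lp_space 1 H" using g(1) by (simp add: Bergman_space_def)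
    have T: "Toeplitz H (symb \<alpha>) f z = of_real V * hartogs_kernel z ?b" if z: "z \<in> H" for z
    proof -
      \<comment> \<open>The kernel is antiholomorphic in its second argument, so the mean value
        property is applied to its conjugate.\<close>
      have hol: "holomorphic2_on (\<lambda>w. cnj (hartogs_kernel z w)) U"
        using holomorphic2_on_cnj_hartogs_kernel[OF z] UH unfolding holomorphic2_on_def by blast
      note mK = set_borel_measurable_holomorphic2[OF H_borel holomorphic2_on_cnj_hartogs_kernel[OF z]]
      note mKU = set_borel_measurable_holomorphic2[OF U hol]
      have "(\<integral>\<^sup>+w. ennreal ((cmod (cnj (hartogs_kernel z w)))\<^sup>2) * indicator U w \<partial>lborel)
         \<le> (\<integral>\<^sup>+w. ennreal (cmod (cnj (hartogs_kernel z w)) powr 2) * indicator H w \<partial>lborel)"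
        using UH by (intro nn_integral_mono) (auto simp: indicator_def powr_numeral)
      also have "\<dots> < \<infinity>"
        using cnj_hartogs_kernel_mem[OF z] Lp_space_iff_nn_integral(1)[OF H_borel mK] by (simp add: Bergman_space_def)
      finally have iU: "set_integrable lborel U (\<lambda>w. cnj (hartogs_kernel z w))"
        by (intro L2_imp_integrable_finite_measure[OF mKU U]) (simp_all add: eU)
      have "Toeplitz H (symb \<alpha>) f z = (LINT w:H|lborel. hartogs_kernel z w * (symb \<alpha> w * f w))"
        by (rule Toeplitz_eq(1)[OF mf f _ z]) simp
      also have "\<dots> = (LINT w:U|lborel. cnj (cnj (hartogs_kernel z w)))"
        unfolding set_lebesgue_integral_def
      proof (rule Bochner_Integration.integral_cong)
        fix w
        have "symb \<alpha> w * f w = of_real (indicator U w)"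
        proof (cases "w \<in> U")
          case True
          then have "cmod (snd w) > 1 / 4" using polydisc_subset_H(2)[OF \<rho>, of "snd w"] by (auto simp: U_def S_def)
          then have "snd w \<noteq> 0" by auto
          then show ?thesis using True by (simp add: symb_eq f_def powr_minus_divide)
        qed (simp add: f_def)
        then show "indicator H w *\<^sub>R (hartogs_kernel z w * (symb \<alpha> w * f w)) = indicator U w *\<^sub>R cnj (cnj (hartogs_kernel z w))"
          using UH by (auto simp: indicator_def)
      qed simp
      also have "\<dots> = cnj (LINT w:U|lborel. cnj (hartogs_kernel z w))"
        unfolding set_lebesgue_integral_def Bochner_Integration.integral_cnj[symmetric] by simp
      also have "\<dots> = of_real V * hartogs_kernel z ?b"
        using ball_product_mean_value[OF hol[unfolded U_def] RS iU[unfolded U_def]] by (simp add: U_def V_def mult_ac)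
      finally show ?thesis .
    qed
    have AE: "AE z in lborel. z \<in> H \<longrightarrow> g z = of_real V * hartogs_kernel z ?b"
    proof -
      have "AE z in lebesgue_on H. g z = of_real V * hartogs_kernel z ?b"
        using g(2) AE_space by eventually_elim (use T in simp)
      then show ?thesis using H_borel by (simp add: AE_restrict_space_iff AE_completion_iff)
    qed
    note sKb = hartogs_kernel_measurable_left[OF bH]
    have "ennreal V * (\<integral>\<^sup>+z. ennreal (cmod (hartogs_kernel z ?b) powr 1) * indicator H z \<partial>lborel)
       = (\<integral>\<^sup>+z. ennreal V * (ennreal (cmod (hartogs_kernel z ?b) powr 1) * indicator H z) \<partial>lborel)"
      using norm_powr_H_measurable[OF sKb, of 1] by (intro nn_integral_cmult[symmetric]) simp
    also have "\<dots> = (\<integral>\<^sup>+z. ennreal (cmod (g z) powr 1) * indicator H z \<partial>lborel)"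
      using AE by (intro nn_integral_cong_AE, eventually_elim) (use V in \<open>auto simp: indicator_def norm_mult ennreal_mult\<close>)
    also have "\<dots> \<le> ennreal \<bar>C0\<bar> * (\<integral>\<^sup>+z. ennreal (cmod (f z) powr 1) * indicator H z \<partial>lborel)"
    proof -
      define X Y where "X = integral\<^sup>L (lebesgue_on H) (\<lambda>z. cmod (g z) powr 1)" and "Y = integral\<^sup>L (lebesgue_on H) (\<lambda>z. cmod (f z) powr 1)"
      have XY: "X \<ge> 0" "Y \<ge> 0" by (auto simp: X_def Y_def)
      have "X powr (1 / 1) \<le> C0 * Y powr (1 / 1)" using g(3) unfolding Lp_norm_def X_def Y_def .
      then have "X \<le> C0 * Y" using XY by simp
      also have "\<dots> \<le> \<bar>C0\<bar> * Y" using XY by (intro mult_right_mono) auto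
      finally show ?thesis
        unfolding Lp_space_iff_nn_integral(2)[OF H_borel sg gL, symmetric] Lp_space_iff_nn_integral(2)[OF H_borel sf fL, symmetric]
          X_def[symmetric] Y_def[symmetric] using XY by (simp add: ennreal_mult[symmetric] ennreal_leI)
    qed
    also have "\<dots> \<le> ennreal \<bar>C0\<bar> * ennreal (4 powr \<alpha> * V)" by (intro mult_left_mono Hf) simp
    also have "\<dots> = ennreal V * ennreal (\<bar>C0\<bar> * 4 powr \<alpha>)" using V by (simp add: ennreal_mult[symmetric] mult_ac)
    finally show ?thesis using V by (subst (asm) ennreal_mult_le_mult_iff) auto
  qed
  then show ?thesis by (intro that[of "\<bar>C0\<bar> * 4 powr \<alpha>"]) auto
qed

text \<open>Near \<open>snd y = 1\<close> only the summand of the trivial root of unity is large.\<close>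

lemma cover_kernel_axis_lower_bound:
  fixes c \<sigma> :: real and y :: "complex \<times> complex"
  assumes c: "0 < c" "c \<le> 1 / 2" "\<And>\<eta>. \<eta> \<in> roots \<Longrightarrow> \<eta> \<noteq> 1 \<Longrightarrow> 4 * c \<le> cmod (\<eta> - 1)"
    and \<sigma>: "1 - c / 2 < \<sigma>" "\<sigma> < 1" and t: "snd y \<noteq> 0" "cmod (snd y) < 1"
  shows "1 / (cmod (1 - snd y * complex_of_real \<sigma>))\<^sup>2
    \<le> (real m)\<^sup>2 * pi\<^sup>2 * 2 ^ N * (cmod (cover_kernel y (0, complex_of_real \<sigma>)) * cmod (snd y) ^ (2 * N)) + (real m / c\<^sup>2 + 4 / c\<^sup>2)"
proof -
  define t where "t = snd y"
  have t0: "t \<noteq> 0" "cmod t < 1" using t by (auto simp: t_def)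
  have \<sigma>0: "\<sigma> > 0" using \<sigma> c by linarith
  have tt: "cmod (t - t * complex_of_real \<sigma>) \<le> c / 2"
  proof -
    have "t - t * complex_of_real \<sigma> = t * complex_of_real (1 - \<sigma>)" by (simp add: algebra_simps)
    then have "cmod (t - t * complex_of_real \<sigma>) = cmod t * (1 - \<sigma>)" using \<sigma> by (simp add: norm_mult del: of_real_diff)
    also have "\<dots> \<le> 1 * (1 - \<sigma>)" using t0 \<sigma> by (intro mult_right_mono) auto
    finally show ?thesis using \<sigma> by simp
  qed
  show ?thesis
  proof (cases "cmod (1 - t) < c")
    case False
    have "cmod (1 - t * complex_of_real \<sigma>) \<ge> cmod (1 - t) - cmod (t - t * complex_of_real \<sigma>)"
      using norm_triangle_ineq4[of "1 - t * complex_of_real \<sigma>" "t - t * complex_of_real \<sigma>"] by simp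
    then have "c / 2 \<le> cmod (1 - t * complex_of_real \<sigma>)" using False tt by linarith
    then have "(c / 2)\<^sup>2 \<le> (cmod (1 - t * complex_of_real \<sigma>))\<^sup>2" using c by (intro power_mono) auto
    then have "1 / (cmod (1 - t * complex_of_real \<sigma>))\<^sup>2 \<le> 1 / (c / 2)\<^sup>2" using c by (intro frac_le) auto
    also have "\<dots> = 4 / c\<^sup>2" by (simp add: power_divide)
    also have "\<dots> \<le> (real m)\<^sup>2 * pi\<^sup>2 * 2 ^ N * (cmod (cover_kernel y (0, complex_of_real \<sigma>)) * cmod t ^ (2 * N)) + (real m / c\<^sup>2 + 4 / c\<^sup>2)"
      by simp
    finally show ?thesis unfolding t_def .
  next
    case True
    define T where "T = (\<lambda>\<eta>. 1 / (cmod (1 - t * cnj (\<eta> * complex_of_real \<sigma>)))\<^sup>2)"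
    define P where "P = pi\<^sup>2 * (cmod t * \<sigma>) ^ N"
    have P: "P > 0" using t0 \<sigma>0 by (simp add: P_def)
    have kern: "cmod (kern y (rot \<eta> (0, complex_of_real \<sigma>))) = T \<eta> / P" if "\<eta> \<in> roots" for \<eta>
      using norm_roots[OF that] \<sigma>0
      by (simp add: kern_def norm_divide norm_bidisc_kernel_eq norm_mult norm_power T_def P_def rot_def t_def mult_ac)
    have T: "T \<eta> \<le> 1 / c\<^sup>2" if \<eta>: "\<eta> \<in> roots - {1}" for \<eta>
    proof -
      have "cmod (1 - t * cnj (\<eta> * complex_of_real \<sigma>)) = cmod \<eta> * cmod (1 - t * cnj (\<eta> * complex_of_real \<sigma>))"
        using norm_roots \<eta> by simp
      also have "\<dots> = cmod (\<eta> - t * (\<eta> * cnj \<eta>) * complex_of_real \<sigma>)"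
        unfolding norm_mult[symmetric] by (simp add: algebra_simps)
      also have "\<dots> = cmod (\<eta> - t * complex_of_real \<sigma>)" using roots_mult_cnj \<eta> by simp
      \<comment> \<open>The gap \<open>4 * c\<close> loses less than \<open>c\<close> for
        \<open>1 - t\<close> and at most \<open>c / 2\<close> for the factor
        \<open>\<sigma>\<close>, so at least \<open>c\<close> remains.\<close>
      also have "\<dots> \<ge> cmod (\<eta> - 1) - cmod (1 - t) - cmod (t - t * complex_of_real \<sigma>)"
        using norm_triangle_ineq4[of "\<eta> - t * complex_of_real \<sigma>" "(1 - t) + (t - t * complex_of_real \<sigma>)"]
          norm_triangle_ineq[of "1 - t" "t - t * complex_of_real \<sigma>"] by simp
      finally have "c \<le> cmod (1 - t * cnj (\<eta> * complex_of_real \<sigma>))" using c(3)[of \<eta>] \<eta> True tt c(1) by simp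
      then have "c\<^sup>2 \<le> (cmod (1 - t * cnj (\<eta> * complex_of_real \<sigma>)))\<^sup>2" using c by (intro power_mono) auto
      then show ?thesis unfolding T_def using c by (intro frac_le) auto
    qed
    let ?k = "\<lambda>\<eta>. kern y (rot \<eta> (0, complex_of_real \<sigma>))"
    have ck: "of_nat m ^ 2 * cover_kernel y (0, complex_of_real \<sigma>) = ?k 1 + (\<Sum>\<eta>\<in>roots - {1}. ?k \<eta>)"
      using m sum.remove[OF finite_roots one_in_roots, of ?k] by (simp add: cover_kernel_def)
    have "T 1 / P = cmod (?k 1)" using kern one_in_roots by simp
    also have "\<dots> \<le> cmod (of_nat m ^ 2 * cover_kernel y (0, complex_of_real \<sigma>)) + cmod (\<Sum>\<eta>\<in>roots - {1}. ?k \<eta>)"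
      unfolding ck using norm_triangle_ineq4[of "?k 1 + (\<Sum>\<eta>\<in>roots - {1}. ?k \<eta>)" "\<Sum>\<eta>\<in>roots - {1}. ?k \<eta>"] by simp
    also have "\<dots> \<le> (real m)\<^sup>2 * cmod (cover_kernel y (0, complex_of_real \<sigma>)) + (real m / c\<^sup>2) / P"
    proof (rule add_mono)
      have "cmod (\<Sum>\<eta>\<in>roots - {1}. ?k \<eta>) \<le> (\<Sum>\<eta>\<in>roots - {1}. (1 / c\<^sup>2) / P)"
      proof (rule sum_norm_le)
        fix \<eta> assume \<eta>: "\<eta> \<in> roots - {1}"
        then have "cmod (?k \<eta>) = T \<eta> / P" using kern by blast
        also have "\<dots> \<le> (1 / c\<^sup>2) / P" using T[OF \<eta>] P by (intro divide_right_mono) auto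
        finally show "cmod (?k \<eta>) \<le> (1 / c\<^sup>2) / P" .
      qed
      also have "\<dots> \<le> real m * ((1 / c\<^sup>2) / P)"
        using card_mono[OF finite_roots, of "roots - {1}"] card_roots P c by (auto intro!: divide_right_mono)
      finally show "cmod (\<Sum>\<eta>\<in>roots - {1}. ?k \<eta>) \<le> (real m / c\<^sup>2) / P" by simp
    qed (simp add: norm_mult norm_power)
    finally have "T 1 \<le> ((real m)\<^sup>2 * cmod (cover_kernel y (0, complex_of_real \<sigma>)) + (real m / c\<^sup>2) / P) * P"
      using P by (simp add: pos_divide_le_eq)
    also have "\<dots> = (real m)\<^sup>2 * cmod (cover_kernel y (0, complex_of_real \<sigma>)) * P + real m / c\<^sup>2"
      using P by (simp add: distrib_right)
    also have "(real m)\<^sup>2 * cmod (cover_kernel y (0, complex_of_real \<sigma>)) * P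
      \<le> (real m)\<^sup>2 * cmod (cover_kernel y (0, complex_of_real \<sigma>)) * (pi\<^sup>2 * (2 * (cmod t)\<^sup>2) ^ N)"
    proof -
      have "1 - cmod t \<le> cmod (1 - t)" using norm_triangle_ineq2[of 1 t] by simp
      \<comment> \<open>Near \<open>t = 1\<close> one has \<open>cmod t > 1 / 2\<close>. This trades
        \<open>cmod t * \<sigma>\<close> for \<open>2 * (cmod t)\<^sup>2\<close> and produces the
        weight \<open>cmod t ^ (2 * N)\<close>, at the price of \<open>2 ^ N\<close>.\<close>
      then have "\<sigma> \<le> 2 * cmod t" using True c(2) \<sigma> by linarith
      then have "cmod t * \<sigma> \<le> cmod t * (2 * cmod t)" by (intro mult_left_mono) auto
      then have "(cmod t * \<sigma>) ^ N \<le> (2 * (cmod t)\<^sup>2) ^ N"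
        using \<sigma>0 by (intro power_mono) (auto simp: power2_eq_square)
      then show ?thesis unfolding P_def by (intro mult_left_mono) auto
    qed
    finally have "T 1 \<le> (real m)\<^sup>2 * pi\<^sup>2 * 2 ^ N * (cmod (cover_kernel y (0, complex_of_real \<sigma>)) * cmod t ^ (2 * N)) + real m / c\<^sup>2"
      by (simp add: power_mult_distrib power_mult[symmetric] mult_ac)
    then have "T 1 \<le> (real m)\<^sup>2 * pi\<^sup>2 * 2 ^ N * (cmod (cover_kernel y (0, complex_of_real \<sigma>)) * cmod t ^ (2 * N)) + (real m / c\<^sup>2 + 4 / c\<^sup>2)"
      by (rule order_trans) simp
    then show ?thesis by (simp add: T_def t_def)
  qed
qed

text \<open>The number \<open>c\<close> is a quarter of the least distance from \<open>1\<close> to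
  another root. The inserted \<open>2\<close> covers \<open>m = 1\<close>, where there is no other
  root, and guarantees \<open>c \<le> 1 / 2\<close>.\<close>

lemma root_gap:
  obtains c :: real where "0 < c" "c \<le> 1 / 2" "\<And>\<eta>. \<eta> \<in> roots \<Longrightarrow> \<eta> \<noteq> 1 \<Longrightarrow> 4 * c \<le> cmod (\<eta> - 1)"
proof -
  define A where "A = insert 2 ((\<lambda>\<eta>. cmod (\<eta> - 1)) ` (roots - {1}))"
  have A: "finite A" "A \<noteq> {}" using finite_roots by (auto simp: A_def)
  have "Min A \<in> A" using A by (rule Min_in)
  then have "Min A > 0" by (auto simp: A_def)
  moreover have "Min A \<le> x" if "x \<in> A" for x using A(1) that by (rule Min_le)
  ultimately show ?thesis by (intro that[of "Min A / 4"]) (auto simp: A_def)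
qed

text \<open>Integrating \<open>cover_kernel_axis_lower_bound\<close> over the bidisc bounds the
  logarithm of \<open>disc_nn_integral_inverse_square\<close> by the L1 norm of the kernel function
  plus a constant. That norm stays below \<open>K\<close>, whereas the logarithm does not.\<close>

lemma not_Toeplitz_bounded_L1:
  fixes \<alpha> :: real
  assumes "\<alpha> \<ge> 0"
  shows "\<not> Toeplitz_maps_boundedly 1 H (symb \<alpha>)"
proof
  assume bdd: "Toeplitz_maps_boundedly 1 H (symb \<alpha>)"
  obtain K where K: "K \<ge> 0" "\<And>\<rho>. 1 / 2 < \<rho> \<Longrightarrow> \<rho> < 1 \<Longrightarrow>
    (\<integral>\<^sup>+z. ennreal (cmod (hartogs_kernel z (0, complex_of_real \<rho>)) powr 1) * indicator H z \<partial>lborel) \<le> ennreal K"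
    using Toeplitz_bounded_L1_imp_kernel_bounded[OF bdd assms] by blast
  obtain c where c: "0 < c" "c \<le> 1 / 2" "\<And>\<eta>. \<eta> \<in> roots \<Longrightarrow> \<eta> \<noteq> 1 \<Longrightarrow> 4 * c \<le> cmod (\<eta> - 1)"
    by (rule root_gap) blast
  define M where "M = real m / c\<^sup>2 + 4 / c\<^sup>2"
  define W where "W = (real m)\<^sup>2 * pi\<^sup>2 * 2 ^ N"
  have W: "W \<ge> 0" by (simp add: W_def)
  have M: "M \<ge> 1"
  proof -
    have "c\<^sup>2 \<le> 1" using c by (simp add: power_le_one)
    then have "1 \<le> 4 / c\<^sup>2" using c by (simp add: pos_le_divide_eq)
    then show ?thesis by (simp add: M_def add_increasing)
  qed
  have bound: "- ln (1 - \<sigma>\<^sup>2) \<le> W * K + M * pi\<^sup>2"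
    if \<sigma>: "1 - c / 2 < \<sigma>" "\<sigma> < 1" "\<sigma> ^ m > 1 / 2" for \<sigma> :: real
  proof -
    have \<sigma>0: "\<sigma> > 0" using \<sigma> c by linarith
    let ?b = "(0 :: complex, complex_of_real \<sigma>)"
    let ?g = "\<lambda>y. cmod (cover_kernel y ?b) * cmod (snd y) ^ (2 * N)"
    have b: "?b \<in> D2'" using \<sigma> \<sigma>0 by simp
    \<comment> \<open>Upstairs the point is \<open>(0, \<sigma>)\<close>, downstairs
      \<open>(0, \<sigma> ^ m)\<close>; hence the requirement
      \<open>\<sigma> ^ m > 1 / 2\<close>.\<close>
    have cb: "cover ?b = (0, complex_of_real (\<sigma> ^ m))" by (simp add: cover_def)
    have bH: "cover ?b \<in> H" using b cover_mem_H_iff by blast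
    have g: "(\<integral>\<^sup>+y. ennreal (?g y) * indicator D2' y \<partial>lborel) \<le> ennreal K"
    proof -
      have "(\<integral>\<^sup>+y. ennreal (?g y) * indicator D2' y \<partial>lborel)
        = (\<integral>\<^sup>+y. ennreal (cmod (hartogs_kernel (cover y) (cover ?b)) powr 1 * cmod (snd y) powr (2 * N)) * indicator D2' y \<partial>lborel)"
      proof (rule nn_integral_cong)
        fix y :: "complex \<times> complex"
        show "ennreal (?g y) * indicator D2' y
          = ennreal (cmod (hartogs_kernel (cover y) (cover ?b)) powr 1 * cmod (snd y) powr (2 * N)) * indicator D2' y"
        proof (cases "y \<in> D2'")
          case True
          then have "cmod (snd y) powr real (2 * N) = cmod (snd y) ^ (2 * N)"
            by (intro powr_realpow) auto
          then show ?thesis using hartogs_kernel_cover[OF True b] by simp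
        qed simp
      qed
      also have "\<dots> \<le> ennreal m * \<dots>"
        using mult_right_mono[of 1 "ennreal m"] m by simp
      also have "\<dots> = (\<integral>\<^sup>+z. ennreal (cmod (hartogs_kernel z (cover ?b)) powr 1) * indicator H z \<partial>lborel)"
        by (rule nn_integral_norm_cover[OF hartogs_kernel_measurable_left[OF bH], symmetric])
      also have "\<dots> \<le> ennreal K"
        unfolding cb using \<sigma> \<sigma>0 m by (intro K(2)) (auto simp: power_less_one_iff)
      finally show ?thesis .
    qed
    have [measurable]: "ball (0::complex) 1 \<in> sets borel" by simp
    have "ennreal (pi * (pi / \<sigma>\<^sup>2 * - ln (1 - \<sigma>\<^sup>2)))
      = (\<integral>\<^sup>+v. indicator (ball 0 1) (v::complex) \<partial>lborel) * (\<integral>\<^sup>+t. ennreal (1 / (cmod (1 - t * complex_of_real \<sigma>))\<^sup>2) * indicator (ball 0 1) t \<partial>lborel)"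
      unfolding disc_nn_integral_inverse_square[OF \<sigma>0 \<sigma>(2)] ennreal_mult'[OF pi_ge_zero] by (simp add: emeasure_unit_disc)
    also have "\<dots> = (\<integral>\<^sup>+y. indicator (ball (0::complex) 1) (fst y) * (ennreal (1 / (cmod (1 - snd y * complex_of_real \<sigma>))\<^sup>2) * indicator (ball 0 1) (snd y)) \<partial>lborel)"
      by (rule nn_integral_product[where f = "indicator (ball 0 1)"
          and g = "\<lambda>t. ennreal (1 / (cmod (1 - t * complex_of_real \<sigma>))\<^sup>2) * indicator (ball 0 1) t", symmetric]) measurable
    also have "\<dots> \<le> (\<integral>\<^sup>+y. ennreal W * (ennreal (?g y) * indicator D2' y) + ennreal M * indicator D2 y \<partial>lborel)"
    proof (rule nn_integral_mono)
      fix y :: "complex \<times> complex"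
      show "indicator (ball 0 1) (fst y) * (ennreal (1 / (cmod (1 - snd y * complex_of_real \<sigma>))\<^sup>2) * indicator (ball 0 1) (snd y))
        \<le> ennreal W * (ennreal (?g y) * indicator D2' y) + ennreal M * indicator D2 y"
      proof (cases "y \<in> D2")
        case D: True
        show ?thesis
        proof (cases "snd y = 0")
          case True
          then show ?thesis using D M by (cases y) simp
        next
          case False
          have y: "y \<in> D2'" "cmod (snd y) < 1" using D False by (cases y; simp)+
          have "1 / (cmod (1 - snd y * complex_of_real \<sigma>))\<^sup>2 \<le> W * ?g y + M"
            unfolding W_def M_def by (rule cover_kernel_axis_lower_bound[OF c \<sigma>(1,2) False y(2)])
          then have "ennreal (1 / (cmod (1 - snd y * complex_of_real \<sigma>))\<^sup>2) \<le> ennreal W * ennreal (?g y) + ennreal M"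
            using W M by (simp add: ennreal_mult[symmetric] ennreal_plus[symmetric] ennreal_leI del: ennreal_plus)
          moreover have "fst y \<in> ball 0 1" "snd y \<in> ball 0 1" using D by (cases y; simp)+
          ultimately show ?thesis using y(1) D by simp
        qed
      qed (cases y, auto simp: indicator_def)
    qed
    also have "\<dots> = ennreal W * (\<integral>\<^sup>+y. ennreal (?g y) * indicator D2' y \<partial>lborel) + ennreal M * emeasure lborel D2"
    proof -
      have [measurable]: "?g \<in> borel_measurable borel"
        unfolding cover_kernel_def kern_def bidisc_kernel_def by measurable
      have [measurable]: "D2' \<in> sets borel" "D2 \<in> sets borel"
        using open_D2 open_D2' by (auto intro: borel_open)
      show ?thesis by (subst nn_integral_add) (auto simp: nn_integral_cmult nn_integral_cmult_indicator)
    qed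
    also have "\<dots> \<le> ennreal W * ennreal K + ennreal M * ennreal (pi * pi)"
      unfolding emeasure_bidisc by (intro add_mono mult_left_mono g) auto
    also have "\<dots> = ennreal (W * K + M * pi\<^sup>2)"
      using W M K(1) by (simp add: ennreal_mult ennreal_plus power2_eq_square)
    finally have "pi * (pi / \<sigma>\<^sup>2 * - ln (1 - \<sigma>\<^sup>2)) \<le> W * K + M * pi\<^sup>2"
      using W M K(1) by (subst (asm) ennreal_le_iff) auto
    moreover have "- ln (1 - \<sigma>\<^sup>2) \<le> pi * (pi / \<sigma>\<^sup>2 * - ln (1 - \<sigma>\<^sup>2))"
    proof -
      have s: "\<sigma>\<^sup>2 < 1" "\<sigma>\<^sup>2 > 0" using \<sigma> \<sigma>0 by (auto simp: power_less_one_iff)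
      then have "- ln (1 - \<sigma>\<^sup>2) \<ge> 0" by simp
      moreover have "1 \<le> pi * (pi / \<sigma>\<^sup>2)"
      proof -
        have "1 * 1 \<le> pi * pi" using pi_ge_two by (intro mult_mono) auto
        then show ?thesis using s by (simp add: pos_le_divide_eq)
      qed
      ultimately have "1 * - ln (1 - \<sigma>\<^sup>2) \<le> (pi * (pi / \<sigma>\<^sup>2)) * - ln (1 - \<sigma>\<^sup>2)" by (rule mult_right_mono[rotated])
      then show ?thesis by (simp add: mult.assoc)
    qed
    ultimately show ?thesis by linarith
  qed
  let ?L = "W * K + M * pi\<^sup>2"
  have "((\<lambda>\<sigma>::real. \<sigma> ^ m) \<longlongrightarrow> 1 ^ m) (at_left 1)" "((\<lambda>\<sigma>::real. 1 - \<sigma>\<^sup>2) \<longlongrightarrow> 1 - 1\<^sup>2) (at_left 1)"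
    by (intro tendsto_intros)+
  from order_tendstoD(1)[OF this(1), of "1 / 2"] order_tendstoD(2)[OF this(2), of "exp (- ?L)"]
  have "eventually (\<lambda>\<sigma>::real. 1 / 2 < \<sigma> ^ m) (at_left 1)" "eventually (\<lambda>\<sigma>::real. 1 - \<sigma>\<^sup>2 < exp (- ?L)) (at_left 1)"
    by simp_all
  moreover have "eventually (\<lambda>\<sigma>. \<sigma> \<in> {1 - c / 2<..<1}) (at_left 1)"
    using c by (intro eventually_at_left_real) simp
  ultimately have "eventually (\<lambda>\<sigma>::real. 1 / 2 < \<sigma> ^ m \<and> 1 - \<sigma>\<^sup>2 < exp (- ?L) \<and> \<sigma> \<in> {1 - c / 2<..<1}) (at_left 1)"
    by (simp add: eventually_conj_iff)
  then obtain \<sigma> :: real where \<sigma>: "1 / 2 < \<sigma> ^ m" "1 - \<sigma>\<^sup>2 < exp (- ?L)" "1 - c / 2 < \<sigma>" "\<sigma> < 1"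
    by (auto dest!: eventually_happens)
  have "\<sigma>\<^sup>2 < 1" using \<sigma> c by (simp add: power_less_one_iff)
  then have "ln (1 - \<sigma>\<^sup>2) < ln (exp (- ?L))" using \<sigma>(2) by (subst ln_less_cancel_iff) auto
  then show False using bound[OF \<sigma>(3,4,1)] by simp
qed

end

theorem theorem1p1:
  fixes m n :: nat and \<alpha> p :: real
  assumes "m > 0" and "n > 0" and "gcd m n = 1"
    and "0 \<le> \<alpha>" and "\<alpha> \<le> (real m + real n - 1) / real m"
    and "1 \<le> p"
  shows "Toeplitz_maps_boundedly p (hartogs_triangle (real m / real n))
           (\<lambda>(z1, z2). complex_of_real (norm z2 powr \<alpha>)) \<longleftrightarrow>
         (2 * real m + 2 * real n) / (real m + real n + 1 + real m * \<alpha>) < p \<and>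
         p < (2 * real m + 2 * real n) / (real m + real n - 1)"
proof -
  interpret hartogs_cover m n by unfold_locales (fact assms)+
  have co: "coprime m n" using assms(3) by (simp add: coprime_iff_gcd_eq_1)
  have N: "real N = real m + real n - 1" using assms(1) by (simp add: N_def of_nat_diff)
  have N0: "real m + real n - 1 > 0" using assms(1,2) by linarith
  have m\<alpha>: "0 \<le> real m * \<alpha>" "real m * \<alpha> \<le> real m + real n - 1"
    using assms(1,4,5) by (simp_all add: field_simps)
  \<comment> \<open>The numerator \<open>2 * m + 2 * n\<close> is \<open>2 * N + 2\<close>, and the
    two denominators are \<open>N + 2 + m * \<alpha>\<close> and \<open>N\<close>.\<close>
  have lower: "(2 * real m + 2 * real n) / (real m + real n + 1 + real m * \<alpha>) < p
      \<longleftrightarrow> 2 * real N + 2 < p * (real N + 2 + m * \<alpha>)"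
    unfolding N using m\<alpha>(1) N0 by (subst pos_divide_less_eq) (auto simp: algebra_simps)
  have upper: "p < (2 * real m + 2 * real n) / (real m + real n - 1)
      \<longleftrightarrow> real N * p < 2 * real N + 2"
    unfolding N using N0 by (subst pos_less_divide_eq) (auto simp: algebra_simps)
  show ?thesis
    unfolding lower upper symb_def[symmetric]
  proof (intro iffI conjI; (elim conjE)?)
    assume bdd: "Toeplitz_maps_boundedly p (hartogs_triangle (real m / real n)) (symb \<alpha>)"
    then show "real N * p < 2 * real N + 2"
      using Toeplitz_bounded_imp_upper assms(4,6) co by blast
    have "p \<noteq> 1" using bdd not_Toeplitz_bounded_L1[OF assms(4)] by metis
    then show "2 * real N + 2 < p * (real N + 2 + m * \<alpha>)"
      using Toeplitz_bounded_imp_lower[OF bdd _ assms(4) co] assms(6) by linarith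
  next
    assume l: "2 * real N + 2 < p * (real N + 2 + m * \<alpha>)"
      and u: "real N * p < 2 * real N + 2"
    \<comment> \<open>At \<open>p = 1\<close> the lower bound would say
      \<open>N < m * \<alpha>\<close>, against the hypothesis on \<open>\<alpha>\<close>.\<close>
    have "p \<noteq> 1" using l m\<alpha>(2) N by auto
    then show "Toeplitz_maps_boundedly p (hartogs_triangle (real m / real n)) (symb \<alpha>)"
      using assms(6) by (intro Toeplitz_bounded l u) simp
  qed
qed

end
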